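(* Assume $\widetilde T\ge4b$. Let $V^*\in B(M,q_0^*,q_1^* )$ be the exact solution, corresponding to the exact coefficient $p^*$ and noiseless data, and suppose that there exist $F\in B(M,q_0,q_1)$ and $F^*\in B(M,q_0^*,q_1^* )$ with $\Vert F-F^*\Vert_{H^4(R)}<\sigma$. Denote $$\omega=\frac{\beta(\widetilde T-4b)+\mu}{2(2\beta b-\mu)},\qquad\rho=\frac12\min\{\omega,1\},$$ and $\lambda_2=\lambda_1(R,3M,\beta)\ge\lambda_1(R,M,\beta)$. Let $\sigma_0\in(0,1)$ be sufficiently small such that $\ln\sigma_0^{-1/(2(2\beta b-\mu))}\ge\lambda_2$, let $\sigma\in(0,\sigma_0)$ with $\sigma<\min\{1,M\}$, and let $$\lambda=\lambda(\sigma)=\ln\sigma^{-1/(2(2\beta b-\mu))}>\lambda_2,\qquad\gamma=\gamma(\sigma)=2e^{-\lambda\beta\widetilde T}=2\sigma^{(\beta\widetilde T)/(2(2\beta b-\mu))},$$ with $\gamma\in(0,1)$. Let $V_{\min,\lambda,\gamma}$ be the unique minimizer of $J_{\lambda,\gamma}$ on $\overline{B(M,q_0,q_1)}$. Fix $\vartheta\in(0,1/3)$ and assume that $V_{\min,\lambda,\gamma}\in B(\vartheta M,q_0,q_1)$. Let $V^{(0)}\in B(\vartheta M,q_0,q_1)$ be arbitrary. Let $\varkappa_0\in(0,1)$ be a sufficiently small number and, for $\varkappa\in(0,\varkappa_0)$, let $\theta=\theta(\varkappa)\in(0,1)$ be a number such that the sequence $$V^{(n)}=V^{(n-1)}-\varkappa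 J'_{\lambda,\gamma}\left(V^{(n-1)}\right),\quad n=1,2,\ldots,$$ is contained in $B(M,q_0,q_1)$ and satisfies $\Vert V_{\min,\lambda,\gamma}-V^{(n)}\Vert_{H^4(R)}\le\theta^n\Vert V_{\min,\lambda,\gamma}-V^{(0)}\Vert_{H^4(R)}$ for all $n\ge1$ (such $\varkappa_0$ and $\theta$ exist). Put $p^{(n)}(y)=4\partial_yV^{(n)}(y,0)$. Then the following convergence estimate is valid: $$\left\Vert V^*-V^{(n)}\right\Vert_{H^1(R_{\beta,\mu,b})}+\left\Vert p^*-p^{(n)}\right\Vert_{L^2(0,2\beta b-\mu)}\le2K\sigma^\rho+4C\theta^n\left\Vert V_{\min,\lambda,\gamma}-V^{(0)}\right\Vert_{H^4(R)},\quad n=1,2,\ldots,$$ where $C=C(R)>0$ depends only on the rectangle $R$, and $K>0$ is a constant independent of $\sigma$, $n$ and $V^{(0)}$.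
   Context: Parameters: $\overline c>1$, $b\ge\sqrt{\overline c}$, $\beta\in(0,1/2)$, $\mu\in(0,2\beta b)$, and $M>0$ is arbitrary. Set $R=\{(y,t):y\in(0,b),\,t\in(0,\widetilde T)\}$ and $R_{\beta,\mu,b}=\{(y,t): y+\beta t<2\beta b-\mu,\ y,t>0\}\subset R$. All functions are real-valued. Spaces: $H_0^2(R)=\{u\in H^2(R):u(0,t)=u_y(0,t)=0,\ u_y(b,t)=0\}$ and $H_0^4(R)=H^4(R)\cap H_0^2(R)$. For functions $q_0(t),q_1(t)$, $t\in(0,\widetilde T)$ (the given, possibly noisy, data) and any number $r>0$, $$B(r,q_0,q_1)=\{u\in H^4(R):u(0,t)=q_0(t),\ u_y(0,t)=q_1(t),\ u_y(b,t)=0,\ \Vert u\Vert_{H^4(R)}<r\},$$ and $\overline{B(r,q_0,q_1)}$ is its closure in $H^4(R)$; $B(r,q_0^*,q_1^* )$ is defined in the same way with the noiseless data $q_0^*,q_1^*$. The number $\sigma$ is the noise level. Functional: $\psi_\lambda(y,t)=e^{-2\lambda(y+\beta t)}$, $\mathcal S(V)=V_{yy}-2V_{yt}+4V_y(y,0)V$, and $$J_{\lambda,\gamma}(V)=\int_R[\mathcal S(V)]^2\psi_\lambda\,dy\,dt+\gamma\Vert V\Vert_{H^4(R)}^2.$$ Its Fréchet derivative at $V\in\overline{B(M,q_0,q_1)}$ is denoted by $J'_{\lambda,\gamma}(V)$ and is identified, through the inner product of $H^4(R)$, with an element of $H_0^4(R)$: $J'_{\lambda,\gamma}(V)(h)=(J'_{\lambda,\gamma}(V),h)_{H^4(R)}$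 for $h\in H_0^4(R)$. Exact solution: $p^*\in C^1(\mathbb R)$ is the exact coefficient, with $p^*(y)=0$ for $y<0$ and $y>\sqrt{\overline c}$; $w^*$ is the solution of $w^*_{tt}=w^*_{yy}+p^*(y)w^*$ for $y\in\mathbb R$, $t>0$, with $w^*(y,0)=0$, $w^*_t(y,0)=\delta(y)$; $f_0^*(t)=w^*(0,t)$, $f_1^*(t)=w_y^*(0,t)$; $V^*(y,t)=\partial_t[w^*(y,t+y)]$ for $(y,t)\in R$; $q_0^*=(f_0^* )'$ and $q_1^*=(f_0^* )''+(f_1^* )'$. Then $\mathcal S(V^* )=0$ in $R$ and $p^*(y)=4\partial_yV^*(y,0)$ for $y\in(0,b)$. The number $\lambda_1=\lambda_1(R,M,\beta)\ge\lambda_0\ge1$, where $\lambda_0=\lambda_0(\beta,R)$ is such that for some $C=C(\beta,R)>0$ the Carleman estimate $$\int_R(u_{yy}-2u_{yt})^2\psi_\lambda\,dydt\ge C\int_R(\lambda(u_y^2+u_t^2)+\lambda^3u^2)\psi_\lambda\,dydt+C\int_0^b(\lambda u_y^2+\lambda^3u^2)(y,0)e^{-2\lambda y}dy-Ce^{-2\lambda\widetilde T}\int_0^b(\lambda u_y^2+\lambda^3u^2)(y,\widetilde T)dy$$ holds for all $u\in H_0^2(R)$ and $\lambda\ge\lambda_0$, is a sufficiently large number depending only on $R,M,\beta$ such that for all $\lambda\ge\lambda_1$ and all $\gamma\in[2e^{-\lambda\beta\widetilde T},1)$ the functional $J_{\lambda,\gamma}$ is strictly convex on $\overline{B(M,q_0,q_1)}$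 in the sense that for all $V_1,V_2\in\overline{B(M,q_0,q_1)}$ $$J_{\lambda,\gamma}(V_2)-J_{\lambda,\gamma}(V_1)-J'_{\lambda,\gamma}(V_1)(V_2-V_1)\ge K_1e^{-2\lambda(2\beta b-\mu)}\left(\Vert V_2-V_1\Vert^2_{H^1(R_{\beta,\mu,b})}+\Vert V_2(y,0)-V_1(y,0)\Vert^2_{H^1(0,2\beta b-\mu)}\right)+\frac{\gamma}{2}\Vert V_2-V_1\Vert^2_{H^4(R)},$$ with a constant $K_1=K_1(\beta,\mu,b,M)>0$. The number $\lambda_1(R,3M,\beta)$ is the analogous number with $M$ replaced by $3M$. For such $\lambda,\gamma$ the minimizer of $J_{\lambda,\gamma}$ on $\overline{B(M,q_0,q_1)}$ exists and is unique. *)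

theory Defs
  imports "HOL-Analysis.Analysis"
begin

text \<open>
  Points of the plane are pairs \<open>(y, t)\<close>. Elements of Lebesgue and Sobolev spaces are represented
  by functions; only their values on the domain, and these up to null sets, matter.
\<close>

section \<open>Test functions and weak derivatives\<close>

definition dir_deriv :: "'a::euclidean_space \<Rightarrow> ('a \<Rightarrow> real) \<Rightarrow> 'a \<Rightarrow> real" where
  "dir_deriv e f = (\<lambda>x. deriv (\<lambda>s. f (x + s *\<^sub>R e)) 0)"

text \<open>The list of directions \<open>ds\<close> plays the role of a multi-index.\<close>

definition iter_deriv :: "'a::euclidean_space list \<Rightarrow> ('a \<Rightarrow> real) \<Rightarrow> 'a \<Rightarrow> real" where
  "iter_deriv ds f = foldr dir_deriv ds f"

definition smooth_fun :: "('a::euclidean_space \<Rightarrow> real) \<Rightarrow> bool" where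
  "smooth_fun f \<longleftrightarrow> (\<forall>ds. set ds \<subseteq> Basis \<longrightarrow> iter_deriv ds f differentiable_on UNIV)"

definition test_fun :: "'a::euclidean_space set \<Rightarrow> ('a \<Rightarrow> real) \<Rightarrow> bool" where
  "test_fun \<Omega> \<phi> \<longleftrightarrow> smooth_fun \<phi> \<and> compact (closure {x. \<phi> x \<noteq> 0}) \<and> closure {x. \<phi> x \<noteq> 0} \<subseteq> \<Omega>"

definition loc_integrable :: "'a::euclidean_space set \<Rightarrow> ('a \<Rightarrow> real) \<Rightarrow> bool" where
  "loc_integrable \<Omega> u \<longleftrightarrow> (\<forall>A. compact A \<and> A \<subseteq> \<Omega> \<longrightarrow> set_integrable lborel A u)"

definition weak_deriv ::
    "'a::euclidean_space set \<Rightarrow> 'a list \<Rightarrow> ('a \<Rightarrow> real) \<Rightarrow> ('a \<Rightarrow> real) \<Rightarrow> bool" where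
  "weak_deriv \<Omega> ds u v \<longleftrightarrow> loc_integrable \<Omega> u \<and> loc_integrable \<Omega> v \<and>
     (\<forall>\<phi>. test_fun \<Omega> \<phi> \<longrightarrow>
        (LINT x:\<Omega>|lborel. u x * iter_deriv ds \<phi> x)
          = (-1) ^ length ds * (LINT x:\<Omega>|lborel. v x * \<phi> x))"

text \<open>A representative of the weak derivative (unique up to a null subset of \<open>\<Omega>\<close> if it exists).\<close>

definition wd :: "'a::euclidean_space set \<Rightarrow> 'a list \<Rightarrow> ('a \<Rightarrow> real) \<Rightarrow> 'a \<Rightarrow> real" where
  "wd \<Omega> ds u = (SOME v. weak_deriv \<Omega> ds u v)"

section \<open>Sobolev spaces\<close>

definition L2 :: "'a::euclidean_space set \<Rightarrow> ('a \<Rightarrow> real) set" where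
  "L2 \<Omega> = {u. set_borel_measurable lborel \<Omega> u \<and> set_integrable lborel \<Omega> (\<lambda>x. (u x)\<^sup>2)}"

definition L2_norm :: "'a::euclidean_space set \<Rightarrow> ('a \<Rightarrow> real) \<Rightarrow> real" where
  "L2_norm \<Omega> u = sqrt (LINT x:\<Omega>|lborel. (u x)\<^sup>2)"

definition yt :: "nat \<Rightarrow> nat \<Rightarrow> (real \<times> real) list" where
  "yt i j = replicate i (1, 0) @ replicate j (0, 1)"

definition Hk :: "nat \<Rightarrow> (real \<times> real) set \<Rightarrow> (real \<times> real \<Rightarrow> real) set" where
  "Hk k \<Omega> = {u \<in> L2 \<Omega>. \<forall>i j. i + j \<le> k \<longrightarrow> (\<exists>v \<in> L2 \<Omega>. weak_deriv \<Omega> (yt i j) u v)}"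

definition Hk_inner ::
    "nat \<Rightarrow> (real \<times> real) set \<Rightarrow> (real \<times> real \<Rightarrow> real) \<Rightarrow> (real \<times> real \<Rightarrow> real) \<Rightarrow> real" where
  "Hk_inner k \<Omega> u v =
     (\<Sum>i\<le>k. \<Sum>j\<le>k - i. LINT x:\<Omega>|lborel. wd \<Omega> (yt i j) u x * wd \<Omega> (yt i j) v x)"

definition Hk_norm :: "nat \<Rightarrow> (real \<times> real) set \<Rightarrow> (real \<times> real \<Rightarrow> real) \<Rightarrow> real" where
  "Hk_norm k \<Omega> u = sqrt (Hk_inner k \<Omega> u u)"

text \<open>The norm of \<open>H\<^sup>1(I)\<close> for an interval \<open>I\<close> of the real line.\<close>

definition H1_norm :: "real set \<Rightarrow> (real \<Rightarrow> real) \<Rightarrow> real" where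
  "H1_norm I g = sqrt ((L2_norm I g)\<^sup>2 + (L2_norm I (wd I [1] g))\<^sup>2)"

section \<open>The rectangle and traces on its sides\<close>

definition Rect :: "real \<Rightarrow> real \<Rightarrow> (real \<times> real) set" where
  "Rect b T = {0<..<b} \<times> {0<..<T}"

definition Rtri :: "real \<Rightarrow> real \<Rightarrow> real \<Rightarrow> (real \<times> real) set" where
  "Rtri \<beta> \<mu> b = {(y, t). y + \<beta> * t < 2 * \<beta> * b - \<mu> \<and> 0 < y \<and> 0 < t}"

text \<open>
  For \<open>v s x\<close>, the value of a function at distance \<open>s\<close> from a side at its point \<open>x \<in> I\<close>, the trace
  on this side is the limit \<open>g\<close> of \<open>v s\<close> in \<open>L\<^sup>2(I)\<close> as \<open>s \<rightarrow> 0\<close>. The mean over \<open>0 < s < \<epsilon>\<close> makes this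
  independent of the values of \<open>v\<close> on null sets. For \<open>H\<^sup>1\<close> functions on the rectangle, this is the
  usual trace; it is only applied to such functions.
\<close>

definition has_trace :: "real set \<Rightarrow> (real \<Rightarrow> real \<Rightarrow> real) \<Rightarrow> (real \<Rightarrow> real) \<Rightarrow> bool" where
  "has_trace I v g \<longleftrightarrow> g \<in> L2 I \<and>
     ((\<lambda>\<epsilon>. (1 / \<epsilon>) * (LINT z:{0<..<\<epsilon>} \<times> I|lborel. (v (fst z) (snd z) - g (snd z))\<^sup>2))
        \<longlongrightarrow> 0) (at_right 0)"

definition trace_left :: "real \<Rightarrow> (real \<times> real \<Rightarrow> real) \<Rightarrow> (real \<Rightarrow> real) \<Rightarrow> bool" where
  "trace_left T u q \<longleftrightarrow> has_trace {0<..<T} (\<lambda>s t. u (s, t)) q"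

definition trace_right :: "real \<Rightarrow> real \<Rightarrow> (real \<times> real \<Rightarrow> real) \<Rightarrow> (real \<Rightarrow> real) \<Rightarrow> bool" where
  "trace_right b T u q \<longleftrightarrow> has_trace {0<..<T} (\<lambda>s t. u (b - s, t)) q"

text \<open>Representatives of \<open>u(\<cdot>, 0)\<close> and \<open>u(\<cdot>, T)\<close> on \<open>(0, b)\<close>.\<close>

definition bottom :: "real \<Rightarrow> (real \<times> real \<Rightarrow> real) \<Rightarrow> real \<Rightarrow> real" where
  "bottom b u = (SOME g. has_trace {0<..<b} (\<lambda>s y. u (y, s)) g)"

definition top_side :: "real \<Rightarrow> real \<Rightarrow> (real \<times> real \<Rightarrow> real) \<Rightarrow> real \<Rightarrow> real" where
  "top_side b T u = (SOME g. has_trace {0<..<b} (\<lambda>s y. u (y, T - s)) g)"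

definition H20 :: "real \<Rightarrow> real \<Rightarrow> (real \<times> real \<Rightarrow> real) set" where
  "H20 b T = {u \<in> Hk 2 (Rect b T).
     trace_left T u (\<lambda>t. 0) \<and> trace_left T (wd (Rect b T) (yt 1 0) u) (\<lambda>t. 0) \<and>
     trace_right b T (wd (Rect b T) (yt 1 0) u) (\<lambda>t. 0)}"

definition H40 :: "real \<Rightarrow> real \<Rightarrow> (real \<times> real \<Rightarrow> real) set" where
  "H40 b T = Hk 4 (Rect b T) \<inter> H20 b T"

definition Bset ::
    "real \<Rightarrow> real \<Rightarrow> real \<Rightarrow> (real \<Rightarrow> real) \<Rightarrow> (real \<Rightarrow> real) \<Rightarrow> (real \<times> real \<Rightarrow> real) set" where
  "Bset b T r q0 q1 = {u \<in> Hk 4 (Rect b T).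
     trace_left T u q0 \<and> trace_left T (wd (Rect b T) (yt 1 0) u) q1 \<and>
     trace_right b T (wd (Rect b T) (yt 1 0) u) (\<lambda>t. 0) \<and> Hk_norm 4 (Rect b T) u < r}"

definition Bclosure ::
    "real \<Rightarrow> real \<Rightarrow> real \<Rightarrow> (real \<Rightarrow> real) \<Rightarrow> (real \<Rightarrow> real) \<Rightarrow> (real \<times> real \<Rightarrow> real) set" where
  "Bclosure b T r q0 q1 = {u \<in> Hk 4 (Rect b T).
     \<forall>\<epsilon>>0. \<exists>v \<in> Bset b T r q0 q1. Hk_norm 4 (Rect b T) (\<lambda>x. u x - v x) < \<epsilon>}"

section \<open>The functional and its gradient\<close>

definition psi :: "real \<Rightarrow> real \<Rightarrow> real \<times> real \<Rightarrow> real" where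
  "psi \<beta> l = (\<lambda>(y, t). exp (- 2 * l * (y + \<beta> * t)))"

definition S_op :: "real \<Rightarrow> real \<Rightarrow> (real \<times> real \<Rightarrow> real) \<Rightarrow> real \<times> real \<Rightarrow> real" where
  "S_op b T V = (\<lambda>x. wd (Rect b T) (yt 2 0) V x - 2 * wd (Rect b T) (yt 1 1) V x
     + 4 * bottom b (wd (Rect b T) (yt 1 0) V) (fst x) * V x)"

definition J_fun ::
    "real \<Rightarrow> real \<Rightarrow> real \<Rightarrow> real \<Rightarrow> real \<Rightarrow> (real \<times> real \<Rightarrow> real) \<Rightarrow> real" where
  "J_fun b T \<beta> l \<gamma> V = (LINT x:Rect b T|lborel. (S_op b T V x)\<^sup>2 * psi \<beta> l x)
     + \<gamma> * (Hk_norm 4 (Rect b T) V)\<^sup>2"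

text \<open>
  \<open>g\<close> represents, through the inner product of \<open>H\<^sup>4(R)\<close>, the Frechet derivative at \<open>V\<close> of \<open>J\<close>
  with respect to increments in \<open>H\<^sub>0\<^sup>4(R)\<close>.
\<close>

definition is_gradient ::
    "real \<Rightarrow> real \<Rightarrow> ((real \<times> real \<Rightarrow> real) \<Rightarrow> real) \<Rightarrow>
      (real \<times> real \<Rightarrow> real) \<Rightarrow> (real \<times> real \<Rightarrow> real) \<Rightarrow> bool" where
  "is_gradient b T J V g \<longleftrightarrow> g \<in> H40 b T \<and>
     (\<forall>\<epsilon>>0. \<exists>\<delta>>0. \<forall>h \<in> H40 b T. Hk_norm 4 (Rect b T) h < \<delta> \<longrightarrow>
        \<bar>J (\<lambda>x. V x + h x) - J V - Hk_inner 4 (Rect b T) g h\<bar> \<le> \<epsilon> * Hk_norm 4 (Rect b T) h)"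

section \<open>The thresholds for the Carleman parameter\<close>

text \<open>
  The weight of the boundary term at \<open>t = T\<close> is the value \<open>exp (- 2 \<lambda> \<beta> T)\<close> that \<open>\<psi>\<^sub>\<lambda>\<close> takes at
  \<open>y = 0\<close>, \<open>t = T\<close>. With the smaller factor \<open>exp (- 2 \<lambda> T)\<close> the estimate fails for all large \<open>\<lambda>\<close>, as
  one sees from \<open>u(y, t) = G(t + 2 y) \<eta>(y)\<close> with \<open>G\<close> supported in a small interval \<open>(T, T + \<epsilon>)\<close> and
  a cut-off \<open>\<eta>\<close> that equals 1 up to a small distance from \<open>y = b\<close> and 0 near \<open>y = b\<close>. Every
  threshold for the latter estimate would be a threshold in the sense of this definition.
\<close>

definition carleman_threshold :: "real \<Rightarrow> real \<Rightarrow> real \<Rightarrow> real \<Rightarrow> bool" where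
  "carleman_threshold b T \<beta> lam0 \<longleftrightarrow>
    (let R = Rect b T in
     \<exists>C>0. \<forall>u \<in> H20 b T. \<forall>l\<ge>lam0.
       (LINT x:R|lborel. (wd R (yt 2 0) u x - 2 * wd R (yt 1 1) u x)\<^sup>2 * psi \<beta> l x)
       \<ge> C * (LINT x:R|lborel. (l * ((wd R (yt 1 0) u x)\<^sup>2 + (wd R (yt 0 1) u x)\<^sup>2)
                 + l ^ 3 * (u x)\<^sup>2) * psi \<beta> l x)
         + C * (LINT y:{0<..<b}|lborel. (l * (bottom b (wd R (yt 1 0) u) y)\<^sup>2
                 + l ^ 3 * (bottom b u y)\<^sup>2) * exp (- 2 * l * y))
         - C * exp (- 2 * l * \<beta> * T)
             * (LINT y:{0<..<b}|lborel. l * (top_side b T (wd R (yt 1 0) u) y)\<^sup>2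
                 + l ^ 3 * (top_side b T u y)\<^sup>2))"

text \<open>
  \<open>lam1\<close> may serve as \<open>\<lambda>\<^sub>1(R, M, \<beta>)\<close>. It does not depend on \<open>\<mu>\<close> or on the data \<open>q0\<close>, \<open>q1\<close>, and
  \<open>K1\<close> does not depend on \<open>q0\<close>, \<open>q1\<close>, \<open>\<lambda>\<close>, \<open>\<gamma>\<close>.
\<close>

definition convexity_threshold ::
    "real \<Rightarrow> real \<Rightarrow> real \<Rightarrow> real \<Rightarrow> real \<Rightarrow> real \<Rightarrow> bool" where
  "convexity_threshold b T \<beta> M lam0 lam1 \<longleftrightarrow>
    lam0 \<ge> 1 \<and> carleman_threshold b T \<beta> lam0 \<and> lam1 \<ge> lam0 \<and>
    (\<forall>\<mu>. 0 < \<mu> \<and> \<mu> < 2 * \<beta> * b \<longrightarrow> (\<exists>K1>0. \<forall>q0 q1 l \<gamma>.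
       l \<ge> lam1 \<and> 2 * exp (- l * \<beta> * T) \<le> \<gamma> \<and> \<gamma> < 1 \<longrightarrow>
       (\<forall>V1 \<in> Bclosure b T M q0 q1. \<exists>g. is_gradient b T (J_fun b T \<beta> l \<gamma>) V1 g \<and>
         (\<forall>V2 \<in> Bclosure b T M q0 q1.
            J_fun b T \<beta> l \<gamma> V2 - J_fun b T \<beta> l \<gamma> V1
              - Hk_inner 4 (Rect b T) g (\<lambda>x. V2 x - V1 x)
            \<ge> K1 * exp (- 2 * l * (2 * \<beta> * b - \<mu>))
                * ((Hk_norm 1 (Rtri \<beta> \<mu> b) (\<lambda>x. V2 x - V1 x))\<^sup>2
                   + (H1_norm {0<..<2 * \<beta> * b - \<mu>} (\<lambda>y. bottom b V2 y - bottom b V1 y))\<^sup>2)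
              + \<gamma> / 2 * (Hk_norm 4 (Rect b T) (\<lambda>x. V2 x - V1 x))\<^sup>2))))"

definition is_minimizer :: "('f \<Rightarrow> real) \<Rightarrow> 'f set \<Rightarrow> 'f \<Rightarrow> bool" where
  "is_minimizer J A V \<longleftrightarrow> V \<in> A \<and> (\<forall>W \<in> A. J V \<le> J W)"

section \<open>The exact solution\<close>

text \<open>
  \<open>w\<close> solves \<open>w\<^sub>t\<^sub>t = w\<^sub>y\<^sub>y + p w\<close> for \<open>t > 0\<close> with \<open>w(y, 0) = 0\<close>, \<open>w\<^sub>t(y, 0) = \<delta>(y)\<close> in the sense of
  distributions: test functions need not vanish at \<open>t = 0\<close>, and integration by parts in \<open>t\<close> produces
  the initial term \<open>\<phi>(0, 0)\<close>. This determines \<open>w\<close> almost everywhere; in the cone \<open>\<bar>y\<bar> < t\<close>, where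
  pointwise values of \<open>w\<close> and of its derivatives are used, \<open>w\<close> is the continuous representative.
\<close>

definition wave_solution :: "(real \<Rightarrow> real) \<Rightarrow> (real \<times> real \<Rightarrow> real) \<Rightarrow> bool" where
  "wave_solution p w \<longleftrightarrow>
     (\<forall>A. compact A \<longrightarrow> set_integrable lborel (A \<inter> {(y, t). 0 < t}) w) \<and>
     (\<forall>\<phi>. test_fun UNIV \<phi> \<longrightarrow>
        (LINT x:{(y, t). 0 < t}|lborel.
           w x * (iter_deriv (yt 0 2) \<phi> x - iter_deriv (yt 2 0) \<phi> x - p (fst x) * \<phi> x))
          = \<phi> (0, 0)) \<and>
     continuous_on {(y, t). \<bar>y\<bar> < t} w"

definition exact_V :: "(real \<times> real \<Rightarrow> real) \<Rightarrow> real \<times> real \<Rightarrow> real" where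
  "exact_V w = (\<lambda>(y, t). deriv (\<lambda>s. w (y, s + y)) t)"

definition exact_f0 :: "(real \<times> real \<Rightarrow> real) \<Rightarrow> real \<Rightarrow> real" where
  "exact_f0 w = (\<lambda>t. w (0, t))"

definition exact_f1 :: "(real \<times> real \<Rightarrow> real) \<Rightarrow> real \<Rightarrow> real" where
  "exact_f1 w = (\<lambda>t. deriv (\<lambda>y. w (y, t)) 0)"

definition exact_q0 :: "(real \<times> real \<Rightarrow> real) \<Rightarrow> real \<Rightarrow> real" where
  "exact_q0 w = deriv (exact_f0 w)"

definition exact_q1 :: "(real \<times> real \<Rightarrow> real) \<Rightarrow> real \<Rightarrow> real" where
  "exact_q1 w = (\<lambda>t. deriv (deriv (exact_f0 w)) t + deriv (exact_f1 w) t)"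

definition coeff_of :: "real \<Rightarrow> real \<Rightarrow> (real \<times> real \<Rightarrow> real) \<Rightarrow> real \<Rightarrow> real" where
  "coeff_of b T V = (\<lambda>y. 4 * bottom b (wd (Rect b T) (yt 1 0) V) y)"

end

theory Submission
  imports Defs
begin

text \<open>Put \<open>q = 2 \<beta> b - \<mu>\<close>. The estimate comes from comparing the minimizer \<open>Vmin\<close> with
  \<open>W = V* + (F - F*)\<close>, the exact solution shifted to the noisy boundary data. \<open>W\<close> is \<open>\<sigma>\<close>-close to \<open>V*\<close>
  in \<open>H\<^sup>4\<close>, satisfies the same boundary conditions as \<open>Vmin\<close> and has norm below \<open>2 M\<close>; this is why
  convexity is needed on a ball larger than that of radius \<open>M\<close>.

  Since \<open>S(V*) = 0\<close> and \<open>F - F*\<close> is smaller than \<open>\<sigma>\<close>, the integral in \<open>J(W)\<close> is \<open>O(\<sigma>\<^sup>2)\<close> (lemma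
  \<open>residual_bound\<close>), hence \<open>J(W) \<le> c \<sigma>\<^sup>2 + 4 \<gamma> M\<^sup>2\<close>. The minimizer lies in the interior of the ball of
  radius \<open>M\<close>, where the gradient term of the convexity inequality cannot be negative (lemma
  \<open>gradient_nonneg_at_interior_minimizer\<close>), and \<open>J(Vmin) \<ge> 0\<close>. So \<open>exp (- 2 \<lambda> q)\<close> times the squared
  distance of \<open>W\<close> and \<open>Vmin\<close> is at most \<open>J(W)\<close> (lemma \<open>stability_estimate\<close>). The choice of \<open>\<lambda>\<close> makes
  this factor equal to \<open>\<sigma>\<close>, and \<open>\<gamma> = 2 \<sigma>\<^sup>e\<close> with \<open>e = \<beta> T / (2 q)\<close>. After division by \<open>\<sigma>\<close> the bound is
  of order \<open>\<sigma> + \<sigma>\<^bsup>e - 1\<^esup>\<close>, and \<open>2 \<rho> \<le> min 1 (e - 1)\<close> because \<open>e - 1\<close> is at least \<open>\<omega>\<close>. Adding the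
  distances from \<open>V*\<close> to \<open>W\<close> and from \<open>Vmin\<close> to the iterate gives the theorem (lemma \<open>error_splitting\<close>);
  \<open>C\<close> is one plus the constant of the trace inequality for \<open>V\<^sub>y\<close> on \<open>t = 0\<close>.

  What remains is to know that \<open>V*\<close> solves \<open>V\<^sub>y\<^sub>y - 2 V\<^sub>y\<^sub>t + p V = 0\<close> almost everywhere, that
  \<open>4 V\<^sub>y(y, 0) = p(y)\<close> and that \<open>V*\<close> is bounded, starting from the distributional definition of \<open>w\<close>
  (lemma \<open>exact_solution_properties\<close>). Testing the wave equation with products in the characteristic
  coordinates \<open>y + t\<close> and \<open>t - y\<close> turns it into a Volterra equation. A Gronwall argument shows that \<open>w\<close>
  vanishes outside the cone \<open>\<bar>y\<bar> < t\<close>, so that inside the cone \<open>w\<close> satisfies the Goursat integral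
  equation with value \<open>1/2\<close> on both characteristics. Differentiating this equation gives \<open>V\<close> and \<open>V\<^sub>y\<close>
  as continuous functions. Although \<open>p\<close> is only of class \<open>C\<^sup>1\<close>, \<open>V\<^sub>y\<close> is differentiable along \<open>(1, -2)\<close>
  with derivative \<open>- p V\<close>; as \<open>\<partial>\<^sub>y\<^sup>2 - 2 \<partial>\<^sub>y \<partial>\<^sub>t\<close> is \<open>\<partial>\<^sub>y\<close> followed by the derivative along \<open>(1, -2)\<close>,
  this is the equation.

  Weak derivatives and traces are handled through one representation: on a strip, a function with a weak
  derivative across the strip is almost everywhere a primitive plus its trace (lemma
  \<open>slab_representation\<close>). It yields the existence of traces, their norm bounds, and that taking a trace
  commutes with weak tangential derivatives (lemma \<open>trace_weak_deriv\<close>).\<close>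

section \<open>Smooth functions and test functions\<close>

text \<open>A whole sequence of successive derivatives is required rather than a statement on iterated
  \<open>deriv\<close>, because such a sequence can be shifted by one place in either direction.\<close>

definition smooth1 :: "(real \<Rightarrow> real) \<Rightarrow> bool" where
  "smooth1 f \<longleftrightarrow> (\<exists>F. F 0 = f \<and> (\<forall>n x. (F n has_real_derivative F (Suc n) x) (at x)))"

lemma smooth1_deriv:
  assumes "smooth1 f"
  obtains f' where "smooth1 f'" "\<And>x. (f has_real_derivative f' x) (at x)"
proof -
  obtain F where F: "F 0 = f" "\<And>n x. (F n has_real_derivative F (Suc n) x) (at x)"
    using assms unfolding smooth1_def by auto
  have "smooth1 (F (Suc 0))"
    unfolding smooth1_def by (rule exI[of _ "\<lambda>n. F (Suc n)"]) (simp add: F)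
  then show ?thesis using F that by metis
qed

lemma smooth1_antideriv:
  assumes "smooth1 f'" "\<And>x. (f has_real_derivative f' x) (at x)"
  shows "smooth1 f"
proof -
  obtain F where F: "F 0 = f'" "\<And>n x. (F n has_real_derivative F (Suc n) x) (at x)"
    using assms unfolding smooth1_def by auto
  have "((case n of 0 \<Rightarrow> f | Suc m \<Rightarrow> F m) has_real_derivative (case Suc n of 0 \<Rightarrow> f | Suc m \<Rightarrow> F m) x) (at x)" for n x
    using F assms by (cases n) auto
  then show ?thesis
    unfolding smooth1_def by (intro exI[of _ "\<lambda>n. case n of 0 \<Rightarrow> f | Suc m \<Rightarrow> F m"]) auto
qed

lemma smooth1_coinduct:
  assumes "f \<in> X"
    and "\<And>g. g \<in> X \<Longrightarrow> \<exists>g'\<in>X. \<forall>x. (g has_real_derivative g' x) (at x)"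
  shows "smooth1 f"
proof -
  obtain D where D: "\<And>g. g \<in> X \<Longrightarrow> D g \<in> X \<and> (\<forall>x. (g has_real_derivative D g x) (at x))"
    using assms(2) by metis
  have "(D ^^ n) f \<in> X" for n
    by (induction n) (use assms(1) D in auto)
  then show ?thesis
    unfolding smooth1_def using D by (intro exI[of _ "\<lambda>n. (D ^^ n) f"]) auto
qed

text \<open>The functions generated by smooth functions of one linear form. All test functions that are
  constructed below, products of bumps in Cartesian or in characteristic coordinates, are of this form,
  and an induction over the generation shows that all their directional derivatives are again of this
  form.\<close>

inductive_set smooth_alg :: "('a::euclidean_space \<Rightarrow> real) set" where
  lin: "smooth1 a \<Longrightarrow> (\<lambda>x. a (x \<bullet> u)) \<in> smooth_alg"
| add: "f \<in> smooth_alg \<Longrightarrow> g \<in> smooth_alg \<Longrightarrow> (\<lambda>x. f x + g x) \<in> smooth_alg"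
| mult: "f \<in> smooth_alg \<Longrightarrow> g \<in> smooth_alg \<Longrightarrow> (\<lambda>x. f x * g x) \<in> smooth_alg"
| inv: "f \<in> smooth_alg \<Longrightarrow> (\<And>x. f x \<noteq> 0) \<Longrightarrow> (\<lambda>x. inverse (f x)) \<in> smooth_alg"

lemma smooth1_const: "smooth1 (\<lambda>x. c)"
proof (rule smooth1_coinduct)
  show "(\<lambda>x. c) \<in> {\<lambda>x. c, \<lambda>x. 0}" by simp
qed auto

lemma smooth_alg_const: "(\<lambda>x. c) \<in> smooth_alg"
  using smooth_alg.lin[OF smooth1_const] by fast

lemma smooth_alg_deriv:
  assumes "f \<in> smooth_alg"
  obtains D where "\<And>x. (f has_derivative (\<lambda>e. D e x)) (at x)" "\<And>e. D e \<in> smooth_alg"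
proof -
  from assms have "\<exists>D. (\<forall>x. (f has_derivative (\<lambda>e. D e x)) (at x)) \<and> (\<forall>e. D e \<in> smooth_alg)"
  proof induction
    case (lin a u)
    obtain a' where a': "smooth1 a'" "\<And>x. (a has_real_derivative a' x) (at x)"
      using smooth1_deriv[OF lin] by auto
    have "((\<lambda>x. a (x \<bullet> u)) has_derivative (\<lambda>e. (e \<bullet> u) * a' (x \<bullet> u))) (at x)" for x
      using DERIV_compose_FDERIV[OF a'(2) has_derivative_inner_left[OF has_derivative_ident], of u x UNIV]
      by simp
    then show ?case
      using smooth_alg.mult[OF smooth_alg_const smooth_alg.lin[OF a'(1)]]
      by (intro exI[of _ "\<lambda>e x. (e \<bullet> u) * a' (x \<bullet> u)"]) auto
  next
    case (add f g)
    then obtain D E where "\<And>x. (f has_derivative (\<lambda>e. D e x)) (at x)" "\<And>e. D e \<in> smooth_alg"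
      "\<And>x. (g has_derivative (\<lambda>e. E e x)) (at x)" "\<And>e. E e \<in> smooth_alg" by metis
    then show ?case
      by (intro exI[of _ "\<lambda>e x. D e x + E e x"]) (auto intro!: smooth_alg.add has_derivative_add)
  next
    case (mult f g)
    then obtain D E where "\<And>x. (f has_derivative (\<lambda>e. D e x)) (at x)" "\<And>e. D e \<in> smooth_alg"
      "\<And>x. (g has_derivative (\<lambda>e. E e x)) (at x)" "\<And>e. E e \<in> smooth_alg" by metis
    then show ?case using mult
      by (intro exI[of _ "\<lambda>e x. f x * E e x + D e x * g x"])
         (auto intro!: smooth_alg.add smooth_alg.mult has_derivative_mult)
  next
    case (inv f)
    then obtain D where D: "\<And>x. (f has_derivative (\<lambda>e. D e x)) (at x)" "\<And>e. D e \<in> smooth_alg"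
      by metis
    have "((\<lambda>x. inverse (f x)) has_derivative (\<lambda>e. (- 1) * (inverse (f x) * D e x * inverse (f x)))) (at x)" for x
      using Deriv.has_derivative_inverse[OF inv.hyps(2) D(1)] by simp
    moreover have "(\<lambda>x. (- 1) * (inverse (f x) * D e x * inverse (f x))) \<in> smooth_alg" for e
      using inv.hyps D(2) by (intro smooth_alg.mult smooth_alg_const smooth_alg.inv) auto
    ultimately show ?case
      by (intro exI[of _ "\<lambda>e x. - 1 * (inverse (f x) * D e x * inverse (f x))"]) blast
  qed
  then show ?thesis using that by auto
qed

text \<open>In dimension one the two notions agree. This gives the closure of \<open>smooth1\<close> under products and
  inverses without Leibniz formulas for higher derivatives.\<close>

lemma smooth1_alg:
  fixes f :: "real \<Rightarrow> real"
  shows "smooth1 f \<longleftrightarrow> f \<in> smooth_alg"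
proof
  assume "smooth1 f"
  from smooth_alg.lin[OF this, of "1::real"] show "f \<in> smooth_alg" by simp
next
  assume "f \<in> smooth_alg"
  then show "smooth1 f"
  proof (rule smooth1_coinduct)
    fix g :: "real \<Rightarrow> real" assume "g \<in> smooth_alg"
    then obtain D where D: "\<And>x. (g has_derivative (\<lambda>e. D e x)) (at x)" "\<And>e. D e \<in> smooth_alg"
      using smooth_alg_deriv by blast
    have "(g has_real_derivative D 1 x) (at x)" for x
    proof -
      interpret linear "\<lambda>e. D e x" using D(1)[of x] has_derivative_linear by blast
      have "(\<lambda>e. D e x) = (*) (D 1 x)"
      proof
        fix e show "D e x = D 1 x * e" using scaleR[of e 1] by simp
      qed
      then show ?thesis using D(1)[of x] unfolding has_field_derivative_def by simp
    qed
    then show "\<exists>g'\<in>smooth_alg. \<forall>x. (g has_real_derivative g' x) (at x)" using D(2) by blast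
  qed
qed

lemma smooth1_add: "smooth1 f \<Longrightarrow> smooth1 g \<Longrightarrow> smooth1 (\<lambda>x. f x + g x)"
  and smooth1_mult: "smooth1 f \<Longrightarrow> smooth1 g \<Longrightarrow> smooth1 (\<lambda>x. f x * g x)"
  and smooth1_inverse: "smooth1 f \<Longrightarrow> (\<And>x. f x \<noteq> 0) \<Longrightarrow> smooth1 (\<lambda>x. inverse (f x))"
  by (simp_all add: smooth1_alg smooth_alg.add smooth_alg.mult smooth_alg.inv)

lemma smooth1_affine:
  assumes "smooth1 f" shows "smooth1 (\<lambda>x. f (c * x + d))"
proof (rule smooth1_coinduct)
  show "(\<lambda>x. f (c * x + d)) \<in> {\<lambda>x. m * g (c * x + d) | m g. smooth1 g}"
    using assms by (auto intro!: exI[of _ 1] exI[of _ f])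
  fix h assume "h \<in> {\<lambda>x. m * g (c * x + d) | m g. smooth1 g}"
  then obtain m g where h: "h = (\<lambda>x. m * g (c * x + d))" "smooth1 g" by auto
  obtain g' where g': "smooth1 g'" "\<And>x. (g has_real_derivative g' x) (at x)"
    using smooth1_deriv[OF h(2)] by auto
  have "(h has_real_derivative (m * c) * g' (c * x + d)) (at x)" for x
    unfolding h by (auto intro!: derivative_eq_intros DERIV_chain2[OF g'(2)])
  then show "\<exists>g'\<in>{\<lambda>x. m * g (c * x + d) | m g. smooth1 g}. \<forall>x. (h has_real_derivative g' x) (at x)"
    using g'(1) by (intro bexI[of _ "\<lambda>x. (m * c) * g' (c * x + d)"]) auto
qed

lemma smooth1_continuous:
  assumes "smooth1 f" shows "continuous_on A f"
  using smooth1_deriv[OF assms] DERIV_isCont continuous_at_imp_continuous_on by metis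

text \<open>For \<open>q = 1\<close> this is the standard example of a smooth function that is flat at 0. The polynomial
  factor makes the family closed under differentiation.\<close>

definition flat :: "real poly \<Rightarrow> real \<Rightarrow> real" where
  "flat q x = (if x \<le> 0 then 0 else poly q (1 / x) * exp (- (1 / x)))"

lemma poly_exp_tendsto_0: "((\<lambda>x. poly q x * exp (- x)) \<longlongrightarrow> 0) at_top" for q :: "real poly"
proof -
  have "((\<lambda>x. \<Sum>i\<le>degree q. coeff q i * (x ^ i / exp x)) \<longlongrightarrow> (\<Sum>i\<le>degree q. coeff q i * 0)) at_top"
    by (intro tendsto_intros tendsto_power_div_exp_0)
  then show ?thesis
    by (simp add: poly_altdef exp_minus sum_distrib_right divide_inverse mult.assoc)
qed

text \<open>With \<open>u = 1 / x\<close> the derivative of \<open>q(u) exp (- u)\<close> is \<open>u\<^sup>2 (q - q')(u) exp (- u)\<close>, and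
  \<open>[:0, 0, 1:]\<close> is the polynomial \<open>u\<^sup>2\<close>. At 0 the difference quotient is of the same kind and tends to 0
  because \<open>exp\<close> dominates polynomials.\<close>

lemma flat_deriv: "(flat q has_real_derivative flat ([:0, 0, 1:] * (q - pderiv q)) x) (at x)"
proof -
  consider "x < 0" | "x = 0" | "x > 0" by linarith
  then show ?thesis
  proof cases
    case 1
    have "(flat q has_real_derivative 0) (at x)"
    proof (rule has_field_derivative_transform_within_open[of "\<lambda>x. 0" 0 x "{..<0}"])
    qed (use 1 in \<open>auto simp: flat_def\<close>)
    then show ?thesis using 1 by (simp add: flat_def)
  next
    case 3
    have "((\<lambda>x. poly q (1 / x) * exp (- (1 / x))) has_real_derivative
        flat ([:0, 0, 1:] * (q - pderiv q)) x) (at x)"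
      using 3 unfolding flat_def
      by (auto intro!: derivative_eq_intros DERIV_chain2[OF poly_DERIV]
          simp: field_simps power2_eq_square)
    then show ?thesis
    proof (rule has_field_derivative_transform_within_open[of _ _ x "{0<..}"])
    qed (use 3 in \<open>auto simp: flat_def\<close>)
  next
    case 2
    have "((\<lambda>h. flat q h / h) \<longlongrightarrow> 0) (at_right 0)"
    proof -
      have "((\<lambda>h. poly (pCons 0 q) (inverse h) * exp (- inverse h)) \<longlongrightarrow> 0) (at_right 0)"
        by (rule filterlim_compose[OF poly_exp_tendsto_0 filterlim_inverse_at_top_right])
      then show ?thesis
        by (rule Lim_transform_eventually)
           (auto simp: eventually_at_right_less flat_def divide_inverse intro!: eventually_at_rightI[of 0 1])
    qed
    moreover have "((\<lambda>h. flat q h / h) \<longlongrightarrow> 0) (at_left 0)"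
      by (rule Lim_transform_eventually[of "\<lambda>h. 0"])
         (auto simp: flat_def intro!: eventually_at_leftI[of "-1" 0])
    ultimately have "((\<lambda>h. flat q h / h) \<longlongrightarrow> 0) (at 0)"
      by (simp add: filterlim_split_at)
    then show ?thesis using 2 by (simp add: DERIV_def flat_def)
  qed
qed

lemma smooth1_flat: "smooth1 (flat q)"
proof (rule smooth1_coinduct)
  show "flat q \<in> range flat" by simp
qed (use flat_deriv in blast)

text \<open>Here \<open>g\<close> is smooth and positive exactly on \<open>(a, b)\<close>. The quotient \<open>n g / (1 + n g)\<close> is bounded by
  1 and tends to the indicator of \<open>(a, b)\<close> as \<open>n\<close> grows.\<close>

definition plateau :: "real \<Rightarrow> real \<Rightarrow> nat \<Rightarrow> real \<Rightarrow> real" where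
  "plateau a b n x = (let g = flat 1 (x - a) * flat 1 (b - x) in real n * g * inverse (1 + real n * g))"

lemma flat_1: "flat 1 x \<ge> 0" "x \<le> 0 \<Longrightarrow> flat 1 x = 0" "x > 0 \<Longrightarrow> flat 1 x > 0"
  by (auto simp: flat_def)

lemma smooth1_plateau: "smooth1 (plateau a b n)"
proof -
  define g where "g = (\<lambda>x. flat 1 (x - a) * flat 1 (b - x))"
  have g: "smooth1 g"
    using smooth1_mult[OF smooth1_affine[OF smooth1_flat, of 1 1 "-a"] smooth1_affine[OF smooth1_flat, of 1 "-1" b]]
    by (simp add: g_def)
  have pos: "1 + real n * g x \<noteq> 0" for x
  proof -
    have "g x \<ge> 0" by (simp add: g_def flat_1)
    then have "real n * g x \<ge> 0" by simp
    then show ?thesis by linarith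
  qed
  have "plateau a b n = (\<lambda>x. real n * g x * inverse (1 + real n * g x))"
    by (auto simp: plateau_def g_def Let_def)
  then show ?thesis
    using pos by (auto intro!: smooth1_mult smooth1_inverse smooth1_add smooth1_const g)
qed

lemma plateau_bounds: "0 \<le> plateau a b n x" "plateau a b n x \<le> 1" "x \<notin> {a<..<b} \<Longrightarrow> plateau a b n x = 0"
proof -
  define g where "g = flat 1 (x - a) * flat 1 (b - x)"
  have "g \<ge> 0" by (simp add: g_def flat_1)
  then have "real n * g \<ge> 0" by simp
  then show "0 \<le> plateau a b n x" "plateau a b n x \<le> 1"
    unfolding plateau_def g_def[symmetric] Let_def by (auto simp: field_simps)
  show "x \<notin> {a<..<b} \<Longrightarrow> plateau a b n x = 0"
    by (auto simp: plateau_def flat_1 not_less)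
qed

lemma plateau_tendsto: "(\<lambda>n. plateau a b n x) \<longlonglongrightarrow> indicator {a<..<b} x"
proof (cases "x \<in> {a<..<b}")
  case True
  define g where "g = flat 1 (x - a) * flat 1 (b - x)"
  have g: "g > 0" using True by (simp add: g_def flat_1)
  have "(\<lambda>n. 1 - inverse (1 + real n * g)) \<longlonglongrightarrow> 1 - 0"
  proof (intro tendsto_intros tendsto_inverse_0_at_top)
    have "filterlim (\<lambda>n. real n * g) at_top sequentially"
      using filterlim_at_top_mult_tendsto_pos[OF tendsto_const g filterlim_real_sequentially]
      by simp
    then show "filterlim (\<lambda>n. 1 + real n * g) at_top sequentially"
      by (rule filterlim_tendsto_add_at_top[OF tendsto_const])
  qed
  moreover have "1 - inverse (1 + real n * g) = plateau a b n x" for n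
  proof -
    have "real n * g \<ge> 0" using g by simp
    then have "1 + real n * g \<noteq> 0" by linarith
    then show ?thesis unfolding plateau_def g_def[symmetric] Let_def by (simp add: field_simps)
  qed
  ultimately show ?thesis using True by simp
next
  case False
  then show ?thesis by (simp add: plateau_bounds del: greaterThanLessThan_iff)
qed

definition bump1 :: "real \<Rightarrow> real \<Rightarrow> (real \<Rightarrow> real) \<Rightarrow> bool" where
  "bump1 c d f \<longleftrightarrow> smooth1 f \<and> (\<forall>x. x \<notin> {c..d} \<longrightarrow> f x = 0)"

lemma bump1_plateau: "bump1 a b (plateau a b n)"
  by (auto simp: bump1_def smooth1_plateau intro!: plateau_bounds(3))

lemma bump1_continuous: "bump1 c d f \<Longrightarrow> continuous_on A f"
  by (simp add: bump1_def smooth1_continuous)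

lemma bump1_measurable[measurable_dest]: "bump1 c d f \<Longrightarrow> f \<in> borel_measurable borel"
  by (intro borel_measurable_continuous_onI bump1_continuous)

lemma bump1_mono: "bump1 c d f \<Longrightarrow> c' \<le> c \<Longrightarrow> d \<le> d' \<Longrightarrow> bump1 c' d' f"
  by (auto simp: bump1_def)

lemma bump1_bounded:
  assumes "bump1 c d f" obtains K where "K > 0" "\<And>x. \<bar>f x\<bar> \<le> K"
proof -
  have "compact (f ` {c..d})"
    by (intro compact_continuous_image bump1_continuous[OF assms]) auto
  then have "bounded (f ` {c..d})" by (rule compact_imp_bounded)
  then obtain K where K: "\<And>x. x \<in> {c..d} \<Longrightarrow> \<bar>f x\<bar> \<le> K"
    unfolding bounded_real by blast
  have "\<bar>f x\<bar> \<le> max K 1" for x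
    using K[of x] assms by (cases "x \<in> {c..d}") (auto simp: bump1_def)
  then show ?thesis using that[of "max K 1"] by auto
qed

lemma bump1_integrable: assumes "bump1 c d f" shows "integrable lborel f"
proof -
  have "integrable lborel (\<lambda>x. indicator {c..d} x *\<^sub>R f x)"
    by (intro borel_integrable_compact bump1_continuous[OF assms]) auto
  moreover have "(\<lambda>x. indicator {c..d} x *\<^sub>R f x) = f"
    using assms by (auto simp: bump1_def indicator_def fun_eq_iff)
  ultimately show ?thesis by simp
qed

text \<open>To the right of the support the primitive is constant, equal to the integral; so it has compact
  support exactly if the integral vanishes.\<close>

lemma bump1_primitive:
  assumes "bump1 c d f" "(LINT x|lborel. f x) = 0"
  shows "bump1 c d (\<lambda>x. LINT s:{..x}|lborel. f s)"
    and "((\<lambda>x. LINT s:{..x}|lborel. f s) has_real_derivative f x) (at x)"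
proof -
  define F where "F = (\<lambda>x. LINT s:{..x}|lborel. f s)"
  have int: "set_integrable lborel A f" if "A \<in> sets borel" for A
    using integrable_mult_indicator[OF _ bump1_integrable[OF assms(1)], of A] that
    by (simp add: set_integrable_def)
  have F0: "F x = 0" if "x < c" for x
  proof -
    have "(\<lambda>s. indicator {..x} s *\<^sub>R f s) = (\<lambda>s. 0)"
      using that assms(1) by (auto simp: bump1_def indicator_def)
    then show ?thesis by (simp add: F_def set_lebesgue_integral_def)
  qed
  have F1: "F x = 0" if "x > d" for x
  proof -
    have "(\<lambda>s. indicator {..x} s *\<^sub>R f s) = f"
      using that assms(1) by (auto simp: bump1_def indicator_def fun_eq_iff)
    then show ?thesis using assms(2) by (simp add: F_def set_lebesgue_integral_def)
  qed
  have der: "(F has_real_derivative f x) (at x)" for x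
  proof -
    define a b where "a = x - 1" and "b = x + 1"
    have eq: "F y = F a + integral {a..y} f" if "y \<in> {a<..<b}" for y
    proof -
      have "F y = (LINT s:{..a} \<union> {a<..y}|lborel. f s)"
        unfolding F_def using that by (auto simp: ivl_disj_un intro!: arg_cong2[where f="\<lambda>A. set_lebesgue_integral lborel A"])
      also have "\<dots> = F a + (LINT s:{a<..y}|lborel. f s)"
        unfolding F_def by (rule set_integral_Un) (auto intro!: int)
      also have "(LINT s:{a<..y}|lborel. f s) = (LINT s:{a..y}|lborel. f s)"
        by (rule set_integral_discrete_difference[of "{a}"]) auto
      also have "\<dots> = integral {a..y} f"
        by (rule set_borel_integral_eq_integral) (auto intro: int)
      finally show ?thesis .
    qed
    have "((\<lambda>y. integral {a..y} f) has_real_derivative f x) (at x within {a..b})"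
      by (rule integral_has_real_derivative) (auto intro: bump1_continuous[OF assms(1)] simp: a_def b_def)
    then have "((\<lambda>y. integral {a..y} f) has_real_derivative f x) (at x within {a<..<b})"
      by (rule DERIV_subset) auto
    from DERIV_add[OF DERIV_const this]
    have "((\<lambda>y. F a + integral {a..y} f) has_real_derivative f x) (at x within {a<..<b})"
      by simp
    then have "((\<lambda>y. F a + integral {a..y} f) has_real_derivative f x) (at x)"
      by (subst (asm) at_within_open) (auto simp: a_def b_def)
    then show ?thesis
      by (rule has_field_derivative_transform_within_open[of _ _ x "{a<..<b}"])
         (use eq in \<open>auto simp: a_def b_def\<close>)
  qed
  have "smooth1 F" using smooth1_antideriv[OF _ der] assms(1) by (simp add: bump1_def)
  then show "bump1 c d (\<lambda>x. LINT s:{..x}|lborel. f s)"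
    using F0 F1 unfolding bump1_def F_def[symmetric] by (auto simp: not_le)
  show "((\<lambda>x. LINT s:{..x}|lborel. f s) has_real_derivative f x) (at x)"
    using der by (simp add: F_def)
qed

lemma bump1_mass_one:
  assumes "a < b" obtains f where "bump1 a b f" "\<And>x. f x \<ge> 0" "(LINT x|lborel. f x) = 1"
    and "\<And>x. x \<notin> {a<..<b} \<Longrightarrow> f x = 0"
proof -
  let ?g = "plateau a b 1"
  have int: "integrable lborel ?g" by (rule bump1_integrable[OF bump1_plateau])
  have pos: "?g x > 0" if "x \<in> {a<..<b}" for x
    using that flat_1(3)[of "x - a"] flat_1(3)[of "b - x"]
    by (simp add: plateau_def Let_def add_pos_pos)
  have "(LINT x|lborel. ?g x) \<noteq> 0"
  proof
    assume "(LINT x|lborel. ?g x) = 0"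
    then have "AE x in lborel. ?g x = 0"
      using integral_nonneg_eq_0_iff_AE[OF int] plateau_bounds(1) by simp
    then have "AE x in lborel. x \<notin> {a<..<b}"
      by eventually_elim (use pos in fastforce)
    then have "emeasure lborel {a<..<b} = 0"
      by (subst (asm) AE_iff_measurable[of "{a<..<b}"]) auto
    then show False using assms by simp
  qed
  moreover have "(LINT x|lborel. ?g x) \<ge> 0" by (simp add: plateau_bounds)
  ultimately have m: "(LINT x|lborel. ?g x) > 0" by simp
  let ?f = "\<lambda>x. ?g x * inverse (LINT x|lborel. ?g x)"
  show ?thesis
  proof (rule that[of ?f])
    show "bump1 a b ?f" using bump1_plateau[of a b 1]
      by (auto simp: bump1_def intro!: smooth1_mult smooth1_const)
    show "(LINT x|lborel. ?f x) = 1" using m int by simp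
    show "?f x \<ge> 0" for x using m by (simp add: plateau_bounds)
    show "?f x = 0" if "x \<notin> {a<..<b}" for x using plateau_bounds(3)[OF that] by simp
  qed
qed

section \<open>Test functions determine a locally integrable function\<close>

text \<open>The boxes are closed under intersections and generate the Borel sets, so the integral of \<open>f\<close>
  vanishes over every Borel set.\<close>

lemma integral_boxes_zero_imp_AE_zero:
  fixes f :: "'a::euclidean_space \<Rightarrow> real"
  assumes f: "integrable lborel f" and box: "\<And>c d. (LINT x:box c d|lborel. f x) = 0"
  shows "AE x in lborel. f x = 0"
proof (rule sigma_finite_measure.density_zero[OF sigma_finite_lborel f])
  have setint: "set_integrable lborel A f" if "A \<in> sets lborel" for A
    using integrable_mult_indicator[OF that f] by (simp add: set_integrable_def)
  have "(\<lambda>n::nat. LINT x:box (- (real n *\<^sub>R One)) (real n *\<^sub>R One)|lborel. f x) \<longlonglongrightarrow> (LINT x|lborel. f x)"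
    unfolding set_lebesgue_integral_def
  proof (rule integral_dominated_convergence[where w="\<lambda>x. norm (f x)"])
    show "AE x in lborel. (\<lambda>n::nat. indicat_real (box (- (real n *\<^sub>R One)) (real n *\<^sub>R One)) x *\<^sub>R f x) \<longlonglongrightarrow> f x"
    proof (rule AE_I2)
      fix x :: 'a
      obtain N where N: "\<And>n i. n \<ge> N \<Longrightarrow> i \<in> Basis \<Longrightarrow> \<bar>x \<bullet> i\<bar> < real n"
      proof -
        obtain N where "norm x < real N" using reals_Archimedean2 by blast
        moreover have "real N \<le> real n \<Longrightarrow> i \<in> Basis \<Longrightarrow> \<bar>x \<bullet> i\<bar> \<le> norm x" for n i
          using Basis_le_norm[of i x] by simp
        ultimately show ?thesis by (intro that[of N]) fastforce
      qed
      then have "x \<in> box (- (real n *\<^sub>R One)) (real n *\<^sub>R One)" if "n \<ge> N" for n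
        using that by (auto simp: mem_box abs_less_iff minus_less_iff)
      then have "eventually (\<lambda>n::nat. indicat_real (box (- (real n *\<^sub>R One)) (real n *\<^sub>R One)) x *\<^sub>R f x = f x) sequentially"
        by (intro eventually_sequentiallyI[of N]) auto
      then show "(\<lambda>n::nat. indicat_real (box (- (real n *\<^sub>R One)) (real n *\<^sub>R One)) x *\<^sub>R f x) \<longlonglongrightarrow> f x"
        by (rule tendsto_eventually)
    qed
  qed (use f in \<open>auto simp: indicator_def\<close>)
  then have total: "(LINT x|lborel. f x) = 0"
    unfolding box by (simp add: LIMSEQ_const_iff)
  fix A :: "'a set" assume "A \<in> sets lborel"
  then have A: "A \<in> sigma_sets UNIV (range (\<lambda>(a, b). box a b))"
    by (simp add: borel_eq_box)
  have "range (\<lambda>(a, b). box a b :: 'a set) \<subseteq> Pow UNIV" by simp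
  have stable: "Int_stable (range (\<lambda>(a, b). box a b :: 'a set))"
    by (auto simp: Int_stable_def box_Int_box)
  show "(LINT x:A|lborel. f x) = 0"
    using stable \<open>range (\<lambda>(a, b). box a b :: 'a set) \<subseteq> Pow UNIV\<close> A
  proof (induction rule: sigma_sets_induct_disjoint)
    case (compl A)
    then have A: "A \<in> sets lborel" by (simp add: borel_eq_box)
    have "(LINT x:UNIV|lborel. f x) = (LINT x:A \<union> (UNIV - A)|lborel. f x)"
      by simp
    also have "\<dots> = (LINT x:A|lborel. f x) + (LINT x:UNIV - A|lborel. f x)"
      by (rule set_integral_Un) (use A in \<open>auto intro!: setint\<close>)
    finally show ?case using compl total by (simp add: set_lebesgue_integral_def)
  next
    case (union A)
    then have A: "\<And>i. A i \<in> sets lborel" by (auto simp: borel_eq_box)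
    have "(LINT x:(\<Union>i. A i)|lborel. f x) = (\<Sum>i. (LINT x:(A i)|lborel. f x))"
      by (rule lebesgue_integral_countable_add)
         (use A union(1) in \<open>auto simp: disjoint_family_on_def intro!: setint\<close>)
    then show ?case using union by simp
  next
    case (basic A)
    then show ?case using box by auto
  next
    case empty
    then show ?case by (simp add: set_lebesgue_integral_def)
  qed
qed

lemma prod_indicator_box:
  "(\<Prod>i\<in>Basis. indicator {c \<bullet> i<..<d \<bullet> i} (x \<bullet> i)) = (indicator (box c d) x :: real)"
  for x :: "'a::euclidean_space"
  by (auto simp: indicator_def mem_box prod_zero_iff)

lemma AE_on_open_by_boxes:
  fixes \<Omega> :: "'a::euclidean_space set"
  assumes "open \<Omega>"
    and box: "\<And>c d. cbox c d \<subseteq> \<Omega> \<Longrightarrow> AE x in lborel. x \<in> box c d \<longrightarrow> P x"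
  shows "AE x in lborel. x \<in> \<Omega> \<longrightarrow> P x"
proof -
  obtain D where D: "countable D" "\<And>X. X \<in> D \<Longrightarrow> \<exists>a b. X = cbox a b" "\<Union> D = \<Omega>"
    using open_countable_Union_open_cbox[OF assms(1)] by metis
  have "AE x in lborel. \<forall>X\<in>D. x \<in> X \<longrightarrow> P x"
  proof (subst AE_ball_countable[OF D(1)], intro ballI)
    fix X assume "X \<in> D"
    then obtain a b where X: "X = cbox a b" "cbox a b \<subseteq> \<Omega>" using D by blast
    have "AE x in lborel. x \<notin> cbox a b - box a b"
      by (rule AE_not_in[OF null_sets_cbox_Diff_box])
    with box[OF X(2)] show "AE x in lborel. x \<in> X \<longrightarrow> P x"
      by eventually_elim (auto simp: X)
  qed
  then show ?thesis by eventually_elim (use D(3) in auto)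
qed

text \<open>The products of plateaus converge boundedly to the indicator of a box; by dominated convergence,
  integrals against them determine the integrals over boxes.\<close>

lemma loc_integrable_plateau_zero:
  fixes f :: "'a::euclidean_space \<Rightarrow> real"
  assumes \<Omega>: "open \<Omega>" and f: "loc_integrable \<Omega> f"
    and zero: "\<And>c d n. cbox c d \<subseteq> \<Omega> \<Longrightarrow> (\<And>i. i \<in> Basis \<Longrightarrow> c \<bullet> i < d \<bullet> i) \<Longrightarrow>
      (LINT x:\<Omega>|lborel. f x * (\<Prod>i\<in>Basis. plateau (c \<bullet> i) (d \<bullet> i) n (x \<bullet> i))) = 0"
  shows "AE x in lborel. x \<in> \<Omega> \<longrightarrow> f x = 0"
proof (rule AE_on_open_by_boxes[OF \<Omega>])
  fix c0 d0 :: 'a assume sub: "cbox c0 d0 \<subseteq> \<Omega>"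
  have fK: "integrable lborel (\<lambda>x. indicator (cbox c0 d0) x * f x)"
    using f sub unfolding loc_integrable_def set_integrable_def by auto
  define F where "F = (\<lambda>x. indicator (box c0 d0) x * f x)"
  have Feq: "F = (\<lambda>x. indicator (box c0 d0) x * (indicator (cbox c0 d0) x * f x))"
    using box_subset_cbox[of c0 d0] by (auto simp: F_def indicator_def fun_eq_iff)
  have F: "integrable lborel F"
    unfolding Feq using integrable_mult_indicator[OF _ fK, of "box c0 d0"] by simp
  have "(LINT x:box c d|lborel. F x) = 0" for c d
  proof -
    obtain c' d' where cd: "box c d \<inter> box c0 d0 = box c' d'"
      unfolding box_Int_box by blast
    have eq: "(LINT x:box c d|lborel. F x) = (LINT x|lborel. indicator (box c' d') x * f x)"
      unfolding set_lebesgue_integral_def F_def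
      using cd by (auto simp: indicator_def intro!: Bochner_Integration.integral_cong)
    show ?thesis
    proof (cases "box c' d' = {}")
      case True
      then show ?thesis unfolding eq by simp
    next
      case False
      then have lt: "\<And>i. i \<in> Basis \<Longrightarrow> c' \<bullet> i < d' \<bullet> i" by (auto simp: box_ne_empty)
      have cb: "cbox c' d' \<subseteq> cbox c0 d0"
      proof -
        have "closure (box c' d') \<subseteq> closure (box c0 d0)"
          using cd by (intro closure_mono) auto
        also have "\<dots> \<subseteq> cbox c0 d0" using box_subset_cbox closed_cbox closure_minimal by blast
        finally show ?thesis by (simp add: closure_box[OF False])
      qed
      define \<phi> where "\<phi> = (\<lambda>n x. \<Prod>i\<in>Basis. plateau (c' \<bullet> i) (d' \<bullet> i) n (x \<bullet> i))"
      have \<phi>m[measurable]: "\<phi> n \<in> borel_measurable borel" for n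
        unfolding \<phi>_def using bump1_measurable[OF bump1_plateau] by measurable
      have \<phi>0: "\<phi> n x = 0" if "x \<notin> box c' d'" for n x
      proof -
        have "\<not> (\<forall>i\<in>Basis. x \<bullet> i \<in> {c' \<bullet> i<..<d' \<bullet> i})"
          using that by (simp add: mem_box)
        then obtain i where "i \<in> Basis" "x \<bullet> i \<notin> {c' \<bullet> i<..<d' \<bullet> i}" by blast
        then show ?thesis unfolding \<phi>_def
          by (intro prod_zero) (auto intro!: bexI[of _ i] plateau_bounds(3))
      qed
      have "(\<lambda>n. LINT x|lborel. (indicator (cbox c0 d0) x * f x) * \<phi> n x) \<longlonglongrightarrow>
          (LINT x|lborel. (indicator (cbox c0 d0) x * f x) * indicator (box c' d') x)"
      proof (rule integral_dominated_convergence[where w="\<lambda>x. norm (indicator (cbox c0 d0) x * f x)"])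
        show "AE x in lborel. (\<lambda>n. (indicator (cbox c0 d0) x * f x) * \<phi> n x) \<longlonglongrightarrow>
          (indicator (cbox c0 d0) x * f x) * indicator (box c' d') x"
          unfolding \<phi>_def prod_indicator_box[symmetric]
          by (intro AE_I2 tendsto_intros tendsto_prod plateau_tendsto)
        have "\<bar>\<phi> n x\<bar> \<le> 1" for n x
          unfolding \<phi>_def by (subst abs_of_nonneg) (auto intro!: prod_nonneg prod_le_1 plateau_bounds)
        then show "AE x in lborel. norm ((indicator (cbox c0 d0) x * f x) * \<phi> n x) \<le> norm (indicator (cbox c0 d0) x * f x)" for n
          by (auto simp: abs_mult intro!: mult_left_le)
        show "(\<lambda>x. (indicator (cbox c0 d0) x * f x) * \<phi> n x) \<in> borel_measurable lborel" for n
          using fK by measurable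
        show "(\<lambda>x. (indicator (cbox c0 d0) x * f x) * indicator (box c' d') x) \<in> borel_measurable lborel"
          using fK by measurable
      qed (use fK in auto)
      moreover have "(LINT x|lborel. (indicator (cbox c0 d0) x * f x) * \<phi> n x) = 0" for n
      proof -
        have "(LINT x|lborel. (indicator (cbox c0 d0) x * f x) * \<phi> n x) = (LINT x:\<Omega>|lborel. f x * \<phi> n x)"
          unfolding set_lebesgue_integral_def
        proof (intro Bochner_Integration.integral_cong refl)
          fix x
          show "(indicator (cbox c0 d0) x * f x) * \<phi> n x = indicator \<Omega> x *\<^sub>R (f x * \<phi> n x)"
            using \<phi>0[of x n] cb sub box_subset_cbox[of c' d']
            by (cases "x \<in> box c' d'") (auto simp: indicator_def)
        qed
        also have "\<dots> = 0" unfolding \<phi>_def by (rule zero) (use cb sub lt in auto)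
        finally show ?thesis .
      qed
      ultimately have "(LINT x|lborel. (indicator (cbox c0 d0) x * f x) * indicator (box c' d') x) = 0"
        by (simp add: LIMSEQ_const_iff)
      moreover have "(LINT x|lborel. (indicator (cbox c0 d0) x * f x) * indicator (box c' d') x)
         = (LINT x|lborel. indicator (box c' d') x * f x)"
        using cb box_subset_cbox[of c' d'] by (intro Bochner_Integration.integral_cong) (auto simp: indicator_def)
      ultimately show ?thesis using eq by simp
    qed
  qed
  from integral_boxes_zero_imp_AE_zero[OF F this]
  show "AE x in lborel. x \<in> box c0 d0 \<longrightarrow> f x = 0"
    by eventually_elim (auto simp: F_def)
qed

lemma dir_deriv_eqI:
  assumes "\<And>x. ((\<lambda>s. f (x + s *\<^sub>R e)) has_real_derivative g x) (at 0)"
  shows "dir_deriv e f = g"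
  using assms by (auto simp: dir_deriv_def intro!: DERIV_imp_deriv)

lemma has_derivative_line:
  fixes f :: "'a::real_normed_vector \<Rightarrow> real"
  assumes "(f has_derivative f') (at x)"
  shows "((\<lambda>s. f (x + s *\<^sub>R e)) has_real_derivative f' e) (at 0)"
proof -
  interpret linear f' using assms has_derivative_linear by blast
  have "((\<lambda>s. x + s *\<^sub>R e) has_derivative (\<lambda>s. s *\<^sub>R e)) (at 0)"
    by (auto intro!: derivative_eq_intros)
  then have "((\<lambda>s. f (x + s *\<^sub>R e)) has_derivative (\<lambda>s. f' (s *\<^sub>R e))) (at 0)"
    by (rule has_derivative_compose) (use assms in simp)
  then show ?thesis by (simp add: has_field_derivative_def scaleR mult.commute[of _ "f' e"])
qed

lemma smooth_alg_iter_deriv: "f \<in> smooth_alg \<Longrightarrow> iter_deriv ds f \<in> smooth_alg"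
proof (induction ds)
  case (Cons e ds)
  then obtain D where D: "\<And>x. (iter_deriv ds f has_derivative (\<lambda>e. D e x)) (at x)" "\<And>e. D e \<in> smooth_alg"
    using smooth_alg_deriv by metis
  have "iter_deriv (e # ds) f = D e"
    using dir_deriv_eqI[OF has_derivative_line[OF D(1)]] by (simp add: iter_deriv_def)
  then show ?case using D(2) by simp
qed (simp add: iter_deriv_def)

lemma smooth_alg_smooth_fun: "f \<in> smooth_alg \<Longrightarrow> smooth_fun f"
  unfolding smooth_fun_def differentiable_on_def differentiable_def
  using smooth_alg_deriv[OF smooth_alg_iter_deriv] by (metis UNIV_I has_derivative_at_withinI)

lemma compact_closed_subset: "compact K \<Longrightarrow> closed S \<Longrightarrow> S \<subseteq> K \<Longrightarrow> compact S"
  using compact_Int_closed[of K S] by (simp add: Int_absorb1)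

lemma smooth_alg_test_fun:
  assumes "f \<in> smooth_alg" "compact K" "K \<subseteq> \<Omega>" "\<And>x. x \<notin> K \<Longrightarrow> f x = 0"
  shows "test_fun \<Omega> f"
proof -
  have "closure {x. f x \<noteq> 0} \<subseteq> K"
    using assms by (intro closure_minimal) (auto simp: compact_imp_closed)
  then show ?thesis unfolding test_fun_def
    using assms(3) smooth_alg_smooth_fun[OF assms(1)] compact_closed_subset[OF assms(2) closed_closure]
    by auto
qed

lemma smooth_alg_prod:
  "finite I \<Longrightarrow> (\<And>i. i \<in> I \<Longrightarrow> f i \<in> smooth_alg) \<Longrightarrow> (\<lambda>x. \<Prod>i\<in>I. f i x) \<in> smooth_alg"
  by (induction I rule: finite_induct) (auto intro: smooth_alg_const smooth_alg.mult)

lemma test_fun_plateau: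
  assumes "cbox c d \<subseteq> \<Omega>"
  shows "test_fun \<Omega> (\<lambda>x. \<Prod>i\<in>Basis. plateau (c \<bullet> i) (d \<bullet> i) n (x \<bullet> i))"
proof (rule smooth_alg_test_fun[OF _ compact_cbox assms])
  show "(\<lambda>x. \<Prod>i\<in>Basis. plateau (c \<bullet> i) (d \<bullet> i) n (x \<bullet> i)) \<in> smooth_alg"
    by (intro smooth_alg_prod smooth_alg.lin[of "plateau (c \<bullet> i) (d \<bullet> i) n" i for i] smooth1_plateau) auto
  fix x assume "x \<notin> cbox c d"
  then obtain i where "i \<in> Basis" "x \<bullet> i \<notin> {c \<bullet> i<..<d \<bullet> i}" by (fastforce simp: mem_box)
  then show "(\<Prod>i\<in>Basis. plateau (c \<bullet> i) (d \<bullet> i) n (x \<bullet> i)) = 0"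
    by (intro prod_zero) (auto intro!: bexI[of _ i] plateau_bounds(3))
qed

lemma test_functions_determine:
  assumes "open \<Omega>" "loc_integrable \<Omega> f"
    and "\<And>\<phi>. test_fun \<Omega> \<phi> \<Longrightarrow> (LINT x:\<Omega>|lborel. f x * \<phi> x) = 0"
  shows "AE x in lborel. x \<in> \<Omega> \<longrightarrow> f x = 0"
  by (rule loc_integrable_plateau_zero[OF assms(1,2)]) (intro assms(3) test_fun_plateau)

lemma prod_Basis_plane: "(\<Prod>i\<in>Basis. F i) = F (1, 0) * F (0, 1)"
  for F :: "real \<times> real \<Rightarrow> real"
  by (simp add: Basis_prod_def prod.union_disjoint)

text \<open>In the plane it is enough to test with products of functions of one variable. This is the form in
  which both the representation on strips and the Volterra equation are obtained.\<close>

lemma product_tests_determine: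
  fixes f :: "real \<times> real \<Rightarrow> real"
  assumes "open \<Omega>" "loc_integrable \<Omega> f"
    and "\<And>a b a' b' A B. bump1 a b A \<Longrightarrow> bump1 a' b' B \<Longrightarrow> a < b \<Longrightarrow> a' < b' \<Longrightarrow> {a..b} \<times> {a'..b'} \<subseteq> \<Omega> \<Longrightarrow>
      (LINT x:\<Omega>|lborel. f x * (A (fst x) * B (snd x))) = 0"
  shows "AE x in lborel. x \<in> \<Omega> \<longrightarrow> f x = 0"
proof (rule loc_integrable_plateau_zero[OF assms(1,2)])
  fix c d :: "real \<times> real" and n
  assume "cbox c d \<subseteq> \<Omega>" and "\<And>i. i \<in> Basis \<Longrightarrow> c \<bullet> i < d \<bullet> i"
  from this(1) this(2)[of "(1, 0)"] this(2)[of "(0, 1)"]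
  show "(LINT x:\<Omega>|lborel. f x * (\<Prod>i\<in>Basis. plateau (c \<bullet> i) (d \<bullet> i) n (x \<bullet> i))) = 0"
    unfolding prod_Basis_plane
    using assms(3)[OF bump1_plateau bump1_plateau, of "fst c" "fst d" "snd c" "snd d" n n]
    by (cases c; cases d) (auto simp: cbox_Pair_eq Basis_prod_def inner_prod_def)
qed

lemma test_fun_product:
  assumes "bump1 a b A" "bump1 a' b' B" "{a..b} \<times> {a'..b'} \<subseteq> \<Omega>"
  shows "test_fun \<Omega> (\<lambda>z::real \<times> real. A (fst z) * B (snd z))"
proof (rule smooth_alg_test_fun[OF _ _ assms(3)])
  have "(\<lambda>z::real \<times> real. A (z \<bullet> (1, 0)) * B (z \<bullet> (0, 1))) \<in> smooth_alg"
    using assms by (intro smooth_alg.mult smooth_alg.lin) (auto simp: bump1_def)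
  then show "(\<lambda>z::real \<times> real. A (fst z) * B (snd z)) \<in> smooth_alg"
    by (simp add: inner_prod_def)
  show "compact ({a..b} \<times> {a'..b'})" by (intro compact_Times) auto
qed (use assms in \<open>auto simp: bump1_def\<close>)

section \<open>Calculus of test functions\<close>

lemma test_fun_differentiable:
  assumes "test_fun \<Omega> \<phi>" shows "\<phi> differentiable (at x)"
  using assms unfolding test_fun_def smooth_fun_def
  by (elim conjE allE[of _ "[]"]) (simp add: iter_deriv_def differentiable_on_def)

lemma test_fun_line:
  assumes "test_fun \<Omega> \<phi>"
  shows "((\<lambda>s. \<phi> (x + s *\<^sub>R e)) has_real_derivative dir_deriv e \<phi> x) (at 0)"
proof -
  obtain f' where "(\<phi> has_derivative f') (at x)"
    using test_fun_differentiable[OF assms] by (auto simp: differentiable_def)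
  from has_derivative_line[OF this, of e] show ?thesis
    by (simp add: dir_deriv_def DERIV_imp_deriv)
qed

lemma dir_deriv_combo:
  assumes "test_fun \<Omega> \<phi>"
  shows "dir_deriv (a *\<^sub>R e + b *\<^sub>R e') \<phi> x = a * dir_deriv e \<phi> x + b * dir_deriv e' \<phi> x"
proof -
  obtain f' where f': "(\<phi> has_derivative f') (at x)"
    using test_fun_differentiable[OF assms] by (auto simp: differentiable_def)
  interpret linear f' using f' has_derivative_linear by blast
  have "dir_deriv e \<phi> x = f' e" for e
    using has_derivative_line[OF f'] by (auto simp: dir_deriv_def DERIV_imp_deriv)
  then show ?thesis by (simp add: add scaleR)
qed

lemma test_fun_continuous: "test_fun \<Omega> \<phi> \<Longrightarrow> continuous_on A \<phi>"
  using test_fun_differentiable differentiable_imp_continuous_within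
  by (metis continuous_at_imp_continuous_on)

lemma test_fun_measurable[measurable_dest]: "test_fun \<Omega> \<phi> \<Longrightarrow> \<phi> \<in> borel_measurable borel"
  by (intro borel_measurable_continuous_onI test_fun_continuous)

lemma test_fun_supp:
  assumes "test_fun \<Omega> \<phi>"
  obtains K where "compact K" "K \<subseteq> \<Omega>" "\<And>x. x \<notin> K \<Longrightarrow> \<phi> x = 0"
proof (rule that[of "closure {x. \<phi> x \<noteq> 0}"])
  show "\<phi> x = 0" if "x \<notin> closure {x. \<phi> x \<noteq> 0}" for x
    using that closure_subset[of "{x. \<phi> x \<noteq> 0}"] by auto
qed (use assms in \<open>auto simp: test_fun_def\<close>)

lemma test_fun_mono: "test_fun \<Omega> \<phi> \<Longrightarrow> \<Omega> \<subseteq> \<Omega>' \<Longrightarrow> test_fun \<Omega>' \<phi>"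
  by (auto simp: test_fun_def)

lemma test_fun_bounded:
  assumes "test_fun \<Omega> \<phi>" obtains C where "C > 0" "\<And>x. \<bar>\<phi> x\<bar> \<le> C"
proof -
  obtain K where K: "compact K" "\<And>x. x \<notin> K \<Longrightarrow> \<phi> x = 0" using test_fun_supp[OF assms] by metis
  have "bounded (\<phi> ` K)"
    by (intro compact_imp_bounded compact_continuous_image test_fun_continuous[OF assms] K)
  then obtain C where C: "\<And>x. x \<in> K \<Longrightarrow> \<bar>\<phi> x\<bar> \<le> C" unfolding bounded_real by blast
  have "\<bar>\<phi> x\<bar> \<le> max C 1" for x using C[of x] K(2)[of x] by (cases "x \<in> K") auto
  then show ?thesis using that[of "max C 1"] by auto
qed

lemma iter_deriv_append: "iter_deriv (ds @ es) \<phi> = iter_deriv ds (iter_deriv es \<phi>)"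
  by (simp add: iter_deriv_def)

lemma test_fun_dir_deriv:
  assumes "test_fun \<Omega> \<phi>" "e \<in> Basis" shows "test_fun \<Omega> (dir_deriv e \<phi>)"
proof -
  let ?K = "closure {x. \<phi> x \<noteq> 0}"
  have "dir_deriv e \<phi> x = 0" if "x \<notin> ?K" for x
  proof -
    have "x \<in> - ?K" using that by simp
    then obtain d where d: "d > 0" "ball x d \<subseteq> - ?K"
      by (rule openE[rotated]) auto
    have 0: "\<phi> y = 0" if "y \<in> ball x d" for y
      using d(2) that closure_subset[of "{x. \<phi> x \<noteq> 0}"] by (auto simp del: mem_ball)
    have "eventually (\<lambda>s. \<phi> (x + s *\<^sub>R e) = 0) (nhds 0)"
    proof (rule eventually_nhds_metric[THEN iffD2], intro exI[of _ d] conjI allI impI)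
      fix s :: real assume "dist s 0 < d"
      then show "\<phi> (x + s *\<^sub>R e) = 0" using assms(2) by (intro 0) (simp add: dist_norm)
    qed (use d in simp)
    then have "deriv (\<lambda>s. \<phi> (x + s *\<^sub>R e)) 0 = deriv (\<lambda>s. 0) 0" by (rule deriv_cong_ev) simp
    then show ?thesis by (simp add: dir_deriv_def)
  qed
  then have sub: "closure {x. dir_deriv e \<phi> x \<noteq> 0} \<subseteq> ?K" by (intro closure_minimal) auto
  have "smooth_fun (dir_deriv e \<phi>)" unfolding smooth_fun_def
  proof (intro allI impI)
    fix ds :: "'a list" assume "set ds \<subseteq> Basis"
    then have "iter_deriv (ds @ [e]) \<phi> differentiable_on UNIV"
      using assms unfolding test_fun_def smooth_fun_def by auto
    then show "iter_deriv ds (dir_deriv e \<phi>) differentiable_on UNIV" by (simp add: iter_deriv_def)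
  qed
  then show ?thesis using sub assms(1) compact_closed_subset[OF _ closed_closure sub] unfolding test_fun_def
    by blast
qed

lemma test_fun_iter_deriv: "test_fun \<Omega> \<phi> \<Longrightarrow> set ds \<subseteq> Basis \<Longrightarrow> test_fun \<Omega> (iter_deriv ds \<phi>)"
proof (induction ds)
  case (Cons e ds)
  then have "test_fun \<Omega> (dir_deriv e (iter_deriv ds \<phi>))" by (intro test_fun_dir_deriv) auto
  then show ?case by (simp add: iter_deriv_def)
qed (simp add: iter_deriv_def)

lemma dir_deriv_off_support:
  assumes "x \<notin> closure {x. \<phi> x \<noteq> 0}" shows "dir_deriv e \<phi> x = 0"
proof -
  let ?S = "(\<lambda>s::real. x + s *\<^sub>R e) -` (- closure {x. \<phi> x \<noteq> 0})"
  have "open ?S" by (intro open_vimage continuous_intros) auto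
  moreover have "0 \<in> ?S" using assms by simp
  ultimately have "eventually (\<lambda>s. s \<in> ?S) (nhds 0)" by (rule eventually_nhds_in_open)
  then have "eventually (\<lambda>s. \<phi> (x + s *\<^sub>R e) = 0) (nhds 0)"
    by eventually_elim (use closure_subset[of "{x. \<phi> x \<noteq> 0}"] in auto)
  then have "deriv (\<lambda>s. \<phi> (x + s *\<^sub>R e)) 0 = deriv (\<lambda>s. 0) 0" by (rule deriv_cong_ev) simp
  then show ?thesis by (simp add: dir_deriv_def)
qed

lemma loc_integrable_test:
  assumes "loc_integrable \<Omega> u" "test_fun \<Omega> \<phi>"
  shows "set_integrable lborel \<Omega> (\<lambda>x. u x * \<phi> x)"
proof -
  obtain K where K: "compact K" "K \<subseteq> \<Omega>" "\<And>x. x \<notin> K \<Longrightarrow> \<phi> x = 0"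
    using test_fun_supp[OF assms(2)] by metis
  obtain C where C: "C > 0" "\<And>x. \<bar>\<phi> x\<bar> \<le> C" using test_fun_bounded[OF assms(2)] by metis
  have i: "integrable lborel (\<lambda>x. indicator K x *\<^sub>R u x)"
    using assms(1) K unfolding loc_integrable_def set_integrable_def by auto
  note [measurable] = test_fun_measurable[OF assms(2)]
  have "integrable lborel (\<lambda>x. (indicator K x *\<^sub>R u x) * \<phi> x)"
  proof (rule Bochner_Integration.integrable_bound)
    show "integrable lborel (\<lambda>x. C * (indicator K x *\<^sub>R u x))" using i by simp
    show "(\<lambda>x. (indicator K x *\<^sub>R u x) * \<phi> x) \<in> borel_measurable lborel" using i by measurable
    show "AE x in lborel. norm ((indicator K x *\<^sub>R u x) * \<phi> x) \<le> norm (C * (indicator K x *\<^sub>R u x))"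
      using C by (auto simp: abs_mult mult.commute intro!: mult_mono)
  qed
  moreover have "(\<lambda>x. (indicator K x *\<^sub>R u x) * \<phi> x) = (\<lambda>x. indicator \<Omega> x *\<^sub>R (u x * \<phi> x))"
    using K by (auto simp: indicator_def fun_eq_iff)
  ultimately show ?thesis by (simp add: set_integrable_def)
qed

lemma loc_integrable_combo:
  assumes "loc_integrable \<Omega> u" "loc_integrable \<Omega> v"
  shows "loc_integrable \<Omega> (\<lambda>x. u x + c * v x)"
  using assms by (auto simp: loc_integrable_def intro!: set_integral_add)

lemma loc_integrable_mono: "loc_integrable \<Omega> u \<Longrightarrow> \<Omega>' \<subseteq> \<Omega> \<Longrightarrow> loc_integrable \<Omega>' u"
  by (auto simp: loc_integrable_def)

lemma continuous_loc_integrable: "continuous_on \<Omega> u \<Longrightarrow> loc_integrable \<Omega> u"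
  unfolding loc_integrable_def set_integrable_def
  using borel_integrable_compact continuous_on_subset by blast

lemma loc_integrable_measurable:
  assumes "open \<Omega>" "loc_integrable \<Omega> u" shows "set_borel_measurable lborel \<Omega> u"
proof (cases "\<Omega> = {}")
  case False
  obtain D where D: "countable D" "\<And>X. X \<in> D \<Longrightarrow> \<exists>a b. X = cbox a b" "\<Union> D = \<Omega>"
    using open_countable_Union_open_cbox[OF assms(1)] by metis
  then have "D \<noteq> {}" using False by auto
  then have "D = range (from_nat_into D)" using range_from_nat_into[OF _ D(1)] by simp
  define X where "X = from_nat_into D"
  have X: "D = range X" using \<open>D = range (from_nat_into D)\<close> by (simp add: X_def)
  define K where "K = (\<lambda>n::nat. \<Union>i\<le>n. X i)"
  have Xc: "compact (X i)" for i using D(2)[of "X i"] X by auto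
  have Kc: "compact (K n)" for n unfolding K_def by (intro compact_UN) (auto simp: Xc)
  have KU: "K n \<subseteq> \<Omega>" for n using X D(3) by (auto simp: K_def)
  have meas: "(\<lambda>x. indicator (K n) x *\<^sub>R u x) \<in> borel_measurable lborel" for n
    using assms(2) Kc KU unfolding loc_integrable_def set_integrable_def by blast
  have lim: "(\<lambda>n. indicator (K n) x *\<^sub>R u x) \<longlonglongrightarrow> indicator \<Omega> x *\<^sub>R u x" for x
  proof (cases "x \<in> \<Omega>")
    case True
    then obtain m where "x \<in> X m" using D(3) X by auto
    then have "eventually (\<lambda>n. indicator (K n) x *\<^sub>R u x = indicator \<Omega> x *\<^sub>R u x) sequentially"
      by (intro eventually_sequentiallyI[of m]) (use True in \<open>auto simp: K_def indicator_def\<close>)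
    then show ?thesis by (rule tendsto_eventually)
  next
    case False
    then have "x \<notin> K n" for n using KU by blast
    then show ?thesis using False by simp
  qed
  show ?thesis unfolding set_borel_measurable_def
    by (rule borel_measurable_LIMSEQ_real[OF lim meas])
qed (simp add: set_borel_measurable_def)

section \<open>Weak derivatives\<close>

lemma weak_deriv_unique:
  assumes "open \<Omega>" "set ds \<subseteq> Basis" "weak_deriv \<Omega> ds u v" "weak_deriv \<Omega> ds u w"
  shows "AE x in lborel. x \<in> \<Omega> \<longrightarrow> v x = w x"
proof -
  have "AE x in lborel. x \<in> \<Omega> \<longrightarrow> v x + (- 1) * w x = 0"
  proof (rule test_functions_determine[OF assms(1)])
    show "loc_integrable \<Omega> (\<lambda>x. v x + (- 1) * w x)"
      using assms by (intro loc_integrable_combo) (auto simp: weak_deriv_def)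
    fix \<phi> assume \<phi>: "test_fun \<Omega> \<phi>"
    have "(LINT x:\<Omega>|lborel. v x * \<phi> x) = (LINT x:\<Omega>|lborel. w x * \<phi> x)"
      using assms(3,4) \<phi> unfolding weak_deriv_def by simp
    moreover have "set_integrable lborel \<Omega> (\<lambda>x. v x * \<phi> x)" "set_integrable lborel \<Omega> (\<lambda>x. w x * \<phi> x)"
      using assms(3,4) \<phi> by (auto simp: weak_deriv_def intro: loc_integrable_test)
    ultimately show "(LINT x:\<Omega>|lborel. (v x + (- 1) * w x) * \<phi> x) = 0"
      by (simp add: algebra_simps set_integral_diff)
  qed
  then show ?thesis by eventually_elim auto
qed

lemma weak_deriv_combo:
  assumes "set ds \<subseteq> Basis" "weak_deriv \<Omega> ds u v" "weak_deriv \<Omega> ds u' v'"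
  shows "weak_deriv \<Omega> ds (\<lambda>x. u x + c * u' x) (\<lambda>x. v x + c * v' x)"
  unfolding weak_deriv_def
proof (intro conjI allI impI)
  fix \<phi> assume \<phi>: "test_fun \<Omega> \<phi>"
  have \<phi>': "test_fun \<Omega> (iter_deriv ds \<phi>)" using test_fun_iter_deriv[OF \<phi> assms(1)] .
  have i: "set_integrable lborel \<Omega> (\<lambda>x. u x * iter_deriv ds \<phi> x)" "set_integrable lborel \<Omega> (\<lambda>x. u' x * iter_deriv ds \<phi> x)"
    "set_integrable lborel \<Omega> (\<lambda>x. v x * \<phi> x)" "set_integrable lborel \<Omega> (\<lambda>x. v' x * \<phi> x)"
    using assms(2,3) \<phi> \<phi>' by (auto simp: weak_deriv_def intro: loc_integrable_test)
  have e: "(LINT x:\<Omega>|lborel. u x * iter_deriv ds \<phi> x) = (-1) ^ length ds * (LINT x:\<Omega>|lborel. v x * \<phi> x)"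
    "(LINT x:\<Omega>|lborel. u' x * iter_deriv ds \<phi> x) = (-1) ^ length ds * (LINT x:\<Omega>|lborel. v' x * \<phi> x)"
    using assms(2,3) \<phi> by (auto simp: weak_deriv_def)
  show "(LINT x:\<Omega>|lborel. (u x + c * u' x) * iter_deriv ds \<phi> x) =
      (-1) ^ length ds * (LINT x:\<Omega>|lborel. (v x + c * v' x) * \<phi> x)"
    using i e by (simp add: distrib_right mult.assoc set_integral_add) (simp add: algebra_simps)
qed (use assms in \<open>auto simp: weak_deriv_def intro: loc_integrable_combo\<close>)

lemma weak_deriv_restrict:
  assumes "set ds \<subseteq> Basis" "weak_deriv \<Omega> ds u v" "\<Omega>' \<subseteq> \<Omega>"
  shows "weak_deriv \<Omega>' ds u v"
  unfolding weak_deriv_def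
proof (intro conjI allI impI)
  fix \<phi> assume \<phi>: "test_fun \<Omega>' \<phi>"
  have *: "(LINT x:\<Omega>'|lborel. f x * g x) = (LINT x:\<Omega>|lborel. f x * g x)" if g: "test_fun \<Omega>' g" for f g
  proof -
    obtain K where "K \<subseteq> \<Omega>'" "\<And>x. x \<notin> K \<Longrightarrow> g x = 0" using test_fun_supp[OF g] by metis
    then have "g x = 0" if "x \<notin> \<Omega>'" for x using that by auto
    then show ?thesis unfolding set_lebesgue_integral_def
      using assms(3) by (intro Bochner_Integration.integral_cong) (auto simp: indicator_def)
  qed
  show "(LINT x:\<Omega>'|lborel. u x * iter_deriv ds \<phi> x) = (-1) ^ length ds * (LINT x:\<Omega>'|lborel. v x * \<phi> x)"
    using *[OF \<phi>, of v] *[OF test_fun_iter_deriv[OF \<phi> assms(1)], of u] assms(2) test_fun_mono[OF \<phi> assms(3)]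
    by (simp add: weak_deriv_def)
qed (use assms loc_integrable_mono in \<open>auto simp: weak_deriv_def\<close>)

lemma wd_weak_deriv: "weak_deriv \<Omega> ds u v \<Longrightarrow> weak_deriv \<Omega> ds u (wd \<Omega> ds u)"
  unfolding wd_def by (rule someI[where P="weak_deriv \<Omega> ds u"])

lemma wd_AE_eq:
  assumes "open \<Omega>" "set ds \<subseteq> Basis" "weak_deriv \<Omega> ds u v"
  shows "AE x in lborel. x \<in> \<Omega> \<longrightarrow> wd \<Omega> ds u x = v x"
  using weak_deriv_unique[OF assms(1,2) wd_weak_deriv[OF assms(3)] assms(3)] .

text \<open>Integration by parts along a direction \<open>e\<close>: the integral of a compactly supported function
  is invariant under translation along \<open>e\<close>, so its derivative along \<open>e\<close> has integral zero.\<close>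

lemma integral_dir_deriv_zero:
  fixes h :: "'a::euclidean_space \<Rightarrow> real"
  assumes der: "\<And>x. ((\<lambda>s. h (x + s *\<^sub>R e)) has_real_derivative g x) (at 0)"
    and h: "continuous_on UNIV h" and g: "continuous_on UNIV g" and K: "compact K"
    and supp: "\<And>x. x \<notin> K \<Longrightarrow> h x = 0" "\<And>x. x \<notin> K \<Longrightarrow> g x = 0"
  shows "(LINT x|lborel. g x) = 0"
proof -
  have der': "((\<lambda>s. h (x + s *\<^sub>R e)) has_real_derivative g (x + s *\<^sub>R e)) (at s)" for x s
    using der[of "x + s *\<^sub>R e"] DERIV_shift[of "\<lambda>r. h (x + r *\<^sub>R e)" _ 0 s]
    by (simp add: algebra_simps)
  have hi: "integrable lborel h"
  proof -
    have "integrable lborel (\<lambda>x. indicator K x *\<^sub>R h x)"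
      by (rule borel_integrable_compact[OF K continuous_on_subset[OF h]]) simp
    moreover have "(\<lambda>x. indicator K x *\<^sub>R h x) = h" using supp by (auto simp: indicator_def fun_eq_iff)
    ultimately show ?thesis by simp
  qed
  have "bounded (g ` K)"
    by (intro compact_imp_bounded compact_continuous_image K continuous_on_subset[OF g]) simp
  then obtain C where C: "\<And>x. x \<in> K \<Longrightarrow> \<bar>g x\<bar> \<le> C" unfolding bounded_real by blast
  have gC: "\<bar>g x\<bar> \<le> max C 0" for x using C[of x] supp(2)[of x] by (cases "x \<in> K") auto
  have "bounded K" using K by (rule compact_imp_bounded)
  then obtain r where r: "\<And>x. x \<in> K \<Longrightarrow> norm x \<le> r" unfolding bounded_iff by blast
  let ?B = "cball (0::'a) (r + norm e)"
  define Q where "Q = (\<lambda>n x. real (Suc n) * (h (x + (1 / real (Suc n)) *\<^sub>R e) - h x))"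
  have hm[measurable]: "h \<in> borel_measurable borel" "g \<in> borel_measurable borel"
    using h g by (auto intro: borel_measurable_continuous_onI)
  have Qb: "norm (Q n x) \<le> max C 0 * indicator ?B x" for n x
  proof -
    define s where "s = 1 / real (Suc n)"
    have s: "0 < s" "s \<le> 1" by (auto simp: s_def)
    obtain \<theta> where \<theta>: "0 < \<theta>" "\<theta> < s" "h (x + s *\<^sub>R e) - h (x + 0 *\<^sub>R e) = (s - 0) * g (x + \<theta> *\<^sub>R e)"
      using MVT2[OF s(1), of "\<lambda>s. h (x + s *\<^sub>R e)" "\<lambda>s. g (x + s *\<^sub>R e)"] der' by blast
    have Q: "Q n x = g (x + \<theta> *\<^sub>R e)"
      using \<theta>(3) by (simp add: Q_def s_def del: of_nat_Suc)
    show ?thesis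
    proof (cases "x \<in> ?B")
      case False
      have "norm (\<theta> *\<^sub>R e) \<le> norm e"
        using \<theta> s by (simp add: mult_left_le_one_le)
      moreover have "norm x \<le> norm (x + \<theta> *\<^sub>R e) + norm (\<theta> *\<^sub>R e)"
        using norm_triangle_ineq4[of "x + \<theta> *\<^sub>R e" "\<theta> *\<^sub>R e"] by simp
      ultimately have "x + \<theta> *\<^sub>R e \<notin> K" using False r[of "x + \<theta> *\<^sub>R e"] by auto
      then show ?thesis using supp Q by simp
    qed (use gC Q in simp)
  qed
  have "(\<lambda>n. LINT x|lborel. Q n x) \<longlonglongrightarrow> (LINT x|lborel. g x)"
  proof (rule integral_dominated_convergence[where w="\<lambda>x. max C 0 * indicator ?B x"])
    show "integrable lborel (\<lambda>x. max C 0 * indicat_real ?B x)"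
      using emeasure_bounded_finite[of ?B]
      by (intro integrable_mult_right integrable_real_indicator) (auto simp: less_top)
    show "AE x in lborel. (\<lambda>n. Q n x) \<longlonglongrightarrow> g x"
    proof (rule AE_I2)
      fix x
      have "((\<lambda>s. (h (x + s *\<^sub>R e) - h x) / s) \<longlongrightarrow> g x) (at 0)"
        using der[of x] by (simp add: DERIV_def)
      moreover have "filterlim (\<lambda>n. 1 / real (Suc n)) (at 0) sequentially"
        by (rule filterlim_atI) (use LIMSEQ_inverse_real_of_nat in \<open>auto simp: inverse_eq_divide\<close>)
      ultimately have "(\<lambda>n. (h (x + (1 / real (Suc n)) *\<^sub>R e) - h x) / (1 / real (Suc n))) \<longlonglongrightarrow> g x"
        by (rule filterlim_compose)
      then show "(\<lambda>n. Q n x) \<longlonglongrightarrow> g x" by (simp add: Q_def mult.commute)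
    qed
  qed (use Qb in \<open>auto simp: Q_def\<close>)
  moreover have "(LINT x|lborel. Q n x) = 0" for n
  proof -
    define c where "c = (1 / real (Suc n)) *\<^sub>R e"
    have "(LINT x|lborel. h (x + c)) = (LINT x|distr lborel borel ((+) c). h x)"
      by (subst integral_distr) (auto simp: add.commute)
    also have "\<dots> = (LINT x|lborel. h x)" by (simp add: lborel_distr_plus)
    finally have eq: "(LINT x|lborel. h (x + c)) = (LINT x|lborel. h x)" .
    have "integrable (distr lborel borel ((+) c)) h" using hi by (simp add: lborel_distr_plus)
    then have "integrable lborel (\<lambda>x. h (x + c))"
      by (subst (asm) integrable_distr_eq) (auto simp: add.commute)
    then show ?thesis using hi eq by (simp add: Q_def c_def[symmetric] del: of_nat_Suc)
  qed
  ultimately show ?thesis by (simp add: LIMSEQ_const_iff)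
qed

text \<open>Only a derivative along the single direction \<open>e\<close> is required. This matters for \<open>V\<^sub>y\<close>, which is
  differentiable along \<open>(1, -2)\<close> but in no other direction in general. The product with the test
  function, extended by zero, is covered by the preceding lemma.\<close>

lemma integration_by_parts_test:
  fixes f :: "'a::euclidean_space \<Rightarrow> real"
  assumes \<Omega>: "open \<Omega>" and f: "continuous_on \<Omega> f" and f': "continuous_on \<Omega> f'"
    and der: "\<And>x. x \<in> \<Omega> \<Longrightarrow> ((\<lambda>s. f (x + s *\<^sub>R e)) has_real_derivative f' x) (at 0)"
    and \<phi>: "test_fun \<Omega> \<phi>" and \<phi>': "continuous_on UNIV (dir_deriv e \<phi>)"
    "\<And>x. x \<notin> closure {x. \<phi> x \<noteq> 0} \<Longrightarrow> dir_deriv e \<phi> x = 0"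
  shows "(LINT x:\<Omega>|lborel. f x * dir_deriv e \<phi> x) = - (LINT x:\<Omega>|lborel. f' x * \<phi> x)"
proof -
  define K where "K = closure {x. \<phi> x \<noteq> 0}"
  have K: "compact K" "K \<subseteq> \<Omega>" using \<phi> by (simp_all add: test_fun_def K_def)
  have \<phi>0: "\<phi> x = 0" if "x \<notin> K" for x
    using that closure_subset[of "{x. \<phi> x \<noteq> 0}"] unfolding K_def by auto
  have \<phi>'0: "dir_deriv e \<phi> x = 0" if "x \<notin> K" for x
    using that \<phi>'(2) unfolding K_def by simp
  note cK = compact_imp_closed[OF K(1)]
  define h where "h = (\<lambda>x. if x \<in> \<Omega> then f x * \<phi> x else 0)"
  define g where "g = (\<lambda>x. if x \<in> \<Omega> then f' x * \<phi> x + f x * dir_deriv e \<phi> x else 0)"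
  have glue: "continuous_on UNIV (\<lambda>x. if x \<in> \<Omega> then F x else 0)"
    if "continuous_on \<Omega> F" "\<And>x. x \<notin> K \<Longrightarrow> F x = 0" for F :: "'a \<Rightarrow> real"
  proof -
    have "continuous_on (\<Omega> \<union> - K) (\<lambda>x. if x \<in> \<Omega> then F x else 0)"
    proof (rule continuous_on_open_Un)
      show "continuous_on \<Omega> (\<lambda>x. if x \<in> \<Omega> then F x else 0)"
        using that(1) by (rule continuous_on_eq) auto
      show "continuous_on (- K) (\<lambda>x. if x \<in> \<Omega> then F x else 0)"
        by (rule continuous_on_eq[of _ "\<lambda>x. 0"]) (auto simp: that(2))
    qed (use \<Omega> cK in auto)
    moreover have "\<Omega> \<union> - K = UNIV" using K(2) by auto
    ultimately show ?thesis by simp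
  qed
  have "(LINT x|lborel. g x) = 0"
  proof (rule integral_dir_deriv_zero[of h e g K])
    show "continuous_on UNIV h" unfolding h_def
      by (rule glue[OF continuous_on_mult[OF f test_fun_continuous[OF \<phi>]]]) (simp add: \<phi>0)
    show "continuous_on UNIV g" unfolding g_def
      by (rule glue[OF continuous_on_add[OF continuous_on_mult[OF f' test_fun_continuous[OF \<phi>]]
            continuous_on_mult[OF f continuous_on_subset[OF \<phi>'(1) subset_UNIV]]]])
         (simp add: \<phi>0 \<phi>'0)
    fix x
    show "((\<lambda>s. h (x + s *\<^sub>R e)) has_real_derivative g x) (at 0)"
    proof (cases "x \<in> \<Omega>")
      case True
      have "((\<lambda>s. f (x + s *\<^sub>R e) * \<phi> (x + s *\<^sub>R e)) has_real_derivative g x) (at 0)"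
        using DERIV_mult[OF der[OF True] test_fun_line[OF \<phi>, of x e]] True by (simp add: g_def mult.commute)
      moreover have "open ((\<lambda>s. x + s *\<^sub>R e) -` \<Omega>)"
        using \<Omega> by (intro open_vimage continuous_intros)
      ultimately show ?thesis
        by (rule has_field_derivative_transform_within_open[where S="(\<lambda>s. x + s *\<^sub>R e) -` \<Omega>"])
           (use True in \<open>auto simp: h_def\<close>)
    next
      case False
      then have x: "x \<in> - K" using K(2) by auto
      have "((\<lambda>s. 0) has_real_derivative g x) (at 0)" using False by (simp add: g_def)
      moreover have "open ((\<lambda>s. x + s *\<^sub>R e) -` (- K))"
        by (intro open_vimage continuous_intros) (use cK in auto)
      ultimately show ?thesis
        by (rule has_field_derivative_transform_within_open[where S="(\<lambda>s. x + s *\<^sub>R e) -` (- K)"])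
           (use x \<phi>0 in \<open>auto simp: h_def\<close>)
    qed
  qed (use K \<phi>0 \<phi>'0 in \<open>auto simp: h_def g_def\<close>)
  moreover have "g = (\<lambda>x. indicator \<Omega> x *\<^sub>R (f' x * \<phi> x) + indicator \<Omega> x *\<^sub>R (f x * dir_deriv e \<phi> x))"
    by (auto simp: g_def indicator_def)
  moreover have "integrable lborel (\<lambda>x. indicator \<Omega> x *\<^sub>R (F x * g1 x))"
    if F: "continuous_on \<Omega> F" and g1: "continuous_on UNIV g1" "\<And>x. x \<notin> K \<Longrightarrow> g1 x = 0" for F g1 :: "'a \<Rightarrow> real"
  proof -
    have "integrable lborel (\<lambda>x. indicator K x *\<^sub>R (F x * g1 x))"
      by (rule borel_integrable_compact[OF K(1) continuous_on_mult[OF continuous_on_subset[OF F K(2)]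
            continuous_on_subset[OF g1(1) subset_UNIV]]])
    moreover have "(\<lambda>x. indicator K x *\<^sub>R (F x * g1 x)) = (\<lambda>x. indicator \<Omega> x *\<^sub>R (F x * g1 x))"
      using K g1 by (auto simp: indicator_def fun_eq_iff)
    ultimately show ?thesis by simp
  qed
  ultimately show ?thesis
    using f f' \<phi>'(1) \<phi>'0 \<phi>0 test_fun_continuous[OF \<phi>, of UNIV] by (simp add: set_lebesgue_integral_def)
qed

section \<open>Square integrable functions and Sobolev norms\<close>

lemma L2I:
  assumes "(\<lambda>x. indicator \<Omega> x * u x) \<in> borel_measurable borel" "integrable lborel (\<lambda>x. (indicator \<Omega> x * u x)\<^sup>2)"
  shows "u \<in> L2 \<Omega>"
proof -
  have "(\<lambda>x. indicator \<Omega> x *\<^sub>R (u x)\<^sup>2) = (\<lambda>x. (indicator \<Omega> x * u x)\<^sup>2)"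
    by (auto simp: indicator_def)
  then show ?thesis using assms by (simp add: L2_def set_borel_measurable_def set_integrable_def)
qed

lemma L2D:
  assumes "u \<in> L2 \<Omega>"
  shows "(\<lambda>x. indicator \<Omega> x * u x) \<in> borel_measurable borel" "integrable lborel (\<lambda>x. (indicator \<Omega> x * u x)\<^sup>2)"
proof -
  have "(\<lambda>x. indicator \<Omega> x *\<^sub>R (u x)\<^sup>2) = (\<lambda>x. (indicator \<Omega> x * u x)\<^sup>2)"
    by (auto simp: indicator_def)
  then show "(\<lambda>x. indicator \<Omega> x * u x) \<in> borel_measurable borel" "integrable lborel (\<lambda>x. (indicator \<Omega> x * u x)\<^sup>2)"
    using assms by (simp_all add: L2_def set_borel_measurable_def set_integrable_def)
qed

lemma L2_norm_eq: "L2_norm \<Omega> u = sqrt (LINT x|lborel. (indicator \<Omega> x * u x)\<^sup>2)"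
  unfolding L2_norm_def set_lebesgue_integral_def
  by (intro arg_cong[where f=sqrt] Bochner_Integration.integral_cong) (auto simp: indicator_def)

lemma L2_norm_nonneg: "L2_norm \<Omega> u \<ge> 0"
  by (simp add: L2_norm_eq)

lemma L2_norm_power2: "(L2_norm \<Omega> u)\<^sup>2 = (LINT x|lborel. (indicator \<Omega> x * u x)\<^sup>2)"
  by (simp add: L2_norm_eq)

lemma L2_mult:
  assumes "u \<in> L2 \<Omega>" "v \<in> L2 \<Omega>"
  shows "integrable lborel (\<lambda>x. (indicator \<Omega> x * u x) * (indicator \<Omega> x * v x))"
proof (rule Bochner_Integration.integrable_bound)
  note [measurable] = L2D(1)[OF assms(1)] L2D(1)[OF assms(2)]
  show "integrable lborel (\<lambda>x. (indicator \<Omega> x * u x)\<^sup>2 + (indicator \<Omega> x * v x)\<^sup>2)"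
    using assms by (intro Bochner_Integration.integrable_add L2D)
  show "(\<lambda>x. (indicator \<Omega> x * u x) * (indicator \<Omega> x * v x)) \<in> borel_measurable lborel" by measurable
  have "\<bar>a * b\<bar> \<le> a\<^sup>2 + b\<^sup>2" for a b :: real
    using sum_squares_bound[of "\<bar>a\<bar>" "\<bar>b\<bar>"] abs_ge_zero[of "a * b"]
    unfolding abs_mult power2_abs by linarith
  then show "AE x in lborel. norm ((indicator \<Omega> x * u x) * (indicator \<Omega> x * v x))
      \<le> norm ((indicator \<Omega> x * u x)\<^sup>2 + (indicator \<Omega> x * v x)\<^sup>2)"
    by (simp add: abs_of_nonneg[OF add_nonneg_nonneg])
qed

lemma L2_combo:
  assumes "u \<in> L2 \<Omega>" "v \<in> L2 \<Omega>"
  shows "(\<lambda>x. u x + c * v x) \<in> L2 \<Omega>"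
proof (rule L2I)
  note [measurable] = L2D(1)[OF assms(1)] L2D(1)[OF assms(2)]
  have eq: "(\<lambda>x. indicator \<Omega> x * (u x + c * v x)) = (\<lambda>x. indicator \<Omega> x * u x + c * (indicator \<Omega> x * v x))"
    by (auto simp: algebra_simps)
  show "(\<lambda>x. indicator \<Omega> x * (u x + c * v x)) \<in> borel_measurable borel"
    unfolding eq by measurable
  have "(\<lambda>x. (indicator \<Omega> x * (u x + c * v x))\<^sup>2) = (\<lambda>x. (indicator \<Omega> x * u x)\<^sup>2 +
      (2 * c) * ((indicator \<Omega> x * u x) * (indicator \<Omega> x * v x)) + c\<^sup>2 * (indicator \<Omega> x * v x)\<^sup>2)"
    by (auto simp: power2_eq_square algebra_simps)
  then show "integrable lborel (\<lambda>x. (indicator \<Omega> x * (u x + c * v x))\<^sup>2)"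
    using L2_mult[OF assms] L2D(2)[OF assms(1)] L2D(2)[OF assms(2)] by simp
qed

lemma L2_cong_AE:
  assumes "u \<in> L2 \<Omega>" "set_borel_measurable lborel \<Omega> v" "AE x in lborel. x \<in> \<Omega> \<longrightarrow> v x = u x"
  shows "v \<in> L2 \<Omega>"
proof (rule L2I)
  show m[measurable]: "(\<lambda>x. indicator \<Omega> x * v x) \<in> borel_measurable borel"
    using assms(2) by (simp add: set_borel_measurable_def)
  note [measurable] = L2D(1)[OF assms(1)]
  have "AE x in lborel. (indicator \<Omega> x * u x)\<^sup>2 = (indicator \<Omega> x * v x)\<^sup>2"
    using assms(3) by eventually_elim (auto simp: indicator_def)
  then show "integrable lborel (\<lambda>x. (indicator \<Omega> x * v x)\<^sup>2)"
    by (intro integrable_cong_AE_imp[OF L2D(2)[OF assms(1)]]) simp_all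
qed

lemma L2_norm_cong_AE:
  assumes "u \<in> L2 \<Omega>" "v \<in> L2 \<Omega>" "AE x in lborel. x \<in> \<Omega> \<longrightarrow> v x = u x"
  shows "L2_norm \<Omega> v = L2_norm \<Omega> u"
proof -
  note [measurable] = L2D(1)[OF assms(1)] L2D(1)[OF assms(2)]
  have "AE x in lborel. (indicator \<Omega> x * v x)\<^sup>2 = (indicator \<Omega> x * u x)\<^sup>2"
    using assms(3) by eventually_elim (auto simp: indicator_def)
  then have "(LINT x|lborel. (indicator \<Omega> x * v x)\<^sup>2) = (LINT x|lborel. (indicator \<Omega> x * u x)\<^sup>2)"
    by (intro integral_cong_AE) simp_all
  then show ?thesis by (simp add: L2_norm_eq)
qed

lemma L2_mono:
  assumes "u \<in> L2 \<Omega>" "\<Omega>' \<subseteq> \<Omega>" "\<Omega>' \<in> sets borel"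
  shows "u \<in> L2 \<Omega>'" "L2_norm \<Omega>' u \<le> L2_norm \<Omega> u"
proof -
  note [measurable] = L2D(1)[OF assms(1)]
  have eq: "indicator \<Omega>' x * u x = indicator \<Omega>' x * (indicator \<Omega> x * u x)" for x
    using assms(2) by (auto simp: indicator_def)
  have le: "(indicator \<Omega>' x * u x)\<^sup>2 \<le> (indicator \<Omega> x * u x)\<^sup>2" for x
    using assms(2) by (auto simp: indicator_def)
  have m: "(\<lambda>x. indicator \<Omega>' x * u x) \<in> borel_measurable borel"
    unfolding eq using assms(3) by measurable
  have i: "integrable lborel (\<lambda>x. (indicator \<Omega>' x * u x)\<^sup>2)"
    by (rule Bochner_Integration.integrable_bound[OF L2D(2)[OF assms(1)]]) (use le m in auto)
  show "u \<in> L2 \<Omega>'" using m i by (rule L2I)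
  show "L2_norm \<Omega>' u \<le> L2_norm \<Omega> u" unfolding L2_norm_eq
    by (intro real_sqrt_le_mono integral_mono i L2D(2)[OF assms(1)] le)
qed

lemma L2_norm_scale: "L2_norm \<Omega> (\<lambda>x. c * u x) = \<bar>c\<bar> * L2_norm \<Omega> u"
proof -
  have "(\<lambda>x. (indicator \<Omega> x * (c * u x))\<^sup>2) = (\<lambda>x. c\<^sup>2 * (indicator \<Omega> x * u x)\<^sup>2)"
    by (auto simp: indicator_def power_mult_distrib)
  then show ?thesis by (simp add: L2_norm_eq real_sqrt_mult)
qed

lemma square_sum_split: "(a + b)\<^sup>2 \<le> (1 + s) * a\<^sup>2 + (1 + 1 / s) * b\<^sup>2" if "s > 0" for a b s :: real
proof -
  have "0 \<le> (s * a - b)\<^sup>2 / s" using that by simp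
  also have "(s * a - b)\<^sup>2 = s * (s * a\<^sup>2) - s * (2 * a * b) + b\<^sup>2"
    by (simp add: power2_eq_square algebra_simps)
  also have "\<dots> / s = s * a\<^sup>2 - 2 * a * b + b\<^sup>2 / s"
    using that by (simp add: add_divide_distrib diff_divide_distrib)
  finally show ?thesis by (simp add: power2_sum distrib_right)
qed

text \<open>The inequality \<open>square_sum_split\<close> is integrated with the optimal parameter \<open>s\<close>, the quotient of
  the two norms. Adding \<open>e / 2\<close> to the norms keeps them positive.\<close>

lemma L2_norm_triangle:
  assumes "u \<in> L2 \<Omega>" "v \<in> L2 \<Omega>"
  shows "L2_norm \<Omega> (\<lambda>x. u x + v x) \<le> L2_norm \<Omega> u + L2_norm \<Omega> v"
proof (rule field_le_epsilon)
  fix e :: real assume "e > 0"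
  define a where "a = L2_norm \<Omega> u + e / 2"
  define b where "b = L2_norm \<Omega> v + e / 2"
  note nn = L2_norm_nonneg[of \<Omega> u] L2_norm_nonneg[of \<Omega> v]
  have pos: "a > 0" "b > 0" using \<open>e > 0\<close> nn unfolding a_def b_def by linarith+
  define s where "s = b / a"
  have s: "s > 0" using pos by (simp add: s_def)
  have uv: "(\<lambda>x. u x + v x) \<in> L2 \<Omega>" using L2_combo[OF assms, of 1] by simp
  note i = L2D(2)[OF assms(1)] L2D(2)[OF assms(2)] L2D(2)[OF uv]
  have "(L2_norm \<Omega> (\<lambda>x. u x + v x))\<^sup>2 \<le>
    (LINT x|lborel. (1 + s) * (indicator \<Omega> x * u x)\<^sup>2 + (1 + 1 / s) * (indicator \<Omega> x * v x)\<^sup>2)"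
    unfolding L2_norm_power2
  proof (rule integral_mono)
    show "(indicator \<Omega> x * (u x + v x))\<^sup>2 \<le> (1 + s) * (indicator \<Omega> x * u x)\<^sup>2 + (1 + 1 / s) * (indicator \<Omega> x * v x)\<^sup>2" for x
      using square_sum_split[OF s, of "indicator \<Omega> x * u x" "indicator \<Omega> x * v x"]
      unfolding distrib_left[of "indicator \<Omega> x"] .
    show "integrable lborel (\<lambda>x. (indicator \<Omega> x * (u x + v x))\<^sup>2)" by (rule i(3))
    show "integrable lborel (\<lambda>x. (1 + s) * (indicator \<Omega> x * u x)\<^sup>2 + (1 + 1 / s) * (indicator \<Omega> x * v x)\<^sup>2)"
      by (intro Bochner_Integration.integrable_add integrable_mult_right i)
  qed
  also have "\<dots> = (1 + s) * (L2_norm \<Omega> u)\<^sup>2 + (1 + 1 / s) * (L2_norm \<Omega> v)\<^sup>2"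
    unfolding L2_norm_power2 using i(1,2) by simp
  also have "\<dots> \<le> (1 + s) * a\<^sup>2 + (1 + 1 / s) * b\<^sup>2"
  proof (rule add_mono; rule mult_left_mono)
    show "(L2_norm \<Omega> u)\<^sup>2 \<le> a\<^sup>2" "(L2_norm \<Omega> v)\<^sup>2 \<le> b\<^sup>2"
      using nn \<open>e > 0\<close> by (auto intro!: power_mono simp: a_def b_def)
  qed (use s in auto)
  also have "\<dots> = (a + b)\<^sup>2"
  proof -
    have "s * a\<^sup>2 = a * b" "1 / s * b\<^sup>2 = a * b" using pos by (simp_all add: s_def power2_eq_square)
    then show ?thesis by (simp add: distrib_right power2_sum)
  qed
  finally have "L2_norm \<Omega> (\<lambda>x. u x + v x) \<le> a + b"
    by (rule power2_le_imp_le) (use pos in simp)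
  then show "L2_norm \<Omega> (\<lambda>x. u x + v x) \<le> L2_norm \<Omega> u + L2_norm \<Omega> v + e"
    by (simp add: a_def b_def)
qed

lemma L2_integrable:
  assumes "u \<in> L2 \<Omega>" "\<Omega> \<in> sets borel" "emeasure lborel \<Omega> < \<infinity>"
  shows "integrable lborel (\<lambda>x. indicator \<Omega> x * u x)"
proof (rule Bochner_Integration.integrable_bound)
  show "integrable lborel (\<lambda>x. indicator \<Omega> x + (indicator \<Omega> x * u x)\<^sup>2)"
    using assms by (intro Bochner_Integration.integrable_add L2D integrable_real_indicator) auto
  show "(\<lambda>x. indicator \<Omega> x * u x) \<in> borel_measurable lborel" using L2D(1)[OF assms(1)] by simp
  have "\<bar>a\<bar> \<le> 1 + a\<^sup>2" for a :: real
    using sum_squares_bound[of 1 "\<bar>a\<bar>"] zero_le_power2[of a] by simp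
  then show "AE x in lborel. norm (indicator \<Omega> x * u x) \<le> norm (indicator \<Omega> x + (indicator \<Omega> x * u x)\<^sup>2)"
    by (auto simp: indicator_def abs_of_nonneg[OF add_nonneg_nonneg])
qed

lemma L2_loc_integrable:
  assumes "u \<in> L2 \<Omega>" shows "loc_integrable \<Omega> u"
  unfolding loc_integrable_def set_integrable_def
proof (intro allI impI)
  fix A assume A: "compact A \<and> A \<subseteq> \<Omega>"
  then have "A \<in> sets borel" "emeasure lborel A < \<infinity>"
    using borel_compact emeasure_bounded_finite compact_imp_bounded by auto
  with A show "integrable lborel (\<lambda>x. indicator A x *\<^sub>R u x)"
    using L2_integrable[OF L2_mono(1)[OF assms, of A]] by simp
qed

lemma yt_Basis: "set (yt i j) \<subseteq> Basis"
  by (auto simp: yt_def Basis_prod_def)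

lemma Hk_wd:
  assumes "open \<Omega>" "u \<in> Hk k \<Omega>" "i + j \<le> k"
  shows "weak_deriv \<Omega> (yt i j) u (wd \<Omega> (yt i j) u)" "wd \<Omega> (yt i j) u \<in> L2 \<Omega>"
proof -
  obtain v where v: "v \<in> L2 \<Omega>" "weak_deriv \<Omega> (yt i j) u v" using assms by (auto simp: Hk_def)
  show w: "weak_deriv \<Omega> (yt i j) u (wd \<Omega> (yt i j) u)" using wd_weak_deriv[OF v(2)] .
  show "wd \<Omega> (yt i j) u \<in> L2 \<Omega>"
    by (rule L2_cong_AE[OF v(1) loc_integrable_measurable[OF assms(1)] wd_AE_eq[OF assms(1) yt_Basis v(2)]])
       (use w in \<open>simp add: weak_deriv_def\<close>)
qed

lemma wd_combo:
  assumes "open \<Omega>" "u \<in> Hk k \<Omega>" "v \<in> Hk k \<Omega>" "i + j \<le> k"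
  shows "AE x in lborel. x \<in> \<Omega> \<longrightarrow>
    wd \<Omega> (yt i j) (\<lambda>x. u x + c * v x) x = wd \<Omega> (yt i j) u x + c * wd \<Omega> (yt i j) v x"
  by (rule wd_AE_eq[OF assms(1) yt_Basis weak_deriv_combo[OF yt_Basis]])
     (use assms Hk_wd in auto)

lemma Hk_combo:
  assumes "open \<Omega>" "u \<in> Hk k \<Omega>" "v \<in> Hk k \<Omega>"
  shows "(\<lambda>x. u x + c * v x) \<in> Hk k \<Omega>"
  unfolding Hk_def
proof (intro CollectI conjI allI impI)
  show "(\<lambda>x. u x + c * v x) \<in> L2 \<Omega>" using assms by (intro L2_combo) (auto simp: Hk_def)
  fix i j assume "i + j \<le> k"
  then show "\<exists>w\<in>L2 \<Omega>. weak_deriv \<Omega> (yt i j) (\<lambda>x. u x + c * v x) w"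
    using assms Hk_wd[OF assms(1,2)] Hk_wd[OF assms(1,3)]
    by (intro bexI[of _ "\<lambda>x. wd \<Omega> (yt i j) u x + c * wd \<Omega> (yt i j) v x"] weak_deriv_combo L2_combo yt_Basis) auto
qed

text \<open>The Sobolev norm is a Euclidean norm of a vector of \<open>L\<^sup>2\<close> norms and therefore inherits the
  triangle inequality from both.\<close>

lemma Hk_norm_L2_set:
  "Hk_norm k \<Omega> u = L2_set (\<lambda>(i, j). L2_norm \<Omega> (wd \<Omega> (yt i j) u)) (SIGMA i:{..k}. {..k - i})"
proof -
  have "(LINT x:\<Omega>|lborel. wd \<Omega> (yt i j) u x * wd \<Omega> (yt i j) u x) = (L2_norm \<Omega> (wd \<Omega> (yt i j) u))\<^sup>2" for i j
    unfolding L2_norm_power2 set_lebesgue_integral_def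
    by (intro Bochner_Integration.integral_cong) (auto simp: indicator_def power2_eq_square)
  then show ?thesis
    unfolding Hk_norm_def Hk_inner_def L2_set_def
    by (simp add: sum.Sigma case_prod_beta)
qed

lemma Hk_norm_nonneg: "Hk_norm k \<Omega> u \<ge> 0"
  by (simp add: Hk_norm_L2_set)

lemma L2_norm_wd_le:
  assumes "i + j \<le> k" shows "L2_norm \<Omega> (wd \<Omega> (yt i j) u) \<le> Hk_norm k \<Omega> u"
  unfolding Hk_norm_L2_set
  using member_le_L2_set[of "SIGMA i:{..k}. {..k - i}" "(i, j)" "\<lambda>(i, j). L2_norm \<Omega> (wd \<Omega> (yt i j) u)"] assms
  by auto

text \<open>The multiple \<open>c u\<close> is treated as the combination \<open>u + (c - 1) u\<close>.\<close>

lemma Hk_norm_scale: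
  assumes "open \<Omega>" "u \<in> Hk k \<Omega>"
  shows "Hk_norm k \<Omega> (\<lambda>x. c * u x) = \<bar>c\<bar> * Hk_norm k \<Omega> u"
proof -
  have *: "L2_norm \<Omega> (wd \<Omega> (yt i j) (\<lambda>x. c * u x)) = \<bar>c\<bar> * L2_norm \<Omega> (wd \<Omega> (yt i j) u)" if "i + j \<le> k" for i j
  proof -
    have u: "(\<lambda>x. c * u x) \<in> Hk k \<Omega>"
      using Hk_combo[OF assms(1) assms(2) assms(2), of "c - 1"] by (simp add: algebra_simps)
    have "AE x in lborel. x \<in> \<Omega> \<longrightarrow> wd \<Omega> (yt i j) (\<lambda>x. c * u x) x = c * wd \<Omega> (yt i j) u x"
      using wd_combo[OF assms(1) assms(2) assms(2) that, of "c - 1"] by (simp add: algebra_simps)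
    moreover have "(\<lambda>x. c * wd \<Omega> (yt i j) u x) \<in> L2 \<Omega>"
      using L2_combo[OF Hk_wd(2)[OF assms that] Hk_wd(2)[OF assms that], of "c - 1"] by (simp add: algebra_simps)
    ultimately have "L2_norm \<Omega> (wd \<Omega> (yt i j) (\<lambda>x. c * u x)) = L2_norm \<Omega> (\<lambda>x. c * wd \<Omega> (yt i j) u x)"
      using Hk_wd(2)[OF assms(1) u that] by (intro L2_norm_cong_AE)
    then show ?thesis by (simp add: L2_norm_scale)
  qed
  have "Hk_norm k \<Omega> (\<lambda>x. c * u x) = L2_set (\<lambda>p. \<bar>c\<bar> * (case p of (i, j) \<Rightarrow> L2_norm \<Omega> (wd \<Omega> (yt i j) u))) (SIGMA i:{..k}. {..k - i})"
    unfolding Hk_norm_L2_set by (rule L2_set_cong) (auto simp: *)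
  then show ?thesis by (simp add: Hk_norm_L2_set L2_set_right_distrib)
qed

lemma Hk_norm_triangle:
  assumes "open \<Omega>" "u \<in> Hk k \<Omega>" "v \<in> Hk k \<Omega>"
  shows "Hk_norm k \<Omega> (\<lambda>x. u x + v x) \<le> Hk_norm k \<Omega> u + Hk_norm k \<Omega> v"
proof -
  let ?S = "SIGMA i:{..k}. {..k - i}"
  let ?N = "\<lambda>u. \<lambda>(i, j). L2_norm \<Omega> (wd \<Omega> (yt i j) u)"
  have "?N (\<lambda>x. u x + v x) p \<le> ?N u p + ?N v p" if "p \<in> ?S" for p
  proof -
    obtain i j where "p = (i, j)" by (cases p)
    with that have p: "p = (i, j)" "i + j \<le> k" by auto
    have uv: "(\<lambda>x. u x + v x) \<in> Hk k \<Omega>" using Hk_combo[OF assms, of 1] by simp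
    note L = Hk_wd(2)[OF assms(1,2) p(2)] Hk_wd(2)[OF assms(1,3) p(2)]
    have "L2_norm \<Omega> (wd \<Omega> (yt i j) (\<lambda>x. u x + v x)) = L2_norm \<Omega> (\<lambda>x. wd \<Omega> (yt i j) u x + wd \<Omega> (yt i j) v x)"
      using wd_combo[OF assms p(2), of 1] L2_combo[OF L, of 1] Hk_wd(2)[OF assms(1) uv p(2)]
      by (intro L2_norm_cong_AE) auto
    then show ?thesis using L2_norm_triangle[OF L] p by simp
  qed
  then have "L2_set (?N (\<lambda>x. u x + v x)) ?S \<le> L2_set (\<lambda>p. ?N u p + ?N v p) ?S"
    by (intro L2_set_mono) (auto simp: L2_norm_nonneg)
  also have "\<dots> \<le> L2_set (?N u) ?S + L2_set (?N v) ?S" by (rule L2_set_triangle_ineq)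
  finally show ?thesis by (simp add: Hk_norm_L2_set)
qed

lemma Hk_mono:
  assumes "u \<in> Hk k \<Omega>" "k' \<le> k" "\<Omega>' \<subseteq> \<Omega>" "\<Omega>' \<in> sets borel"
  shows "u \<in> Hk k' \<Omega>'"
  unfolding Hk_def
proof (intro CollectI conjI allI impI)
  show "u \<in> L2 \<Omega>'" by (rule L2_mono(1)[OF _ assms(3,4)]) (use assms(1) in \<open>simp add: Hk_def\<close>)
  fix i j assume "i + j \<le> k'"
  then have ij: "i + j \<le> k" using assms(2) by simp
  have "\<forall>i j. i + j \<le> k \<longrightarrow> (\<exists>v\<in>L2 \<Omega>. weak_deriv \<Omega> (yt i j) u v)"
    using assms(1) unfolding Hk_def mem_Collect_eq by (rule conjunct2)
  from this[rule_format, OF ij] obtain v where v: "v \<in> L2 \<Omega>" "weak_deriv \<Omega> (yt i j) u v" ..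
  show "\<exists>v\<in>L2 \<Omega>'. weak_deriv \<Omega>' (yt i j) u v"
    by (rule bexI[where x=v and P="weak_deriv \<Omega>' (yt i j) u", OF weak_deriv_restrict[OF yt_Basis v(2) assms(3)] L2_mono(1)[OF v(1) assms(3,4)]])
qed

lemma Hk_norm_mono:
  assumes "open \<Omega>" "open \<Omega>'" "u \<in> Hk k \<Omega>" "k' \<le> k" "\<Omega>' \<subseteq> \<Omega>"
  shows "Hk_norm k' \<Omega>' u \<le> Hk_norm k \<Omega> u"
proof -
  have b: "\<Omega>' \<in> sets borel" using assms by auto
  have le: "L2_norm \<Omega>' (wd \<Omega>' (yt i j) u) \<le> L2_norm \<Omega> (wd \<Omega> (yt i j) u)" if ij: "i + j \<le> k'" for i j
  proof -
    have ij': "i + j \<le> k" using ij assms by simp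
    note w = Hk_wd[OF assms(1,3) ij']
    have u: "u \<in> Hk k' \<Omega>'" by (rule Hk_mono[OF assms(3,4,5) b])
    have "L2_norm \<Omega>' (wd \<Omega>' (yt i j) u) = L2_norm \<Omega>' (wd \<Omega> (yt i j) u)"
      by (rule L2_norm_cong_AE[OF L2_mono(1)[OF w(2) assms(5) b] Hk_wd(2)[OF assms(2) u ij]
          wd_AE_eq[OF assms(2) yt_Basis weak_deriv_restrict[OF yt_Basis w(1) assms(5)]]])
    then show ?thesis using L2_mono(2)[OF w(2) assms(5) b] by simp
  qed
  have "Hk_norm k' \<Omega>' u \<le> L2_set (\<lambda>(i, j). L2_norm \<Omega> (wd \<Omega> (yt i j) u)) (SIGMA i:{..k'}. {..k' - i})"
    unfolding Hk_norm_L2_set by (rule L2_set_mono) (auto simp: L2_norm_nonneg le)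
  also have "\<dots> \<le> Hk_norm k \<Omega> u"
    unfolding Hk_norm_L2_set L2_set_def
    using assms(4) by (intro real_sqrt_le_mono sum_mono2) auto
  finally show ?thesis .
qed

lemma Hk_inner_scale:
  assumes "open \<Omega>" "u \<in> Hk k \<Omega>" "v \<in> Hk k \<Omega>"
  shows "Hk_inner k \<Omega> u (\<lambda>x. c * v x) = c * Hk_inner k \<Omega> u v"
proof -
  have "(LINT x:\<Omega>|lborel. wd \<Omega> (yt i j) u x * wd \<Omega> (yt i j) (\<lambda>x. c * v x) x)
      = c * (LINT x:\<Omega>|lborel. wd \<Omega> (yt i j) u x * wd \<Omega> (yt i j) v x)" if ij: "i + j \<le> k" for i j
  proof -
    have cv: "(\<lambda>x. c * v x) \<in> Hk k \<Omega>"
      using Hk_combo[OF assms(1) assms(3) assms(3), of "c - 1"] by (simp add: algebra_simps)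
    note [measurable] = L2D(1)[OF Hk_wd(2)[OF assms(1,2) ij]] L2D(1)[OF Hk_wd(2)[OF assms(1,3) ij]]
      L2D(1)[OF Hk_wd(2)[OF assms(1) cv ij]]
    have *: "indicator \<Omega> x *\<^sub>R (f x * g x) = (indicator \<Omega> x * f x) * (indicator \<Omega> x * g x)" for f g :: "real \<times> real \<Rightarrow> real" and x
      by (auto simp: indicator_def)
    have "(LINT x:\<Omega>|lborel. wd \<Omega> (yt i j) u x * wd \<Omega> (yt i j) (\<lambda>x. c * v x) x)
      = (LINT x|lborel. c * ((indicator \<Omega> x * wd \<Omega> (yt i j) u x) * (indicator \<Omega> x * wd \<Omega> (yt i j) v x)))"
      unfolding set_lebesgue_integral_def *
    proof (rule integral_cong_AE)
      have "AE x in lborel. x \<in> \<Omega> \<longrightarrow> wd \<Omega> (yt i j) (\<lambda>x. c * v x) x = c * wd \<Omega> (yt i j) v x"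
        using wd_combo[OF assms(1) assms(3) assms(3) ij, of "c - 1"] by (simp add: algebra_simps)
      then show "AE x in lborel. (indicator \<Omega> x * wd \<Omega> (yt i j) u x) * (indicator \<Omega> x * wd \<Omega> (yt i j) (\<lambda>x. c * v x) x)
        = c * ((indicator \<Omega> x * wd \<Omega> (yt i j) u x) * (indicator \<Omega> x * wd \<Omega> (yt i j) v x))"
        by eventually_elim (auto simp: indicator_def)
    qed measurable
    then show ?thesis unfolding set_lebesgue_integral_def * by simp
  qed
  then show ?thesis unfolding Hk_inner_def by (simp add: sum_distrib_left)
qed

text \<open>The weak derivative \<open>w\<close> may be tested with \<open>iter_deriv es \<phi>\<close>, which is again a test function.\<close>

lemma weak_deriv_split:
  assumes "weak_deriv \<Omega> (ds @ es) u v" "weak_deriv \<Omega> ds u w" "set es \<subseteq> Basis"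
  shows "weak_deriv \<Omega> es w v"
  unfolding weak_deriv_def
proof (intro conjI allI impI)
  fix \<phi> assume \<phi>: "test_fun \<Omega> \<phi>"
  have "(LINT x:\<Omega>|lborel. u x * iter_deriv ds (iter_deriv es \<phi>) x)
      = (-1) ^ length ds * (LINT x:\<Omega>|lborel. w x * iter_deriv es \<phi> x)"
    using assms(2) test_fun_iter_deriv[OF \<phi> assms(3)] unfolding weak_deriv_def by blast
  moreover have "(LINT x:\<Omega>|lborel. u x * iter_deriv (ds @ es) \<phi> x)
      = (-1) ^ length (ds @ es) * (LINT x:\<Omega>|lborel. v x * \<phi> x)"
    using assms(1) \<phi> unfolding weak_deriv_def by blast
  ultimately have "(-1) ^ length ds * (LINT x:\<Omega>|lborel. w x * iter_deriv es \<phi> x)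
      = (-1) ^ length ds * ((-1) ^ length es * (LINT x:\<Omega>|lborel. v x * \<phi> x))"
    by (simp add: iter_deriv_append power_add mult.assoc)
  then show "(LINT x:\<Omega>|lborel. w x * iter_deriv es \<phi> x) = (-1) ^ length es * (LINT x:\<Omega>|lborel. v x * \<phi> x)"
    by simp
qed (use assms in \<open>auto simp: weak_deriv_def\<close>)

lemma weak_deriv_cong_AE:
  assumes "weak_deriv \<Omega> ds u v" "set ds \<subseteq> Basis" "loc_integrable \<Omega> u'" "loc_integrable \<Omega> v'"
    and "AE x in lborel. x \<in> \<Omega> \<longrightarrow> u' x = u x" "AE x in lborel. x \<in> \<Omega> \<longrightarrow> v' x = v x"
  shows "weak_deriv \<Omega> ds u' v'"
proof -
  have *: "(LINT x:\<Omega>|lborel. f x * g x) = (LINT x:\<Omega>|lborel. f' x * g x)"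
    if "loc_integrable \<Omega> f" "loc_integrable \<Omega> f'" "test_fun \<Omega> g" "AE x in lborel. x \<in> \<Omega> \<longrightarrow> f' x = f x"
    for f f' g :: "'a \<Rightarrow> real"
    unfolding set_lebesgue_integral_def
  proof (rule integral_cong_AE)
    show "(\<lambda>x. indicator \<Omega> x *\<^sub>R (f x * g x)) \<in> borel_measurable lborel"
      "(\<lambda>x. indicator \<Omega> x *\<^sub>R (f' x * g x)) \<in> borel_measurable lborel"
      using loc_integrable_test[OF that(1,3)] loc_integrable_test[OF that(2,3)]
      by (auto simp: set_integrable_def dest: borel_measurable_integrable)
    show "AE x in lborel. indicator \<Omega> x *\<^sub>R (f x * g x) = indicator \<Omega> x *\<^sub>R (f' x * g x)"
      using that(4) by eventually_elim (auto simp: indicator_def)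
  qed
  show ?thesis
    using assms *[of u u'] *[of v v'] test_fun_iter_deriv[OF _ assms(2)]
    by (auto simp: weak_deriv_def)
qed

section \<open>Integrals over strips\<close>

lemma lborel_swap: "distr lborel borel prod.swap = (lborel :: (real \<times> real) measure)"
proof -
  have "(lborel :: (real \<times> real) measure) = distr (lborel \<Otimes>\<^sub>M lborel) (lborel \<Otimes>\<^sub>M lborel) (\<lambda>(x, y). (y, x))"
    using lborel_pair.distr_pair_swap[where ?'a=real and ?'b=real] by (simp add: lborel_prod)
  also have "\<dots> = distr lborel borel prod.swap"
    unfolding lborel_prod by (intro distr_cong) (auto simp: prod.swap_def)
  finally show ?thesis by simp
qed

lemma fst_measurable[measurable]: "(fst :: real \<times> real \<Rightarrow> real) \<in> borel_measurable borel"
  and snd_measurable[measurable]: "(snd :: real \<times> real \<Rightarrow> real) \<in> borel_measurable borel"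
  by (intro borel_measurable_continuous_onI continuous_intros)+

lemma integrable_indicator_bounded:
  "bounded A \<Longrightarrow> A \<in> sets borel \<Longrightarrow> integrable lborel (indicator A :: 'a::euclidean_space \<Rightarrow> real)"
  by (intro integrable_real_indicator emeasure_bounded_finite) simp_all

lemma integrable_mult_bounded:
  fixes h k :: "'a::euclidean_space \<Rightarrow> real"
  assumes "integrable lborel h" "k \<in> borel_measurable borel" "\<And>z. \<bar>k z\<bar> \<le> c"
  shows "integrable lborel (\<lambda>z. h z * k z)"
proof (rule Bochner_Integration.integrable_bound)
  show "integrable lborel (\<lambda>z. c * h z)" using assms(1) by simp
  show "(\<lambda>z. h z * k z) \<in> borel_measurable lborel" using assms(1,2) by measurable
  have "\<bar>h z * k z\<bar> \<le> \<bar>c * h z\<bar>" for z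
    using mult_left_mono[OF order_trans[OF assms(3)[of z] abs_ge_self], of "\<bar>h z\<bar>"]
    by (simp add: abs_mult mult.commute)
  then show "AE z in lborel. norm (h z * k z) \<le> norm (c * h z)" by simp
qed

lemma swap_measurable[measurable]: "(prod.swap :: real \<times> real \<Rightarrow> real \<times> real) \<in> borel_measurable borel"
  by (intro borel_measurable_continuous_onI continuous_intros)

lemma integral_swap: "(LINT z|lborel. f (prod.swap z)) = (LINT z|lborel. f z)"
  if "f \<in> borel_measurable borel" for f :: "real \<times> real \<Rightarrow> real"
  using integral_distr[of "prod.swap" lborel borel f] that by (simp add: lborel_swap)

lemma integrable_swap: "integrable lborel (\<lambda>z. f (prod.swap z)) \<longleftrightarrow> integrable lborel f"
  if "f \<in> borel_measurable borel" for f :: "real \<times> real \<Rightarrow> real"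
  using integrable_distr_eq[of "prod.swap" lborel borel f] that by (simp add: lborel_swap)

lemma AE_swap:
  assumes "AE z in lborel. P z" shows "AE z in lborel. P (prod.swap z :: real \<times> real)"
proof -
  have "AE z in distr lborel borel (prod.swap :: real \<times> real \<Rightarrow> real \<times> real). P z"
    unfolding lborel_swap by (rule assms)
  from AE_distrD[OF _ this] show ?thesis by simp
qed

lemma product_integral:
  fixes f :: "'a::euclidean_space \<Rightarrow> real" and g :: "'b::euclidean_space \<Rightarrow> real"
  assumes f: "integrable lborel f" and g: "integrable lborel g"
  shows "integrable lborel (\<lambda>z. f (fst z) * g (snd z))"
    and "(LINT z|lborel. f (fst z) * g (snd z)) = (LINT x|lborel. f x) * (LINT x|lborel. g x)"
proof -
  have fm[measurable]: "f \<in> borel_measurable borel" "g \<in> borel_measurable borel" using f g by auto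
  have "integrable (lborel \<Otimes>\<^sub>M lborel) (\<lambda>z. f (fst z) * g (snd z))"
  proof (rule lborel_pair.Fubini_integrable)
    show "(\<lambda>z. f (fst z) * g (snd z)) \<in> borel_measurable (lborel \<Otimes>\<^sub>M lborel)" by measurable
    show "integrable lborel (\<lambda>x. LINT y|lborel. norm (f (fst (x, y)) * g (snd (x, y))))"
      using f g by (simp add: abs_mult)
    show "AE x in lborel. integrable lborel (\<lambda>y. f (fst (x, y)) * g (snd (x, y)))"
      using g by simp
  qed
  then show i: "integrable lborel (\<lambda>z. f (fst z) * g (snd z))" by (simp add: lborel_prod)
  have "(LINT z|lborel. f (fst z) * g (snd z)) = (LINT x|lborel. LINT y|lborel. f x * g y)"
    using lborel_pair.integral_fst'[of "\<lambda>z. f (fst z) * g (snd z)"] i by (simp add: lborel_prod)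
  then show "(LINT z|lborel. f (fst z) * g (snd z)) = (LINT x|lborel. f x) * (LINT x|lborel. g x)"
    by simp
qed

lemma AE_fst:
  assumes "AE x in lborel. P x" shows "AE z in lborel. P (fst (z :: real \<times> real))"
proof -
  have "AE z in lborel \<Otimes>\<^sub>M lborel. P (fst (z :: real \<times> real))"
  proof -
    obtain N where N: "{x. \<not> P x} \<subseteq> N" "N \<in> null_sets lborel"
      using assms by (auto elim!: AE_E simp: null_sets_def)
    have "N \<times> (UNIV :: real set) \<in> null_sets (lborel \<Otimes>\<^sub>M lborel)"
      by (rule lborel.times_in_null_sets1[OF N(2)]) simp
    then have "AE z in lborel \<Otimes>\<^sub>M lborel. z \<notin> N \<times> (UNIV :: real set)" by (rule AE_not_in)
    then show ?thesis by eventually_elim (use N(1) in auto)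
  qed
  then show ?thesis unfolding lborel_prod .
qed

lemma AE_snd:
  assumes "AE x in lborel. P x" shows "AE z in lborel. P (snd (z :: real \<times> real))"
  using AE_swap[OF AE_fst[OF assms]] by simp

section \<open>Traces on a side of a rectangle\<close>

text \<open>The square of \<open>v\<close> minus its mean \<open>c\<close> has a nonnegative integral.\<close>

lemma set_integral_square_le:
  fixes v :: "real \<Rightarrow> real"
  assumes "0 < s" "set_integrable lborel {0<..<s} v" "set_integrable lborel {0<..<s} (\<lambda>r. (v r)\<^sup>2)"
  shows "(LINT r:{0<..<s}|lborel. v r)\<^sup>2 \<le> s * (LINT r:{0<..<s}|lborel. (v r)\<^sup>2)"
proof -
  define N where "N = (LINT r:{0<..<s}|lborel. v r)"
  define c where "c = N / s"
  have i: "set_integrable lborel {0<..<s} (\<lambda>r. - (2 * c) * v r)"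
    "set_integrable lborel {0<..<s} (\<lambda>r. c\<^sup>2)"
  proof -
    show "set_integrable lborel {0<..<s} (\<lambda>r. - (2 * c) * v r)"
      by (rule set_integrable_mult_right) (use assms(2) in simp)
    show "set_integrable lborel {0<..<s} (\<lambda>r. c\<^sup>2)"
      unfolding set_integrable_def by (intro integrable_scaleR_left integrable_indicator_bounded) auto
  qed
  have "0 \<le> (LINT r:{0<..<s}|lborel. (v r - c)\<^sup>2)"
    unfolding set_lebesgue_integral_def by (rule integral_nonneg_AE) auto
  also have "\<dots> = (LINT r:{0<..<s}|lborel. ((v r)\<^sup>2 + - (2 * c) * v r) + c\<^sup>2)"
    by (simp add: power2_diff algebra_simps)
  also have "\<dots> = (LINT r:{0<..<s}|lborel. (v r)\<^sup>2) + - (2 * c) * N + c\<^sup>2 * s"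
  proof -
    have "(LINT r:{0<..<s}|lborel. ((v r)\<^sup>2 + - (2 * c) * v r) + c\<^sup>2)
        = (LINT r:{0<..<s}|lborel. (v r)\<^sup>2 + - (2 * c) * v r) + (LINT r:{0<..<s}|lborel. c\<^sup>2)"
      by (intro set_integral_add) (use i assms in auto)
    also have "(LINT r:{0<..<s}|lborel. (v r)\<^sup>2 + - (2 * c) * v r)
        = (LINT r:{0<..<s}|lborel. (v r)\<^sup>2) + (LINT r:{0<..<s}|lborel. - (2 * c) * v r)"
      by (intro set_integral_add) (use i assms in auto)
    also have "(LINT r:{0<..<s}|lborel. - (2 * c) * v r) = - (2 * c) * N"
      unfolding N_def by (rule set_integral_mult_right)
    also have "(LINT r:{0<..<s}|lborel. c\<^sup>2) = c\<^sup>2 * s"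
      using assms(1) by (simp add: set_lebesgue_integral_def)
    finally show ?thesis .
  qed
  also have "c\<^sup>2 * s = N\<^sup>2 / s" using assms(1) by (simp add: c_def power2_eq_square)
  also have "- (2 * c) * N = - 2 * (N\<^sup>2 / s)" by (simp add: c_def power2_eq_square)
  finally have "N\<^sup>2 / s \<le> (LINT r:{0<..<s}|lborel. (v r)\<^sup>2)" by simp
  then show ?thesis using assms(1) by (simp add: N_def field_simps)
qed

definition strip :: "real \<Rightarrow> real set \<Rightarrow> (real \<times> real) set" where
  "strip L I = {0<..<L} \<times> I"

lemma strip_measure:
  assumes "bounded I" "I \<in> sets borel"
  shows "strip L I \<in> sets borel" "emeasure lborel (strip L I) < \<infinity>"
proof -
  show "strip L I \<in> sets borel"
    unfolding strip_def using assms(2) by (simp add: borel_prod[symmetric])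
  have "bounded (strip L I)" unfolding strip_def by (intro bounded_Times assms) auto
  from emeasure_bounded_finite[OF this] show "emeasure lborel (strip L I) < \<infinity>" .
qed

lemma integral_slice:
  fixes f :: "real \<times> real \<Rightarrow> real"
  assumes "integrable lborel f"
  shows "(LINT z|lborel. f z) = (LINT x|lborel. LINT s|lborel. f (s, x))"
    and "AE x in lborel. integrable lborel (\<lambda>s. f (s, x))"
    and "integrable lborel (\<lambda>x. LINT s|lborel. f (s, x))"
proof -
  have f: "integrable (lborel \<Otimes>\<^sub>M lborel) (\<lambda>(s, x). f (s, x))" using assms by (simp add: lborel_prod)
  show "(LINT z|lborel. f z) = (LINT x|lborel. LINT s|lborel. f (s, x))"
    using lborel_pair.integral_snd[OF f] by (simp add: lborel_prod)
  show "AE x in lborel. integrable lborel (\<lambda>s. f (s, x))"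
    using lborel_pair.AE_integrable_snd[OF f] by simp
  show "integrable lborel (\<lambda>x. LINT s|lborel. f (s, x))"
    using lborel_pair.integrable_snd[OF f] by simp
qed

text \<open>A function that is weakly differentiable in the first variable is, almost everywhere, a primitive
  \<open>N\<close> of its weak derivative plus a function \<open>g\<close> of the second variable. For the proof, \<open>u - g - N\<close> is
  tested with \<open>A(s) B(x)\<close>. With a fixed bump \<open>b0\<close> of mass one and \<open>m\<close> the integral of \<open>A\<close>, one writes
  \<open>A = (A - m b0) + m b0\<close>. The first part has a primitive of compact support, so the hypothesis applies
  to it. The second part gives zero if \<open>g(x)\<close> is chosen as the integral of \<open>(u - N)(s, x) b0(s)\<close> over
  \<open>s\<close>; by Fubini, \<open>N\<close> contributes to this the integral of \<open>v(r, x) (1 - \<beta> r)\<close>, where \<open>\<beta>\<close> is the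
  primitive of \<open>b0\<close>.\<close>

lemma slab_representation:
  fixes u v :: "real \<times> real \<Rightarrow> real"
  assumes L: "L > 0" and I: "open I" "bounded I"
    and u: "u \<in> L2 (strip L I)" and v: "v \<in> L2 (strip L I)"
    and weak: "\<And>A A' B a b a' b'. bump1 a b A \<Longrightarrow> (\<And>s. (A has_real_derivative A' s) (at s)) \<Longrightarrow> bump1 a b A' \<Longrightarrow>
      bump1 a' b' B \<Longrightarrow> {a..b} \<subseteq> {0<..<L} \<Longrightarrow> {a'..b'} \<subseteq> I \<Longrightarrow>
      (LINT z:strip L I|lborel. u z * (A' (fst z) * B (snd z))) = - (LINT z:strip L I|lborel. v z * (A (fst z) * B (snd z)))"
  obtains g where "g \<in> borel_measurable borel" "integrable lborel (\<lambda>x. indicator I x * g x)"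
    "AE z in lborel. z \<in> strip L I \<longrightarrow>
      u z = g (snd z) + (LINT r:{0<..<fst z}|lborel. indicator (strip L I) (r, snd z) * v (r, snd z))"
proof -
  let ?Q = "strip L I"
  have Ib: "I \<in> sets borel" using I by simp
  note Q = strip_measure[OF I(2) Ib, of L]
  define U where "U = (\<lambda>z. indicator ?Q z * u z)"
  define V where "V = (\<lambda>z. indicator ?Q z * v z)"
  have Ui: "integrable lborel U" and Vi: "integrable lborel V"
    unfolding U_def V_def using u v Q by (auto intro: L2_integrable)
  have Um[measurable]: "U \<in> borel_measurable borel" and Vm[measurable]: "V \<in> borel_measurable borel"
    using Ui Vi by auto
  obtain b0 where b0: "bump1 (L/4) (L/2) b0" "(LINT x|lborel. b0 x) = 1"
  proof -
    have "L/4 < L/2" using L by simp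
    from bump1_mass_one[OF this] obtain f where "bump1 (L/4) (L/2) f" "(LINT x|lborel. f x) = 1" by metis
    then show thesis by (rule that)
  qed
  note [measurable] = bump1_measurable[OF b0(1)]
  define \<beta> where "\<beta> = (\<lambda>r. LINT s:{..r}|lborel. b0 s)"
  obtain K0 where K0: "K0 > 0" "\<And>x. \<bar>b0 x\<bar> \<le> K0" using bump1_bounded[OF b0(1)] by auto
  have primm: "(\<lambda>r. LINT s:{..r}|lborel. f s) \<in> borel_measurable borel"
    if f[measurable]: "f \<in> borel_measurable borel" for f :: "real \<Rightarrow> real"
  proof -
    have "(\<lambda>(r, s). (if s \<le> r then 1 else 0) * f s) \<in> borel_measurable (borel \<Otimes>\<^sub>M lborel)"
      by measurable
    from lborel.borel_measurable_lebesgue_integral[OF this]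
    have "(\<lambda>r. LINT s|lborel. (if s \<le> r then 1 else 0) * f s) \<in> borel_measurable borel" .
    moreover have "(LINT s|lborel. (if s \<le> r then 1 else 0) * f s) = (LINT s:{..r}|lborel. f s)" for r
      unfolding set_lebesgue_integral_def by (intro Bochner_Integration.integral_cong) auto
    ultimately show ?thesis by simp
  qed
  have primb: "\<bar>LINT s:{..r}|lborel. f s\<bar> \<le> (LINT s|lborel. \<bar>f s\<bar>)" if f: "integrable lborel f" for f :: "real \<Rightarrow> real" and r
  proof -
    have "\<bar>LINT s:{..r}|lborel. f s\<bar> \<le> (LINT s|lborel. norm (indicator {..r} s *\<^sub>R f s))"
      unfolding set_lebesgue_integral_def using integral_norm_bound[of lborel "\<lambda>s. indicator {..r} s *\<^sub>R f s"] by simp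
    also have "\<dots> \<le> (LINT s|lborel. \<bar>f s\<bar>)"
    proof (rule integral_mono)
      show "integrable lborel (\<lambda>s. norm (indicator {..r} s *\<^sub>R f s))"
        by (intro integrable_norm integrable_mult_indicator f) simp
    qed (use f in \<open>auto simp: indicator_def\<close>)
    finally show ?thesis .
  qed
  have \<beta>m[measurable]: "\<beta> \<in> borel_measurable borel" unfolding \<beta>_def by (rule primm) simp
  obtain K1 where K1: "\<And>r. \<bar>\<beta> r\<bar> \<le> K1" unfolding \<beta>_def using primb[OF bump1_integrable[OF b0(1)]] by blast
  \<comment> \<open>by Fubini, its integral along a line equals that of \<open>(u - N) b0\<close>, and \<open>1 - \<beta>\<close> takes over the role
    of \<open>b0\<close>\<close>
  define H where "H = (\<lambda>z. U z * b0 (fst z) - V z * (1 - \<beta> (fst z)))"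
  have Hi: "integrable lborel H"
  proof -
    have "\<bar>1 - \<beta> (fst z)\<bar> \<le> 1 + K1" for z :: "real \<times> real" using K1[of "fst z"] by linarith
    then have "integrable lborel (\<lambda>z. V z * (1 - \<beta> (fst z)))" by (rule integrable_mult_bounded[OF Vi, rotated]) measurable
    moreover have "integrable lborel (\<lambda>z. U z * b0 (fst z))"
      by (rule integrable_mult_bounded[OF Ui _ K0(2)]) measurable
    ultimately show ?thesis unfolding H_def by (rule Bochner_Integration.integrable_diff[rotated])
  qed
  define g where "g = (\<lambda>x. LINT r|lborel. H (r, x))"
  define N where "N = (\<lambda>z::real \<times> real. LINT r|lborel. V (r, snd z) * indicator {..<fst z} r)"
  note Hs = integral_slice[OF Hi]
  have gi: "integrable lborel g" unfolding g_def by (rule Hs(3))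
  have gm[measurable]: "g \<in> borel_measurable borel" using gi by auto
  define n where "n = (\<lambda>x. LINT r|lborel. \<bar>V (r, x)\<bar>)"
  have absV: "integrable lborel (\<lambda>z. \<bar>V z\<bar>)" using Vi by auto
  have ni: "integrable lborel n" unfolding n_def by (rule integral_slice(3)[OF absV])
  have n0: "n x \<ge> 0" for x by (simp add: n_def)
  have Nm[measurable]: "N \<in> borel_measurable borel"
  proof -
    have "(\<lambda>(z::real \<times> real, r). V (r, snd z) * (if r < fst z then 1 else 0)) \<in> borel_measurable (borel \<Otimes>\<^sub>M lborel)"
      by measurable
    from lborel.borel_measurable_lebesgue_integral[OF this]
    have "(\<lambda>z::real \<times> real. LINT r|lborel. V (r, snd z) * (if r < fst z then 1 else 0)) \<in> borel_measurable borel" .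
    moreover have "(LINT r|lborel. V (r, snd z) * (if r < fst z then 1 else 0)) = N z" for z :: "real \<times> real"
      unfolding N_def by (intro Bochner_Integration.integral_cong) auto
    ultimately show ?thesis by simp
  qed
  have Nm'[measurable]: "N \<in> borel_measurable lborel" using Nm by simp
  have Nb: "AE x in lborel. \<forall>s. \<bar>N (s, x)\<bar> \<le> n x"
    using integral_slice(2)[OF Vi]
  proof eventually_elim
    case (elim x)
    show ?case
    proof
      fix s
      have "\<bar>N (s, x)\<bar> \<le> (LINT r|lborel. norm (V (r, x) * indicator {..<s} r))"
        unfolding N_def using integral_norm_bound[of lborel "\<lambda>r. V (r, x) * indicator {..<s} r"] by simp
      also have "\<dots> \<le> (LINT r|lborel. \<bar>V (r, x)\<bar>)"
        using elim integrable_mult_indicator[of "{..<s}" lborel "\<lambda>r. V (r, x)"]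
        by (intro integral_mono) (auto simp: indicator_def mult.commute[of "V _"] simp flip: real_norm_def intro!: integrable_norm)
      finally show "\<bar>N (s, x)\<bar> \<le> n x" by (simp add: n_def)
    qed
  qed
  have gN: "integrable lborel (\<lambda>z. indicator {0<..<L} (fst z) * g (snd z))"
    "integrable lborel (\<lambda>z. indicator {0<..<L} (fst z) * n (snd z))"
    by (rule product_integral(1)[OF integrable_indicator_bounded gi] product_integral(1)[OF integrable_indicator_bounded ni]; simp)+
  have Ni: "integrable lborel (\<lambda>z. indicator {0<..<L} (fst z) * N z)"
  proof (rule Bochner_Integration.integrable_bound[OF gN(2)])
    show "AE z in lborel. norm (indicator {0<..<L} (fst z) * N z) \<le> norm (indicator {0<..<L} (fst z) * n (snd z))"
      using AE_snd[OF Nb]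
    proof eventually_elim
      case (elim z)
      then have "\<bar>N z\<bar> \<le> n (snd z)" by (metis prod.collapse)
      then show ?case using n0 by (auto simp: indicator_def)
    qed
    show "(\<lambda>z. indicator {0<..<L} (fst z) * N z) \<in> borel_measurable lborel" by measurable
  qed
  define f where "f = (\<lambda>z. u z - (g (snd z) + N z))"
  have fi: "integrable lborel (\<lambda>z. indicator ?Q z * f z)"
  proof -
    have "integrable lborel (\<lambda>z. U z - (indicator ?Q z * (indicator {0<..<L} (fst z) * g (snd z)) + indicator ?Q z * (indicator {0<..<L} (fst z) * N z)))"
      using integrable_mult_indicator[OF _ gN(1), of ?Q] integrable_mult_indicator[OF _ Ni, of ?Q] Q Ui
      by (intro Bochner_Integration.integrable_diff Bochner_Integration.integrable_add) auto
    moreover have "(\<lambda>z. U z - (indicator ?Q z * (indicator {0<..<L} (fst z) * g (snd z)) + indicator ?Q z * (indicator {0<..<L} (fst z) * N z)))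
       = (\<lambda>z. indicator ?Q z * f z)"
      by (auto simp: U_def f_def strip_def indicator_def fun_eq_iff)
    ultimately show ?thesis by simp
  qed
  have "AE z in lborel. z \<in> ?Q \<longrightarrow> f z = 0"
  proof (rule product_tests_determine)
    show "open ?Q" unfolding strip_def by (intro open_Times I) auto
    show "loc_integrable ?Q f" unfolding loc_integrable_def
    proof (intro allI impI)
      fix A assume A: "compact A \<and> A \<subseteq> ?Q"
      have "set_integrable lborel ?Q f" using fi by (simp add: set_integrable_def)
      then show "set_integrable lborel A f"
        by (rule set_integrable_subset) (use A borel_compact in auto)
    qed
    fix a b a' b' :: real and A B
    assume A: "bump1 a b A" and B: "bump1 a' b' B" and lt: "a < b" "a' < b'" and sub: "{a..b} \<times> {a'..b'} \<subseteq> ?Q"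
    have ab: "{a..b} \<subseteq> {0<..<L}" "{a'..b'} \<subseteq> I"
    proof -
      have "x \<in> {0<..<L}" if "x \<in> {a..b}" for x
        using subsetD[OF sub, of "(x, a')"] that lt by (simp add: strip_def)
      then show "{a..b} \<subseteq> {0<..<L}" by blast
      have "x \<in> I" if "x \<in> {a'..b'}" for x
        using subsetD[OF sub, of "(a, x)"] that lt by (simp add: strip_def)
      then show "{a'..b'} \<subseteq> I" by blast
    qed
    have Az: "A s = 0" if "s \<notin> {0<..<L}" for s
    proof -
      have "s \<notin> {a..b}" using ab(1) that by blast
      then show ?thesis using A unfolding bump1_def by blast
    qed
    have Bz: "B x = 0" if "x \<notin> I" for x
    proof -
      have "x \<notin> {a'..b'}" using ab(2) that by blast
      then show ?thesis using B unfolding bump1_def by blast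
    qed
    note [measurable] = bump1_measurable[OF A] bump1_measurable[OF B]
    note Ai = bump1_integrable[OF A]
    obtain KA where KA: "KA > 0" "\<And>x. \<bar>A x\<bar> \<le> KA" using bump1_bounded[OF A] by auto
    obtain KB where KB: "KB > 0" "\<And>x. \<bar>B x\<bar> \<le> KB" using bump1_bounded[OF B] by auto
    define m where "m = (LINT s|lborel. A s)"
    define \<alpha> where "\<alpha> = (\<lambda>r. LINT s:{..r}|lborel. A s)"
    have \<alpha>m[measurable]: "\<alpha> \<in> borel_measurable borel" unfolding \<alpha>_def by (rule primm) simp
    obtain K2 where K2: "\<And>r. \<bar>\<alpha> r\<bar> \<le> K2" unfolding \<alpha>_def using primb[OF Ai] by blast
    \<comment> \<open>the part of \<open>A\<close> with integral zero\<close>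
    define E' where "E' = (\<lambda>s. A s - m * b0 s)"
    define lo where "lo = min a (L/4)"
    define hi where "hi = max b (L/2)"
    have "a \<in> {a..b}" "b \<in> {a..b}" using lt by auto
    with ab(1) have "a \<in> {0<..<L}" "b \<in> {0<..<L}" by blast+
    then have "0 < a" "b < L" by auto
    then have lohi: "{lo..hi} \<subseteq> {0<..<L}" using L by (auto simp: lo_def hi_def min_def max_def)
    have A': "bump1 lo hi A" and b0': "bump1 lo hi b0"
      using A b0(1) lt L by (auto intro: bump1_mono simp: lo_def hi_def)
    have E': "bump1 lo hi E'"
    proof -
      have "smooth1 (\<lambda>s. A s + (- m) * b0 s)"
        using A' b0' by (intro smooth1_add smooth1_mult smooth1_const) (auto simp: bump1_def)
      then show ?thesis using A' b0' by (auto simp: bump1_def E'_def)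
    qed
    have b0i: "integrable lborel b0" by (rule bump1_integrable[OF b0(1)])
    have E0: "(LINT s|lborel. E' s) = 0"
      unfolding E'_def using Ai b0i by (simp add: m_def[symmetric] b0(2))
    define E where "E = (\<lambda>r. LINT s:{..r}|lborel. E' s)"
    have Eeq: "E r = \<alpha> r - m * \<beta> r" for r
    proof -
      have "set_integrable lborel {..r} A" "set_integrable lborel {..r} b0"
        using integrable_mult_indicator[OF _ Ai, of "{..r}"] integrable_mult_indicator[OF _ b0i, of "{..r}"]
        by (simp_all add: set_integrable_def)
      moreover from this(2) have "set_integrable lborel {..r} (\<lambda>s. m * b0 s)"
        by (rule set_integrable_mult_right)
      ultimately have "set_integrable lborel {..r} A" "set_integrable lborel {..r} (\<lambda>s. m * b0 s)" by simp_all
      then show ?thesis unfolding E_def E'_def \<alpha>_def \<beta>_def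
        by (simp add: set_integral_diff set_integral_mult_right)
    qed
    have "(LINT z:?Q|lborel. u z * (E' (fst z) * B (snd z))) = - (LINT z:?Q|lborel. v z * (E (fst z) * B (snd z)))"
      unfolding E_def
      by (rule weak[OF bump1_primitive(1)[OF E' E0] bump1_primitive(2)[OF E' E0] E' B lohi ab(2)])
    then have id1: "(LINT z|lborel. U z * (E' (fst z) * B (snd z))) = - (LINT z|lborel. V z * (E (fst z) * B (snd z)))"
      by (simp add: set_lebesgue_integral_def U_def V_def mult.assoc)
    \<comment> \<open>all the products below are integrable, being bounded multiples of \<open>U\<close>, \<open>V\<close>, \<open>H\<close>\<close>
    have cB: "\<bar>k * B (snd z)\<bar> \<le> c * KB" if "\<bar>k\<bar> \<le> c" for k c and z :: "real \<times> real"
      using that KB by (auto simp: abs_mult intro!: mult_mono)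
    have i1: "integrable lborel (\<lambda>z. U z * (A (fst z) * B (snd z)))"
      by (rule integrable_mult_bounded[OF Ui _ cB[OF KA(2)]]) measurable
    have i2: "integrable lborel (\<lambda>z. U z * (b0 (fst z) * B (snd z)))"
      by (rule integrable_mult_bounded[OF Ui _ cB[OF K0(2)]]) measurable
    have i3: "integrable lborel (\<lambda>z. V z * (\<alpha> (fst z) * B (snd z)))"
      by (rule integrable_mult_bounded[OF Vi _ cB[OF K2]]) measurable
    have i4: "integrable lborel (\<lambda>z. V z * (\<beta> (fst z) * B (snd z)))"
      by (rule integrable_mult_bounded[OF Vi _ cB[OF K1]]) measurable
    have i5: "integrable lborel (\<lambda>z. V z * B (snd z))"
      by (rule integrable_mult_bounded[OF Vi _ KB(2)]) measurable
    have id2: "(LINT z|lborel. U z * (A (fst z) * B (snd z))) - m * (LINT z|lborel. U z * (b0 (fst z) * B (snd z)))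
       = - (LINT z|lborel. V z * (\<alpha> (fst z) * B (snd z))) + m * (LINT z|lborel. V z * (\<beta> (fst z) * B (snd z)))"
      using id1 i1 i2 i3 i4 unfolding Eeq E'_def by (simp add: algebra_simps)
    have gB: "(LINT z|lborel. (A (fst z) * (g (snd z) * B (snd z)))) = m * (LINT z|lborel. H z * B (snd z))"
    proof -
      have gBi: "integrable lborel (\<lambda>x. g x * B x)"
      proof (rule Bochner_Integration.integrable_bound)
        show "integrable lborel (\<lambda>x. KB * g x)" using gi by simp
        show "AE x in lborel. norm (g x * B x) \<le> norm (KB * g x)"
          using KB by (auto simp: abs_mult mult.commute intro!: mult_right_mono)
        show "(\<lambda>x. g x * B x) \<in> borel_measurable lborel" by measurable
      qed
      have HB: "integrable lborel (\<lambda>z. H z * B (snd z))" by (rule integrable_mult_bounded[OF Hi _ KB(2)]) measurable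
      have "(LINT z|lborel. A (fst z) * (g (snd z) * B (snd z))) = m * (LINT x|lborel. g x * B x)"
        unfolding m_def by (rule product_integral(2)[OF Ai gBi])
      also have "(LINT x|lborel. g x * B x) = (LINT z|lborel. H z * B (snd z))"
        unfolding integral_slice(1)[OF HB] by (simp add: g_def)
      finally show ?thesis .
    qed
    have NAi: "integrable lborel (\<lambda>z. N z * (A (fst z) * B (snd z)))"
    proof -
      have "integrable lborel (\<lambda>z. (indicator {0<..<L} (fst z) * N z) * (A (fst z) * B (snd z)))"
        by (rule integrable_mult_bounded[OF Ni _ cB[OF KA(2)]]) measurable
      moreover have "(indicator {0<..<L} s * y) * (A s * w) = y * (A s * w)" for s y w
        using Az[of s] by (cases "s \<in> {0<..<L}") simp_all
      ultimately show ?thesis by simp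
    qed
    have NB: "(LINT z|lborel. N z * (A (fst z) * B (snd z)))
        = m * (LINT z|lborel. V z * B (snd z)) - (LINT z|lborel. V z * (\<alpha> (fst z) * B (snd z)))"
    proof -
      have k: "integrable lborel (\<lambda>z. V z * ((m - \<alpha> (fst z)) * B (snd z)))"
        using i3 i5 by (simp add: algebra_simps)
      have *: "(LINT s|lborel. N (s, x) * (A s * B x)) = (LINT r|lborel. V (r, x) * ((m - \<alpha> r) * B x))"
        if V: "integrable lborel (\<lambda>r. V (r, x))" for x
      proof -
        have Vx[measurable]: "(\<lambda>r. V (r, x)) \<in> borel_measurable borel" using V by auto
        have pi: "integrable lborel (\<lambda>z. (A (fst z) * V (snd z, x)) * indicator {z. snd z < fst z} z)"
        proof (rule integrable_mult_bounded[OF product_integral(1)[OF Ai V], where c=1])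
          show "(indicator {z. snd z < fst z} :: real \<times> real \<Rightarrow> real) \<in> borel_measurable borel" by measurable
        qed (simp add: indicator_def)
        have pi': "integrable (lborel \<Otimes>\<^sub>M lborel) (\<lambda>(s, r). A s * V (r, x) * indicator {..<s} r)"
          using pi by (simp add: lborel_prod case_prod_beta' indicator_def)
        have "(LINT s|lborel. N (s, x) * A s) = (LINT s|lborel. LINT r|lborel. A s * V (r, x) * indicator {..<s} r)"
          unfolding N_def by (simp add: mult_ac)
        also have "\<dots> = (LINT r|lborel. LINT s|lborel. A s * V (r, x) * indicator {..<s} r)"
          using lborel_pair.Fubini_integral[OF pi'] by simp
        also have "\<dots> = (LINT r|lborel. V (r, x) * (m - \<alpha> r))"
        proof (intro Bochner_Integration.integral_cong refl)
          fix r
          have "(LINT s|lborel. A s * V (r, x) * indicator {..<s} r)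
              = (LINT s|lborel. V (r, x) * (A s - indicator {..r} s *\<^sub>R A s))"
            by (intro Bochner_Integration.integral_cong) (auto simp: indicator_def)
          also have "\<dots> = V (r, x) * (m - \<alpha> r)"
            using Ai integrable_mult_indicator[OF _ Ai, of "{..r}"]
            by (simp add: m_def \<alpha>_def set_lebesgue_integral_def)
          finally show "(LINT s|lborel. A s * V (r, x) * indicator {..<s} r) = V (r, x) * (m - \<alpha> r)" .
        qed
        finally have "(LINT s|lborel. N (s, x) * A s) * B x = (LINT r|lborel. V (r, x) * (m - \<alpha> r)) * B x" by simp
        then show ?thesis by (simp flip: mult.assoc)
      qed
      have "AE x in lborel. (LINT s|lborel. N (s, x) * (A s * B x)) = (LINT r|lborel. V (r, x) * ((m - \<alpha> r) * B x))"
        using integral_slice(2)[OF Vi] by (rule eventually_mono) (rule *)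
      then have "(LINT z|lborel. N z * (A (fst z) * B (snd z))) = (LINT z|lborel. V z * ((m - \<alpha> (fst z)) * B (snd z)))"
        unfolding integral_slice(1)[OF NAi] integral_slice(1)[OF k] fst_conv snd_conv
        using integral_slice(3)[OF NAi] integral_slice(3)[OF k]
        by (intro integral_cong_AE) auto
      also have "\<dots> = m * (LINT z|lborel. V z * B (snd z)) - (LINT z|lborel. V z * (\<alpha> (fst z) * B (snd z)))"
        using i3 i5 by (simp add: algebra_simps)
      finally show ?thesis .
    qed
    have H2: "(LINT z|lborel. H z * B (snd z)) = (LINT z|lborel. U z * (b0 (fst z) * B (snd z)))
        - (LINT z|lborel. V z * B (snd z)) + (LINT z|lborel. V z * (\<beta> (fst z) * B (snd z)))"
      unfolding H_def using i2 i4 i5 by (simp add: algebra_simps)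
    have gAi: "integrable lborel (\<lambda>z. A (fst z) * (g (snd z) * B (snd z)))"
    proof -
      have "integrable lborel (\<lambda>z. (indicator {0<..<L} (fst z) * g (snd z)) * (A (fst z) * B (snd z)))"
        by (rule integrable_mult_bounded[OF gN(1) _ cB[OF KA(2)]]) measurable
      moreover have "(indicator {0<..<L} s * y) * (A s * w) = A s * (y * w)" for s y w
        using Az[of s] by (cases "s \<in> {0<..<L}") simp_all
      ultimately show ?thesis by simp
    qed
    have "(LINT z:?Q|lborel. f z * (A (fst z) * B (snd z)))
       = (LINT z|lborel. U z * (A (fst z) * B (snd z)) - (A (fst z) * (g (snd z) * B (snd z)) + N z * (A (fst z) * B (snd z))))"
      unfolding set_lebesgue_integral_def
    proof (intro Bochner_Integration.integral_cong refl)
      fix z :: "real \<times> real"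
      show "indicator ?Q z *\<^sub>R (f z * (A (fst z) * B (snd z))) =
        U z * (A (fst z) * B (snd z)) - (A (fst z) * (g (snd z) * B (snd z)) + N z * (A (fst z) * B (snd z)))"
      proof (cases "z \<in> ?Q")
        case False
        then have "A (fst z) = 0 \<or> B (snd z) = 0"
          using Az[of "fst z"] Bz[of "snd z"] by (cases z) (auto simp: strip_def)
        then show ?thesis using False by auto
      qed (simp add: U_def f_def algebra_simps)
    qed
    also have "\<dots> = 0"
      using i1 gAi NAi gB NB H2 id2 by (simp add: algebra_simps)
    finally show "(LINT z:?Q|lborel. f z * (A (fst z) * B (snd z))) = 0" .
  qed
  then have "AE z in lborel. z \<in> ?Q \<longrightarrow> u z = g (snd z) + (LINT r:{0<..<fst z}|lborel. indicator ?Q (r, snd z) * v (r, snd z))"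
  proof eventually_elim
    case (elim z)
    have "N z = (LINT r:{0<..<fst z}|lborel. indicator ?Q (r, snd z) * v (r, snd z))"
      unfolding N_def V_def set_lebesgue_integral_def
      by (intro Bochner_Integration.integral_cong) (auto simp: indicator_def strip_def)
    then show ?case using elim by (simp add: f_def)
  qed
  then show ?thesis
    using that[of g] gm integrable_mult_indicator[OF _ gi, of I] Ib by simp
qed

text \<open>Weak differentiability in the first variable, tested with products only. In this form the left
  side of the rectangle and, after exchanging the two variables, its bottom side are instances of the
  same situation.\<close>

definition strip_deriv :: "real \<Rightarrow> real set \<Rightarrow> (real \<times> real \<Rightarrow> real) \<Rightarrow> (real \<times> real \<Rightarrow> real) \<Rightarrow> bool" where
  "strip_deriv L I u v \<longleftrightarrow> u \<in> L2 (strip L I) \<and> v \<in> L2 (strip L I) \<and>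
    (\<forall>A A' B a b a' b'. bump1 a b A \<longrightarrow> (\<forall>s. (A has_real_derivative A' s) (at s)) \<longrightarrow> bump1 a b A' \<longrightarrow>
      bump1 a' b' B \<longrightarrow> {a..b} \<subseteq> {0<..<L} \<longrightarrow> {a'..b'} \<subseteq> I \<longrightarrow>
      (LINT z:strip L I|lborel. u z * (A' (fst z) * B (snd z))) = - (LINT z:strip L I|lborel. v z * (A (fst z) * B (snd z))))"

text \<open>A quantitative form of having the trace \<open>g\<close>: at distance \<open>s\<close> from the side, \<open>u\<close> deviates from \<open>g\<close>
  by at most \<open>sqrt (s m)\<close>, where \<open>m\<close> is integrable along the side.\<close>

definition trace_bound :: "real \<Rightarrow> real set \<Rightarrow> (real \<times> real \<Rightarrow> real) \<Rightarrow> (real \<Rightarrow> real) \<Rightarrow> (real \<Rightarrow> real) \<Rightarrow> bool" where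
  "trace_bound L I u g m \<longleftrightarrow> g \<in> L2 I \<and> integrable lborel m \<and> (\<forall>x. m x \<ge> 0) \<and>
    (AE z in lborel. z \<in> strip L I \<longrightarrow> (u z - g (snd z))\<^sup>2 \<le> fst z * m (snd z))"

lemma snd_L2:
  assumes "g \<in> L2 I" "L > 0"
  shows "(\<lambda>z. g (snd z)) \<in> L2 (strip L I)" "(L2_norm (strip L I) (\<lambda>z. g (snd z)))\<^sup>2 = L * (L2_norm I g)\<^sup>2"
proof -
  note [measurable] = L2D(1)[OF assms(1)]
  have eq: "indicator (strip L I) z * g (snd z) = indicator {0<..<L} (fst z) * (indicator I (snd z) * g (snd z))" for z
    by (cases z) (auto simp: strip_def indicator_def)
  have eq2: "(indicator (strip L I) z * g (snd z))\<^sup>2 = indicator {0<..<L} (fst z) * (indicator I (snd z) * g (snd z))\<^sup>2" for z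
    by (cases z) (auto simp: strip_def indicator_def)
  have i: "integrable lborel (indicator {0<..<L} :: real \<Rightarrow> real)" by (rule integrable_indicator_bounded) auto
  show "(\<lambda>z. g (snd z)) \<in> L2 (strip L I)"
  proof (rule L2I)
    show "(\<lambda>x. indicator (strip L I) x * g (snd x)) \<in> borel_measurable borel"
      unfolding eq by measurable
    show "integrable lborel (\<lambda>x. (indicator (strip L I) x * g (snd x))\<^sup>2)"
      unfolding eq2 by (rule product_integral(1)[OF i L2D(2)[OF assms(1)]])
  qed
  show "(L2_norm (strip L I) (\<lambda>z. g (snd z)))\<^sup>2 = L * (L2_norm I g)\<^sup>2"
    unfolding L2_norm_power2 eq2 product_integral(2)[OF i L2D(2)[OF assms(1)]]
    using assms(2) by simp
qed

lemma two_squares: "(a + b)\<^sup>2 \<le> 2 * a\<^sup>2 + 2 * b\<^sup>2" for a b :: real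
  using square_sum_split[of 1 a b] by simp

text \<open>In the representation by a primitive, the Cauchy-Schwarz inequality bounds the square of the
  integral of \<open>v\<close> over \<open>(0, s)\<close> by \<open>s\<close> times the integral of \<open>v\<^sup>2\<close> along the whole line, which is \<open>m\<close>.\<close>

lemma strip_deriv_trace_bound:
  assumes L: "L > 0" and I: "open I" "bounded I" and uv: "strip_deriv L I u v"
  obtains g m where "trace_bound L I u g m" "(LINT x|lborel. m x) = (L2_norm (strip L I) v)\<^sup>2"
proof -
  let ?Q = "strip L I"
  have Ib: "I \<in> sets borel" using I by simp
  note Q = strip_measure[OF I(2) Ib, of L]
  have u: "u \<in> L2 ?Q" and v: "v \<in> L2 ?Q" using uv by (auto simp: strip_deriv_def)
  obtain g where gm[measurable]: "g \<in> borel_measurable borel"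
    and g: "AE z in lborel. z \<in> ?Q \<longrightarrow>
      u z = g (snd z) + (LINT r:{0<..<fst z}|lborel. indicator ?Q (r, snd z) * v (r, snd z))"
  proof (rule slab_representation[OF L I u v])
    show "(LINT z:strip L I|lborel. u z * (A' (fst z) * B (snd z))) = - (LINT z:strip L I|lborel. v z * (A (fst z) * B (snd z)))"
      if "bump1 a b A" "\<And>s. (A has_real_derivative A' s) (at s)" "bump1 a b A'"
        "bump1 a' b' B" "{a..b} \<subseteq> {0<..<L}" "{a'..b'} \<subseteq> I" for A A' B a b a' b'
      using uv that unfolding strip_deriv_def by blast
  qed blast
  define V where "V = (\<lambda>z. indicator ?Q z * v z)"
  have Vi: "integrable lborel V" unfolding V_def using v Q by (auto intro: L2_integrable)
  have V2: "integrable lborel (\<lambda>z. (V z)\<^sup>2)" unfolding V_def by (rule L2D(2)[OF v])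
  define m where "m = (\<lambda>x. LINT r|lborel. (V (r, x))\<^sup>2)"
  have mi: "integrable lborel m" unfolding m_def by (rule integral_slice(3)[OF V2])
  have m0: "m x \<ge> 0" for x by (simp add: m_def)
  have mt: "(LINT x|lborel. m x) = (L2_norm ?Q v)\<^sup>2"
    unfolding m_def L2_norm_power2 using integral_slice(1)[OF V2] by (simp add: V_def)
  have "AE x in lborel. \<forall>s>0. (LINT r:{0<..<s}|lborel. V (r, x))\<^sup>2 \<le> s * m x"
    using integral_slice(2)[OF Vi] integral_slice(2)[OF V2]
  proof eventually_elim
    case (elim x)
    show ?case
    proof (intro allI impI)
      fix s :: real assume s: "s > 0"
      have i: "set_integrable lborel {0<..<s} (\<lambda>r. V (r, x))" "set_integrable lborel {0<..<s} (\<lambda>r. (V (r, x))\<^sup>2)"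
        unfolding set_integrable_def using elim by (auto intro!: integrable_mult_indicator simp del: real_scaleR_def)
      have "(LINT r:{0<..<s}|lborel. V (r, x))\<^sup>2 \<le> s * (LINT r:{0<..<s}|lborel. (V (r, x))\<^sup>2)"
        by (rule set_integral_square_le[OF s i])
      also have "(LINT r:{0<..<s}|lborel. (V (r, x))\<^sup>2) \<le> m x"
        unfolding m_def set_lebesgue_integral_def
        by (rule integral_mono) (use i(2) elim in \<open>auto simp: set_integrable_def indicator_def\<close>)
      finally show "(LINT r:{0<..<s}|lborel. V (r, x))\<^sup>2 \<le> s * m x" using s by simp
    qed
  qed
  from AE_snd[OF this] g
  have est: "AE z in lborel. z \<in> ?Q \<longrightarrow> (u z - g (snd z))\<^sup>2 \<le> fst z * m (snd z)"
    by eventually_elim (auto simp: V_def strip_def)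
  have gL2: "g \<in> L2 I"
  proof (rule L2I)
    show gI: "(\<lambda>x. indicator I x * g x) \<in> borel_measurable borel" using Ib by measurable
    have il: "integrable lborel (indicator {0<..<L} :: real \<Rightarrow> real)" by (rule integrable_indicator_bounded) auto
    have "integrable lborel (\<lambda>z. indicator {0<..<L} (fst z) * (indicator I (snd z) * g (snd z))\<^sup>2)"
    proof (rule Bochner_Integration.integrable_bound)
      show "integrable lborel (\<lambda>z. 2 * (indicator ?Q z * u z)\<^sup>2 + 2 * L * (indicator {0<..<L} (fst z) * m (snd z)))"
        using L2D(2)[OF u] product_integral(1)[OF il mi] by simp
      show "(\<lambda>z. indicator {0<..<L} (fst z) * (indicator I (snd z) * g (snd z))\<^sup>2) \<in> borel_measurable lborel"
        using gI by measurable
      show "AE z in lborel. norm (indicator {0<..<L} (fst z) * (indicator I (snd z) * g (snd z))\<^sup>2)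
         \<le> norm (2 * (indicator ?Q z * u z)\<^sup>2 + 2 * L * (indicator {0<..<L} (fst z) * m (snd z)))"
        using est
      proof eventually_elim
        case (elim z)
        show ?case
        proof (cases "z \<in> ?Q")
          case True
          then have z: "fst z \<in> {0<..<L}" "snd z \<in> I" by (auto simp: strip_def)
          have "(g (snd z))\<^sup>2 \<le> 2 * (u z)\<^sup>2 + 2 * (g (snd z) - u z)\<^sup>2"
            using two_squares[of "u z" "g (snd z) - u z"] by simp
          also have "(g (snd z) - u z)\<^sup>2 = (u z - g (snd z))\<^sup>2" by (rule power2_commute)
          also have "\<dots> \<le> fst z * m (snd z)" using elim True by simp
          also have "\<dots> \<le> L * m (snd z)" using z m0 by (intro mult_right_mono) auto
          finally have "(g (snd z))\<^sup>2 \<le> 2 * (u z)\<^sup>2 + 2 * (L * m (snd z))" by simp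
          then show ?thesis using True z by simp
        next
          case False
          then have "fst z \<notin> {0<..<L} \<or> snd z \<notin> I" by (cases z) (auto simp: strip_def)
          then show ?thesis by (auto simp del: greaterThanLessThan_iff)
        qed
      qed
    qed
    from integral_slice(3)[OF this] show "integrable lborel (\<lambda>x. (indicator I x * g x)\<^sup>2)"
      using L by simp
  qed
  show ?thesis by (rule that[of g m]) (use gL2 mi m0 est mt in \<open>auto simp: trace_bound_def\<close>)
qed

text \<open>The inequality \<open>g\<^sup>2 \<le> 2 u\<^sup>2 + 2 (u - g)\<^sup>2\<close> is averaged over the strip.\<close>

lemma trace_bound_L2:
  assumes "L > 0" "trace_bound L I u g m" "u \<in> L2 (strip L I)"
  shows "(L2_norm I g)\<^sup>2 \<le> 2 / L * (L2_norm (strip L I) u)\<^sup>2 + 2 * L * (LINT x|lborel. m x)"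
proof -
  let ?Q = "strip L I"
  have g: "g \<in> L2 I" and mi: "integrable lborel m" and m0: "\<And>x. m x \<ge> 0"
    and est: "AE z in lborel. z \<in> ?Q \<longrightarrow> (u z - g (snd z))\<^sup>2 \<le> fst z * m (snd z)"
    using assms(2) by (auto simp: trace_bound_def)
  have il: "integrable lborel (indicator {0<..<L} :: real \<Rightarrow> real)" by (rule integrable_indicator_bounded) auto
  note pm = product_integral[OF il mi]
  have "L * (L2_norm I g)\<^sup>2 = (LINT z|lborel. (indicator ?Q z * g (snd z))\<^sup>2)"
    using snd_L2(2)[OF g assms(1)] by (simp add: L2_norm_power2)
  also have "\<dots> \<le> (LINT z|lborel. 2 * (indicator ?Q z * u z)\<^sup>2 + 2 * L * (indicator {0<..<L} (fst z) * m (snd z)))"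
  proof (rule integral_mono_AE)
    show "integrable lborel (\<lambda>z. (indicator ?Q z * g (snd z))\<^sup>2)" by (rule L2D(2)[OF snd_L2(1)[OF g assms(1)]])
    show "integrable lborel (\<lambda>z. 2 * (indicator ?Q z * u z)\<^sup>2 + 2 * L * (indicator {0<..<L} (fst z) * m (snd z)))"
      using L2D(2)[OF assms(3)] pm(1) by simp
    show "AE z in lborel. (indicator ?Q z * g (snd z))\<^sup>2 \<le> 2 * (indicator ?Q z * u z)\<^sup>2 + 2 * L * (indicator {0<..<L} (fst z) * m (snd z))"
      using est
    proof eventually_elim
      case (elim z)
      show ?case
      proof (cases "z \<in> ?Q")
        case True
        then have z: "fst z \<in> {0<..<L}" by (auto simp: strip_def)
        have "(g (snd z))\<^sup>2 \<le> 2 * (u z)\<^sup>2 + 2 * (g (snd z) - u z)\<^sup>2"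
          using two_squares[of "u z" "g (snd z) - u z"] by simp
        also have "(g (snd z) - u z)\<^sup>2 = (u z - g (snd z))\<^sup>2" by (rule power2_commute)
        also have "\<dots> \<le> fst z * m (snd z)" using elim True by simp
        also have "\<dots> \<le> L * m (snd z)" using z m0 by (intro mult_right_mono) auto
        finally have "(g (snd z))\<^sup>2 \<le> 2 * (u z)\<^sup>2 + 2 * (L * m (snd z))" by simp
        then show ?thesis using True z by simp
      next
        case False
        then show ?thesis using m0 assms(1) by simp
      qed
    qed
  qed
  also have "\<dots> = 2 * (L2_norm ?Q u)\<^sup>2 + 2 * L * (L * (LINT x|lborel. m x))"
    using L2D(2)[OF assms(3)] pm assms(1) by (simp add: L2_norm_power2)
  finally have "L * (L2_norm I g)\<^sup>2 \<le> 2 * (L2_norm ?Q u)\<^sup>2 + 2 * L * (L * (LINT x|lborel. m x))" .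
  then show ?thesis using assms(1) by (simp add: field_simps)
qed

definition trace_mean :: "real set \<Rightarrow> (real \<times> real \<Rightarrow> real) \<Rightarrow> (real \<Rightarrow> real) \<Rightarrow> real \<Rightarrow> real" where
  "trace_mean I u g \<epsilon> = 1 / \<epsilon> * (L2_norm (strip \<epsilon> I) (\<lambda>z. u z - g (snd z)))\<^sup>2"

lemma has_trace_mean:
  "has_trace I v g \<longleftrightarrow> g \<in> L2 I \<and> (trace_mean I (\<lambda>z. v (fst z) (snd z)) g \<longlongrightarrow> 0) (at_right 0)"
proof -
  have "(LINT z:{0<..<\<epsilon>} \<times> I|lborel. (v (fst z) (snd z) - g (snd z))\<^sup>2)
      = (L2_norm (strip \<epsilon> I) (\<lambda>z. v (fst z) (snd z) - g (snd z)))\<^sup>2" for \<epsilon>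
    unfolding L2_norm_power2 set_lebesgue_integral_def strip_def
    by (intro Bochner_Integration.integral_cong) (auto simp: indicator_def)
  then show ?thesis by (simp add: has_trace_def trace_mean_def[abs_def])
qed

lemma L2_minus_snd:
  assumes "u \<in> L2 (strip L I)" "g \<in> L2 I" "0 < \<epsilon>" "\<epsilon> \<le> L" "I \<in> sets borel"
  shows "(\<lambda>z. u z - g (snd z)) \<in> L2 (strip \<epsilon> I)"
proof -
  have "L > 0" using assms by simp
  have "(\<lambda>z. u z + (- 1) * g (snd z)) \<in> L2 (strip L I)"
    by (intro L2_combo assms snd_L2 \<open>L > 0\<close>)
  then have "(\<lambda>z. u z - g (snd z)) \<in> L2 (strip L I)" by simp
  then show ?thesis
  proof (rule L2_mono(1))
    show "strip \<epsilon> I \<subseteq> strip L I" using assms(4) by (auto simp: strip_def)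
    show "strip \<epsilon> I \<in> sets borel"
      unfolding strip_def using assms(5) by (simp add: borel_prod[symmetric])
  qed
qed

lemma L2_norm_square_sum:
  assumes "u \<in> L2 \<Omega>" "v \<in> L2 \<Omega>"
  shows "(L2_norm \<Omega> (\<lambda>x. u x + v x))\<^sup>2 \<le> 2 * (L2_norm \<Omega> u)\<^sup>2 + 2 * (L2_norm \<Omega> v)\<^sup>2"
proof -
  have "(L2_norm \<Omega> (\<lambda>x. u x + v x))\<^sup>2 \<le> (L2_norm \<Omega> u + L2_norm \<Omega> v)\<^sup>2"
    by (intro power_mono L2_norm_triangle assms L2_norm_nonneg)
  also have "\<dots> \<le> 2 * (L2_norm \<Omega> u)\<^sup>2 + 2 * (L2_norm \<Omega> v)\<^sup>2" by (rule two_squares)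
  finally show ?thesis .
qed

lemma eventually_at_right_0: "L > 0 \<Longrightarrow> (\<And>\<epsilon>. 0 < \<epsilon> \<Longrightarrow> \<epsilon> < L \<Longrightarrow> P \<epsilon>) \<Longrightarrow> eventually P (at_right (0::real))"
  using eventually_at_rightI[of 0 L P] by simp

lemma trace_mean_nonneg: "\<epsilon> > 0 \<Longrightarrow> trace_mean I u g \<epsilon> \<ge> 0"
  by (simp add: trace_mean_def)

lemma squeeze_to_0:
  fixes f g :: "real \<Rightarrow> real"
  assumes "(g \<longlongrightarrow> 0) F" "\<forall>\<^sub>F x in F. 0 \<le> f x" "\<forall>\<^sub>F x in F. f x \<le> g x"
  shows "(f \<longlongrightarrow> 0) F"
  by (rule tendsto_sandwich[OF assms(2,3) tendsto_const assms(1)])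

lemma has_trace_combo:
  assumes L: "L > 0" "I \<in> sets borel"
    and u: "(\<lambda>z. u (fst z) (snd z)) \<in> L2 (strip L I)" and v: "(\<lambda>z. v (fst z) (snd z)) \<in> L2 (strip L I)"
    and g: "has_trace I u g" and h: "has_trace I v h"
  shows "has_trace I (\<lambda>s x. u s x + c * v s x) (\<lambda>x. g x + c * h x)"
proof -
  have gL: "g \<in> L2 I" "(trace_mean I (\<lambda>z. u (fst z) (snd z)) g \<longlongrightarrow> 0) (at_right 0)"
    and hL: "h \<in> L2 I" "(trace_mean I (\<lambda>z. v (fst z) (snd z)) h \<longlongrightarrow> 0) (at_right 0)"
    using g h by (auto simp: has_trace_mean)
  have "((\<lambda>\<epsilon>. 2 * trace_mean I (\<lambda>z. u (fst z) (snd z)) g \<epsilon> + 2 * c\<^sup>2 * trace_mean I (\<lambda>z. v (fst z) (snd z)) h \<epsilon>)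
      \<longlongrightarrow> 2 * 0 + 2 * c\<^sup>2 * 0) (at_right 0)"
    by (intro tendsto_intros gL hL)
  then have lim: "((\<lambda>\<epsilon>. 2 * trace_mean I (\<lambda>z. u (fst z) (snd z)) g \<epsilon> + 2 * c\<^sup>2 * trace_mean I (\<lambda>z. v (fst z) (snd z)) h \<epsilon>)
      \<longlongrightarrow> 0) (at_right 0)" by simp
  have "(trace_mean I (\<lambda>z. u (fst z) (snd z) + c * v (fst z) (snd z)) (\<lambda>x. g x + c * h x) \<longlongrightarrow> 0) (at_right 0)"
  proof (rule squeeze_to_0[OF lim])
    show "\<forall>\<^sub>F \<epsilon> in at_right 0. 0 \<le> trace_mean I (\<lambda>z. u (fst z) (snd z) + c * v (fst z) (snd z)) (\<lambda>x. g x + c * h x) \<epsilon>"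
      by (rule eventually_at_right_0[OF L(1)]) (simp add: trace_mean_nonneg)
    show "\<forall>\<^sub>F \<epsilon> in at_right 0. trace_mean I (\<lambda>z. u (fst z) (snd z) + c * v (fst z) (snd z)) (\<lambda>x. g x + c * h x) \<epsilon>
      \<le> 2 * trace_mean I (\<lambda>z. u (fst z) (snd z)) g \<epsilon> + 2 * c\<^sup>2 * trace_mean I (\<lambda>z. v (fst z) (snd z)) h \<epsilon>"
    proof (rule eventually_at_right_0[OF L(1)])
      fix \<epsilon> assume e: "0 < \<epsilon>" "\<epsilon> < L"
      have 1: "(\<lambda>z. u (fst z) (snd z) - g (snd z)) \<in> L2 (strip \<epsilon> I)"
        by (rule L2_minus_snd[OF u gL(1)]) (use e L in auto)
      have 2: "(\<lambda>z. v (fst z) (snd z) - h (snd z)) \<in> L2 (strip \<epsilon> I)"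
        by (rule L2_minus_snd[OF v hL(1)]) (use e L in auto)
      have 3: "(\<lambda>z. c * (v (fst z) (snd z) - h (snd z))) \<in> L2 (strip \<epsilon> I)"
        using L2_combo[OF 2 2, of "c - 1"] by (simp add: algebra_simps)
      have "(L2_norm (strip \<epsilon> I) (\<lambda>z. u (fst z) (snd z) + c * v (fst z) (snd z) - (g (snd z) + c * h (snd z))))\<^sup>2
          = (L2_norm (strip \<epsilon> I) (\<lambda>z. (u (fst z) (snd z) - g (snd z)) + c * (v (fst z) (snd z) - h (snd z))))\<^sup>2"
        by (simp add: algebra_simps)
      also have "\<dots> \<le> 2 * (L2_norm (strip \<epsilon> I) (\<lambda>z. u (fst z) (snd z) - g (snd z)))\<^sup>2
          + 2 * (L2_norm (strip \<epsilon> I) (\<lambda>z. c * (v (fst z) (snd z) - h (snd z))))\<^sup>2"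
        by (rule L2_norm_square_sum[OF 1 3])
      also have "(L2_norm (strip \<epsilon> I) (\<lambda>z. c * (v (fst z) (snd z) - h (snd z))))\<^sup>2
          = c\<^sup>2 * (L2_norm (strip \<epsilon> I) (\<lambda>z. v (fst z) (snd z) - h (snd z)))\<^sup>2"
        by (simp only: L2_norm_scale power_mult_distrib power2_abs)
      finally show "trace_mean I (\<lambda>z. u (fst z) (snd z) + c * v (fst z) (snd z)) (\<lambda>x. g x + c * h x) \<epsilon>
        \<le> 2 * trace_mean I (\<lambda>z. u (fst z) (snd z)) g \<epsilon> + 2 * c\<^sup>2 * trace_mean I (\<lambda>z. v (fst z) (snd z)) h \<epsilon>"
        using e unfolding trace_mean_def by (simp add: field_simps)
    qed
  qed
  then show ?thesis using L2_combo[OF gL(1) hL(1)] by (simp add: has_trace_mean)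
qed

text \<open>The norm of \<open>g - h\<close> does not depend on the width \<epsilon> of the strip, while the two means that bound it
  tend to 0.\<close>

lemma has_trace_unique:
  assumes L: "L > 0" "I \<in> sets borel" and u: "(\<lambda>z. u (fst z) (snd z)) \<in> L2 (strip L I)"
    and g: "has_trace I u g" and h: "has_trace I u h"
  shows "AE x in lborel. x \<in> I \<longrightarrow> g x = h x"
proof -
  have gL: "g \<in> L2 I" "(trace_mean I (\<lambda>z. u (fst z) (snd z)) g \<longlongrightarrow> 0) (at_right 0)"
    and hL: "h \<in> L2 I" "(trace_mean I (\<lambda>z. u (fst z) (snd z)) h \<longlongrightarrow> 0) (at_right 0)"
    using g h by (auto simp: has_trace_mean)
  have d: "(\<lambda>x. g x - h x) \<in> L2 I" using L2_combo[OF gL(1) hL(1), of "- 1"] by simp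
  have "((\<lambda>\<epsilon>. 2 * trace_mean I (\<lambda>z. u (fst z) (snd z)) g \<epsilon> + 2 * trace_mean I (\<lambda>z. u (fst z) (snd z)) h \<epsilon>)
      \<longlongrightarrow> 2 * 0 + 2 * 0) (at_right 0)"
    by (intro tendsto_intros gL hL)
  moreover have "\<forall>\<^sub>F \<epsilon> in at_right 0. (L2_norm I (\<lambda>x. g x - h x))\<^sup>2 \<le>
      2 * trace_mean I (\<lambda>z. u (fst z) (snd z)) g \<epsilon> + 2 * trace_mean I (\<lambda>z. u (fst z) (snd z)) h \<epsilon>"
  proof (rule eventually_at_right_0[OF L(1)])
    fix \<epsilon> assume e: "0 < \<epsilon>" "\<epsilon> < L"
    have 1: "(\<lambda>z. u (fst z) (snd z) - g (snd z)) \<in> L2 (strip \<epsilon> I)"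
      by (rule L2_minus_snd[OF u gL(1)]) (use e L in auto)
    have 2: "(\<lambda>z. u (fst z) (snd z) - h (snd z)) \<in> L2 (strip \<epsilon> I)"
      by (rule L2_minus_snd[OF u hL(1)]) (use e L in auto)
    have 3: "(\<lambda>z. (- 1) * (u (fst z) (snd z) - g (snd z))) \<in> L2 (strip \<epsilon> I)"
      using L2_combo[OF 1 1, of "- 2"] by (simp add: algebra_simps)
    have "\<epsilon> * (L2_norm I (\<lambda>x. g x - h x))\<^sup>2 = (L2_norm (strip \<epsilon> I) (\<lambda>z. g (snd z) - h (snd z)))\<^sup>2"
      using snd_L2(2)[OF d e(1)] by simp
    also have "\<dots> = (L2_norm (strip \<epsilon> I) (\<lambda>z. (- 1) * (u (fst z) (snd z) - g (snd z)) + (u (fst z) (snd z) - h (snd z))))\<^sup>2"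
      by (simp add: algebra_simps)
    also have "\<dots> \<le> 2 * (L2_norm (strip \<epsilon> I) (\<lambda>z. (- 1) * (u (fst z) (snd z) - g (snd z))))\<^sup>2
        + 2 * (L2_norm (strip \<epsilon> I) (\<lambda>z. u (fst z) (snd z) - h (snd z)))\<^sup>2"
      by (rule L2_norm_square_sum[OF 3 2])
    also have "L2_norm (strip \<epsilon> I) (\<lambda>z. (- 1) * (u (fst z) (snd z) - g (snd z))) =
        L2_norm (strip \<epsilon> I) (\<lambda>z. u (fst z) (snd z) - g (snd z))"
      by (subst L2_norm_scale) simp
    finally show "(L2_norm I (\<lambda>x. g x - h x))\<^sup>2 \<le>
      2 * trace_mean I (\<lambda>z. u (fst z) (snd z)) g \<epsilon> + 2 * trace_mean I (\<lambda>z. u (fst z) (snd z)) h \<epsilon>"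
      using e unfolding trace_mean_def by (simp add: field_simps)
  qed
  ultimately have "(L2_norm I (\<lambda>x. g x - h x))\<^sup>2 \<le> 2 * 0 + 2 * 0"
    by (rule tendsto_lowerbound) simp
  then have "(LINT x|lborel. (indicator I x * (g x - h x))\<^sup>2) = 0"
    by (simp add: L2_norm_power2[symmetric])
  then have "AE x in lborel. (indicator I x * (g x - h x))\<^sup>2 = 0"
    using integral_nonneg_eq_0_iff_AE[OF L2D(2)[OF d]] by simp
  then show ?thesis by eventually_elim auto
qed

lemma has_trace_cong_AE:
  assumes "has_trace I u g" "L > 0" "I \<in> sets borel"
    and u: "(\<lambda>z. u (fst z) (snd z)) \<in> L2 (strip L I)" and v: "(\<lambda>z. v (fst z) (snd z)) \<in> L2 (strip L I)"
    and ae: "AE z in lborel. z \<in> strip L I \<longrightarrow> v (fst z) (snd z) = u (fst z) (snd z)"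
  shows "has_trace I v g"
proof -
  have gL: "g \<in> L2 I" "(trace_mean I (\<lambda>z. u (fst z) (snd z)) g \<longlongrightarrow> 0) (at_right 0)"
    using assms(1) by (auto simp: has_trace_mean)
  have "\<forall>\<^sub>F \<epsilon> in at_right 0. trace_mean I (\<lambda>z. u (fst z) (snd z)) g \<epsilon> = trace_mean I (\<lambda>z. v (fst z) (snd z)) g \<epsilon>"
  proof (rule eventually_at_right_0[OF assms(2)])
    fix \<epsilon> assume e: "0 < \<epsilon>" "\<epsilon> < L"
    have "L2_norm (strip \<epsilon> I) (\<lambda>z. u (fst z) (snd z) - g (snd z)) = L2_norm (strip \<epsilon> I) (\<lambda>z. v (fst z) (snd z) - g (snd z))"
    proof (rule L2_norm_cong_AE)
      show "(\<lambda>z. v (fst z) (snd z) - g (snd z)) \<in> L2 (strip \<epsilon> I)" "(\<lambda>z. u (fst z) (snd z) - g (snd z)) \<in> L2 (strip \<epsilon> I)"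
        by (rule L2_minus_snd[OF v gL(1)] L2_minus_snd[OF u gL(1)]; use e assms in simp)+
      show "AE x in lborel. x \<in> strip \<epsilon> I \<longrightarrow> u (fst x) (snd x) - g (snd x) = v (fst x) (snd x) - g (snd x)"
        using ae by eventually_elim (use e in \<open>auto simp: strip_def\<close>)
    qed
    then show "trace_mean I (\<lambda>z. u (fst z) (snd z)) g \<epsilon> = trace_mean I (\<lambda>z. v (fst z) (snd z)) g \<epsilon>"
      by (simp add: trace_mean_def)
  qed
  from Lim_transform_eventually[OF gL(2) this] gL(1) show ?thesis by (simp add: has_trace_mean)
qed

lemma trace_bound_has_trace:
  assumes L: "L > 0" "I \<in> sets borel" and tb: "trace_bound L I (\<lambda>z. u (fst z) (snd z)) g m"
  shows "has_trace I u g"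
proof -
  have g: "g \<in> L2 I" and mi: "integrable lborel m" and m0: "\<And>x. m x \<ge> 0"
    and est: "AE z in lborel. z \<in> strip L I \<longrightarrow> (u (fst z) (snd z) - g (snd z))\<^sup>2 \<le> fst z * m (snd z)"
    using tb by (auto simp: trace_bound_def)
  have "((\<lambda>\<epsilon>. \<epsilon> * (LINT x|lborel. m x)) \<longlongrightarrow> 0 * (LINT x|lborel. m x)) (at_right 0)"
    by (intro tendsto_intros)
  then have lim: "((\<lambda>\<epsilon>. \<epsilon> * (LINT x|lborel. m x)) \<longlongrightarrow> 0) (at_right 0)" by simp
  have "(trace_mean I (\<lambda>z. u (fst z) (snd z)) g \<longlongrightarrow> 0) (at_right 0)"
  proof (rule squeeze_to_0[OF lim])
    show "\<forall>\<^sub>F \<epsilon> in at_right 0. 0 \<le> trace_mean I (\<lambda>z. u (fst z) (snd z)) g \<epsilon>"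
      by (rule eventually_at_right_0[OF L(1)]) (simp add: trace_mean_nonneg)
    show "\<forall>\<^sub>F \<epsilon> in at_right 0. trace_mean I (\<lambda>z. u (fst z) (snd z)) g \<epsilon> \<le> \<epsilon> * (LINT x|lborel. m x)"
    proof (rule eventually_at_right_0[OF L(1)])
      fix \<epsilon> assume e: "0 < \<epsilon>" "\<epsilon> < L"
      have il: "integrable lborel (\<lambda>s. \<epsilon> * indicator {0<..<\<epsilon>} s :: real)"
        by (intro integrable_mult_right integrable_indicator_bounded) auto
      note pm = product_integral[OF il mi]
      have "(LINT z|lborel. (indicator (strip \<epsilon> I) z * (u (fst z) (snd z) - g (snd z)))\<^sup>2)
        \<le> (LINT z|lborel. \<epsilon> * indicator {0<..<\<epsilon>} (fst z) * m (snd z))"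
      proof (rule integral_mono_AE')
        show "AE z in lborel. (indicator (strip \<epsilon> I) z * (u (fst z) (snd z) - g (snd z)))\<^sup>2 \<le> \<epsilon> * indicator {0<..<\<epsilon>} (fst z) * m (snd z)"
          using est
        proof eventually_elim
          case (elim z)
          show ?case
          proof (cases "z \<in> strip \<epsilon> I")
            case True
            then have z: "z \<in> strip L I" "0 < fst z" "fst z < \<epsilon>" using e by (auto simp: strip_def)
            have "fst z * m (snd z) \<le> \<epsilon> * m (snd z)" using z m0 by (intro mult_right_mono) auto
            then show ?thesis using True z elim by simp
          next
            case False
            then show ?thesis using m0 e by simp
          qed
        qed
        show "AE z in lborel. 0 \<le> \<epsilon> * indicator {0<..<\<epsilon>} (fst z) * m (snd z)"
          using m0 e by auto
      qed (rule pm(1))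
      also have "\<dots> = \<epsilon> * (\<epsilon> * (LINT x|lborel. m x))" using pm(2) e by simp
      finally show "trace_mean I (\<lambda>z. u (fst z) (snd z)) g \<epsilon> \<le> \<epsilon> * (LINT x|lborel. m x)"
        unfolding trace_mean_def L2_norm_power2 using e by (simp add: field_simps)
    qed
  qed
  then show ?thesis using g by (simp add: has_trace_mean)
qed

lemma test_fun_real:
  fixes \<phi> :: "real \<Rightarrow> real"
  assumes "test_fun I \<phi>"
  shows "(\<phi> has_real_derivative iter_deriv [1] \<phi> x) (at x)" "smooth1 \<phi>"
proof -
  have step: "(g has_real_derivative dir_deriv 1 g x) (at x)" if "test_fun I g" for g x
  proof -
    have "((\<lambda>s. g (s + x)) has_real_derivative dir_deriv 1 g x) (at 0)"
      using test_fun_line[OF that, of x 1] by (simp add: add.commute)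
    then show ?thesis using DERIV_shift[of g "dir_deriv 1 g x" 0 x] by simp
  qed
  show "(\<phi> has_real_derivative iter_deriv [1] \<phi> x) (at x)"
    using step[OF assms] by (simp add: iter_deriv_def)
  show "smooth1 \<phi>"
  proof (rule smooth1_coinduct)
    show "\<phi> \<in> {g. test_fun I g}" using assms by simp
    fix g assume "g \<in> {g. test_fun I g}"
    then have "test_fun I g" by simp
    from step[OF this] test_fun_dir_deriv[OF this, of 1]
    show "\<exists>g'\<in>{g. test_fun I g}. \<forall>x. (g has_real_derivative g' x) (at x)"
      by (intro bexI[of _ "dir_deriv 1 g"]) auto
  qed
qed

lemma narrow_bumps:
  obtains K where "K > 0" "\<And>\<epsilon>. \<epsilon> > 0 \<Longrightarrow> \<exists>A. bump1 (\<epsilon> / 4) (\<epsilon> / 2) A \<and> (\<forall>s. \<bar>A s\<bar> \<le> K / \<epsilon>) \<and> (LINT s|lborel. A s) = 1"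
proof -
  have "(1 / 4 :: real) < 1 / 2" by simp
  from bump1_mass_one[OF this] obtain a where a: "bump1 (1/4) (1/2) a" "(LINT s|lborel. a s) = 1" by metis
  obtain K where K: "K > 0" "\<And>s. \<bar>a s\<bar> \<le> K" using bump1_bounded[OF a(1)] by auto
  have "\<exists>A. bump1 (\<epsilon> / 4) (\<epsilon> / 2) A \<and> (\<forall>s. \<bar>A s\<bar> \<le> K / \<epsilon>) \<and> (LINT s|lborel. A s) = 1" if e: "\<epsilon> > 0" for \<epsilon>
  proof (intro exI[of _ "\<lambda>s. inverse \<epsilon> * a (inverse \<epsilon> * s + 0)"] conjI allI)
    have "smooth1 (\<lambda>s. inverse \<epsilon> * a (inverse \<epsilon> * s + 0))"
      using a(1) by (intro smooth1_mult smooth1_const smooth1_affine) (simp add: bump1_def)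
    moreover have "a (inverse \<epsilon> * s) = 0" if "s \<notin> {\<epsilon> / 4..\<epsilon> / 2}" for s
    proof -
      have "inverse \<epsilon> * s \<notin> {1/4..1/2}" using that e by (auto simp: field_simps)
      then show ?thesis using a(1) unfolding bump1_def by blast
    qed
    ultimately show "bump1 (\<epsilon> / 4) (\<epsilon> / 2) (\<lambda>s. inverse \<epsilon> * a (inverse \<epsilon> * s + 0))"
      by (simp add: bump1_def)
    show "\<bar>inverse \<epsilon> * a (inverse \<epsilon> * s + 0)\<bar> \<le> K / \<epsilon>" for s
      using K(2)[of "inverse \<epsilon> * s"] e by (simp add: abs_mult field_simps)
    have "(LINT s|lborel. a s) = \<bar>inverse \<epsilon>\<bar> * (LINT s|lborel. a (0 + inverse \<epsilon> * s))"
      using lborel_integral_real_affine[of "inverse \<epsilon>" a 0] e by simp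
    then show "(LINT s|lborel. inverse \<epsilon> * a (inverse \<epsilon> * s + 0)) = 1"
      using a(2) e by simp
  qed
  then show ?thesis using that[OF K(1)] by blast
qed

lemma zero_by_sqrt_bound:
  assumes "L > 0" "\<And>\<epsilon>. 0 < \<epsilon> \<Longrightarrow> \<epsilon> < L \<Longrightarrow> \<bar>X\<bar> \<le> c * sqrt \<epsilon>"
  shows "X = (0::real)"
proof -
  have "((\<lambda>\<epsilon>. c * sqrt \<epsilon>) \<longlongrightarrow> c * sqrt 0) (at_right 0)"
    by (intro tendsto_intros)
  moreover have "\<forall>\<^sub>F \<epsilon> in at_right 0. \<bar>X\<bar> \<le> c * sqrt \<epsilon>"
    by (rule eventually_at_right_0[OF assms(1)]) (rule assms(2))
  ultimately have "\<bar>X\<bar> \<le> c * sqrt 0" by (rule tendsto_lowerbound) simp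
  then show ?thesis by simp
qed

text \<open>Taking traces commutes with weak tangential derivatives. The relation between \<open>u\<close> and \<open>w\<close> is
  tested with \<open>A(s) \<phi>(x)\<close>, where \<open>A\<close> has mass one and lives on \<open>0 < s < \<epsilon>\<close>. Replacing \<open>u\<close> and \<open>w\<close> by
  their traces changes the integrals by \<open>O(sqrt \<epsilon>)\<close>: the deviation is \<open>O(sqrt \<epsilon>)\<close>, and \<open>A\<close> is \<open>O(1 / \<epsilon>)\<close>
  on an interval of length \<epsilon>.\<close>

lemma trace_weak_deriv:
  assumes L: "L > 0" and I: "open I" "bounded I"
    and tu: "trace_bound L I u g m" and tw: "trace_bound L I w h k"
    and u: "u \<in> L2 (strip L I)" and w: "w \<in> L2 (strip L I)"
    and cross: "\<And>A a b \<phi>. bump1 a b A \<Longrightarrow> {a..b} \<subseteq> {0<..<L} \<Longrightarrow> test_fun I \<phi> \<Longrightarrow>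
      (LINT z:strip L I|lborel. u z * (A (fst z) * iter_deriv [1] \<phi> (snd z))) =
      - (LINT z:strip L I|lborel. w z * (A (fst z) * \<phi> (snd z)))"
  shows "weak_deriv I [1] g h"
  unfolding weak_deriv_def
proof (intro conjI allI impI)
  let ?Q = "strip L I"
  have Ib: "I \<in> sets borel" using I by simp
  note Q = strip_measure[OF I(2) Ib, of L]
  have g: "g \<in> L2 I" and mi: "integrable lborel m" and m0: "\<And>x. m x \<ge> 0"
    and gest: "AE z in lborel. z \<in> ?Q \<longrightarrow> (u z - g (snd z))\<^sup>2 \<le> fst z * m (snd z)"
    using tu by (auto simp: trace_bound_def)
  have h: "h \<in> L2 I" and ki: "integrable lborel k" and k0: "\<And>x. k x \<ge> 0"
    and hest: "AE z in lborel. z \<in> ?Q \<longrightarrow> (w z - h (snd z))\<^sup>2 \<le> fst z * k (snd z)"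
    using tw by (auto simp: trace_bound_def)
  show lg: "loc_integrable I g" and lh: "loc_integrable I h" using g h by (auto intro: L2_loc_integrable)
  fix \<phi> assume \<phi>: "test_fun I \<phi>"
  define \<phi>' where "\<phi>' = iter_deriv [1] \<phi>"
  have \<phi>'t: "test_fun I \<phi>'" unfolding \<phi>'_def by (rule test_fun_iter_deriv[OF \<phi>]) auto
  note [measurable] = test_fun_measurable[OF \<phi>] test_fun_measurable[OF \<phi>'t]
  obtain C1 where C1: "C1 > 0" "\<And>x. \<bar>\<phi> x\<bar> \<le> C1" using test_fun_bounded[OF \<phi>] by auto
  obtain C2 where C2: "C2 > 0" "\<And>x. \<bar>\<phi>' x\<bar> \<le> C2" using test_fun_bounded[OF \<phi>'t] by auto
  define C where "C = C1 + C2"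
  have C: "C > 0" "\<bar>\<phi> x\<bar> \<le> C" "\<bar>\<phi>' x\<bar> \<le> C" for x
    using C1(1) C2(1) C1(2)[of x] C2(2)[of x] by (auto simp: C_def)
  have ig: "integrable lborel (\<lambda>x. indicator I x *\<^sub>R (g x * \<phi>' x))" and ih: "integrable lborel (\<lambda>x. indicator I x *\<^sub>R (h x * \<phi> x))"
    using loc_integrable_test[OF lg \<phi>'t] loc_integrable_test[OF lh \<phi>] by (auto simp: set_integrable_def)
  define X where "X = (LINT x:I|lborel. g x * \<phi>' x) + (LINT x:I|lborel. h x * \<phi> x)"
  define D where "D = (LINT x|lborel. 2 * indicator I x + m x + k x)"
  obtain K where K: "K > 0" "\<And>\<epsilon>. \<epsilon> > 0 \<Longrightarrow> \<exists>A. bump1 (\<epsilon> / 4) (\<epsilon> / 2) A \<and> (\<forall>s. \<bar>A s\<bar> \<le> K / \<epsilon>) \<and> (LINT s|lborel. A s) = 1"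
    using narrow_bumps by blast
  have Ii: "integrable lborel (indicator I :: real \<Rightarrow> real)"
    by (rule integrable_indicator_bounded[OF I(2) Ib])
  have "X = 0"
  proof (rule zero_by_sqrt_bound[OF L])
    fix \<epsilon> assume e: "0 < \<epsilon>" "\<epsilon> < L"
    obtain A where A: "bump1 (\<epsilon> / 4) (\<epsilon> / 2) A" "\<And>s. \<bar>A s\<bar> \<le> K / \<epsilon>" "(LINT s|lborel. A s) = 1"
      using K(2)[OF e(1)] by blast
    note [measurable] = bump1_measurable[OF A(1)]
    have A0: "A s = 0" if "s \<notin> {0<..<\<epsilon>}" for s
    proof -
      have "s \<notin> {\<epsilon> / 4..\<epsilon> / 2}" using that e by auto
      then show ?thesis using A(1) unfolding bump1_def by blast
    qed
    define F where "F = (\<lambda>z. A (fst z) * (indicator I (snd z) *\<^sub>R (g (snd z) * \<phi>' (snd z)) + indicator I (snd z) *\<^sub>R (h (snd z) * \<phi> (snd z))))"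
    note pF = product_integral[OF bump1_integrable[OF A(1)] Bochner_Integration.integrable_add[OF ig ih]]
    have Fi: "integrable lborel F" unfolding F_def by (rule pF(1))
    have FX: "(LINT z|lborel. F z) = X"
      unfolding F_def X_def pF(2) using ig ih A(3) by (simp add: set_lebesgue_integral_def)
    define G where "G = (\<lambda>z. (indicator ?Q z * u z) * (A (fst z) * \<phi>' (snd z)) + (indicator ?Q z * w z) * (A (fst z) * \<phi> (snd z)))"
    have b: "\<bar>A (fst z) * f (snd z)\<bar> \<le> K / \<epsilon> * C" if "\<And>x. \<bar>f x\<bar> \<le> C" for f :: "real \<Rightarrow> real" and z :: "real \<times> real"
      unfolding abs_mult by (rule mult_mono[OF A(2) that]) (use K e in auto)
    have G1: "integrable lborel (\<lambda>z. (indicator ?Q z * u z) * (A (fst z) * \<phi>' (snd z)))"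
      by (rule integrable_mult_bounded[OF L2_integrable[OF u Q] _ b[OF C(3)]]) measurable
    have G2: "integrable lborel (\<lambda>z. (indicator ?Q z * w z) * (A (fst z) * \<phi> (snd z)))"
      by (rule integrable_mult_bounded[OF L2_integrable[OF w Q] _ b[OF C(2)]]) measurable
    have Gi: "integrable lborel G" unfolding G_def by (rule Bochner_Integration.integrable_add[OF G1 G2])
    have "{\<epsilon> / 4..\<epsilon> / 2} \<subseteq> {0<..<L}" using e by auto
    from cross[OF A(1) this \<phi>] have G0: "(LINT z|lborel. G z) = 0"
      unfolding G_def \<phi>'_def[symmetric] using G1 G2 by (simp add: set_lebesgue_integral_def mult.assoc)
    define N where "N = (\<lambda>z::real \<times> real. (K * C / \<epsilon> * sqrt \<epsilon> * indicator {0<..<\<epsilon>} (fst z)) * (2 * indicator I (snd z) + m (snd z) + k (snd z)))"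
    have i1: "integrable lborel (\<lambda>s. K * C / \<epsilon> * sqrt \<epsilon> * indicator {0<..<\<epsilon>} s :: real)"
      by (intro integrable_mult_right integrable_indicator_bounded) auto
    have i2: "integrable lborel (\<lambda>x. 2 * indicator I x + m x + k x)" using Ii mi ki by simp
    note pN = product_integral[OF i1 i2]
    have Ni: "integrable lborel N" unfolding N_def by (rule pN(1))
    have N0: "(LINT z|lborel. N z) = K * C * D * sqrt \<epsilon>"
      unfolding N_def pN(2) D_def[symmetric] using e by simp
    have root: "\<bar>a\<bar> \<le> sqrt \<epsilon> * (1 + q)" if "a\<^sup>2 \<le> s * q" "0 < s" "s < \<epsilon>" "q \<ge> 0" for a s q :: real
    proof -
      have "\<bar>a\<bar> \<le> sqrt (s * q)" using real_sqrt_le_mono[OF that(1)] by simp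
      also have "\<dots> \<le> sqrt \<epsilon> * sqrt q" unfolding real_sqrt_mult
        using that by (intro mult_right_mono) auto
      also have "sqrt q \<le> 1 + q"
      proof (rule real_le_lsqrt)
        show "q \<le> (1 + q)\<^sup>2" using that(4) by (simp add: power2_sum)
      qed (use that in auto)
      finally show ?thesis using e by (simp add: mult_left_mono)
    qed
    have "AE z in lborel. norm (F z - G z) \<le> N z"
      using gest hest
    proof eventually_elim
      case (elim z)
      show ?case
      proof (cases "fst z \<in> {0<..<\<epsilon>} \<and> snd z \<in> I")
        case True
        then have z: "z \<in> ?Q" "0 < fst z" "fst z < \<epsilon>" using e by (cases z; auto simp: strip_def)+
        have 1: "\<bar>g (snd z) - u z\<bar> \<le> sqrt \<epsilon> * (1 + m (snd z))"
          using root[of "u z - g (snd z)" "fst z" "m (snd z)"] elim z m0 by (simp add: abs_minus_commute)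
        have 2: "\<bar>h (snd z) - w z\<bar> \<le> sqrt \<epsilon> * (1 + k (snd z))"
          using root[of "w z - h (snd z)" "fst z" "k (snd z)"] elim z k0 by (simp add: abs_minus_commute)
        have "F z - G z = A (fst z) * ((g (snd z) - u z) * \<phi>' (snd z) + (h (snd z) - w z) * \<phi> (snd z))"
          using z True by (simp add: F_def G_def algebra_simps)
        then have "norm (F z - G z) = \<bar>A (fst z)\<bar> * \<bar>(g (snd z) - u z) * \<phi>' (snd z) + (h (snd z) - w z) * \<phi> (snd z)\<bar>"
          by (simp add: abs_mult)
        also have "\<dots> \<le> K / \<epsilon> * (sqrt \<epsilon> * (1 + m (snd z)) * C + sqrt \<epsilon> * (1 + k (snd z)) * C)"
        proof (rule mult_mono[OF A(2)])
          have "\<bar>(g (snd z) - u z) * \<phi>' (snd z) + (h (snd z) - w z) * \<phi> (snd z)\<bar>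
            \<le> \<bar>g (snd z) - u z\<bar> * \<bar>\<phi>' (snd z)\<bar> + \<bar>h (snd z) - w z\<bar> * \<bar>\<phi> (snd z)\<bar>"
            by (metis abs_mult abs_triangle_ineq)
          also have "\<dots> \<le> sqrt \<epsilon> * (1 + m (snd z)) * C + sqrt \<epsilon> * (1 + k (snd z)) * C"
            using 1 2 C e m0[of "snd z"] k0[of "snd z"] by (intro add_mono mult_mono) auto
          finally show "\<bar>(g (snd z) - u z) * \<phi>' (snd z) + (h (snd z) - w z) * \<phi> (snd z)\<bar>
            \<le> sqrt \<epsilon> * (1 + m (snd z)) * C + sqrt \<epsilon> * (1 + k (snd z)) * C" .
        qed (use K e in auto)
        also have "\<dots> = N z" using True e by (simp add: N_def field_simps)
        finally show ?thesis .
      next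
        case False
        have "F z = 0" "G z = 0"
          using False A0[of "fst z"] by (auto simp: F_def G_def strip_def indicator_def)
        moreover have "N z \<ge> 0" using m0 k0 K C e by (simp add: N_def)
        ultimately show ?thesis by simp
      qed
    qed
    then have "(LINT z|lborel. norm (F z - G z)) \<le> (LINT z|lborel. N z)"
      by (intro integral_mono_AE integrable_norm Bochner_Integration.integrable_diff Fi Gi Ni)
    then have "norm (LINT z|lborel. F z - G z) \<le> (LINT z|lborel. N z)"
      using integral_norm_bound[of lborel "\<lambda>z. F z - G z"] by linarith
    then show "\<bar>X\<bar> \<le> K * C * D * sqrt \<epsilon>" using Fi Gi FX G0 N0 by simp
  qed
  then show "(LINT x:I|lborel. g x * iter_deriv [1] \<phi> x) = (-1) ^ length [1::real] * (LINT x:I|lborel. h x * \<phi> x)"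
    by (simp add: X_def \<phi>'_def)
qed

section \<open>Traces of Sobolev functions on the rectangle\<close>

lemma Rect_strip: "Rect b T = strip b {0<..<T}"
  by (simp add: Rect_def strip_def)

lemma Rect_open: "open (Rect b T)"
  unfolding Rect_def by (intro open_Times) auto

lemma Rect_measure: "Rect b T \<in> sets borel" "emeasure lborel (Rect b T) < \<infinity>"
  unfolding Rect_strip by (intro strip_measure; simp)+

lemma indicator_strip_swap: "indicator (strip T {0<..<b}) z = indicator (Rect b T) (prod.swap z)"
  by (cases z) (auto simp: strip_def Rect_def indicator_def)

lemma L2_swap:
  assumes "u \<in> L2 (Rect b T)"
  shows "(\<lambda>z. u (snd z, fst z)) \<in> L2 (strip T {0<..<b})"
    and "L2_norm (strip T {0<..<b}) (\<lambda>z. u (snd z, fst z)) = L2_norm (Rect b T) u"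
proof -
  define U where "U = (\<lambda>z. indicator (Rect b T) z * u z)"
  have U[measurable]: "U \<in> borel_measurable borel" and U2: "integrable lborel (\<lambda>z. (U z)\<^sup>2)"
    using L2D[OF assms] by (simp_all add: U_def)
  have eq: "indicator (strip T {0<..<b}) z * u (snd z, fst z) = U (prod.swap z)" for z
    by (simp add: U_def indicator_strip_swap prod.swap_def)
  show "(\<lambda>z. u (snd z, fst z)) \<in> L2 (strip T {0<..<b})"
  proof (rule L2I; unfold eq)
    show "(\<lambda>z. U (prod.swap z)) \<in> borel_measurable borel" by measurable
    show "integrable lborel (\<lambda>z. (U (prod.swap z))\<^sup>2)"
      using integrable_swap[of "\<lambda>z. (U z)\<^sup>2"] U2 by simp
  qed
  show "L2_norm (strip T {0<..<b}) (\<lambda>z. u (snd z, fst z)) = L2_norm (Rect b T) u"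
  proof -
    have "(\<lambda>z. (U z)\<^sup>2) \<in> borel_measurable borel" by measurable
    from integral_swap[OF this] show ?thesis unfolding L2_norm_eq eq by (simp add: U_def)
  qed
qed

lemma strip_integral_swap:
  fixes f :: "real \<times> real \<Rightarrow> real"
  assumes "set_integrable lborel (Rect b T) f"
  shows "(LINT z:strip T {0<..<b}|lborel. f (snd z, fst z)) = (LINT z:Rect b T|lborel. f z)"
proof -
  have "(\<lambda>z. indicator (Rect b T) z *\<^sub>R f z) \<in> borel_measurable borel"
    using assms by (auto simp: set_integrable_def)
  from integral_swap[OF this] show ?thesis
    by (simp add: set_lebesgue_integral_def indicator_strip_swap prod.swap_def)
qed

lemma dir_deriv_product:
  assumes "\<And>s. (A has_real_derivative A' s) (at s)" "\<And>s. (B has_real_derivative B' s) (at s)"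
  shows "dir_deriv (c, d) (\<lambda>z::real \<times> real. A (fst z) * B (snd z))
    = (\<lambda>z. c * A' (fst z) * B (snd z) + d * A (fst z) * B' (snd z))"
proof (rule dir_deriv_eqI)
  fix z :: "real \<times> real"
  have "((\<lambda>s. A (fst z + s * c)) has_real_derivative A' (fst z + 0 * c) * c) (at 0)"
    by (rule DERIV_chain2[OF assms(1)]) (auto intro!: derivative_eq_intros)
  moreover have "((\<lambda>s. B (snd z + s * d)) has_real_derivative B' (snd z + 0 * d) * d) (at 0)"
    by (rule DERIV_chain2[OF assms(2)]) (auto intro!: derivative_eq_intros)
  ultimately have "((\<lambda>s. A (fst z + s * c) * B (snd z + s * d)) has_real_derivative
     (A' (fst z + 0 * c) * c) * B (snd z + 0 * d) + (B' (snd z + 0 * d) * d) * A (fst z + 0 * c)) (at 0)"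
    by (rule DERIV_mult)
  then show "((\<lambda>s. A (fst (z + s *\<^sub>R (c, d))) * B (snd (z + s *\<^sub>R (c, d)))) has_real_derivative
      c * A' (fst z) * B (snd z) + d * A (fst z) * B' (snd z)) (at 0)"
    by (simp add: algebra_simps)
qed

lemma strip_deriv_left:
  assumes "u \<in> L2 (Rect b T)" "v \<in> L2 (Rect b T)" "weak_deriv (Rect b T) (yt 1 0) u v"
  shows "strip_deriv b {0<..<T} u v"
  unfolding strip_deriv_def Rect_strip[symmetric]
proof (intro conjI allI impI assms)
  fix A A' B a c a' c'
  assume A: "bump1 a c A" "\<forall>s. (A has_real_derivative A' s) (at s)" "bump1 a c A'" and B: "bump1 a' c' B"
    and sub: "{a..c} \<subseteq> {0<..<b}" "{a'..c'} \<subseteq> {0<..<T}"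
  obtain B' where B': "\<And>s. (B has_real_derivative B' s) (at s)" using B smooth1_deriv unfolding bump1_def by metis
  have "test_fun (Rect b T) (\<lambda>z. A (fst z) * B (snd z))"
    by (rule test_fun_product[OF A(1) B]) (use sub in \<open>auto simp: Rect_def\<close>)
  moreover have "iter_deriv (yt 1 0) (\<lambda>z. A (fst z) * B (snd z)) = (\<lambda>z. A' (fst z) * B (snd z))"
    using dir_deriv_product[of A A' B B' 1 0] A(2) B' by (simp add: iter_deriv_def yt_def)
  ultimately show "(LINT z:Rect b T|lborel. u z * (A' (fst z) * B (snd z))) = - (LINT z:Rect b T|lborel. v z * (A (fst z) * B (snd z)))"
    using assms(3) unfolding weak_deriv_def by (fastforce simp: yt_def)
qed

lemma strip_deriv_bottom:
  assumes u: "u \<in> L2 (Rect b T)" and v: "v \<in> L2 (Rect b T)" and uv: "weak_deriv (Rect b T) (yt 0 1) u v"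
  shows "strip_deriv T {0<..<b} (\<lambda>z. u (snd z, fst z)) (\<lambda>z. v (snd z, fst z))"
  unfolding strip_deriv_def
proof (intro conjI allI impI L2_swap u v)
  fix A A' B a c a' c'
  assume A: "bump1 a c A" "\<forall>s. (A has_real_derivative A' s) (at s)" "bump1 a c A'" and B: "bump1 a' c' B"
    and sub: "{a..c} \<subseteq> {0<..<T}" "{a'..c'} \<subseteq> {0<..<b}"
  obtain B' where B': "\<And>s. (B has_real_derivative B' s) (at s)" using B smooth1_deriv unfolding bump1_def by metis
  have t: "test_fun (Rect b T) (\<lambda>z. B (fst z) * A (snd z))"
    by (rule test_fun_product[OF B A(1)]) (use sub in \<open>auto simp: Rect_def\<close>)
  have d: "iter_deriv (yt 0 1) (\<lambda>z. B (fst z) * A (snd z)) = (\<lambda>z. B (fst z) * A' (snd z))"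
    using dir_deriv_product[of B B' A A' 0 1] A(2) B' by (simp add: iter_deriv_def yt_def)
  have t': "test_fun (Rect b T) (\<lambda>z. B (fst z) * A' (snd z))"
    using test_fun_iter_deriv[OF t yt_Basis, of 0 1] unfolding d .
  have "(LINT z:Rect b T|lborel. u z * (B (fst z) * A' (snd z))) = - (LINT z:Rect b T|lborel. v z * (B (fst z) * A (snd z)))"
    using uv t d unfolding weak_deriv_def by (fastforce simp: yt_def)
  then show "(LINT z:strip T {0<..<b}|lborel. u (snd z, fst z) * (A' (fst z) * B (snd z))) =
     - (LINT z:strip T {0<..<b}|lborel. v (snd z, fst z) * (A (fst z) * B (snd z)))"
    using strip_integral_swap[OF loc_integrable_test[OF L2_loc_integrable[OF u] t']]
      strip_integral_swap[OF loc_integrable_test[OF L2_loc_integrable[OF v] t]]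
    by (simp add: mult.commute[of "A _"] mult.commute[of "A' _"])
qed

lemma bottom_unique:
  assumes "0 < T" "u \<in> L2 (Rect b T)" "has_trace {0<..<b} (\<lambda>s y. u (y, s)) g"
  shows "has_trace {0<..<b} (\<lambda>s y. u (y, s)) (bottom b u)"
    and "AE y in lborel. y \<in> {0<..<b} \<longrightarrow> bottom b u y = g y"
proof -
  show t: "has_trace {0<..<b} (\<lambda>s y. u (y, s)) (bottom b u)"
    unfolding bottom_def by (rule someI[of "has_trace {0<..<b} (\<lambda>s y. u (y, s))", OF assms(3)])
  show "AE y in lborel. y \<in> {0<..<b} \<longrightarrow> bottom b u y = g y"
    by (rule has_trace_unique[OF assms(1) _ L2_swap(1)[OF assms(2)] t assms(3)]) simp
qed

lemma bottom_trace_bound: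
  assumes b: "0 < b" and T: "0 < T" and u: "u \<in> L2 (Rect b T)" and v: "v \<in> L2 (Rect b T)"
    and uv: "weak_deriv (Rect b T) (yt 0 1) u v"
  obtains m where "trace_bound T {0<..<b} (\<lambda>z. u (snd z, fst z)) (bottom b u) m"
    "has_trace {0<..<b} (\<lambda>s y. u (y, s)) (bottom b u)"
    "(L2_norm {0<..<b} (bottom b u))\<^sup>2 \<le> 2 / T * (L2_norm (Rect b T) u)\<^sup>2 + 2 * T * (L2_norm (Rect b T) v)\<^sup>2"
proof -
  obtain g m where gm: "trace_bound T {0<..<b} (\<lambda>z. u (snd z, fst z)) g m"
    and m: "(LINT x|lborel. m x) = (L2_norm (strip T {0<..<b}) (\<lambda>z. v (snd z, fst z)))\<^sup>2"
    using strip_deriv_trace_bound[OF T _ _ strip_deriv_bottom[OF u v uv]] by auto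
  have "has_trace {0<..<b} (\<lambda>s y. u (y, s)) g"
    by (rule trace_bound_has_trace[OF T _ gm]) simp
  note bu = bottom_unique[OF T u this]
  have bL: "bottom b u \<in> L2 {0<..<b}" using bu(1) by (simp add: has_trace_def)
  have tb: "trace_bound T {0<..<b} (\<lambda>z. u (snd z, fst z)) (bottom b u) m"
  proof -
    have est: "AE z in lborel. z \<in> strip T {0<..<b} \<longrightarrow> (u (snd z, fst z) - g (snd z))\<^sup>2 \<le> fst z * m (snd z)"
      using gm by (simp add: trace_bound_def)
    have "AE z in lborel. z \<in> strip T {0<..<b} \<longrightarrow> (u (snd z, fst z) - bottom b u (snd z))\<^sup>2 \<le> fst z * m (snd z)"
      using est AE_snd[OF bu(2)] by eventually_elim (auto simp: strip_def)
    then show ?thesis using gm bL by (simp add: trace_bound_def)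
  qed
  have "(L2_norm {0<..<b} (bottom b u))\<^sup>2 \<le> 2 / T * (L2_norm (Rect b T) u)\<^sup>2 + 2 * T * (L2_norm (Rect b T) v)\<^sup>2"
    using trace_bound_L2[OF T tb L2_swap(1)[OF u]] by (simp add: m L2_swap(2)[OF u] L2_swap(2)[OF v])
  then show ?thesis using that[OF tb bu(1)] by simp
qed

lemma yt_split: "yt 1 1 = yt 1 0 @ yt 0 1" "yt 2 0 = yt 1 0 @ yt 1 0"
  by (simp_all add: yt_def numeral_2_eq_2)

lemma Hk_wd_split:
  assumes "u \<in> Hk 2 (Rect b T)"
  shows "weak_deriv (Rect b T) (yt 0 1) (wd (Rect b T) (yt 1 0) u) (wd (Rect b T) (yt 1 1) u)"
proof (rule weak_deriv_split[OF _ _ yt_Basis])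
  show "weak_deriv (Rect b T) (yt 1 0 @ yt 0 1) u (wd (Rect b T) (yt 1 1) u)"
    unfolding yt_split(1)[symmetric] by (rule Hk_wd(1)[OF Rect_open assms]) simp
  show "weak_deriv (Rect b T) (yt 1 0) u (wd (Rect b T) (yt 1 0) u)"
    by (rule Hk_wd(1)[OF Rect_open assms]) simp
qed

lemma bottom_combo:
  assumes bT: "0 < b" "0 < T" and u: "u \<in> L2 (Rect b T)" "u' \<in> L2 (Rect b T)" "weak_deriv (Rect b T) (yt 0 1) u u'"
    and v: "v \<in> L2 (Rect b T)" "v' \<in> L2 (Rect b T)" "weak_deriv (Rect b T) (yt 0 1) v v'"
    and w: "w \<in> L2 (Rect b T)" "AE z in lborel. z \<in> Rect b T \<longrightarrow> w z = u z + c * v z"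
  shows "AE y in lborel. y \<in> {0<..<b} \<longrightarrow> bottom b w y = bottom b u y + c * bottom b v y"
proof -
  have tu: "has_trace {0<..<b} (\<lambda>s y. u (y, s)) (bottom b u)" using bottom_trace_bound[OF bT u] by metis
  have tv: "has_trace {0<..<b} (\<lambda>s y. v (y, s)) (bottom b v)" using bottom_trace_bound[OF bT v] by metis
  have "has_trace {0<..<b} (\<lambda>s y. u (y, s) + c * v (y, s)) (\<lambda>y. bottom b u y + c * bottom b v y)"
    by (rule has_trace_combo[OF bT(2) _ L2_swap(1)[OF u(1)] L2_swap(1)[OF v(1)] tu tv]) simp
  then have "has_trace {0<..<b} (\<lambda>s y. w (y, s)) (\<lambda>y. bottom b u y + c * bottom b v y)"
  proof (rule has_trace_cong_AE[OF _ bT(2)])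
    show "(\<lambda>z. w (snd z, fst z)) \<in> L2 (strip T {0<..<b})" by (rule L2_swap[OF w(1)])
    show "(\<lambda>z. u (snd z, fst z) + c * v (snd z, fst z)) \<in> L2 (strip T {0<..<b})"
      by (intro L2_combo L2_swap u v)
    show "AE z in lborel. z \<in> strip T {0<..<b} \<longrightarrow> w (snd z, fst z) = u (snd z, fst z) + c * v (snd z, fst z)"
      using AE_swap[OF w(2)] by eventually_elim (auto simp: strip_def Rect_def)
  qed simp
  from bottom_unique(2)[OF bT(2) w(1) this] show ?thesis .
qed

text \<open>The trace of \<open>u\<^sub>y\<close> exists because \<open>u\<^sub>y\<^sub>t\<close> is square integrable, and is the derivative of the trace
  of \<open>u\<close>.\<close>

lemma bottom_weak_deriv:
  assumes bT: "0 < b" "0 < T" and u: "u \<in> Hk 2 (Rect b T)"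
  shows "weak_deriv {0<..<b} [1] (bottom b u) (bottom b (wd (Rect b T) (yt 1 0) u))"
proof -
  let ?R = "Rect b T"
  have u2: "u \<in> L2 ?R" using u by (simp add: Hk_def)
  have ut: "weak_deriv ?R (yt 0 1) u (wd ?R (yt 0 1) u)" "wd ?R (yt 0 1) u \<in> L2 ?R"
    and uy: "weak_deriv ?R (yt 1 0) u (wd ?R (yt 1 0) u)" "wd ?R (yt 1 0) u \<in> L2 ?R"
    and uyt: "wd ?R (yt 1 1) u \<in> L2 ?R"
    using Hk_wd[OF Rect_open u] by auto
  obtain m where m: "trace_bound T {0<..<b} (\<lambda>z. u (snd z, fst z)) (bottom b u) m"
    using bottom_trace_bound[OF bT u2 ut(2,1)] by metis
  obtain k where k: "trace_bound T {0<..<b} (\<lambda>z. wd ?R (yt 1 0) u (snd z, fst z)) (bottom b (wd ?R (yt 1 0) u)) k"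
    using bottom_trace_bound[OF bT uy(2) uyt Hk_wd_split[OF u]] by metis
  show ?thesis
  proof (rule trace_weak_deriv[OF bT(2) _ _ m k L2_swap(1)[OF u2] L2_swap(1)[OF uy(2)]])
    fix A a c \<phi> assume A: "bump1 a c A" "{a..c} \<subseteq> {0<..<T}" and \<phi>: "test_fun {0<..<b} \<phi>"
    obtain A' where A': "\<And>s. (A has_real_derivative A' s) (at s)" using A smooth1_deriv unfolding bump1_def by metis
    obtain K where K: "compact K" "K \<subseteq> {0<..<b}" "\<And>x. x \<notin> K \<Longrightarrow> \<phi> x = 0" using test_fun_supp[OF \<phi>] by metis
    have t: "test_fun ?R (\<lambda>z. \<phi> (fst z) * A (snd z))"
    proof (rule smooth_alg_test_fun)
      have "(\<lambda>z::real \<times> real. \<phi> (z \<bullet> (1, 0)) * A (z \<bullet> (0, 1))) \<in> smooth_alg"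
        using A test_fun_real(2)[OF \<phi>] by (intro smooth_alg.mult smooth_alg.lin) (auto simp: bump1_def)
      then show "(\<lambda>z::real \<times> real. \<phi> (fst z) * A (snd z)) \<in> smooth_alg" by (simp add: inner_prod_def)
      show "compact (K \<times> {a..c})" by (intro compact_Times K) auto
      show "K \<times> {a..c} \<subseteq> ?R" using K(2) A(2) by (auto simp: Rect_def)
      show "\<phi> (fst z) * A (snd z) = 0" if "z \<notin> K \<times> {a..c}" for z
        using that K(3) A(1) by (cases z) (auto simp: bump1_def)
    qed
    have d: "iter_deriv (yt 1 0) (\<lambda>z. \<phi> (fst z) * A (snd z)) = (\<lambda>z. iter_deriv [1] \<phi> (fst z) * A (snd z))"
      using dir_deriv_product[of \<phi> "iter_deriv [1] \<phi>" A A' 1 0] test_fun_real(1)[OF \<phi>] A'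
      by (simp add: iter_deriv_def yt_def)
    have t': "test_fun ?R (\<lambda>z. iter_deriv [1] \<phi> (fst z) * A (snd z))"
      using test_fun_iter_deriv[OF t yt_Basis, of 1 0] unfolding d .
    have "(LINT z:?R|lborel. u z * (iter_deriv [1] \<phi> (fst z) * A (snd z))) = - (LINT z:?R|lborel. wd ?R (yt 1 0) u z * (\<phi> (fst z) * A (snd z)))"
      using uy(1) t d unfolding weak_deriv_def by (fastforce simp: yt_def)
    then show "(LINT z:strip T {0<..<b}|lborel. u (snd z, fst z) * (A (fst z) * iter_deriv [1] \<phi> (snd z))) =
       - (LINT z:strip T {0<..<b}|lborel. wd ?R (yt 1 0) u (snd z, fst z) * (A (fst z) * \<phi> (snd z)))"
      using strip_integral_swap[OF loc_integrable_test[OF L2_loc_integrable[OF u2] t']]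
        strip_integral_swap[OF loc_integrable_test[OF L2_loc_integrable[OF uy(2)] t]]
      by (simp add: mult.commute[of "A _"])
  qed auto
qed

text \<open>This trace inequality is the origin of the constant \<open>C\<close> in the convergence estimate.\<close>

lemma bottom_wd_norm:
  assumes bT: "0 < b" "0 < T" and u: "u \<in> Hk 2 (Rect b T)"
  shows "(L2_norm {0<..<b} (bottom b (wd (Rect b T) (yt 1 0) u)))\<^sup>2 \<le> (2 / T + 2 * T) * (Hk_norm 2 (Rect b T) u)\<^sup>2"
    and "bottom b (wd (Rect b T) (yt 1 0) u) \<in> L2 {0<..<b}"
proof -
  let ?R = "Rect b T"
  have uy: "wd ?R (yt 1 0) u \<in> L2 ?R" and uyt: "wd ?R (yt 1 1) u \<in> L2 ?R"
    using Hk_wd[OF Rect_open u] by auto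
  obtain m where tr: "has_trace {0<..<b} (\<lambda>s y. wd ?R (yt 1 0) u (y, s)) (bottom b (wd ?R (yt 1 0) u))"
    and le: "(L2_norm {0<..<b} (bottom b (wd ?R (yt 1 0) u)))\<^sup>2 \<le>
      2 / T * (L2_norm ?R (wd ?R (yt 1 0) u))\<^sup>2 + 2 * T * (L2_norm ?R (wd ?R (yt 1 1) u))\<^sup>2"
    using bottom_trace_bound[OF bT uy uyt Hk_wd_split[OF u]] by metis
  show "bottom b (wd ?R (yt 1 0) u) \<in> L2 {0<..<b}" using tr by (simp add: has_trace_def)
  have "(L2_norm ?R (wd ?R (yt 1 0) u))\<^sup>2 \<le> (Hk_norm 2 ?R u)\<^sup>2" "(L2_norm ?R (wd ?R (yt 1 1) u))\<^sup>2 \<le> (Hk_norm 2 ?R u)\<^sup>2"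
    by (intro power_mono L2_norm_wd_le L2_norm_nonneg; simp)+
  then have "2 / T * (L2_norm ?R (wd ?R (yt 1 0) u))\<^sup>2 + 2 * T * (L2_norm ?R (wd ?R (yt 1 1) u))\<^sup>2
     \<le> 2 / T * (Hk_norm 2 ?R u)\<^sup>2 + 2 * T * (Hk_norm 2 ?R u)\<^sup>2"
    using bT by (intro add_mono mult_left_mono) auto
  with le show "(L2_norm {0<..<b} (bottom b (wd ?R (yt 1 0) u)))\<^sup>2 \<le> (2 / T + 2 * T) * (Hk_norm 2 ?R u)\<^sup>2"
    by (simp add: distrib_right)
qed

lemma L2_norm_wd_zero:
  assumes "open \<Omega>" "u \<in> Hk k \<Omega>" shows "L2_norm \<Omega> u \<le> Hk_norm k \<Omega> u"
proof -
  have u2: "u \<in> L2 \<Omega>" using assms by (simp add: Hk_def)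
  have "weak_deriv \<Omega> (yt 0 0) u u"
    using L2_loc_integrable[OF u2] by (simp add: weak_deriv_def yt_def iter_deriv_def)
  from wd_AE_eq[OF assms(1) yt_Basis this]
  have "L2_norm \<Omega> (wd \<Omega> (yt 0 0) u) = L2_norm \<Omega> u"
    using u2 Hk_wd(2)[OF assms, of 0 0] by (intro L2_norm_cong_AE) auto
  then show ?thesis using L2_norm_wd_le[of 0 0 k \<Omega> u] by simp
qed

text \<open>On each horizontal line a function of \<open>H\<^sup>1\<close> is bounded by its trace on the left side and its
  \<open>y\<close>-derivative. A bound \<open>m(t)\<close> that is uniform in \<open>y\<close> makes products with functions of \<open>y\<close> alone
  square integrable, which is what the term \<open>V\<^sub>y(y, 0) V(y, t)\<close> of the functional requires.\<close>

lemma Hk_sup_bound: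
  assumes bT: "0 < b" "0 < T" and u: "u \<in> Hk 1 (Rect b T)"
  obtains m where "integrable lborel m" "\<And>t. m t \<ge> 0"
    "(LINT t|lborel. m t) \<le> (4 / b + 6 * b) * (Hk_norm 1 (Rect b T) u)\<^sup>2"
    "AE z in lborel. z \<in> Rect b T \<longrightarrow> (u z)\<^sup>2 \<le> m (snd z)"
proof -
  let ?R = "Rect b T" and ?H = "(Hk_norm 1 (Rect b T) u)\<^sup>2"
  have u2: "u \<in> L2 ?R" using u by (simp add: Hk_def)
  have uy: "weak_deriv ?R (yt 1 0) u (wd ?R (yt 1 0) u)" "wd ?R (yt 1 0) u \<in> L2 ?R"
    using Hk_wd[OF Rect_open u, of 1 0] by auto
  obtain g k where gk: "trace_bound b {0<..<T} u g k" and k: "(LINT x|lborel. k x) = (L2_norm ?R (wd ?R (yt 1 0) u))\<^sup>2"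
    using strip_deriv_trace_bound[OF bT(1) _ _ strip_deriv_left[OF u2 uy(2,1)]] by (auto simp: Rect_strip)
  have g: "g \<in> L2 {0<..<T}" and ki: "integrable lborel k" and k0: "\<And>x. k x \<ge> 0"
    and est: "AE z in lborel. z \<in> ?R \<longrightarrow> (u z - g (snd z))\<^sup>2 \<le> fst z * k (snd z)"
    using gk by (auto simp: trace_bound_def Rect_strip)
  define m where "m = (\<lambda>t. 2 * (indicator {0<..<T} t * g t)\<^sup>2 + 2 * b * k t)"
  have mi: "integrable lborel m" unfolding m_def using L2D(2)[OF g] ki by simp
  have "(LINT t|lborel. m t) = 2 * (L2_norm {0<..<T} g)\<^sup>2 + 2 * b * (LINT x|lborel. k x)"
    unfolding m_def L2_norm_power2 using L2D(2)[OF g] ki by simp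
  also have "\<dots> \<le> 2 * (2 / b * (L2_norm ?R u)\<^sup>2 + 2 * b * (LINT x|lborel. k x)) + 2 * b * (LINT x|lborel. k x)"
    using trace_bound_L2[OF bT(1) gk u2[unfolded Rect_strip]] by (simp add: Rect_strip)
  also have "\<dots> \<le> 2 * (2 / b * ?H + 2 * b * ?H) + 2 * b * ?H"
  proof -
    have 1: "(L2_norm ?R u)\<^sup>2 \<le> ?H" by (intro power_mono L2_norm_wd_zero Rect_open u L2_norm_nonneg)
    have 2: "(LINT x|lborel. k x) \<le> ?H" unfolding k by (intro power_mono L2_norm_wd_le L2_norm_nonneg) simp
    show ?thesis using bT by (intro add_mono mult_left_mono 1 2) auto
  qed
  also have "\<dots> = (4 / b + 6 * b) * ?H" by (simp add: algebra_simps)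
  finally have int: "(LINT t|lborel. m t) \<le> (4 / b + 6 * b) * ?H" .
  have "AE z in lborel. z \<in> ?R \<longrightarrow> (u z)\<^sup>2 \<le> m (snd z)"
    using est
  proof eventually_elim
    case (elim z)
    show ?case
    proof
      assume z: "z \<in> ?R"
      then have z': "0 < fst z" "fst z < b" "snd z \<in> {0<..<T}" by (auto simp: Rect_def)
      have "(u z)\<^sup>2 \<le> 2 * (g (snd z))\<^sup>2 + 2 * (u z - g (snd z))\<^sup>2"
        using two_squares[of "g (snd z)" "u z - g (snd z)"] by simp
      also have "(u z - g (snd z))\<^sup>2 \<le> fst z * k (snd z)" using elim z by simp
      also have "fst z * k (snd z) \<le> b * k (snd z)" using z' k0 by (intro mult_right_mono) auto
      finally show "(u z)\<^sup>2 \<le> m (snd z)" using z' by (simp add: m_def)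
    qed
  qed
  moreover have "m t \<ge> 0" for t using bT k0 by (simp add: m_def)
  ultimately show ?thesis using that[OF mi _ int] by blast
qed

section \<open>The Goursat integral equation\<close>

lemma continuous_on_plane:
  fixes F :: "real \<Rightarrow> real \<Rightarrow> real"
  assumes "continuous_on UNIV (\<lambda>z. F (fst z) (snd z))" "continuous_on A f" "continuous_on A g"
  shows "continuous_on A (\<lambda>x. F (f x) (g x))"
  using continuous_on_compose2[OF assms(1) continuous_on_Pair[OF assms(2,3)] subset_UNIV] by simp

text \<open>Rescaling to the interval \<open>[0, 1]\<close> moves the variable bound of integration into the integrand.\<close>

lemma continuous_on_parameter_integral:
  fixes F :: "real \<Rightarrow> real \<Rightarrow> real"
  assumes F: "continuous_on UNIV (\<lambda>z. F (fst z) (snd z))"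
  shows "continuous_on UNIV (\<lambda>z. integral {0..snd z} (F (fst z)))"
proof -
  have eq: "integral {0..r} (F s) = max r 0 * integral {0..1} (\<lambda>\<theta>. F s (max r 0 * \<theta>))" for s r
  proof (cases "r > 0")
    case True
    have "(\<lambda>x. x / r) ` {0..r} = {0..1}"
    proof
      show "{0..1} \<subseteq> (\<lambda>x. x / r) ` {0..r}"
      proof
        fix x :: real assume "x \<in> {0..1}"
        then have "x = (x * r) / r" "x * r \<in> {0..r}" using True by (auto intro: mult_left_le_one_le)
        then show "x \<in> (\<lambda>x. x / r) ` {0..r}" by blast
      qed
    qed (use True in auto)
    with integral_stretch_real[of r 0 r "F s"] True show ?thesis by simp
  next
    case False
    then show ?thesis by (cases "r = 0") auto
  qed
  have comp: "continuous_on UNIV (\<lambda>(z, \<theta>). F (fst z) (max (snd z) 0 * \<theta>))"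
    unfolding case_prod_beta' by (intro continuous_on_plane[OF F] continuous_intros)
  have "continuous_on UNIV (\<lambda>z::real \<times> real. integral (cbox 0 1) (\<lambda>\<theta>. F (fst z) (max (snd z) 0 * \<theta>)))"
    by (rule integral_continuous_on_param) (rule continuous_on_subset[OF comp], simp)
  then show ?thesis unfolding eq by (auto intro!: continuous_intros)
qed

lemma continuous_on_curry:
  fixes F :: "real \<Rightarrow> real \<Rightarrow> real"
  assumes "continuous_on UNIV (\<lambda>z. F (fst z) (snd z))"
  shows "continuous_on A (F s)" "continuous_on A (\<lambda>s. F s r)"
  by (rule continuous_on_plane[OF assms]; intro continuous_intros)+

lemma integral_upper_deriv:
  fixes f :: "real \<Rightarrow> real"
  assumes "continuous_on UNIV f" "r > 0"
  shows "((\<lambda>r. integral {0..r} f) has_real_derivative f r) (at r)"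
proof -
  have "((\<lambda>r. integral {0..r} f) has_real_derivative f r) (at r within {0..r + 1})"
    by (rule integral_has_real_derivative) (use assms in \<open>auto intro: continuous_on_subset\<close>)
  then have "((\<lambda>r. integral {0..r} f) has_real_derivative f r) (at r within {0<..<r + 1})"
    by (rule DERIV_subset) auto
  then show ?thesis by (subst (asm) at_within_open) (use assms in auto)
qed

lemma parameter_integral_deriv:
  fixes F F' :: "real \<Rightarrow> real \<Rightarrow> real"
  assumes F: "\<And>s. continuous_on UNIV (F s)" and F': "continuous_on UNIV (\<lambda>z. F' (fst z) (snd z))"
    and der: "\<And>s r. s > 0 \<Longrightarrow> r \<ge> 0 \<Longrightarrow> ((\<lambda>s. F s r) has_real_derivative F' s r) (at s)"
    and s: "s > 0"
  shows "((\<lambda>s. integral {0..r} (F s)) has_real_derivative integral {0..r} (F' s)) (at s)"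
proof -
  have "((\<lambda>s. integral (cbox 0 r) (F s)) has_real_derivative integral (cbox 0 r) (F' s)) (at s within {0<..})"
  proof (rule leibniz_rule_field_derivative)
    show "((\<lambda>s. F s t) has_real_derivative F' x t) (at x within {0<..})" if "x \<in> {0<..}" "t \<in> cbox 0 r" for x t
      using der[of x t] that by (auto intro: has_field_derivative_at_within)
    show "F x integrable_on cbox 0 r" for x
      using integrable_continuous[OF continuous_on_subset[OF F]] by blast
    have "continuous_on UNIV (\<lambda>(x, t). F' x t)" using F' by (simp add: case_prod_beta)
    then show "continuous_on ({0<..} \<times> cbox 0 r) (\<lambda>(x, t). F' x t)" by (rule continuous_on_subset) simp
  qed (use s in auto)
  then show ?thesis by (subst (asm) at_within_open) (use s in auto)
qed

text \<open>A chain rule along the diagonal. Continuity of one partial derivative, together with the existence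
  of the other at the point, is all that is available for \<open>W\<close>.\<close>

lemma diagonal_deriv:
  fixes f f1 :: "real \<Rightarrow> real \<Rightarrow> real"
  assumes f1: "continuous_on UNIV (\<lambda>z. f1 (fst z) (snd z))"
    and d1: "\<And>s r. s > 0 \<Longrightarrow> r > 0 \<Longrightarrow> ((\<lambda>s. f s r) has_real_derivative f1 s r) (at s)"
    and d2: "((\<lambda>r. f s0 r) has_real_derivative c) (at r0)"
    and pos: "s0 > 0" "r0 > 0"
  shows "((\<lambda>h. f (s0 + h) (r0 + h)) has_real_derivative f1 s0 r0 + c) (at 0)"
proof -
  have "((\<lambda>h. (f (s0 + h) (r0 + h) - f s0 (r0 + h)) / h) \<longlongrightarrow> f1 s0 r0) (at 0)"
    unfolding LIM_eq
  proof (intro allI impI)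
    fix e :: real assume "e > 0"
    have "isCont (\<lambda>z. f1 (fst z) (snd z)) (s0, r0)"
      using f1 by (simp add: continuous_on_eq_continuous_at)
    then obtain d where d: "d > 0" "\<And>z. dist z (s0, r0) < d \<Longrightarrow> dist (f1 (fst z) (snd z)) (f1 s0 r0) < e"
      using \<open>e > 0\<close> unfolding continuous_at_eps_delta by fastforce
    define d' where "d' = min (d / 2) (min s0 r0)"
    show "\<exists>s>0. \<forall>x. x \<noteq> 0 \<and> norm (x - 0) < s \<longrightarrow> norm ((f (s0 + x) (r0 + x) - f s0 (r0 + x)) / x - f1 s0 r0) < e"
    proof (intro exI[of _ d'] conjI allI impI)
      show "d' > 0" using d pos by (simp add: d'_def)
      fix h :: real assume "h \<noteq> 0 \<and> norm (h - 0) < d'"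
      then have h: "h \<noteq> 0" "\<bar>h\<bar> < d / 2" "\<bar>h\<bar> < s0" "\<bar>h\<bar> < r0" by (auto simp: d'_def)
      define g where "g = (\<lambda>t. f (s0 + t * h) (r0 + h))"
      have gd: "(g has_real_derivative f1 (s0 + t * h) (r0 + h) * h) (at t)" if "0 \<le> t" "t \<le> 1" for t
      proof -
        have "\<bar>t * h\<bar> \<le> \<bar>h\<bar>" using that by (simp add: abs_mult mult_left_le_one_le)
        then have "s0 + t * h > 0" "r0 + h > 0" using h by linarith+
        then show ?thesis unfolding g_def
          by (intro DERIV_chain2[OF d1]) (auto intro!: derivative_eq_intros)
      qed
      obtain t where t: "0 < t" "t < 1" "g 1 - g 0 = (1 - 0) * (f1 (s0 + t * h) (r0 + h) * h)"
        using MVT2[of 0 1 g "\<lambda>t. f1 (s0 + t * h) (r0 + h) * h"] gd by auto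
      have q: "(f (s0 + h) (r0 + h) - f s0 (r0 + h)) / h = f1 (s0 + t * h) (r0 + h)"
        using t(3) h(1) by (simp add: g_def)
      have "dist (s0 + t * h, r0 + h) (s0, r0) \<le> \<bar>t * h\<bar> + \<bar>h\<bar>"
        unfolding dist_Pair_Pair using sqrt_sum_squares_le_sum_abs[of "t * h" h] by (simp add: dist_real_def)
      also have "\<bar>t * h\<bar> \<le> \<bar>h\<bar>" using t by (simp add: abs_mult mult_left_le_one_le)
      finally have "dist (s0 + t * h, r0 + h) (s0, r0) < d" using h by simp
      from d(2)[OF this] show "norm ((f (s0 + h) (r0 + h) - f s0 (r0 + h)) / h - f1 s0 r0) < e"
        by (simp add: q dist_real_def)
    qed
  qed
  moreover have "((\<lambda>h. (f s0 (r0 + h) - f s0 r0) / h) \<longlongrightarrow> c) (at 0)"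
    using d2 by (simp add: DERIV_def)
  ultimately have "((\<lambda>h. (f (s0 + h) (r0 + h) - f s0 (r0 + h)) / h + (f s0 (r0 + h) - f s0 r0) / h) \<longlongrightarrow> f1 s0 r0 + c) (at 0)"
    by (rule tendsto_add)
  then show ?thesis by (simp add: DERIV_def add_divide_distrib[symmetric])
qed

text \<open>\<open>W s r\<close> stands for \<open>w\<close> in characteristic coordinates; \<open>W_eq\<close> is the integrated form of
  \<open>4 W\<^sub>s\<^sub>r = p W\<close> with the value \<open>1/2\<close> on both axes.\<close>

locale goursat =
  fixes p p' :: "real \<Rightarrow> real" and W :: "real \<Rightarrow> real \<Rightarrow> real"
  assumes p_deriv: "\<And>y. (p has_real_derivative p' y) (at y)" and p'_cont: "continuous_on UNIV p'"
    and W_cont: "continuous_on UNIV (\<lambda>z. W (fst z) (snd z))"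
    and W_eq: "\<And>s r. s \<ge> 0 \<Longrightarrow> r \<ge> 0 \<Longrightarrow>
      W s r = 1 / 2 + 1 / 4 * integral (cbox (0, 0) (s, r)) (\<lambda>z. p ((fst z - snd z) / 2) * W (fst z) (snd z))"
begin

text \<open>\<open>X\<close> and \<open>Y\<close> are the partial derivatives of \<open>W\<close> in \<open>s\<close> and \<open>r\<close>, \<open>Gs\<close> and \<open>Gr\<close> those of \<open>G\<close>, and \<open>Z\<close>
  is twice the derivative of \<open>X + Y\<close> in \<open>s\<close>. They are defined by formulas that make sense and are
  continuous in the whole plane, whereas the equation, and with it differentiability, is available for
  positive \<open>s\<close> and \<open>r\<close> only.\<close>

definition G :: "real \<Rightarrow> real \<Rightarrow> real" where "G s r = p ((s - r) / 2) * W s r"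
definition X :: "real \<Rightarrow> real \<Rightarrow> real" where "X s r = 1 / 4 * integral {0..r} (G s)"
definition Y :: "real \<Rightarrow> real \<Rightarrow> real" where "Y s r = 1 / 4 * integral {0..s} (\<lambda>\<xi>. G \<xi> r)"
definition Gs :: "real \<Rightarrow> real \<Rightarrow> real" where "Gs s r = p' ((s - r) / 2) / 2 * W s r + p ((s - r) / 2) * X s r"
definition Gr :: "real \<Rightarrow> real \<Rightarrow> real" where "Gr s r = - p' ((s - r) / 2) / 2 * W s r + p ((s - r) / 2) * Y s r"
definition Z :: "real \<Rightarrow> real \<Rightarrow> real" where "Z s r = 1 / 2 * integral {0..r} (Gs s) + 1 / 2 * G s r"

lemma p_cont: "continuous_on A p"
  using p_deriv by (meson DERIV_isCont continuous_at_imp_continuous_on)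

lemma p_comp_cont: "continuous_on A (\<lambda>z::real \<times> real. p ((fst z - snd z) / 2))"
  "continuous_on A (\<lambda>z::real \<times> real. p' ((fst z - snd z) / 2))"
  by (rule continuous_on_compose2[OF p_cont[of UNIV]] continuous_on_compose2[OF p'_cont]; auto intro!: continuous_intros)+

lemma G_cont: "continuous_on UNIV (\<lambda>z. G (fst z) (snd z))"
  unfolding G_def by (intro continuous_intros p_comp_cont W_cont)

lemma X_cont: "continuous_on UNIV (\<lambda>z. X (fst z) (snd z))"
  unfolding X_def by (intro continuous_intros continuous_on_parameter_integral G_cont)

lemma Y_cont: "continuous_on UNIV (\<lambda>z. Y (fst z) (snd z))"
proof -
  have "continuous_on UNIV (\<lambda>z::real \<times> real. G (snd z) (fst z))"
    by (intro continuous_on_plane[OF G_cont] continuous_intros)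
  then have "continuous_on UNIV (\<lambda>z::real \<times> real. integral {0..snd z} (\<lambda>s. G s (fst z)))"
    by (rule continuous_on_parameter_integral)
  then have "continuous_on UNIV (\<lambda>z::real \<times> real. integral {0..fst z} (\<lambda>s. G s (snd z)))"
    by (rule continuous_on_plane[of "\<lambda>r s. integral {0..s} (\<lambda>s. G s r)"]) (intro continuous_intros)+
  then show ?thesis unfolding Y_def by (intro continuous_intros)
qed

lemma Gs_cont: "continuous_on UNIV (\<lambda>z. Gs (fst z) (snd z))"
  unfolding Gs_def divide_inverse[of "p' _"] by (intro continuous_intros p_comp_cont W_cont X_cont)

lemma Z_cont: "continuous_on UNIV (\<lambda>z. Z (fst z) (snd z))"
  unfolding Z_def by (intro continuous_intros continuous_on_parameter_integral Gs_cont G_cont)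

lemma W_G: "s \<ge> 0 \<Longrightarrow> r \<ge> 0 \<Longrightarrow> W s r = 1 / 2 + 1 / 4 * integral (cbox (0, 0) (s, r)) (\<lambda>z. G (fst z) (snd z))"
  unfolding G_def by (rule W_eq)

lemma W_X:
  assumes "s \<ge> 0" "r \<ge> 0" shows "W s r = 1 / 2 + integral {0..s} (\<lambda>\<xi>. X \<xi> r)"
proof -
  have "integral (cbox (0, 0) (s, r)) (\<lambda>z. G (fst z) (snd z)) = integral {0..s} (\<lambda>\<xi>. integral {0..r} (G \<xi>))"
    using integral_prod_continuous[OF continuous_on_subset[OF G_cont subset_UNIV], of 0 0 s r] by simp
  then show ?thesis unfolding W_G[OF assms] X_def by simp
qed

lemma W_Y:
  assumes "s \<ge> 0" "r \<ge> 0" shows "W s r = 1 / 2 + integral {0..r} (\<lambda>\<eta>. Y s \<eta>)"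
proof -
  have c: "continuous_on (cbox (0, 0) (s, r)) (\<lambda>(x, y). G x y)"
    using continuous_on_subset[OF G_cont] by (simp add: case_prod_beta)
  have c': "continuous_on (cbox (0, 0) (r, s)) (\<lambda>(x, y). G y x)"
    unfolding case_prod_beta' by (intro continuous_on_plane[OF G_cont] continuous_intros)
  have "integral (cbox (0, 0) (s, r)) (\<lambda>z. G (fst z) (snd z)) = integral (cbox (0, 0) (r, s)) (\<lambda>(x, y). G y x)"
    using integral_swap_2dim[OF c] by (simp add: case_prod_beta')
  also have "\<dots> = integral {0..r} (\<lambda>x. integral {0..s} (\<lambda>y. G y x))"
    using integral_prod_continuous[OF c'] by simp
  finally show ?thesis unfolding W_G[OF assms] Y_def by simp
qed

lemma W_s: assumes "s > 0" "r \<ge> 0" shows "((\<lambda>s. W s r) has_real_derivative X s r) (at s)"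
proof -
  have "((\<lambda>s. 1 / 2 + integral {0..s} (\<lambda>\<xi>. X \<xi> r)) has_real_derivative X s r) (at s)"
    using DERIV_add[OF DERIV_const integral_upper_deriv[OF continuous_on_curry(2)[OF X_cont] assms(1)]] by simp
  then show ?thesis
    by (rule has_field_derivative_transform_within_open[of _ _ s "{0<..}"])
       (use assms W_X in auto)
qed

lemma W_r: assumes "s \<ge> 0" "r > 0" shows "((\<lambda>r. W s r) has_real_derivative Y s r) (at r)"
proof -
  have "((\<lambda>r. 1 / 2 + integral {0..r} (\<lambda>\<eta>. Y s \<eta>)) has_real_derivative Y s r) (at r)"
    using DERIV_add[OF DERIV_const integral_upper_deriv[OF continuous_on_curry(1)[OF Y_cont] assms(2)]] by simp
  then show ?thesis
    by (rule has_field_derivative_transform_within_open[of _ _ r "{0<..}"])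
       (use assms W_Y in auto)
qed

lemma p_s: "((\<lambda>s. p ((s - r) / 2)) has_real_derivative p' ((s - r) / 2) / 2) (at s)"
  by (rule DERIV_cong[OF DERIV_chain2[OF p_deriv]]) (auto intro!: derivative_eq_intros)

lemma p_r: "((\<lambda>r. p ((s - r) / 2)) has_real_derivative - p' ((s - r) / 2) / 2) (at r)"
  by (rule DERIV_cong[OF DERIV_chain2[OF p_deriv]]) (auto intro!: derivative_eq_intros)

lemma G_s: "s > 0 \<Longrightarrow> r \<ge> 0 \<Longrightarrow> ((\<lambda>s. G s r) has_real_derivative Gs s r) (at s)"
  unfolding G_def Gs_def by (rule DERIV_cong[OF DERIV_mult[OF p_s W_s]]) auto

lemma G_r: "s \<ge> 0 \<Longrightarrow> r > 0 \<Longrightarrow> ((\<lambda>r. G s r) has_real_derivative Gr s r) (at r)"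
  unfolding G_def Gr_def by (rule DERIV_cong[OF DERIV_mult[OF p_r W_r]]) auto

lemma XY_s:
  assumes "s > 0" "r \<ge> 0"
  shows "((\<lambda>s. X s r + Y s r) has_real_derivative Z s r / 2) (at s)"
proof -
  have "((\<lambda>s. integral {0..r} (G s)) has_real_derivative integral {0..r} (Gs s)) (at s)"
    by (rule parameter_integral_deriv[OF continuous_on_curry(1)[OF G_cont] Gs_cont G_s assms(1)])
  moreover have "((\<lambda>s. integral {0..s} (\<lambda>\<xi>. G \<xi> r)) has_real_derivative G s r) (at s)"
    by (rule integral_upper_deriv[OF continuous_on_curry(2)[OF G_cont] assms(1)])
  ultimately have "((\<lambda>s. 1 / 4 * integral {0..r} (G s) + 1 / 4 * integral {0..s} (\<lambda>\<xi>. G \<xi> r)) has_real_derivative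
     1 / 4 * integral {0..r} (Gs s) + 1 / 4 * G s r) (at s)"
    by (intro DERIV_add DERIV_cmult)
  then show ?thesis unfolding X_def Y_def by (rule DERIV_cong) (simp add: Z_def)
qed

text \<open>The terms with \<open>p'\<close> in \<open>Gs\<close> and \<open>Gr\<close> cancel. This is the reason why the second order equation
  holds without second derivatives of \<open>p\<close>.\<close>

lemma Z_r:
  assumes "s \<ge> 0" "r > 0"
  shows "((\<lambda>r. Z s r) has_real_derivative p ((s - r) / 2) / 2 * (X s r + Y s r)) (at r)"
proof -
  have "((\<lambda>r. 1 / 2 * integral {0..r} (Gs s) + 1 / 2 * G s r) has_real_derivative 1 / 2 * Gs s r + 1 / 2 * Gr s r) (at r)"
    by (intro DERIV_add DERIV_cmult integral_upper_deriv continuous_on_curry(1)[OF Gs_cont] G_r assms)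
  moreover have "1 / 2 * Gs s r + 1 / 2 * Gr s r = p ((s - r) / 2) / 2 * (X s r + Y s r)"
    by (simp add: Gs_def Gr_def algebra_simps)
  ultimately show ?thesis unfolding Z_def by (rule DERIV_cong)
qed

text \<open>At \<open>t = 0\<close> the integral in \<open>Z\<close> is empty and \<open>W = 1/2\<close>, so \<open>Z = G / 2 = p / 4\<close>. The linear rate in
  \<open>t\<close> is what the notion \<open>trace_bound\<close> asks for.\<close>

lemma Z_initial:
  obtains C where "C \<ge> 0" "\<And>y t. 0 < y \<Longrightarrow> y < b \<Longrightarrow> 0 < t \<Longrightarrow> t < T \<Longrightarrow> \<bar>Z (t + 2 * y) t - p y / 4\<bar> \<le> C * t"
proof -
  let ?K = "{0..T + 2 * b} \<times> {0..T}"
  have K: "compact ?K" by (intro compact_Times) auto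
  have bd: "\<exists>C\<ge>0. \<forall>z\<in>?K. \<bar>F (fst z) (snd z)\<bar> \<le> C" if "continuous_on UNIV (\<lambda>z. F (fst z) (snd z))" for F :: "real \<Rightarrow> real \<Rightarrow> real"
  proof -
    have "bounded ((\<lambda>z. F (fst z) (snd z)) ` ?K)"
      by (intro compact_imp_bounded compact_continuous_image K continuous_on_subset[OF that]) simp
    then obtain C where "\<And>z. z \<in> ?K \<Longrightarrow> \<bar>F (fst z) (snd z)\<bar> \<le> C" unfolding bounded_real by blast
    then show ?thesis by (intro exI[of _ "max C 0"]) (auto intro: max.coboundedI1)
  qed
  obtain C1 where C1: "C1 \<ge> 0" "\<And>z. z \<in> ?K \<Longrightarrow> \<bar>Gs (fst z) (snd z)\<bar> \<le> C1" using bd[OF Gs_cont] by blast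
  obtain C2 where C2: "C2 \<ge> 0" "\<And>z. z \<in> ?K \<Longrightarrow> \<bar>Y (fst z) (snd z)\<bar> \<le> C2" using bd[OF Y_cont] by blast
  obtain C3 where C3: "C3 \<ge> 0" "\<And>z. z \<in> ?K \<Longrightarrow> \<bar>p ((fst z - snd z) / 2)\<bar> \<le> C3"
    using bd[of "\<lambda>s r. p ((s - r) / 2)", OF p_comp_cont(1)] by blast
  have "\<bar>Z (t + 2 * y) t - p y / 4\<bar> \<le> (C1 + C3 * C2) * t" if yt: "0 < y" "y < b" "0 < t" "t < T" for y t
  proof -
    let ?s = "t + 2 * y"
    have in_K: "(?s, \<eta>) \<in> ?K" if "\<eta> \<in> {0..t}" for \<eta> using that yt by auto
    have 1: "\<bar>integral {0..t} (Gs ?s)\<bar> \<le> C1 * t"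
      using integral_bound[of 0 t "Gs ?s" C1] C1(2) in_K yt continuous_on_curry(1)[OF Gs_cont] by force
    have "\<bar>integral {0..t} (\<lambda>\<eta>. Y ?s \<eta>)\<bar> \<le> C2 * t"
      using integral_bound[of 0 t "Y ?s" C2] C2(2) in_K yt continuous_on_curry(1)[OF Y_cont] by force
    then have 2: "\<bar>W ?s t - 1 / 2\<bar> \<le> C2 * t" using W_Y[of ?s t] yt by simp
    have 3: "\<bar>p y\<bar> \<le> C3" using C3(2)[OF in_K[of t]] yt by simp
    have "Z ?s t - p y / 4 = 1 / 2 * integral {0..t} (Gs ?s) + 1 / 2 * (p y * (W ?s t - 1 / 2))"
      by (simp add: Z_def G_def algebra_simps)
    then have "\<bar>Z ?s t - p y / 4\<bar> \<le> 1 / 2 * \<bar>integral {0..t} (Gs ?s)\<bar> + 1 / 2 * (\<bar>p y\<bar> * \<bar>W ?s t - 1 / 2\<bar>)"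
      by (simp add: abs_mult[symmetric]) 
    also have "\<dots> \<le> 1 / 2 * (C1 * t) + 1 / 2 * (C3 * (C2 * t))"
      using 1 2 3 C3(1) by (intro add_mono mult_left_mono mult_mono) auto
    also have "\<dots> \<le> C1 * t + C3 * (C2 * t)"
      using mult_nonneg_nonneg[OF C1(1), of t] mult_nonneg_nonneg[OF C3(1) mult_nonneg_nonneg[OF C2(1), of t]] yt by simp
    finally show ?thesis by (simp add: algebra_simps)
  qed
  then show ?thesis using that[of "C1 + C3 * C2"] C1(1) C2(1) C3(1) by simp
qed

text \<open>Put \<open>s = t + 2 y\<close> and \<open>r = t\<close>. The derivative of \<open>W(t + 2 y, t)\<close> in \<open>t\<close> is \<open>X + Y\<close>, and \<open>\<partial>\<^sub>y\<close> acts
  as \<open>2 \<partial>\<^sub>s\<close>. The direction \<open>(1, -2)\<close> leaves \<open>s\<close> fixed, and the derivative along it is \<open>- 2 \<partial>\<^sub>r\<close>.\<close>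

definition V :: "real \<times> real \<Rightarrow> real" where "V = (\<lambda>(y, t). X (t + 2 * y) t + Y (t + 2 * y) t)"
definition Vy :: "real \<times> real \<Rightarrow> real" where "Vy = (\<lambda>(y, t). Z (t + 2 * y) t)"

lemma shear_cont:
  fixes F :: "real \<Rightarrow> real \<Rightarrow> real"
  assumes "continuous_on UNIV (\<lambda>z. F (fst z) (snd z))"
  shows "continuous_on A (\<lambda>(y, t). F (t + 2 * y) t)"
  unfolding case_prod_beta' by (intro continuous_on_plane[OF assms] continuous_intros)

lemma V_cont: "continuous_on A V"
  unfolding V_def by (rule shear_cont[OF continuous_on_add[OF X_cont Y_cont]])

lemma Vy_cont: "continuous_on A Vy"
  unfolding Vy_def by (rule shear_cont[OF Z_cont])

lemma W_time_deriv:
  assumes "y > 0" "t > 0"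
  shows "((\<lambda>\<tau>. W (\<tau> + 2 * y) \<tau>) has_real_derivative V (y, t)) (at t)"
proof -
  have "((\<lambda>h. W ((t + 2 * y) + h) (t + h)) has_real_derivative X (t + 2 * y) t + Y (t + 2 * y) t) (at 0)"
    by (rule diagonal_deriv[OF X_cont]) (use assms in \<open>auto intro: W_s W_r\<close>)
  then have "((\<lambda>h. (\<lambda>\<tau>. W (\<tau> + 2 * y) \<tau>) (h + t)) has_real_derivative X (t + 2 * y) t + Y (t + 2 * y) t) (at 0)"
    by (simp add: algebra_simps)
  then show ?thesis
    using DERIV_shift[of "\<lambda>\<tau>. W (\<tau> + 2 * y) \<tau>" _ 0 t] by (simp add: V_def)
qed

lemma V_line:
  assumes "fst z > 0" "snd z > 0"
  shows "((\<lambda>\<sigma>. V (z + \<sigma> *\<^sub>R (1, 0))) has_real_derivative Vy z) (at 0)"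
proof -
  obtain y t where z: "z = (y, t)" by (cases z)
  have "((\<lambda>\<sigma>. (\<lambda>s. X s t + Y s t) (t + 2 * (y + \<sigma>))) has_real_derivative Z (t + 2 * (y + 0)) t / 2 * 2) (at 0)"
    by (rule DERIV_chain2[OF XY_s]) (use assms z in \<open>auto intro!: derivative_eq_intros\<close>)
  then show ?thesis by (simp add: z V_def Vy_def)
qed

lemma Vy_line:
  assumes "fst z > 0" "snd z > 0"
  shows "((\<lambda>\<sigma>. Vy (z + \<sigma> *\<^sub>R (1, - 2))) has_real_derivative - p (fst z) * V z) (at 0)"
proof -
  obtain y t where z: "z = (y, t)" by (cases z)
  have "((\<lambda>\<sigma>. Z (t + 2 * y) (t - 2 * \<sigma>)) has_real_derivative
      (p ((t + 2 * y - (t - 2 * 0)) / 2) / 2 * (X (t + 2 * y) (t - 2 * 0) + Y (t + 2 * y) (t - 2 * 0))) * (- 2)) (at 0)"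
    by (rule DERIV_chain2[OF Z_r]) (use assms z in \<open>auto intro!: derivative_eq_intros\<close>)
  then show ?thesis by (simp add: z V_def Vy_def algebra_simps)
qed

lemma weak_Vy: "weak_deriv (Rect b T) (yt 1 0) V Vy"
  unfolding weak_deriv_def
proof (intro conjI allI impI)
  show "loc_integrable (Rect b T) V" "loc_integrable (Rect b T) Vy"
    by (rule continuous_loc_integrable[OF V_cont] continuous_loc_integrable[OF Vy_cont])+
  fix \<phi> assume \<phi>: "test_fun (Rect b T) \<phi>"
  have "test_fun (Rect b T) (dir_deriv (1, 0) \<phi>)"
    by (rule test_fun_dir_deriv[OF \<phi>]) (simp add: Basis_prod_def)
  then have "(LINT x:Rect b T|lborel. V x * dir_deriv (1, 0) \<phi> x) = - (LINT x:Rect b T|lborel. Vy x * \<phi> x)"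
    by (intro integration_by_parts_test[OF Rect_open V_cont Vy_cont V_line \<phi> test_fun_continuous dir_deriv_off_support])
       (auto simp: Rect_def)
  then show "(LINT x:Rect b T|lborel. V x * iter_deriv (yt 1 0) \<phi> x) = (-1) ^ length (yt 1 0) * (LINT x:Rect b T|lborel. Vy x * \<phi> x)"
    by (simp add: yt_def iter_deriv_def)
qed

text \<open>Factoring the operator as the derivative along \<open>(1, -2)\<close> of \<open>\<partial>\<^sub>y\<close> allows two integrations by parts
  that need only the derivatives provided by \<open>V_line\<close> and \<open>Vy_line\<close>.\<close>

lemma weak_equation:
  assumes \<phi>: "test_fun (Rect b T) \<phi>"
  shows "(LINT x:Rect b T|lborel. V x * iter_deriv (yt 2 0) \<phi> x) - 2 * (LINT x:Rect b T|lborel. V x * iter_deriv (yt 1 1) \<phi> x)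
    = - (LINT x:Rect b T|lborel. p (fst x) * V x * \<phi> x)"
proof -
  let ?R = "Rect b T"
  let ?y = "dir_deriv (1, 0) \<phi>" and ?t = "dir_deriv (0, 1) \<phi>"
  have ty: "test_fun ?R ?y" and tt: "test_fun ?R ?t"
    by (rule test_fun_dir_deriv[OF \<phi>], simp add: Basis_prod_def)+
  have 1: "(LINT x:?R|lborel. V x * iter_deriv (yt 2 0) \<phi> x) = - (LINT x:?R|lborel. Vy x * ?y x)"
    using weak_Vy[of b T] ty unfolding weak_deriv_def by (auto simp: yt_def iter_deriv_def numeral_2_eq_2)
  have 2: "(LINT x:?R|lborel. V x * iter_deriv (yt 1 1) \<phi> x) = - (LINT x:?R|lborel. Vy x * ?t x)"
    using weak_Vy[of b T] tt unfolding weak_deriv_def by (auto simp: yt_def iter_deriv_def)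
  have comb: "dir_deriv (1, - 2) \<phi> = (\<lambda>x. ?y x + (- 2) * ?t x)"
    using dir_deriv_combo[OF \<phi>, of 1 "(1, 0)" "- 2" "(0, 1)"] by auto
  have "(LINT x:?R|lborel. Vy x * dir_deriv (1, - 2) \<phi> x) = - (LINT x:?R|lborel. (- p (fst x) * V x) * \<phi> x)"
  proof (rule integration_by_parts_test[OF Rect_open Vy_cont _ Vy_line \<phi> _ dir_deriv_off_support])
    show "continuous_on ?R (\<lambda>z. - p (fst z) * V z)"
      by (intro continuous_intros V_cont continuous_on_compose2[OF p_cont[of UNIV]]) auto
    show "continuous_on UNIV (dir_deriv (1, - 2) \<phi>)"
      unfolding comb by (intro continuous_intros test_fun_continuous[OF ty] test_fun_continuous[OF tt])
  qed (auto simp: Rect_def)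
  moreover have "(LINT x:?R|lborel. Vy x * dir_deriv (1, - 2) \<phi> x)
     = (LINT x:?R|lborel. Vy x * ?y x) - 2 * (LINT x:?R|lborel. Vy x * ?t x)"
  proof -
    have i: "set_integrable lborel ?R (\<lambda>x. Vy x * ?y x)" "set_integrable lborel ?R (\<lambda>x. Vy x * ?t x)"
      by (rule loc_integrable_test[OF continuous_loc_integrable[OF Vy_cont] ty]
          loc_integrable_test[OF continuous_loc_integrable[OF Vy_cont] tt])+
    have "(LINT x:?R|lborel. Vy x * dir_deriv (1, - 2) \<phi> x) = (LINT x:?R|lborel. Vy x * ?y x - 2 * (Vy x * ?t x))"
      unfolding comb by (simp add: algebra_simps)
    also have "\<dots> = (LINT x:?R|lborel. Vy x * ?y x) - (LINT x:?R|lborel. 2 * (Vy x * ?t x))"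
      by (rule set_integral_diff(2)[OF i(1) set_integrable_mult_right]) (use i(2) in simp)
    finally show ?thesis by simp
  qed
  ultimately show ?thesis using 1 2 by (simp add: set_lebesgue_integral_def)
qed

lemma V_bounded: obtains C where "C > 0" "\<And>z. z \<in> Rect b T \<Longrightarrow> \<bar>V z\<bar> \<le> C"
proof -
  have "bounded (V ` ({0..b} \<times> {0..T}))"
    by (intro compact_imp_bounded compact_continuous_image V_cont compact_Times) auto
  then obtain C where C: "\<And>z. z \<in> {0..b} \<times> {0..T} \<Longrightarrow> \<bar>V z\<bar> \<le> C" unfolding bounded_real by blast
  have "\<bar>V z\<bar> \<le> max C 1" if "z \<in> Rect b T" for z
  proof -
    have "z \<in> {0..b} \<times> {0..T}" using that by (auto simp: Rect_def)
    then show ?thesis using C[of z] by simp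
  qed
  then show ?thesis using that[of "max C 1"] by simp
qed

text \<open>The functions \<open>wd\<close> are chosen representatives; the equation for them follows because all its terms
  are determined by their integrals against test functions.\<close>

lemma equation_AE:
  assumes v: "v \<in> Hk 2 (Rect b T)" "\<And>z. z \<in> Rect b T \<Longrightarrow> v z = V z"
  shows "AE z in lborel. z \<in> Rect b T \<longrightarrow>
    wd (Rect b T) (yt 2 0) v z - 2 * wd (Rect b T) (yt 1 1) v z + p (fst z) * v z = 0"
proof -
  let ?R = "Rect b T"
  have w: "weak_deriv ?R (yt 2 0) v (wd ?R (yt 2 0) v)" "weak_deriv ?R (yt 1 1) v (wd ?R (yt 1 1) v)"
    by (rule Hk_wd(1)[OF Rect_open v(1)]; simp)+
  have pV: "loc_integrable ?R (\<lambda>z. p (fst z) * V z)"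
    by (intro continuous_loc_integrable continuous_intros V_cont continuous_on_compose2[OF p_cont[of UNIV]]) auto
  have l: "loc_integrable ?R (wd ?R (yt 2 0) v)" "loc_integrable ?R (wd ?R (yt 1 1) v)"
    using w by (auto simp: weak_deriv_def)
  have "AE z in lborel. z \<in> ?R \<longrightarrow> (wd ?R (yt 2 0) v z + (- 2) * wd ?R (yt 1 1) v z) + 1 * (p (fst z) * V z) = 0"
  proof (rule test_functions_determine[OF Rect_open loc_integrable_combo[OF loc_integrable_combo[OF l] pV]])
    fix \<phi> assume \<phi>: "test_fun ?R \<phi>"
    have vV: "(LINT x:?R|lborel. v x * f x) = (LINT x:?R|lborel. V x * f x)" for f
      unfolding set_lebesgue_integral_def using v(2)
      by (intro Bochner_Integration.integral_cong) (auto simp: indicator_def)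
    note i = loc_integrable_test[OF l(1) \<phi>] loc_integrable_test[OF l(2) \<phi>] loc_integrable_test[OF pV \<phi>]
    have 1: "(LINT x:?R|lborel. wd ?R (yt 2 0) v x * \<phi> x) = (LINT x:?R|lborel. V x * iter_deriv (yt 2 0) \<phi> x)"
      "(LINT x:?R|lborel. wd ?R (yt 1 1) v x * \<phi> x) = (LINT x:?R|lborel. V x * iter_deriv (yt 1 1) \<phi> x)"
      using w \<phi> unfolding weak_deriv_def vV by (auto simp: yt_def)
    have "(LINT z:?R|lborel. ((wd ?R (yt 2 0) v z + (- 2) * wd ?R (yt 1 1) v z) + 1 * (p (fst z) * V z)) * \<phi> z)
      = (LINT x:?R|lborel. wd ?R (yt 2 0) v x * \<phi> x) - 2 * (LINT x:?R|lborel. wd ?R (yt 1 1) v x * \<phi> x)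
        + (LINT x:?R|lborel. p (fst x) * V x * \<phi> x)"
      using i unfolding set_lebesgue_integral_def set_integrable_def
      by (simp add: distrib_left distrib_right right_diff_distrib left_diff_distrib mult.assoc mult.left_commute[of _ 2])
    also have "\<dots> = 0" unfolding 1 using weak_equation[OF \<phi>] by simp
    finally show "(LINT z:?R|lborel. ((wd ?R (yt 2 0) v z + (- 2) * wd ?R (yt 1 1) v z) + 1 * (p (fst z) * V z)) * \<phi> z) = 0" .
  qed
  then show ?thesis by eventually_elim (use v(2) in auto)
qed

text \<open>\<open>Vy\<close> represents the weak \<open>y\<close>-derivative, and its trace can be read off from \<open>Z_initial\<close>.\<close>

lemma initial_AE:
  assumes v: "v \<in> Hk 2 (Rect b T)" "\<And>z. z \<in> Rect b T \<Longrightarrow> v z = V z" and bT: "0 < b" "0 < T"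
  shows "AE y in lborel. y \<in> {0<..<b} \<longrightarrow> 4 * bottom b (wd (Rect b T) (yt 1 0) v) y = p y"
proof -
  let ?R = "Rect b T"
  have vVy: "weak_deriv ?R (yt 1 0) v Vy"
  proof (rule weak_deriv_cong_AE[OF weak_Vy yt_Basis])
    show "loc_integrable ?R v" using v(1) by (intro L2_loc_integrable) (simp add: Hk_def)
    show "loc_integrable ?R Vy" by (rule continuous_loc_integrable[OF Vy_cont])
  qed (use v(2) in auto)
  have wL: "wd ?R (yt 1 0) v \<in> L2 ?R" by (rule Hk_wd(2)[OF Rect_open v(1)]) simp
  have ae: "AE z in lborel. z \<in> ?R \<longrightarrow> wd ?R (yt 1 0) v z = Vy z"
    by (rule wd_AE_eq[OF Rect_open yt_Basis vVy])
  have VyL: "Vy \<in> L2 ?R"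
    by (rule L2_cong_AE[OF wL loc_integrable_measurable[OF Rect_open continuous_loc_integrable[OF Vy_cont]]])
       (use ae in \<open>auto elim!: eventually_mono\<close>)
  obtain C where C: "C \<ge> 0" "\<And>y t. 0 < y \<Longrightarrow> y < b \<Longrightarrow> 0 < t \<Longrightarrow> t < T \<Longrightarrow> \<bar>Z (t + 2 * y) t - p y / 4\<bar> \<le> C * t"
    using Z_initial by blast
  have "trace_bound T {0<..<b} (\<lambda>z. Vy (snd z, fst z)) (\<lambda>y. p y / 4) (\<lambda>x. C\<^sup>2 * T * indicator {0<..<b} x)"
    unfolding trace_bound_def
  proof (intro conjI allI AE_I2 impI)
    show "(\<lambda>y. p y / 4) \<in> L2 {0<..<b}"
    proof (rule L2I)
      have [measurable]: "p \<in> borel_measurable borel" by (rule borel_measurable_continuous_onI[OF p_cont])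
      show "(\<lambda>x. indicator {0<..<b} x * (p x / 4)) \<in> borel_measurable borel" by measurable
      have "integrable lborel (\<lambda>x. indicator {0..b} x *\<^sub>R (p x / 4)\<^sup>2)"
        by (intro borel_integrable_compact continuous_intros p_cont) auto
      then show "integrable lborel (\<lambda>x. (indicator {0<..<b} x * (p x / 4))\<^sup>2)"
        by (rule Bochner_Integration.integrable_bound) (auto simp: indicator_def)
    qed
    show "integrable lborel (\<lambda>x. C\<^sup>2 * T * indicator {0<..<b} x)"
      by (intro integrable_mult_right integrable_indicator_bounded) auto
    show "0 \<le> C\<^sup>2 * T * indicator {0<..<b} x" for x using bT by simp
    fix z assume "z \<in> strip T {0<..<b}"
    then obtain t y where z: "z = (t, y)" "0 < t" "t < T" "0 < y" "y < b" by (auto simp: strip_def)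
    have "(Z (t + 2 * y) t - p y / 4)\<^sup>2 \<le> (C * t)\<^sup>2"
      using C(2)[OF z(4,5,2,3)] by (rule power2_le_iff_abs_le[THEN iffD2, rotated]) (use C z in simp)
    also have "\<dots> = t * (C\<^sup>2 * t)" by (simp add: power2_eq_square)
    also have "\<dots> \<le> t * (C\<^sup>2 * T)" using z by (intro mult_left_mono) auto
    finally show "(Vy (snd z, fst z) - p (snd z) / 4)\<^sup>2 \<le> fst z * (C\<^sup>2 * T * indicator {0<..<b} (snd z))"
      using z by (simp add: Vy_def)
  qed
  then have "has_trace {0<..<b} (\<lambda>s y. Vy (y, s)) (\<lambda>y. p y / 4)"
    by (intro trace_bound_has_trace[OF bT(2)]) auto
  then have "has_trace {0<..<b} (\<lambda>s y. wd ?R (yt 1 0) v (y, s)) (\<lambda>y. p y / 4)"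
  proof (rule has_trace_cong_AE[OF _ bT(2)])
    show "(\<lambda>z. wd ?R (yt 1 0) v (snd z, fst z)) \<in> L2 (strip T {0<..<b})" by (rule L2_swap[OF wL])
    show "(\<lambda>z. Vy (snd z, fst z)) \<in> L2 (strip T {0<..<b})" by (rule L2_swap[OF VyL])
    show "AE z in lborel. z \<in> strip T {0<..<b} \<longrightarrow> wd ?R (yt 1 0) v (snd z, fst z) = Vy (snd z, fst z)"
      using AE_swap[OF ae] by eventually_elim (auto simp: strip_def Rect_def)
  qed simp
  from bottom_unique(2)[OF bT(2) wL this] show ?thesis by eventually_elim auto
qed

end

section \<open>Characteristic coordinates\<close>

definition char :: "real \<times> real \<Rightarrow> real \<times> real" where
  "char z = (fst z + snd z, snd z - fst z)"

definition char_inv :: "real \<times> real \<Rightarrow> real \<times> real" where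
  "char_inv z = ((fst z - snd z) / 2, (fst z + snd z) / 2)"

lemma char_inv: "char (char_inv z) = z" "char_inv (char z) = z"
  by (simp_all add: char_def char_inv_def field_simps)

lemma char_cont: "continuous_on A char" "continuous_on A char_inv"
  unfolding char_def[abs_def] char_inv_def[abs_def] by (intro continuous_intros; simp)+

lemma char_measurable[measurable]: "char \<in> borel_measurable borel" "char_inv \<in> borel_measurable borel"
  by (intro borel_measurable_continuous_onI char_cont)+

text \<open>For fixed \<open>y\<close> the map is a translation in \<open>t\<close>; after Fubini it is \<open>y \<mapsto> s + 2 y\<close> for fixed \<open>s\<close>,
  which accounts for the factor 2.\<close>

lemma nn_integral_char:
  assumes f[measurable]: "f \<in> borel_measurable borel"
  shows "(\<integral>\<^sup>+z. f z \<partial>lborel) = 2 * (\<integral>\<^sup>+z. f (char z) \<partial>lborel)"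
proof -
  have fp[measurable]: "f \<in> borel_measurable (borel \<Otimes>\<^sub>M borel)" using f by (simp add: borel_prod)
  have "(\<integral>\<^sup>+z. f (char z) \<partial>lborel) = (\<integral>\<^sup>+y. \<integral>\<^sup>+t. f (char (y, t)) \<partial>lborel \<partial>lborel)"
  proof -
    have "(\<lambda>z. f (char z)) \<in> borel_measurable (lborel \<Otimes>\<^sub>M lborel)"
      unfolding lborel_prod by measurable
    from lborel.nn_integral_fst[OF this] show ?thesis by (simp add: lborel_prod)
  qed
  also have "\<dots> = (\<integral>\<^sup>+y. \<integral>\<^sup>+s. f (s + 2 * y, s) \<partial>lborel \<partial>lborel)"
  proof (rule nn_integral_cong)
    fix y :: real
    have m: "(\<lambda>s. f (s + 2 * y, s)) \<in> borel_measurable borel" by measurable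
    show "(\<integral>\<^sup>+t. f (char (y, t)) \<partial>lborel) = (\<integral>\<^sup>+s. f (s + 2 * y, s) \<partial>lborel)"
      using nn_integral_real_affine[OF m, of 1 "- y"] by (simp add: char_def algebra_simps)
  qed
  also have "\<dots> = (\<integral>\<^sup>+s. \<integral>\<^sup>+y. f (s + 2 * y, s) \<partial>lborel \<partial>lborel)"
    by (rule lborel_pair.Fubini') (simp add: case_prod_beta')
  finally have eq: "(\<integral>\<^sup>+z. f (char z) \<partial>lborel) = (\<integral>\<^sup>+s. \<integral>\<^sup>+y. f (s + 2 * y, s) \<partial>lborel \<partial>lborel)" .
  have "(\<integral>\<^sup>+z. f z \<partial>lborel) = (\<integral>\<^sup>+s. \<integral>\<^sup>+x. f (x, s) \<partial>lborel \<partial>lborel)"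
    using lborel_pair.nn_integral_snd[of f] by (simp add: lborel_prod)
  also have "\<dots> = (\<integral>\<^sup>+s. 2 * \<integral>\<^sup>+y. f (s + 2 * y, s) \<partial>lborel \<partial>lborel)"
  proof (rule nn_integral_cong)
    fix s :: real
    have m: "(\<lambda>x. f (x, s)) \<in> borel_measurable borel" by measurable
    show "(\<integral>\<^sup>+x. f (x, s) \<partial>lborel) = 2 * (\<integral>\<^sup>+y. f (s + 2 * y, s) \<partial>lborel)"
      using nn_integral_real_affine[OF m, of 2 s] by simp
  qed
  also have "\<dots> = 2 * (\<integral>\<^sup>+s. \<integral>\<^sup>+y. f (s + 2 * y, s) \<partial>lborel \<partial>lborel)"
    by (rule nn_integral_cmult) measurable
  finally show ?thesis unfolding eq .
qed

lemma lborel_char: "density (distr lborel borel char) (\<lambda>_. ennreal 2) = lborel"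
proof (rule measure_eqI)
  fix A assume "A \<in> sets (density (distr lborel borel char) (\<lambda>_. ennreal 2))"
  then have A[measurable]: "A \<in> sets borel" by simp
  have "emeasure (density (distr lborel borel char) (\<lambda>_. ennreal 2)) A = (\<integral>\<^sup>+z. 2 * indicator A z \<partial>distr lborel borel char)"
    by (subst emeasure_density) auto
  also have "\<dots> = 2 * (\<integral>\<^sup>+z. indicator A (char z) \<partial>lborel)"
    by (subst nn_integral_distr) (auto simp: nn_integral_cmult)
  also have "\<dots> = (\<integral>\<^sup>+z. indicator A z \<partial>lborel)" by (rule nn_integral_char[symmetric]) simp
  also have "\<dots> = emeasure lborel A" by simp
  finally show "emeasure (density (distr lborel borel char) (\<lambda>_. ennreal 2)) A = emeasure lborel A" .
qed simp

lemma integral_char: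
  fixes f :: "real \<times> real \<Rightarrow> real"
  assumes f[measurable]: "f \<in> borel_measurable borel"
  shows "(LINT z|lborel. f z) = 2 * (LINT z|lborel. f (char z))"
    and "integrable lborel f \<longleftrightarrow> integrable lborel (\<lambda>z. f (char z))"
proof -
  have "(LINT z|lborel. f z) = (LINT z|density (distr lborel borel char) (\<lambda>_. ennreal 2). f z)"
    unfolding lborel_char ..
  also have "\<dots> = (LINT z|distr lborel borel char. 2 * f z)" by (subst integral_density) auto
  also have "\<dots> = 2 * (LINT z|lborel. f (char z))" by (subst integral_distr) auto
  finally show "(LINT z|lborel. f z) = 2 * (LINT z|lborel. f (char z))" .
  have "integrable lborel f \<longleftrightarrow> integrable (density (distr lborel borel char) (\<lambda>_. ennreal 2)) f"
    unfolding lborel_char ..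
  also have "\<dots> \<longleftrightarrow> integrable (distr lborel borel char) (\<lambda>z. 2 * f z)" by (subst integrable_density) auto
  also have "\<dots> \<longleftrightarrow> integrable lborel (\<lambda>z. f (char z))" by (subst integrable_distr_eq) auto
  finally show "integrable lborel f \<longleftrightarrow> integrable lborel (\<lambda>z. f (char z))" .
qed

lemma char_line_deriv:
  assumes "\<And>x. (A has_real_derivative A' x) (at x)" "\<And>x. (B has_real_derivative B' x) (at x)"
  shows "((\<lambda>s. A (fst (z + s *\<^sub>R (c, d)) + snd (z + s *\<^sub>R (c, d))) * B (snd (z + s *\<^sub>R (c, d)) - fst (z + s *\<^sub>R (c, d))))
    has_real_derivative (c + d) * (A' (fst z + snd z) * B (snd z - fst z)) + (d - c) * (A (fst z + snd z) * B' (snd z - fst z))) (at 0)"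
proof -
  have "((\<lambda>s. A ((fst z + snd z) + s * (c + d))) has_real_derivative A' ((fst z + snd z) + 0 * (c + d)) * (c + d)) (at 0)"
    by (rule DERIV_chain2[OF assms(1)]) (auto intro!: derivative_eq_intros)
  moreover have "((\<lambda>s. B ((snd z - fst z) + s * (d - c))) has_real_derivative B' ((snd z - fst z) + 0 * (d - c)) * (d - c)) (at 0)"
    by (rule DERIV_chain2[OF assms(2)]) (auto intro!: derivative_eq_intros)
  ultimately have "((\<lambda>s. A ((fst z + snd z) + s * (c + d)) * B ((snd z - fst z) + s * (d - c))) has_real_derivative
      (A' ((fst z + snd z) + 0 * (c + d)) * (c + d)) * B ((snd z - fst z) + 0 * (d - c)) +
      (B' ((snd z - fst z) + 0 * (d - c)) * (d - c)) * A ((fst z + snd z) + 0 * (c + d))) (at 0)"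
    by (rule DERIV_mult)
  then show ?thesis by (simp add: algebra_simps)
qed

text \<open>In characteristic coordinates the wave operator is four times the mixed second derivative.\<close>

lemma char_second_derivs:
  assumes A: "\<And>x. (A has_real_derivative A' x) (at x)" "\<And>x. (A' has_real_derivative A'' x) (at x)"
    and B: "\<And>x. (B has_real_derivative B' x) (at x)" "\<And>x. (B' has_real_derivative B'' x) (at x)"
  defines "\<phi> \<equiv> \<lambda>z::real \<times> real. A (fst z + snd z) * B (snd z - fst z)"
  shows "iter_deriv (yt 0 2) \<phi> z - iter_deriv (yt 2 0) \<phi> z = 4 * (A' (fst z + snd z) * B' (snd z - fst z))"
proof -
  have D: "dir_deriv (c, d) \<phi> = (\<lambda>z. (c + d) * (A' (fst z + snd z) * B (snd z - fst z)) + (d - c) * (A (fst z + snd z) * B' (snd z - fst z)))" for c d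
    unfolding \<phi>_def by (rule dir_deriv_eqI) (rule char_line_deriv[OF A(1) B(1)])
  have DD: "dir_deriv (c, d) (dir_deriv (c, d) \<phi>) = (\<lambda>z. (c + d) * ((c + d) * (A'' (fst z + snd z) * B (snd z - fst z)) + (d - c) * (A' (fst z + snd z) * B' (snd z - fst z)))
      + (d - c) * ((c + d) * (A' (fst z + snd z) * B' (snd z - fst z)) + (d - c) * (A (fst z + snd z) * B'' (snd z - fst z))))" for c d
    unfolding D by (rule dir_deriv_eqI)
      (intro DERIV_add DERIV_cmult char_line_deriv[OF A(2) B(1)] char_line_deriv[OF A(1) B(2)])
  show ?thesis by (simp add: iter_deriv_def yt_def numeral_2_eq_2 DD)
qed

lemma char_test_fun:
  assumes A: "bump1 a b A" and B: "bump1 a' b' B"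
  shows "test_fun UNIV (\<lambda>z::real \<times> real. A (fst z + snd z) * B (snd z - fst z))"
proof (rule smooth_alg_test_fun)
  have "(\<lambda>z::real \<times> real. A (z \<bullet> (1, 1)) * B (z \<bullet> (- 1, 1))) \<in> smooth_alg"
    using A B by (intro smooth_alg.mult smooth_alg.lin) (auto simp: bump1_def)
  then show "(\<lambda>z::real \<times> real. A (fst z + snd z) * B (snd z - fst z)) \<in> smooth_alg"
    by (simp add: inner_prod_def)
  show "compact (char_inv ` ({a..b} \<times> {a'..b'}))"
    by (intro compact_continuous_image char_cont compact_Times) auto
  fix z assume z: "z \<notin> char_inv ` ({a..b} \<times> {a'..b'})"
  have "char z \<notin> {a..b} \<times> {a'..b'}"
  proof
    assume "char z \<in> {a..b} \<times> {a'..b'}"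
    then have "char_inv (char z) \<in> char_inv ` ({a..b} \<times> {a'..b'})" by (rule imageI)
    with z show False by (simp add: char_inv)
  qed
  then show "A (fst z + snd z) * B (snd z - fst z) = 0"
    using A B by (auto simp: char_def bump1_def)
qed simp

section \<open>A Gronwall inequality\<close>

lemma nn_integral_exp_ge:
  assumes "k > 0"
  shows "(\<integral>\<^sup>+x. ennreal (exp (- k * x)) * indicator {a<..} x \<partial>lborel) = ennreal (exp (- k * a) / k)"
proof -
  have "(\<integral>\<^sup>+x. ennreal (exp (- k * x)) * indicator {a<..} x \<partial>lborel) = (\<integral>\<^sup>+x. ennreal (exp (- k * x)) * indicator {a..} x \<partial>lborel)"
  proof (rule nn_integral_cong_AE)
    have "AE x in lborel. x \<noteq> a" by (rule AE_lborel_singleton)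
    then show "AE x in lborel. ennreal (exp (- k * x)) * indicator {a<..} x = ennreal (exp (- k * x)) * indicator {a..} x"
      by eventually_elim (auto simp: indicator_def)
  qed
  also have "\<dots> = ennreal (0 - (- exp (- k * a) / k))"
  proof (rule nn_integral_FTC_atLeast)
    show "DERIV (\<lambda>x. - exp (- k * x) / k) x :> exp (- k * x)" for x
      using assms by (auto intro!: derivative_eq_intros)
    have "filterlim (\<lambda>x. k * x) at_top at_top"
      by (rule filterlim_tendsto_pos_mult_at_top[OF tendsto_const assms filterlim_ident])
    then have "((\<lambda>x. exp (- (k * x))) \<longlongrightarrow> 0) at_top"
      by (intro filterlim_compose[OF exp_at_bot] filterlim_compose[OF filterlim_uminus_at_bot_at_top])
    from tendsto_mult_right[OF this, of "- 1 / k"] show "((\<lambda>x. - exp (- k * x) / k) \<longlongrightarrow> 0) at_top"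
      by simp
  qed auto
  finally show ?thesis by simp
qed

lemma order_set_borel: "{x. fst (snd x) < fst (fst x) \<and> snd (snd x) < snd (fst (x :: (real \<times> real) \<times> (real \<times> real)))} \<in> sets borel"
  by (intro borel_open open_Collect_conj open_Collect_less continuous_intros)

text \<open>In the norm of \<open>L\<^sup>1\<close> with weight \<open>exp (- k (s + r))\<close> and \<open>k\<^sup>2 = 2 c\<close>, the operator on the
  right-hand side has norm \<open>1/2\<close>: by Fubini one integrates the weight over the quadrant above a point,
  which divides its value there by \<open>k\<^sup>2\<close>. The support condition makes the weight at most 1 where \<open>f\<close>
  does not vanish, so that the weighted norm of \<open>f\<close> is finite.\<close>

lemma gronwall_plane:
  fixes f :: "real \<times> real \<Rightarrow> real"
  assumes f: "integrable lborel f" and f0: "\<And>z. f z \<ge> 0" and supp: "\<And>z. fst z + snd z \<le> 0 \<Longrightarrow> f z = 0"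
    and c: "c > 0"
    and le: "AE z in lborel. f z \<le> c * (LINT z'|lborel. indicator {z'. fst z' < fst z \<and> snd z' < snd z} z' * f z')"
  shows "AE z in lborel. f z = 0"
proof -
  have fm[measurable]: "f \<in> borel_measurable borel" using f by auto
  \<comment> \<open>chosen such that \<open>c / k\<^sup>2 = 1/2\<close>\<close>
  define k where "k = sqrt (2 * c)"
  have k: "k > 0" "k * k = 2 * c" using c by (simp_all add: k_def)
  define om where "om = (\<lambda>z::real \<times> real. exp (- k * (fst z + snd z)))"
  have [measurable]: "om \<in> borel_measurable borel"
    unfolding om_def by (intro borel_measurable_continuous_onI continuous_intros)
  define I where "I = (\<integral>\<^sup>+z. ennreal (f z) * ennreal (om z) \<partial>lborel)"
  have "I \<le> (\<integral>\<^sup>+z. ennreal (f z) \<partial>lborel)"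
    unfolding I_def
  proof (rule nn_integral_mono)
    fix z
    have "f z * om z \<le> f z"
    proof (cases "fst z + snd z \<le> 0")
      case False
      then have "om z \<le> 1" using k by (simp add: om_def)
      then show ?thesis using f0[of z] by (simp add: mult_left_le)
    qed (simp add: supp)
    then show "ennreal (f z) * ennreal (om z) \<le> ennreal (f z)"
      using f0 by (simp add: ennreal_mult[symmetric] om_def ennreal_leI)
  qed
  also have "\<dots> < \<infinity>" using f f0 by (simp add: nn_integral_eq_integral)
  finally have fin: "I < \<infinity>" .
  define R where "R = {x. fst (snd x) < fst (fst x) \<and> snd (snd x) < snd (fst (x :: (real \<times> real) \<times> (real \<times> real)))}"
  have [measurable]: "R \<in> sets borel" unfolding R_def by (rule order_set_borel)
  have prodm[measurable]: "(\<lambda>x. ennreal (om (fst x)) * (ennreal c * (indicator R x * ennreal (f (snd x))))) \<in> borel_measurable (lborel \<Otimes>\<^sub>M lborel)"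
  proof -
    have [measurable]: "R \<in> sets (borel \<Otimes>\<^sub>M borel)" unfolding borel_prod R_def by (rule order_set_borel)
    show ?thesis by measurable
  qed
  have sec: "ennreal (LINT z'|lborel. indicator {z'. fst z' < fst z \<and> snd z' < snd z} z' * f z')
      = (\<integral>\<^sup>+z'. indicator R (z, z') * ennreal (f z') \<partial>lborel)" for z
  proof -
    have S: "{z'. fst z' < fst z \<and> snd z' < snd z} \<in> sets borel"
      by (intro borel_open open_Collect_conj open_Collect_less continuous_intros)
    have "integrable lborel (\<lambda>z'. indicator {z'. fst z' < fst z \<and> snd z' < snd z} z' * f z')"
      using integrable_mult_indicator[OF _ f, of "{z'. fst z' < fst z \<and> snd z' < snd z}"] S by simp
    then have "(\<integral>\<^sup>+z'. ennreal (indicator {z'. fst z' < fst z \<and> snd z' < snd z} z' * f z') \<partial>lborel)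
      = ennreal (LINT z'|lborel. indicator {z'. fst z' < fst z \<and> snd z' < snd z} z' * f z')"
      using f0 by (intro nn_integral_eq_integral) auto
    moreover have "ennreal (indicator {z'. fst z' < fst z \<and> snd z' < snd z} z' * f z') = indicator R (z, z') * ennreal (f z')" for z'
      by (auto simp: R_def indicator_def)
    ultimately show ?thesis by simp
  qed
  have "I \<le> (\<integral>\<^sup>+z. \<integral>\<^sup>+z'. ennreal (om z) * (ennreal c * (indicator R (z, z') * ennreal (f z'))) \<partial>lborel \<partial>lborel)"
    unfolding I_def
  proof (rule nn_integral_mono_AE)
    show "AE z in lborel. ennreal (f z) * ennreal (om z) \<le> (\<integral>\<^sup>+z'. ennreal (om z) * (ennreal c * (indicator R (z, z') * ennreal (f z'))) \<partial>lborel)"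
      using le
    proof eventually_elim
      case (elim z)
      have [measurable]: "(\<lambda>z'. indicator R (z, z') * ennreal (f z')) \<in> borel_measurable lborel"
      proof -
        have "(\<lambda>z'. indicator {z'. fst z' < fst z \<and> snd z' < snd z} z' * ennreal (f z')) \<in> borel_measurable lborel"
        proof -
          have [measurable]: "{z'. fst z' < fst z \<and> snd z' < snd z} \<in> sets borel"
            by (intro borel_open open_Collect_conj open_Collect_less continuous_intros)
          show ?thesis by measurable
        qed
        then show ?thesis by (simp add: R_def indicator_def)
      qed
      have "ennreal (f z) \<le> ennreal (c * (LINT z'|lborel. indicator {z'. fst z' < fst z \<and> snd z' < snd z} z' * f z'))"
        by (rule ennreal_leI[OF elim])
      also have "\<dots> = ennreal c * (\<integral>\<^sup>+z'. indicator R (z, z') * ennreal (f z') \<partial>lborel)"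
        using c by (simp add: ennreal_mult' sec)
      finally have "ennreal (f z) * ennreal (om z) \<le> (ennreal c * (\<integral>\<^sup>+z'. indicator R (z, z') * ennreal (f z') \<partial>lborel)) * ennreal (om z)"
        by (rule mult_right_mono) simp
      also have "\<dots> = (\<integral>\<^sup>+z'. ennreal (om z) * (ennreal c * (indicator R (z, z') * ennreal (f z'))) \<partial>lborel)"
        by (simp add: nn_integral_cmult mult.commute)
      finally show ?case .
    qed
  qed
  also have "\<dots> = (\<integral>\<^sup>+z'. \<integral>\<^sup>+z. ennreal (om z) * (ennreal c * (indicator R (z, z') * ennreal (f z'))) \<partial>lborel \<partial>lborel)"
    by (rule lborel_pair.Fubini') (use prodm in \<open>simp add: case_prod_beta'\<close>)
  also have "\<dots> = (\<integral>\<^sup>+z'. ennreal (1 / 2) * (ennreal (f z') * ennreal (om z')) \<partial>lborel)"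
  proof (rule nn_integral_cong)
    fix z' :: "real \<times> real"
    have "(\<integral>\<^sup>+z. ennreal (om z) * (ennreal c * (indicator R (z, z') * ennreal (f z'))) \<partial>lborel)
      = (\<integral>\<^sup>+z. (ennreal c * ennreal (f z')) * ((ennreal (exp (- k * fst z)) * indicator {fst z'<..} (fst z)) * (ennreal (exp (- k * snd z)) * indicator {snd z'<..} (snd z))) \<partial>lborel)"
    proof (rule nn_integral_cong)
      fix z :: "real \<times> real"
      have "om z = exp (- k * fst z) * exp (- k * snd z)" by (simp add: om_def exp_add[symmetric] algebra_simps)
      then have "ennreal (om z) = ennreal (exp (- k * fst z)) * ennreal (exp (- k * snd z))" by (simp add: ennreal_mult)
      moreover have "indicator R (z, z') = (indicator {fst z'<..} (fst z) * indicator {snd z'<..} (snd z) :: ennreal)"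
        by (auto simp: R_def indicator_def)
      ultimately show "ennreal (om z) * (ennreal c * (indicator R (z, z') * ennreal (f z'))) =
        (ennreal c * ennreal (f z')) * ((ennreal (exp (- k * fst z)) * indicator {fst z'<..} (fst z)) * (ennreal (exp (- k * snd z)) * indicator {snd z'<..} (snd z)))"
        by (simp add: mult_ac)
    qed
    also have "\<dots> = (ennreal c * ennreal (f z')) * (\<integral>\<^sup>+z. (ennreal (exp (- k * fst z)) * indicator {fst z'<..} (fst z)) * (ennreal (exp (- k * snd z)) * indicator {snd z'<..} (snd z)) \<partial>lborel)"
      by (rule nn_integral_cmult) measurable
    also have "(\<integral>\<^sup>+z. (ennreal (exp (- k * fst z)) * indicator {fst z'<..} (fst z)) * (ennreal (exp (- k * snd z)) * indicator {snd z'<..} (snd z)) \<partial>lborel)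
      = (\<integral>\<^sup>+x. \<integral>\<^sup>+y. (ennreal (exp (- k * x)) * indicator {fst z'<..} x) * (ennreal (exp (- k * y)) * indicator {snd z'<..} y) \<partial>lborel \<partial>lborel)"
    proof -
      have "(\<lambda>z. (ennreal (exp (- k * fst z)) * indicator {fst z'<..} (fst z)) * (ennreal (exp (- k * snd z)) * indicator {snd z'<..} (snd z))) \<in> borel_measurable (lborel \<Otimes>\<^sub>M lborel)"
        by measurable
      from lborel.nn_integral_fst[OF this] show ?thesis by (simp add: lborel_prod)
    qed
    also have "\<dots> = ennreal (exp (- k * fst z') / k) * ennreal (exp (- k * snd z') / k)"
      using nn_integral_exp_ge[OF k(1)] by (simp add: nn_integral_cmult nn_integral_multc)
    also have "\<dots> = ennreal (om z' / (2 * c))"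
      using k by (simp add: ennreal_mult[symmetric] om_def exp_add[symmetric] algebra_simps)
    also have "(ennreal c * ennreal (f z')) * ennreal (om z' / (2 * c)) = ennreal (1 / 2) * (ennreal (f z') * ennreal (om z'))"
    proof -
      have om0: "om z' \<ge> 0" by (simp add: om_def)
      have "(ennreal c * ennreal (f z')) * ennreal (om z' / (2 * c)) = ennreal ((c * f z') * (om z' / (2 * c)))"
      proof -
        have "ennreal ((c * f z') * (om z' / (2 * c))) = ennreal (c * f z') * ennreal (om z' / (2 * c))"
          using c f0[of z'] om0 by (intro ennreal_mult) auto
        moreover have "ennreal (c * f z') = ennreal c * ennreal (f z')"
          using c f0[of z'] by (intro ennreal_mult) auto
        ultimately show ?thesis by (simp only:)
      qed
      also have "(c * f z') * (om z' / (2 * c)) = 1 / 2 * (f z' * om z')" using c by simp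
      also have "ennreal (1 / 2 * (f z' * om z')) = ennreal (1 / 2) * ennreal (f z' * om z')"
        using f0[of z'] om0 by (intro ennreal_mult) auto
      also have "ennreal (f z' * om z') = ennreal (f z') * ennreal (om z')"
        by (rule ennreal_mult[OF f0 om0])
      finally show ?thesis .
    qed
    finally show "(\<integral>\<^sup>+z. ennreal (om z) * (ennreal c * (indicator R (z, z') * ennreal (f z'))) \<partial>lborel) = ennreal (1 / 2) * (ennreal (f z') * ennreal (om z'))" .
  qed
  also have "\<dots> = ennreal (1 / 2) * I"
    unfolding I_def by (rule nn_integral_cmult) measurable
  finally have "I \<le> ennreal (1 / 2) * I" .
  moreover obtain i where i: "I = ennreal i" "i \<ge> 0" using fin by (cases I) auto
  ultimately have "ennreal i \<le> ennreal (1 / 2 * i)" using i by (simp add: ennreal_mult del: times_divide_eq_left)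
  then have "i \<le> 1 / 2 * i" using i by (simp add: ennreal_le_iff)
  then have "I = 0" using i by simp
  then have "AE z in lborel. ennreal (f z) * ennreal (om z) = 0"
    unfolding I_def by (subst (asm) nn_integral_0_iff_AE) auto
  then show ?thesis
  proof eventually_elim
    case (elim z)
    then have "f z \<le> 0" by (auto simp: om_def ennreal_eq_0_iff)
    then show ?case using f0[of z] by simp
  qed
qed

section \<open>The distributional wave equation as an integral equation\<close>

lemma bounded_loc_integrable:
  fixes k :: "'a::euclidean_space \<Rightarrow> real"
  assumes "k \<in> borel_measurable borel" "\<And>z. \<bar>k z\<bar> \<le> c"
  shows "loc_integrable \<Omega> k"
  unfolding loc_integrable_def set_integrable_def
proof (intro allI impI)
  fix A assume "compact A \<and> A \<subseteq> \<Omega>"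
  then have "integrable lborel (indicator A :: 'a \<Rightarrow> real)"
    by (intro integrable_indicator_bounded compact_imp_bounded borel_compact) auto
  from integrable_mult_bounded[OF this assms] show "integrable lborel (\<lambda>x. indicator A x *\<^sub>R k x)" by simp
qed

text \<open>The primitive of \<open>A\<close> that vanishes near plus infinity is constant and possibly nonzero to the left
  of the support. A multiple of a bump on \<open>[- 2 L, - L]\<close> is added to \<open>A\<close>, which gives the primitive
  compact support and does not change it on the right of \<open>- L\<close>.\<close>

lemma corrected_primitive:
  assumes A: "bump1 a b A" and ab: "- L < a" "b < L" and L: "L > 0"
  shows "\<exists>E E'. bump1 (- 2 * L) L E \<and> (\<forall>x. (E has_real_derivative E' x) (at x)) \<and> bump1 (- 2 * L) L E' \<and>
    (\<forall>x. x > - L \<longrightarrow> E' x = A x) \<and> (\<forall>x. x > - L \<longrightarrow> E x = - (LINT s|lborel. indicator {x<..} s * A s))"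
proof -
  have "- 2 * L < - L" using L by simp
  from bump1_mass_one[OF this] obtain c where c: "bump1 (- 2 * L) (- L) c" "(LINT x|lborel. c x) = 1" by metis
  define m where "m = (LINT x|lborel. A x)"
  define E' where "E' = (\<lambda>x. A x + (- m) * c x)"
  note Ai = bump1_integrable[OF A] and ci = bump1_integrable[OF c(1)]
  have A': "bump1 (- 2 * L) L A" and c': "bump1 (- 2 * L) L c"
    using A c(1) ab L by (auto intro: bump1_mono)
  have E': "bump1 (- 2 * L) L E'"
  proof -
    have "smooth1 E'" unfolding E'_def
      using A' c' by (intro smooth1_add smooth1_mult smooth1_const) (auto simp: bump1_def)
    then show ?thesis using A' c' by (auto simp: bump1_def E'_def)
  qed
  have "(LINT x|lborel. E' x) = (LINT x|lborel. A x) + (LINT x|lborel. (- m) * c x)"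
    unfolding E'_def by (rule Bochner_Integration.integral_add[OF Ai integrable_mult_right]) (use ci in simp)
  then have 0: "(LINT x|lborel. E' x) = 0" using c(2) by (simp add: m_def)
  have eq: "E' x = A x" if "x > - L" for x
    using c(1) that by (auto simp: E'_def bump1_def)
  note E'i = bump1_integrable[OF E']
  have prim: "(LINT s:{..x}|lborel. E' s) = - (LINT s|lborel. indicator {x<..} s * A s)" if x: "x > - L" for x
  proof -
    have "(LINT s:{..x}|lborel. E' s) = (LINT s|lborel. E' s - indicator {x<..} s *\<^sub>R E' s)"
      unfolding set_lebesgue_integral_def by (intro Bochner_Integration.integral_cong) (auto simp: indicator_def)
    also have "\<dots> = (LINT s|lborel. E' s) - (LINT s|lborel. indicator {x<..} s *\<^sub>R E' s)"
      by (intro Bochner_Integration.integral_diff E'i integrable_mult_indicator) simp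
    also have "(LINT s|lborel. indicator {x<..} s *\<^sub>R E' s) = (LINT s|lborel. indicator {x<..} s * A s)"
      using x eq by (intro Bochner_Integration.integral_cong) (auto simp: indicator_def)
    finally show ?thesis using 0 by simp
  qed
  show ?thesis
    by (rule exI[of _ "\<lambda>x. LINT s:{..x}|lborel. E' s"], rule exI[of _ E'])
       (intro conjI allI impI bump1_primitive(1)[OF E' 0] bump1_primitive(2)[OF E' 0] E' eq prim)
qed

text \<open>If the corner of the rectangle converges, the indicators converge outside two lines, which are
  null sets.\<close>

lemma continuous_on_rectangle_integral:
  fixes f :: "real \<times> real \<Rightarrow> real"
  assumes f: "loc_integrable UNIV f"
  shows "continuous_on UNIV (\<lambda>z. LINT z'|lborel. indicator ({0<..<fst z} \<times> {0<..<snd z}) z' * f z')"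
  unfolding continuous_on_sequentially
proof (intro allI ballI impI)
  fix Zs z assume "(\<forall>n. Zs n \<in> UNIV) \<and> Zs \<longlonglongrightarrow> (z :: real \<times> real)"
  then have lim: "Zs \<longlonglongrightarrow> z" by simp
  then have lim1: "(\<lambda>n. fst (Zs n)) \<longlonglongrightarrow> fst z" and lim2: "(\<lambda>n. snd (Zs n)) \<longlonglongrightarrow> snd z"
    by (auto intro: tendsto_fst tendsto_snd)
  obtain B where B: "\<And>n. norm (Zs n) \<le> B"
    using convergent_imp_Bseq[OF convergentI[OF lim]] by (auto simp: Bseq_def)
  let ?K = "{0..B} \<times> {0..B}"
  have K: "compact ?K" by (intro compact_Times) auto
  have i: "integrable lborel (\<lambda>z'. indicator ?K z' * f z')"
    using f K by (auto simp: loc_integrable_def set_integrable_def)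
  have fm[measurable]: "f \<in> borel_measurable borel"
    using loc_integrable_measurable[OF open_UNIV f] by (simp add: set_borel_measurable_def)
  have rect[measurable]: "{0<..<s} \<times> {0<..<r} \<in> sets borel" for s r :: real
    by (intro borel_open open_Times) auto
  have "(\<lambda>n. LINT z'|lborel. indicator ({0<..<fst (Zs n)} \<times> {0<..<snd (Zs n)}) z' * f z') \<longlonglongrightarrow>
     (LINT z'|lborel. indicator ({0<..<fst z} \<times> {0<..<snd z}) z' * f z')"
  proof (rule integral_dominated_convergence)
    show "integrable lborel (\<lambda>z'. norm (indicator ?K z' * f z'))" by (rule integrable_norm[OF i])
    show "AE z' in lborel. (\<lambda>n. indicator ({0<..<fst (Zs n)} \<times> {0<..<snd (Zs n)}) z' * f z') \<longlonglongrightarrow>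
        indicator ({0<..<fst z} \<times> {0<..<snd z}) z' * f z'"
      using AE_fst[OF AE_lborel_singleton[of "fst z"]] AE_snd[OF AE_lborel_singleton[of "snd z"]]
    proof eventually_elim
      case (elim z')
      have "\<forall>\<^sub>F n in sequentially. (fst z' < fst (Zs n)) = (fst z' < fst z)"
        using order_tendstoD[OF lim1, of "fst z'"] elim(1)
        by (cases "fst z' < fst z") (auto elim: eventually_mono)
      moreover have "\<forall>\<^sub>F n in sequentially. (snd z' < snd (Zs n)) = (snd z' < snd z)"
        using order_tendstoD[OF lim2, of "snd z'"] elim(2)
        by (cases "snd z' < snd z") (auto elim: eventually_mono)
      ultimately have "\<forall>\<^sub>F n in sequentially. indicator ({0<..<fst (Zs n)} \<times> {0<..<snd (Zs n)}) z' * f z' =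
          indicator ({0<..<fst z} \<times> {0<..<snd z}) z' * f z'"
        by eventually_elim (cases z'; auto simp: indicator_def)
      then show ?case by (rule tendsto_eventually)
    qed
    fix n
    have "fst (Zs n) \<le> B" "snd (Zs n) \<le> B"
      using B[of n] norm_fst_le[of "fst (Zs n)" "snd (Zs n)"] norm_snd_le[of "snd (Zs n)" "fst (Zs n)"] by auto
    then show "AE z' in lborel. norm (indicator ({0<..<fst (Zs n)} \<times> {0<..<snd (Zs n)}) z' * f z') \<le> norm (indicator ?K z' * f z')"
      by (intro AE_I2) (auto simp: indicator_def)
  qed measurable
  then show "((\<lambda>z. LINT z'|lborel. indicator ({0<..<fst z} \<times> {0<..<snd z}) z' * f z') \<circ> Zs) \<longlonglongrightarrow>
     (LINT z'|lborel. indicator ({0<..<fst z} \<times> {0<..<snd z}) z' * f z')"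
    by (simp add: comp_def)
qed

lemma continuous_AE_eq:
  fixes f g :: "'a::euclidean_space \<Rightarrow> real"
  assumes S: "open S" and fg: "continuous_on S f" "continuous_on S g"
    and ae: "AE z in lborel. z \<in> S \<longrightarrow> f z = g z" and z: "z \<in> S"
  shows "f z = g z"
proof (rule ccontr)
  assume "f z \<noteq> g z"
  define U where "U = S \<inter> (\<lambda>z. f z - g z) -` (- {0})"
  have "open U" unfolding U_def
    by (rule continuous_open_preimage[OF continuous_on_diff[OF fg] S]) auto
  moreover have "z \<in> U" using z \<open>f z \<noteq> g z\<close> by (simp add: U_def)
  ultimately have "\<not> negligible U" using open_not_negligible by blast
  moreover have "negligible U"
  proof -
    have "AE z in lborel. z \<notin> U" using ae by eventually_elim (auto simp: U_def)
    then have "U \<in> null_sets lborel"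
      using \<open>open U\<close> by (subst (asm) AE_iff_null_sets[symmetric]) auto
    then show ?thesis by (simp add: negligible_iff_null_sets null_sets_completionI)
  qed
  ultimately show False by blast
qed

locale wave_problem =
  fixes p :: "real \<Rightarrow> real" and w :: "real \<times> real \<Rightarrow> real" and c0 :: real
  assumes wave: "wave_solution p w" and p_cont: "continuous_on UNIV p"
    and p_bound: "\<And>y. \<bar>p y\<bar> \<le> c0" and c0: "c0 > 0"
begin

text \<open>\<open>w\<close> extended by zero to \<open>t \<le> 0\<close>, and \<open>w\<close> and \<open>p\<close> in characteristic coordinates.\<close>

definition w0 :: "real \<times> real \<Rightarrow> real" where "w0 z = (if snd z > 0 then w z else 0)"
definition Wt :: "real \<times> real \<Rightarrow> real" where "Wt z = w0 (char_inv z)"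
definition P :: "real \<times> real \<Rightarrow> real" where "P z = p (fst (char_inv z))"

lemma P_cont: "continuous_on A P"
  unfolding P_def[abs_def]
  by (rule continuous_on_compose2[OF p_cont]) (auto intro: continuous_on_fst char_cont)

lemma P_measurable[measurable]: "P \<in> borel_measurable borel"
  by (intro borel_measurable_continuous_onI P_cont)

lemma P_bound: "\<bar>P z\<bar> \<le> c0"
  by (simp add: P_def p_bound)

lemma w0_loc_integrable: "loc_integrable UNIV w0"
  unfolding loc_integrable_def
proof (intro allI impI)
  fix A :: "(real \<times> real) set" assume "compact A \<and> A \<subseteq> UNIV"
  then have "set_integrable lborel (A \<inter> {(y, t). 0 < t}) w" using wave by (auto simp: wave_solution_def)
  moreover have "(\<lambda>x. indicator (A \<inter> {(y, t). 0 < t}) x *\<^sub>R w x) = (\<lambda>x. indicator A x *\<^sub>R w0 x)"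
    by (auto simp: fun_eq_iff indicator_def w0_def)
  ultimately show "set_integrable lborel A w0" by (simp add: set_integrable_def)
qed

lemma w0_measurable[measurable]: "w0 \<in> borel_measurable borel"
  using loc_integrable_measurable[OF open_UNIV w0_loc_integrable] by (simp add: set_borel_measurable_def)

lemma Wt_measurable[measurable]: "Wt \<in> borel_measurable borel"
  unfolding Wt_def[abs_def] by measurable

lemma Wt_char: "Wt (char z) = w0 z"
  by (simp add: Wt_def char_inv)

lemma Wt_zero: "fst z + snd z \<le> 0 \<Longrightarrow> Wt z = 0"
  by (simp add: Wt_def w0_def char_inv_def)

lemma Wt_loc_integrable: "loc_integrable UNIV Wt"
  unfolding loc_integrable_def set_integrable_def
proof (intro allI impI)
  fix A :: "(real \<times> real) set" assume A: "compact A \<and> A \<subseteq> UNIV"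
  then have Ab[measurable]: "A \<in> sets borel" by (auto intro: borel_compact)
  have "compact (char_inv ` A)" using A by (intro compact_continuous_image char_cont) auto
  then have "integrable lborel (\<lambda>x. indicator (char_inv ` A) x *\<^sub>R w0 x)"
    using w0_loc_integrable by (auto simp: loc_integrable_def set_integrable_def)
  moreover have "indicator (char_inv ` A) z = (indicator A (char z) :: real)" for z
  proof -
    have "z \<in> char_inv ` A \<longleftrightarrow> char z \<in> A"
      using char_inv by (metis imageE imageI)
    then show ?thesis by (simp add: indicator_def)
  qed
  ultimately have "integrable lborel (\<lambda>z. indicator A (char z) *\<^sub>R Wt (char z))" by (simp add: Wt_char)
  then show "integrable lborel (\<lambda>x. indicator A x *\<^sub>R Wt x)"
    by (subst integral_char(2)) (auto intro!: borel_measurable_times)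
qed

lemma Wt_test_integrable:
  fixes k :: "real \<times> real \<Rightarrow> real"
  assumes "k \<in> borel_measurable borel" "\<And>z. \<bar>k z\<bar> \<le> C" "compact K" "\<And>z. z \<notin> K \<Longrightarrow> k z = 0"
  shows "integrable lborel (\<lambda>z. Wt z * k z)"
proof -
  have "integrable lborel (\<lambda>x. indicator K x *\<^sub>R Wt x)"
    using Wt_loc_integrable assms(3) by (auto simp: loc_integrable_def set_integrable_def)
  from integrable_mult_bounded[OF this assms(1,2)]
  have "integrable lborel (\<lambda>x. indicator K x *\<^sub>R Wt x * k x)" .
  moreover have "(\<lambda>x. indicator K x *\<^sub>R Wt x * k x) = (\<lambda>x. Wt x * k x)"
    using assms(4) by (auto simp: indicator_def fun_eq_iff)
  ultimately show ?thesis by simp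
qed

lemma Wt_product_integrable:
  assumes A: "bump1 a b A" and B: "bump1 a' b' B" and m: "m \<in> borel_measurable borel" "\<And>z. \<bar>m z\<bar> \<le> M"
  shows "integrable lborel (\<lambda>z. Wt z * (m z * (A (fst z) * B (snd z))))"
proof -
  obtain KA where KA: "KA > 0" "\<And>x. \<bar>A x\<bar> \<le> KA" using bump1_bounded[OF A] by auto
  obtain KB where KB: "KB > 0" "\<And>x. \<bar>B x\<bar> \<le> KB" using bump1_bounded[OF B] by auto
  note [measurable] = bump1_measurable[OF A] bump1_measurable[OF B] m(1)
  have M: "M \<ge> 0" using m(2)[of 0] by linarith
  show ?thesis
  proof (rule Wt_test_integrable[of _ "M * (KA * KB)" "{a..b} \<times> {a'..b'}"])
    show "(\<lambda>z. m z * (A (fst z) * B (snd z))) \<in> borel_measurable borel" by measurable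
    show "\<bar>m z * (A (fst z) * B (snd z))\<bar> \<le> M * (KA * KB)" for z
      unfolding abs_mult using KA KB m(2) M by (intro mult_mono) auto
    show "compact ({a..b} \<times> {a'..b'})" by (intro compact_Times) auto
    show "m z * (A (fst z) * B (snd z)) = 0" if "z \<notin> {a..b} \<times> {a'..b'}" for z
    proof -
      have "fst z \<notin> {a..b} \<or> snd z \<notin> {a'..b'}" using that by (cases z) auto
      then show ?thesis using A B unfolding bump1_def by auto
    qed
  qed
qed

text \<open>The wave equation tested with \<open>A(y + t) B(t - y)\<close>. The factors \<open>1/2\<close> and \<open>1/4\<close> arise from the
  Jacobian 2 and the factor 4 in \<open>char_second_derivs\<close>.\<close>

lemma weak_identity:
  assumes A: "bump1 a b A" "\<And>x. (A has_real_derivative A' x) (at x)" "bump1 a b A'"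
    and B: "bump1 a' b' B" "\<And>x. (B has_real_derivative B' x) (at x)" "bump1 a' b' B'"
  shows "(LINT z|lborel. Wt z * (A' (fst z) * B' (snd z)))
    = 1 / 2 * (A 0 * B 0) + 1 / 4 * (LINT z|lborel. Wt z * (P z * (A (fst z) * B (snd z))))"
proof -
  note [measurable] = bump1_measurable[OF A(1)] bump1_measurable[OF B(1)] bump1_measurable[OF A(3)] bump1_measurable[OF B(3)]
  obtain A'' where A'': "\<And>x. (A' has_real_derivative A'' x) (at x)" using A(3) smooth1_deriv unfolding bump1_def by metis
  obtain B'' where B'': "\<And>x. (B' has_real_derivative B'' x) (at x)" using B(3) smooth1_deriv unfolding bump1_def by metis
  let ?\<phi> = "\<lambda>z::real \<times> real. A (fst z + snd z) * B (snd z - fst z)"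
  have "(LINT x:{(y, t). 0 < t}|lborel. w x * (iter_deriv (yt 0 2) ?\<phi> x - iter_deriv (yt 2 0) ?\<phi> x - p (fst x) * ?\<phi> x)) = ?\<phi> (0, 0)"
    using wave char_test_fun[OF A(1) B(1)] unfolding wave_solution_def by blast
  then have "(LINT x:{(y, t). 0 < t}|lborel. w x * (4 * (A' (fst x + snd x) * B' (snd x - fst x)) - p (fst x) * ?\<phi> x)) = A 0 * B 0"
    unfolding char_second_derivs[OF A(2) A'' B(2) B''] by simp
  moreover define F where "F = (\<lambda>z. 4 * (Wt z * (A' (fst z) * B' (snd z))) - Wt z * (P z * (A (fst z) * B (snd z))))"
  have i1: "integrable lborel (\<lambda>z. Wt z * (A' (fst z) * B' (snd z)))"
    using Wt_product_integrable[OF A(3) B(3), of "\<lambda>z. 1" 1] by simp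
  have i2: "integrable lborel (\<lambda>z. Wt z * (P z * (A (fst z) * B (snd z))))"
    by (rule Wt_product_integrable[OF A(1) B(1) P_measurable P_bound])
  have "(LINT x:{(y, t). 0 < t}|lborel. w x * (4 * (A' (fst x + snd x) * B' (snd x - fst x)) - p (fst x) * ?\<phi> x))
      = (LINT z|lborel. F (char z))"
    unfolding set_lebesgue_integral_def
  proof (intro Bochner_Integration.integral_cong refl)
    fix z :: "real \<times> real"
    have Pc: "P (char z) = p (fst z)" by (simp add: P_def char_inv)
    have sel: "fst (char z) = fst z + snd z" "snd (char z) = snd z - fst z" by (simp_all add: char_def)
    have ind: "indicator {(y, t). 0 < t} z *\<^sub>R (w z * q) = w0 z * q" for q
      by (cases z) (simp add: w0_def)
    show "indicator {(y, t). 0 < t} z *\<^sub>R (w z * (4 * (A' (fst z + snd z) * B' (snd z - fst z)) - p (fst z) * ?\<phi> z)) = F (char z)"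
      unfolding ind F_def Wt_char Pc sel by (simp add: right_diff_distrib mult.left_commute)
  qed
  moreover have "(LINT z|lborel. F z) = 2 * (LINT z|lborel. F (char z))"
    by (rule integral_char(1)) (simp add: F_def)
  moreover have "(LINT z|lborel. F z) = 4 * (LINT z|lborel. Wt z * (A' (fst z) * B' (snd z))) - (LINT z|lborel. Wt z * (P z * (A (fst z) * B (snd z))))"
    unfolding F_def using i1 i2 by simp
  ultimately show ?thesis by simp
qed

text \<open>The Volterra equation is derived on the triangles \<open>wave_triangle L\<close>, which exhaust the half plane
  \<open>s + r > 0\<close>. The primitives from \<open>corrected_primitive\<close> are the right ones only where both coordinates
  exceed \<open>- L\<close>; accordingly the source \<open>P Wt\<close> is cut off to a square. \<open>free_wave\<close> is the solution for
  \<open>p = 0\<close>.\<close>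

definition square_upto :: "real \<Rightarrow> (real \<times> real) set" where "square_upto L = {- L<..<L} \<times> {- L<..<L}"
definition wave_triangle :: "real \<Rightarrow> (real \<times> real) set" where "wave_triangle L = {z. 0 < fst z + snd z \<and> fst z < L \<and> snd z < L}"
definition wave_source :: "real \<Rightarrow> real \<times> real \<Rightarrow> real" where "wave_source L z = indicator (square_upto L) z * (P z * Wt z)"
definition source_integral :: "real \<Rightarrow> real \<times> real \<Rightarrow> real" where
  "source_integral L z = (LINT z'|lborel. indicator {z'. fst z' < fst z \<and> snd z' < snd z} z' * wave_source L z')"
definition free_wave :: "real \<times> real \<Rightarrow> real" where "free_wave z = (if 0 < fst z \<and> 0 < snd z then 1 / 2 else 0)"

lemma lower_borel[measurable]: "{z'. fst z' < s \<and> snd z' < r} \<in> sets (borel :: (real \<times> real) measure)"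
  by (intro borel_open open_Collect_conj open_Collect_less continuous_intros)

lemma wave_triangle_open: "open (wave_triangle L)"
  unfolding wave_triangle_def by (intro open_Collect_conj open_Collect_less continuous_intros)

lemma wave_source_integrable: "integrable lborel (wave_source L)"
proof -
  have "square_upto L \<subseteq> {- L..L} \<times> {- L..L}" by (auto simp: square_upto_def)
  moreover have "square_upto L \<in> sets borel" unfolding square_upto_def by (intro borel_open open_Times) auto
  moreover have "compact ({- L..L} \<times> {- L..L})" by (intro compact_Times) auto
  ultimately have "set_integrable lborel (square_upto L) Wt"
    using Wt_loc_integrable set_integrable_subset[of lborel "{- L..L} \<times> {- L..L}" Wt "square_upto L"]
    by (auto simp: loc_integrable_def)
  then have "integrable lborel (\<lambda>z. indicator (square_upto L) z *\<^sub>R Wt z)" by (simp add: set_integrable_def)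
  from integrable_mult_bounded[OF this P_measurable P_bound]
  show ?thesis unfolding wave_source_def[abs_def] by (simp add: mult_ac)
qed

lemma source_integral_measurable[measurable]: "source_integral L \<in> borel_measurable borel"
proof -
  define R where "R = {x. fst (snd x) < fst (fst x) \<and> snd (snd x) < snd (fst (x :: (real \<times> real) \<times> (real \<times> real)))}"
  have [measurable]: "R \<in> sets (borel \<Otimes>\<^sub>M borel)" unfolding borel_prod R_def by (rule order_set_borel)
  have [measurable]: "wave_source L \<in> borel_measurable borel" using wave_source_integrable by auto
  have "(\<lambda>(z, z'). indicator R (z, z') * wave_source L z') \<in> borel_measurable (borel \<Otimes>\<^sub>M lborel)"
    by measurable
  from lborel.borel_measurable_lebesgue_integral[OF this]
  have "(\<lambda>z. LINT z'|lborel. indicator R (z, z') * wave_source L z') \<in> borel_measurable borel" .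
  then show ?thesis by (simp add: source_integral_def[abs_def] R_def indicator_def)
qed

lemma source_integral_bound: "\<bar>source_integral L z\<bar> \<le> (LINT z'|lborel. \<bar>wave_source L z'\<bar>)"
proof -
  have i: "integrable lborel (\<lambda>z'. indicator {z'. fst z' < fst z \<and> snd z' < snd z} z' * wave_source L z')"
    using integrable_mult_indicator[OF _ wave_source_integrable, of "{z'. fst z' < fst z \<and> snd z' < snd z}" L] by simp
  have "\<bar>source_integral L z\<bar> \<le> (LINT z'|lborel. norm (indicator {z'. fst z' < fst z \<and> snd z' < snd z} z' * wave_source L z'))"
    unfolding source_integral_def real_norm_def[symmetric] by (rule integral_norm_bound)
  also have "\<dots> \<le> (LINT z'|lborel. \<bar>wave_source L z'\<bar>)"
  proof (rule integral_mono)
    show "integrable lborel (\<lambda>z'. norm (indicator {z'. fst z' < fst z \<and> snd z' < snd z} z' * wave_source L z'))"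
      by (rule integrable_norm[OF i])
    show "integrable lborel (\<lambda>z'. \<bar>wave_source L z'\<bar>)" using wave_source_integrable by (rule integrable_abs)
  qed (auto simp: indicator_def)
  finally show ?thesis .
qed

text \<open>The weak identity is applied to primitives of \<open>A\<close> and \<open>B\<close>, so that \<open>Wt\<close> itself is tested against
  \<open>A B\<close>. The corrections of the primitives are not seen: \<open>Wt\<close> vanishes for \<open>s + r \<le> 0\<close>, and a point of
  the half plane \<open>s + r > 0\<close> with one coordinate below \<open>- L\<close> has the other one above \<open>L\<close>, beyond all
  supports.\<close>

lemma volterra_local:
  assumes L: "L > 0"
  shows "AE z in lborel. z \<in> wave_triangle L \<longrightarrow> Wt z = free_wave z + 1 / 4 * source_integral L z"
proof -
  have free_wavem[measurable]: "free_wave \<in> borel_measurable borel"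
  proof -
    have "{z::real \<times> real. 0 < fst z \<and> 0 < snd z} \<in> sets borel"
      by (intro borel_open open_Collect_conj open_Collect_less continuous_intros)
    then have "(\<lambda>z::real \<times> real. 1 / 2 * indicator {z. 0 < fst z \<and> 0 < snd z} z :: real) \<in> borel_measurable borel" by measurable
    then show ?thesis by (simp add: free_wave_def[abs_def] indicator_def of_bool_def if_distrib)
  qed
  have free_waveb: "\<bar>free_wave z\<bar> \<le> 1" for z by (simp add: free_wave_def)
  have [measurable]: "wave_source L \<in> borel_measurable borel" using wave_source_integrable by auto
  have "AE z in lborel. z \<in> wave_triangle L \<longrightarrow> (Wt z + (- 1) * free_wave z) + (- 1 / 4) * source_integral L z = 0"
  proof (rule product_tests_determine[OF wave_triangle_open])
    show "loc_integrable (wave_triangle L) (\<lambda>z. (Wt z + (- 1) * free_wave z) + (- 1 / 4) * source_integral L z)"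
      by (intro loc_integrable_combo loc_integrable_mono[OF Wt_loc_integrable]
          bounded_loc_integrable[OF free_wavem free_waveb] bounded_loc_integrable[OF source_integral_measurable source_integral_bound]) simp
    fix a b a' b' A B
    assume A: "bump1 a b A" and B: "bump1 a' b' B" and lt: "a < b" "a' < b'" and sub: "{a..b} \<times> {a'..b'} \<subseteq> wave_triangle L"
    note [measurable] = bump1_measurable[OF A] bump1_measurable[OF B]
    obtain KA where KA: "KA > 0" "\<And>x. \<bar>A x\<bar> \<le> KA" using bump1_bounded[OF A] by auto
    obtain KB where KB: "KB > 0" "\<And>x. \<bar>B x\<bar> \<le> KB" using bump1_bounded[OF B] by auto
    have "(a, a') \<in> wave_triangle L" "(b, a') \<in> wave_triangle L" "(a, b') \<in> wave_triangle L"
      using lt by (auto intro!: subsetD[OF sub])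
    then have ab: "- L < a" "b < L" "- L < a'" "b' < L" using lt by (auto simp: wave_triangle_def)
    obtain E E' where E: "bump1 (- 2 * L) L E" "\<And>x. (E has_real_derivative E' x) (at x)" "bump1 (- 2 * L) L E'"
      "\<And>x. x > - L \<Longrightarrow> E' x = A x" "\<And>x. x > - L \<Longrightarrow> E x = - (LINT s|lborel. indicator {x<..} s * A s)"
      using corrected_primitive[OF A ab(1,2) L] by blast
    obtain F F' where F: "bump1 (- 2 * L) L F" "\<And>x. (F has_real_derivative F' x) (at x)" "bump1 (- 2 * L) L F'"
      "\<And>x. x > - L \<Longrightarrow> F' x = B x" "\<And>x. x > - L \<Longrightarrow> F x = - (LINT s|lborel. indicator {x<..} s * B s)"
      using corrected_primitive[OF B ab(3,4) L] by blast
    define \<alpha> where "\<alpha> = (\<lambda>x. LINT s|lborel. indicator {x<..} s * A s)"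
    define \<gamma> where "\<gamma> = (\<lambda>x. LINT s|lborel. indicator {x<..} s * B s)"
    have big: "F x = 0" "F' x = 0" "E x = 0" "E' x = 0" "A x = 0" "B x = 0" if "x > L" for x
      using that E(1,3) F(1,3) A B ab by (auto simp: bump1_def)
    have \<alpha>L: "\<alpha> x = 0" if "x \<ge> L" for x
    proof -
      have "(\<lambda>s. indicator {x<..} s * A s) = (\<lambda>s. 0)"
        using A that ab(2) by (auto simp: fun_eq_iff bump1_def indicator_def)
      then show ?thesis by (simp add: \<alpha>_def)
    qed
    have \<gamma>L: "\<gamma> x = 0" if "x \<ge> L" for x
    proof -
      have "(\<lambda>s. indicator {x<..} s * B s) = (\<lambda>s. 0)"
        using B that ab(4) by (auto simp: fun_eq_iff bump1_def indicator_def)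
      then show ?thesis by (simp add: \<gamma>_def)
    qed
    have iA: "integrable lborel (\<lambda>s. indicator {x<..} s * A s)" for x
      using integrable_mult_indicator[OF _ bump1_integrable[OF A], of "{x<..}"] by simp
    have iB: "integrable lborel (\<lambda>s. indicator {x<..} s * B s)" for x
      using integrable_mult_indicator[OF _ bump1_integrable[OF B], of "{x<..}"] by simp
    \<comment> \<open>on the half plane the corrections do not contribute\<close>
    have lhs: "(LINT z|lborel. Wt z * (E' (fst z) * F' (snd z))) = (LINT z|lborel. Wt z * (A (fst z) * B (snd z)))"
    proof (intro Bochner_Integration.integral_cong refl)
      fix z :: "real \<times> real"
      consider "fst z + snd z \<le> 0" | "fst z \<le> - L" "snd z > L" | "snd z \<le> - L" "fst z > L" | "fst z > - L" "snd z > - L"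
        by linarith
      then show "Wt z * (E' (fst z) * F' (snd z)) = Wt z * (A (fst z) * B (snd z))"
        by cases (simp_all add: Wt_zero big E(4) F(4))
    qed
    have rhs: "Wt z * (P z * (E (fst z) * F (snd z))) = wave_source L z * (\<alpha> (fst z) * \<gamma> (snd z))" for z
    proof -
      consider "fst z + snd z \<le> 0" | "fst z \<le> - L" "snd z > L" | "snd z \<le> - L" "fst z > L"
        | "fst z > - L" "snd z > - L" "fst z \<ge> L \<or> snd z \<ge> L" | "fst z > - L" "snd z > - L" "fst z < L" "snd z < L"
        by linarith
      then show ?thesis
      proof cases
        case 4
        then show ?thesis using \<alpha>L \<gamma>L E(5) F(5) by (auto simp: \<alpha>_def \<gamma>_def)
      next
        case 5
        then have "z \<in> square_upto L" by (cases z) (simp add: square_upto_def)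
        with 5 show ?thesis using E(5) F(5) by (simp add: wave_source_def \<alpha>_def \<gamma>_def)
      next
        case 2
        then have "z \<notin> square_upto L" by (cases z) (simp add: square_upto_def)
        with 2 show ?thesis by (simp add: wave_source_def big)
      next
        case 3
        then have "z \<notin> square_upto L" by (cases z) (simp add: square_upto_def)
        with 3 show ?thesis by (simp add: wave_source_def big)
      qed (simp add: Wt_zero wave_source_def)
    qed
    have E0: "E 0 * F 0 = 2 * (LINT z|lborel. free_wave z * (A (fst z) * B (snd z)))"
    proof -
      have "E 0 * F 0 = (LINT s|lborel. indicator {0<..} s * A s) * (LINT s|lborel. indicator {0<..} s * B s)"
        using E(5)[of 0] F(5)[of 0] L by simp
      also have "\<dots> = (LINT z|lborel. (indicator {0<..} (fst z) * A (fst z)) * (indicator {0<..} (snd z) * B (snd z)))"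
        by (rule product_integral(2)[OF iA iB, symmetric])
      also have "\<dots> = (LINT z|lborel. 2 * (free_wave z * (A (fst z) * B (snd z))))"
        by (intro Bochner_Integration.integral_cong) (auto simp: free_wave_def indicator_def)
      finally show ?thesis by simp
    qed
    \<comment> \<open>exchanging the order of integration moves the kernel from the test function to \<open>P Wt\<close>\<close>
    define R where "R = {x. fst (snd x) < fst (fst x) \<and> snd (snd x) < snd (fst (x :: (real \<times> real) \<times> (real \<times> real)))}"
    have Rm: "R \<in> sets borel" unfolding R_def by (rule order_set_borel)
    have AB: "integrable lborel (\<lambda>z. A (fst z) * B (snd z))"
      by (rule product_integral(1)[OF bump1_integrable[OF A] bump1_integrable[OF B]])
    have int4: "integrable lborel (\<lambda>x. ((A (fst (fst x)) * B (snd (fst x))) * wave_source L (snd x)) * indicator R x)"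
      by (rule integrable_mult_bounded[OF product_integral(1)[OF AB wave_source_integrable], where c=1])
         (use Rm in \<open>auto simp: indicator_def\<close>)
    have fub: "(LINT z'|lborel. LINT z|lborel. ((A (fst z) * B (snd z)) * wave_source L z') * indicator R (z, z'))
        = (LINT z|lborel. LINT z'|lborel. ((A (fst z) * B (snd z)) * wave_source L z') * indicator R (z, z'))"
      using lborel_pair.Fubini_integral[of "\<lambda>z z'. ((A (fst z) * B (snd z)) * wave_source L z') * indicator R (z, z')"] int4
      by (simp add: lborel_prod case_prod_beta')
    have f1: "(LINT z|lborel. ((A (fst z) * B (snd z)) * wave_source L z') * indicator R (z, z')) = wave_source L z' * (\<alpha> (fst z') * \<gamma> (snd z'))" for z'
    proof -
      have "(LINT z|lborel. ((A (fst z) * B (snd z)) * wave_source L z') * indicator R (z, z'))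
         = (LINT z|lborel. wave_source L z' * ((indicator {fst z'<..} (fst z) * A (fst z)) * (indicator {snd z'<..} (snd z) * B (snd z))))"
        by (intro Bochner_Integration.integral_cong) (auto simp: R_def indicator_def)
      also have "\<dots> = wave_source L z' * (\<alpha> (fst z') * \<gamma> (snd z'))"
        unfolding \<alpha>_def \<gamma>_def product_integral(2)[OF iA iB, symmetric] by simp
      finally show ?thesis .
    qed
    have f2: "(LINT z'|lborel. ((A (fst z) * B (snd z)) * wave_source L z') * indicator R (z, z')) = source_integral L z * (A (fst z) * B (snd z))" for z
    proof -
      have "(LINT z'|lborel. ((A (fst z) * B (snd z)) * wave_source L z') * indicator R (z, z'))
         = (LINT z'|lborel. (A (fst z) * B (snd z)) * (indicator {z'. fst z' < fst z \<and> snd z' < snd z} z' * wave_source L z'))"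
        by (intro Bochner_Integration.integral_cong) (auto simp: R_def indicator_def)
      then show ?thesis by (simp add: source_integral_def)
    qed
    have HA: "(LINT z|lborel. Wt z * (P z * (E (fst z) * F (snd z)))) = (LINT z|lborel. source_integral L z * (A (fst z) * B (snd z)))"
      unfolding rhs using fub unfolding f1 f2 .
    have id: "(LINT z|lborel. Wt z * (A (fst z) * B (snd z)))
        = (LINT z|lborel. free_wave z * (A (fst z) * B (snd z))) + 1 / 4 * (LINT z|lborel. source_integral L z * (A (fst z) * B (snd z)))"
      using weak_identity[OF E(1,2,3) F(1,2,3)] unfolding lhs HA E0 by simp
    have i1: "integrable lborel (\<lambda>z. Wt z * (A (fst z) * B (snd z)))"
      using Wt_product_integrable[OF A B, of "\<lambda>z. 1" 1] by simp
    have i2: "integrable lborel (\<lambda>z. free_wave z * (A (fst z) * B (snd z)))"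
      using integrable_mult_bounded[OF AB free_wavem free_waveb] by (simp add: mult.commute)
    have i3: "integrable lborel (\<lambda>z. source_integral L z * (A (fst z) * B (snd z)))"
      using integrable_mult_bounded[OF AB source_integral_measurable source_integral_bound] by (simp add: mult.commute)
    have "(LINT z:wave_triangle L|lborel. ((Wt z + (- 1) * free_wave z) + (- 1 / 4) * source_integral L z) * (A (fst z) * B (snd z)))
      = (LINT z|lborel. (Wt z * (A (fst z) * B (snd z)) - free_wave z * (A (fst z) * B (snd z))) - 1 / 4 * (source_integral L z * (A (fst z) * B (snd z))))"
      unfolding set_lebesgue_integral_def
    proof (intro Bochner_Integration.integral_cong refl)
      fix z :: "real \<times> real"
      have "A (fst z) * B (snd z) = 0" if "z \<notin> wave_triangle L"
      proof -
        have "z \<notin> {a..b} \<times> {a'..b'}" using that sub by blast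
        then have "fst z \<notin> {a..b} \<or> snd z \<notin> {a'..b'}" by (cases z) auto
        then show ?thesis using A B unfolding bump1_def by auto
      qed
      moreover have "((x + (- 1) * q) + (- 1 / 4) * h) * k = (x * k - q * k) - 1 / 4 * (h * k)" for x q h k :: real
        by (simp add: algebra_simps)
      ultimately show "indicator (wave_triangle L) z *\<^sub>R (((Wt z + (- 1) * free_wave z) + (- 1 / 4) * source_integral L z) * (A (fst z) * B (snd z))) =
        (Wt z * (A (fst z) * B (snd z)) - free_wave z * (A (fst z) * B (snd z))) - 1 / 4 * (source_integral L z * (A (fst z) * B (snd z)))"
        by (cases "z \<in> wave_triangle L") auto
    qed
    also have "\<dots> = 0" using i1 i2 i3 id by simp
    finally show "(LINT z:wave_triangle L|lborel. ((Wt z + (- 1) * free_wave z) + (- 1 / 4) * source_integral L z) * (A (fst z) * B (snd z))) = 0" .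
  qed
  then show ?thesis by eventually_elim auto
qed

text \<open>Where one coordinate is negative the free wave is zero, and all points below such a point that lie
  in the half plane \<open>s + r > 0\<close> are of the same kind. Hence \<open>\<bar>Wt\<bar>\<close> satisfies there the homogeneous
  inequality of \<open>gronwall_plane\<close>.\<close>

lemma vanish_local:
  assumes L: "L > 0" and N: "N = {z \<in> wave_triangle L. fst z < 0} \<or> N = {z \<in> wave_triangle L. snd z < 0}"
  shows "AE z in lborel. z \<in> N \<longrightarrow> Wt z = 0"
proof -
  have Nb[measurable]: "N \<in> sets borel"
  proof -
    have "open {z \<in> wave_triangle L. fst z < 0}" "open {z \<in> wave_triangle L. snd z < 0}"
      using wave_triangle_open[of L] by (auto simp: Collect_conj_eq intro!: open_Int open_Collect_less continuous_intros)
    then show ?thesis using N by auto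
  qed
  have Nbox: "N \<subseteq> {- L..L} \<times> {- L..L}" using N by (auto simp: wave_triangle_def)
  have "set_integrable lborel N Wt"
  proof (rule set_integrable_subset[OF _ _ Nbox])
    have "compact ({- L..L} \<times> {- L..L})" by (intro compact_Times) auto
    then show "set_integrable lborel ({- L..L} \<times> {- L..L}) Wt"
      using Wt_loc_integrable by (auto simp: loc_integrable_def)
  qed simp
  define f where "f = (\<lambda>z. indicator N z * \<bar>Wt z\<bar>)"
  have fi: "integrable lborel f"
  proof -
    have "integrable lborel (\<lambda>z. \<bar>indicator N z *\<^sub>R Wt z\<bar>)"
      using \<open>set_integrable lborel N Wt\<close> unfolding set_integrable_def by (rule integrable_abs)
    then show ?thesis by (simp add: f_def abs_mult)
  qed
  have "AE z in lborel. f z = 0"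
  proof (rule gronwall_plane[OF fi])
    show "0 \<le> f z" for z by (simp add: f_def)
    show "fst z + snd z \<le> 0 \<Longrightarrow> f z = 0" for z by (simp add: f_def Wt_zero)
    show "c0 / 4 > 0" using c0 by simp
    show "AE z in lborel. f z \<le> c0 / 4 * (LINT z'|lborel. indicator {z'. fst z' < fst z \<and> snd z' < snd z} z' * f z')"
      using volterra_local[OF L]
    proof eventually_elim
      case (elim z)
      let ?I = "indicator {z'. fst z' < fst z \<and> snd z' < snd z} :: _ \<Rightarrow> real"
      have i: "integrable lborel (\<lambda>z'. ?I z' * f z')"
        using integrable_mult_indicator[OF _ fi, of "{z'. fst z' < fst z \<and> snd z' < snd z}"] by simp
      show ?case
      proof (cases "z \<in> N")
        case True
        then have zOm: "z \<in> wave_triangle L" and q: "free_wave z = 0" using N by (auto simp: free_wave_def)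
        have "\<bar>source_integral L z\<bar> \<le> (LINT z'|lborel. norm (?I z' * wave_source L z'))"
          unfolding source_integral_def real_norm_def[symmetric] by (rule integral_norm_bound)
        also have "\<dots> \<le> (LINT z'|lborel. c0 * (?I z' * f z'))"
        proof (rule integral_mono)
          show "integrable lborel (\<lambda>z'. norm (?I z' * wave_source L z'))"
            using integrable_mult_indicator[OF _ wave_source_integrable, of "{z'. fst z' < fst z \<and> snd z' < snd z}" L]
            by (intro integrable_norm) simp
          show "integrable lborel (\<lambda>z'. c0 * (?I z' * f z'))" using i by simp
          fix z' :: "real \<times> real"
          show "norm (?I z' * wave_source L z') \<le> c0 * (?I z' * f z')"
          proof (cases "fst z' < fst z \<and> snd z' < snd z \<and> Wt z' \<noteq> 0")
            case T: True
            then have "0 < fst z' + snd z'" using Wt_zero[of z'] by linarith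
            then have "z' \<in> N" using T True N zOm by (auto simp: wave_triangle_def)
            then have f': "f z' = \<bar>Wt z'\<bar>" by (simp add: f_def)
            have "\<bar>wave_source L z'\<bar> \<le> \<bar>P z'\<bar> * \<bar>Wt z'\<bar>" by (simp add: wave_source_def indicator_def abs_mult)
            also have "\<dots> \<le> c0 * \<bar>Wt z'\<bar>" by (intro mult_right_mono P_bound) simp
            finally show ?thesis using T f' by simp
          next
            case False
            then show ?thesis using c0 by (auto simp: wave_source_def f_def indicator_def)
          qed
        qed
        also have "\<dots> = c0 * (LINT z'|lborel. ?I z' * f z')" by simp
        finally have "\<bar>source_integral L z\<bar> \<le> c0 * (LINT z'|lborel. ?I z' * f z')" .
        then show ?thesis using elim zOm q True by (simp add: f_def)
      next
        case False
        have "0 \<le> (LINT z'|lborel. ?I z' * f z')" by (rule Bochner_Integration.integral_nonneg) (simp add: f_def)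
        then show ?thesis using False c0 by (simp add: f_def)
      qed
    qed
  qed
  then show ?thesis by eventually_elim (auto simp: f_def)
qed

lemma vanish: "AE z in lborel. fst z < 0 \<or> snd z < 0 \<longrightarrow> Wt z = 0"
proof -
  have "AE z in lborel. \<forall>n::nat. z \<in> wave_triangle (real (Suc n)) \<longrightarrow> fst z < 0 \<or> snd z < 0 \<longrightarrow> Wt z = 0"
  proof (subst AE_all_countable, intro allI)
    fix n :: nat
    have L: "real (Suc n) > 0" by simp
    from vanish_local[OF L disjI1[OF refl]] vanish_local[OF L disjI2[OF refl]]
    show "AE z in lborel. z \<in> wave_triangle (real (Suc n)) \<longrightarrow> fst z < 0 \<or> snd z < 0 \<longrightarrow> Wt z = 0"
      by eventually_elim auto
  qed
  then show ?thesis
  proof eventually_elim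
    case (elim z)
    show ?case
    proof (cases "fst z + snd z \<le> 0")
      case False
      obtain n where "max (fst z) (snd z) < real n" using reals_Archimedean2 by blast
      then have "z \<in> wave_triangle (real (Suc n))" using False by (auto simp: wave_triangle_def)
      then show ?thesis using elim by blast
    qed (simp add: Wt_zero)
  qed
qed

text \<open>The right-hand side of the Volterra equation, now that the source is known to vanish outside the
  quadrant. It is defined and continuous in the whole plane.\<close>

definition W :: "real \<Rightarrow> real \<Rightarrow> real" where
  "W s r = 1 / 2 + 1 / 4 * (LINT z'|lborel. indicator ({0<..<s} \<times> {0<..<r}) z' * (P z' * Wt z'))"

lemma PWt_loc_integrable: "loc_integrable UNIV (\<lambda>z. P z * Wt z)"
  unfolding loc_integrable_def set_integrable_def
proof (intro allI impI)
  fix A :: "(real \<times> real) set" assume "compact A \<and> A \<subseteq> UNIV"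
  then have "integrable lborel (\<lambda>x. indicator A x *\<^sub>R Wt x)"
    using Wt_loc_integrable by (auto simp: loc_integrable_def set_integrable_def)
  from integrable_mult_bounded[OF this P_measurable P_bound]
  show "integrable lborel (\<lambda>x. indicator A x *\<^sub>R (P x * Wt x))" by (simp add: mult_ac)
qed

lemma W_cont: "continuous_on UNIV (\<lambda>z. W (fst z) (snd z))"
  unfolding W_def by (intro continuous_intros continuous_on_rectangle_integral PWt_loc_integrable)

lemma W_AE: "AE z in lborel. 0 < fst z \<and> 0 < snd z \<longrightarrow> Wt z = W (fst z) (snd z)"
proof -
  have "AE z in lborel. \<forall>n::nat. z \<in> wave_triangle (real (Suc n)) \<longrightarrow> Wt z = free_wave z + 1 / 4 * source_integral (real (Suc n)) z"
    by (subst AE_all_countable) (intro allI volterra_local, simp)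
  then show ?thesis
  proof eventually_elim
    case (elim z)
    show ?case
    proof
      assume z: "0 < fst z \<and> 0 < snd z"
      obtain n where "max (fst z) (snd z) < real n" using reals_Archimedean2 by blast
      then have L: "fst z < real (Suc n)" "snd z < real (Suc n)" by auto
      let ?L = "real (Suc n)"
      have "z \<in> wave_triangle ?L" using z L by (auto simp: wave_triangle_def)
      with elim have "Wt z = free_wave z + 1 / 4 * source_integral ?L z" by blast
      also have "source_integral ?L z = (LINT z'|lborel. indicator ({0<..<fst z} \<times> {0<..<snd z}) z' * (P z' * Wt z'))"
        unfolding source_integral_def
      proof (rule integral_cong_AE)
        have [measurable]: "{0<..<s} \<times> {0<..<r} \<in> sets borel" for s r :: real by (intro borel_open open_Times) auto
        have [measurable]: "wave_source ?L \<in> borel_measurable borel" using wave_source_integrable[of ?L] by auto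
        show "(\<lambda>z'. indicator {z'. fst z' < fst z \<and> snd z' < snd z} z' * wave_source ?L z') \<in> borel_measurable lborel" by measurable
        show "(\<lambda>z'. indicator ({0<..<fst z} \<times> {0<..<snd z}) z' * (P z' * Wt z')) \<in> borel_measurable lborel" by measurable
        show "AE z' in lborel. indicator {z'. fst z' < fst z \<and> snd z' < snd z} z' * wave_source ?L z' =
            indicator ({0<..<fst z} \<times> {0<..<snd z}) z' * (P z' * Wt z')"
          using vanish AE_fst[OF AE_lborel_singleton[of 0]] AE_snd[OF AE_lborel_singleton[of 0]]
        proof eventually_elim
          case (elim z')
          show ?case
          proof (cases "0 < fst z' \<and> 0 < snd z'")
            case True
            then show ?thesis using L z by (cases z') (auto simp: wave_source_def square_upto_def indicator_def)
          next
            case False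
            then have "Wt z' = 0" using elim by auto
            then show ?thesis by (simp add: wave_source_def)
          qed
        qed
      qed
      finally show "Wt z = W (fst z) (snd z)" using z by (simp add: W_def free_wave_def)
    qed
  qed
qed

text \<open>In the cone \<open>w\<close> is continuous, so an identity that holds almost everywhere holds at every point.\<close>

lemma W_eq_Wt:
  assumes "0 < fst z" "0 < snd z" shows "Wt z = W (fst z) (snd z)"
proof -
  let ?S = "{z::real \<times> real. 0 < fst z \<and> 0 < snd z}"
  have S: "open ?S" by (intro open_Collect_conj open_Collect_less continuous_intros)
  have cone: "char_inv ` ?S \<subseteq> {(y, t). \<bar>y\<bar> < t}" by (auto simp: char_inv_def)
  have wc: "continuous_on ?S (\<lambda>z. w (char_inv z))"
    by (rule continuous_on_compose2[OF _ char_cont(2) cone]) (use wave in \<open>simp add: wave_solution_def\<close>)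
  have eq: "Wt z = w (char_inv z)" if "z \<in> ?S" for z
    using that by (simp add: Wt_def w0_def char_inv_def)
  have "w (char_inv z) = W (fst z) (snd z)"
  proof (rule continuous_AE_eq[OF S wc continuous_on_subset[OF W_cont subset_UNIV]])
    show "AE z in lborel. z \<in> ?S \<longrightarrow> w (char_inv z) = W (fst z) (snd z)"
      using W_AE by eventually_elim (simp add: eq[symmetric])
    show "z \<in> ?S" using assms by simp
  qed
  then show ?thesis using eq[of z] assms by simp
qed

lemma W_integral_eq:
  assumes "s \<ge> 0" "r \<ge> 0"
  shows "W s r = 1 / 2 + 1 / 4 * integral (cbox (0, 0) (s, r)) (\<lambda>z. p ((fst z - snd z) / 2) * W (fst z) (snd z))"
proof -
  let ?F = "\<lambda>z::real \<times> real. p ((fst z - snd z) / 2) * W (fst z) (snd z)"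
  have Fc: "continuous_on A ?F" for A
    by (intro continuous_intros continuous_on_compose2[OF p_cont] continuous_on_subset[OF W_cont]) auto
  have bx: "box (0, 0) (s, r) = {0<..<s} \<times> {0<..<r}"
    by (auto simp: box_def Basis_prod_def inner_prod_def)
  have "(LINT z'|lborel. indicator ({0<..<s} \<times> {0<..<r}) z' * (P z' * Wt z')) = (LINT z':box (0, 0) (s, r)|lborel. ?F z')"
    unfolding set_lebesgue_integral_def bx
  proof (intro Bochner_Integration.integral_cong refl)
    fix z' :: "real \<times> real"
    show "indicator ({0<..<s} \<times> {0<..<r}) z' * (P z' * Wt z') = indicator ({0<..<s} \<times> {0<..<r}) z' *\<^sub>R ?F z'"
    proof (cases "z' \<in> {0<..<s} \<times> {0<..<r}")
      case True
      then have "0 < fst z'" "0 < snd z'" by auto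
      then show ?thesis using W_eq_Wt[of z'] by (simp add: P_def char_inv_def)
    qed simp
  qed
  also have "\<dots> = integral (box (0, 0) (s, r)) ?F"
  proof (rule set_borel_integral_eq_integral(2))
    have "set_integrable lborel (cbox (0, 0) (s, r)) ?F"
      unfolding set_integrable_def by (intro borel_integrable_compact Fc) auto
    then show "set_integrable lborel (box (0, 0) (s, r)) ?F"
      by (rule set_integrable_subset) (auto simp: box_subset_cbox)
  qed
  also have "\<dots> = integral (cbox (0, 0) (s, r)) ?F" by (rule integral_open_interval)
  finally show ?thesis by (simp add: W_def)
qed

lemma w_eq_W:
  assumes "0 < y" "0 < s" shows "w (y, s + y) = W (s + 2 * y) s"
proof -
  have "Wt (s + 2 * y, s) = W (s + 2 * y) s" using W_eq_Wt[of "(s + 2 * y, s)"] assms by simp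
  moreover have "char_inv (s + 2 * y, s) = (y, s + y)" by (simp add: char_inv_def)
  then have "Wt (s + 2 * y, s) = w (y, s + y)"
    using assms by (simp add: Wt_def w0_def)
  ultimately show ?thesis by simp
qed

end

text \<open>The function \<open>V\<close> of the Goursat problem is the derivative of \<open>w(y, s + y)\<close> in \<open>s\<close>: in
  characteristic coordinates the point \<open>(y, s + y)\<close> is \<open>(s + 2 y, s)\<close>.\<close>

lemma exact_solution_properties:
  assumes wave: "wave_solution p w" and p: "p C1_differentiable_on UNIV" and supp: "\<And>y. y < 0 \<or> y > d \<Longrightarrow> p y = 0"
    and bT: "0 < b" "0 < T" and H: "exact_V w \<in> Hk 2 (Rect b T)"
  shows "AE z in lborel. z \<in> Rect b T \<longrightarrow>
      wd (Rect b T) (yt 2 0) (exact_V w) z - 2 * wd (Rect b T) (yt 1 1) (exact_V w) z + p (fst z) * exact_V w z = 0"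
    and "AE y in lborel. y \<in> {0<..<b} \<longrightarrow> coeff_of b T (exact_V w) y = p y"
    and "\<exists>C>0. \<forall>z\<in>Rect b T. \<bar>exact_V w z\<bar> \<le> C"
    and "\<exists>C>0. \<forall>y. \<bar>p y\<bar> \<le> C" and "continuous_on UNIV p"
proof -
  obtain p' where p': "\<And>y. (p has_real_derivative p' y) (at y)" "continuous_on UNIV p'"
    using p unfolding C1_differentiable_on_def by (auto simp: has_real_derivative_iff_has_vector_derivative)
  show pc: "continuous_on UNIV p"
    using p'(1) by (meson DERIV_isCont continuous_at_imp_continuous_on)
  have "bounded (p ` {0..d})"
    by (intro compact_imp_bounded compact_continuous_image continuous_on_subset[OF pc]) auto
  then obtain C where C: "\<And>y. y \<in> {0..d} \<Longrightarrow> \<bar>p y\<bar> \<le> C" unfolding bounded_real by blast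
  have pb: "\<bar>p y\<bar> \<le> max C 1" for y
  proof (cases "y < 0 \<or> y > d")
    case True
    then show ?thesis using supp[of y] by auto
  next
    case False
    then show ?thesis using C[of y] by simp
  qed
  then show "\<exists>C>0. \<forall>y. \<bar>p y\<bar> \<le> C" by (intro exI[of _ "max C 1"]) auto
  interpret wp: wave_problem p w "max C 1"
    by unfold_locales (use wave pc pb in auto)
  interpret g: goursat p p' wp.W
    by unfold_locales (use p' wp.W_cont wp.W_integral_eq in auto)
  have VV: "exact_V w z = g.V z" if "z \<in> Rect b T" for z
  proof -
    obtain y t where z: "z = (y, t)" "0 < y" "0 < t" using \<open>z \<in> Rect b T\<close> by (auto simp: Rect_def)
    have "((\<lambda>s. w (y, s + y)) has_real_derivative g.V (y, t)) (at t)"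
      by (rule has_field_derivative_transform_within_open[OF g.W_time_deriv[OF z(2,3)], of "{0<..}"])
         (use z wp.w_eq_W in auto)
    then show ?thesis using z by (simp add: exact_V_def DERIV_imp_deriv)
  qed
  show "AE z in lborel. z \<in> Rect b T \<longrightarrow>
      wd (Rect b T) (yt 2 0) (exact_V w) z - 2 * wd (Rect b T) (yt 1 1) (exact_V w) z + p (fst z) * exact_V w z = 0"
    by (rule g.equation_AE[OF H VV])
  show "AE y in lborel. y \<in> {0<..<b} \<longrightarrow> coeff_of b T (exact_V w) y = p y"
    unfolding coeff_of_def by (rule g.initial_AE[OF H VV bT])
  obtain C' where "C' > 0" "\<And>z. z \<in> Rect b T \<Longrightarrow> \<bar>g.V z\<bar> \<le> C'" using g.V_bounded by metis
  then show "\<exists>C>0. \<forall>z\<in>Rect b T. \<bar>exact_V w z\<bar> \<le> C" using VV by (intro exI[of _ C']) auto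
qed

section \<open>Linear structure of the boundary conditions\<close>

lemma lborel_reflect: "distr lborel borel (\<lambda>z. (b - fst z, snd z)) = (lborel :: (real \<times> real) measure)"
proof -
  define c where "c = (\<lambda>j::real \<times> real. if j = (1, 0) then - 1 else (1::real))"
  have B: "(\<Sum>j\<in>Basis. F j) = F (1, 0) + F (0, 1)" for F :: "real \<times> real \<Rightarrow> real \<times> real"
    by (simp add: Basis_prod_def sum.union_disjoint)
  have T: "(\<lambda>x. (b, 0) + (\<Sum>j\<in>Basis. (c j * (x \<bullet> j)) *\<^sub>R j)) = (\<lambda>z. (b - fst z, snd z))"
    unfolding B by (auto simp: c_def inner_prod_def)
  have "(lborel :: (real \<times> real) measure) = density (distr lborel borel (\<lambda>z. (b - fst z, snd z))) (\<lambda>_. (\<Prod>j\<in>Basis. \<bar>c j\<bar>))"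
    using lborel_affine_euclidean[of c "(b, 0)"] unfolding T by (auto simp: c_def)
  moreover have "(\<Prod>j\<in>Basis. \<bar>c j\<bar>) = 1" unfolding prod_Basis_plane by (simp add: c_def)
  ultimately show ?thesis by (simp add: density_1)
qed

lemma reflect_measurable[measurable]: "(\<lambda>z::real \<times> real. (b - fst z, snd z)) \<in> borel_measurable borel"
  by (intro borel_measurable_continuous_onI continuous_intros)

lemma L2_reflect:
  assumes "u \<in> L2 (Rect b T)"
  shows "(\<lambda>z. u (b - fst z, snd z)) \<in> L2 (strip b {0<..<T})"
proof -
  define U where "U = (\<lambda>z. indicator (Rect b T) z * u z)"
  have U[measurable]: "U \<in> borel_measurable borel" and U2: "integrable lborel (\<lambda>z. (U z)\<^sup>2)"
    using L2D[OF assms] by (simp_all add: U_def)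
  have eq: "indicator (strip b {0<..<T}) z * u (b - fst z, snd z) = U (b - fst z, snd z)" for z
    by (cases z) (auto simp: U_def strip_def Rect_def indicator_def)
  have "integrable (distr lborel borel (\<lambda>z. (b - fst z, snd z))) (\<lambda>z. (U z)\<^sup>2)"
    unfolding lborel_reflect by (rule U2)
  then have "integrable lborel (\<lambda>z. (U (b - fst z, snd z))\<^sup>2)"
    by (subst (asm) integrable_distr_eq) auto
  then show ?thesis by (intro L2I; unfold eq) auto
qed

lemma AE_reflect:
  fixes P :: "real \<times> real \<Rightarrow> bool" and b :: real
  assumes "AE z in lborel. P z" shows "AE z in lborel. P (b - fst z, snd z)"
proof -
  have "AE z in distr lborel borel (\<lambda>z. (b - fst z, snd z)). P z" unfolding lborel_reflect by (rule assms)
  from AE_distrD[OF _ this] show ?thesis by simp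
qed

text \<open>The affine space that contains \<open>Bset\<close>. Without the bound on the norm the class is stable under
  linear combinations, the boundary data being combined in the same way.\<close>

definition boundary_class :: "real \<Rightarrow> real \<Rightarrow> (real \<Rightarrow> real) \<Rightarrow> (real \<Rightarrow> real) \<Rightarrow> (real \<times> real \<Rightarrow> real) set" where
  "boundary_class b T q0 q1 = {u \<in> Hk 4 (Rect b T).
     trace_left T u q0 \<and> trace_left T (wd (Rect b T) (yt 1 0) u) q1 \<and>
     trace_right b T (wd (Rect b T) (yt 1 0) u) (\<lambda>t. 0)}"

lemma Bset_boundary_class: "u \<in> Bset b T r q0 q1 \<longleftrightarrow> u \<in> boundary_class b T q0 q1 \<and> Hk_norm 4 (Rect b T) u < r"
  by (auto simp: Bset_def boundary_class_def)

lemma boundary_class_combo: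
  assumes b: "b > 0" and u: "u \<in> boundary_class b T q0 q1" and v: "v \<in> boundary_class b T r0 r1"
  shows "(\<lambda>x. u x + c * v x) \<in> boundary_class b T (\<lambda>t. q0 t + c * r0 t) (\<lambda>t. q1 t + c * r1 t)"
proof -
  let ?R = "Rect b T" and ?w = "\<lambda>x. u x + c * v x"
  let ?D = "wd (Rect b T) (yt 1 0)"
  have H: "u \<in> Hk 4 ?R" "v \<in> Hk 4 ?R" using u v by (auto simp: boundary_class_def)
  have wH: "?w \<in> Hk 4 ?R" by (rule Hk_combo[OF Rect_open H])
  have L: "u \<in> L2 ?R" "v \<in> L2 ?R" using H by (auto simp: Hk_def)
  have DL: "?D f \<in> L2 ?R" if "f \<in> Hk 4 ?R" for f
    by (rule Hk_wd(2)[OF Rect_open that]) simp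
  note D = DL[OF H(1)] DL[OF H(2)] DL[OF wH]
  have Dw: "AE x in lborel. x \<in> ?R \<longrightarrow> ?D ?w x = ?D u x + c * ?D v x"
    by (rule wd_combo[OF Rect_open H]) simp
  have I: "{0<..<T} \<in> sets borel" by simp
  have left: "(\<lambda>z. f (fst z, snd z)) \<in> L2 (strip b {0<..<T})" if "f \<in> L2 ?R" for f
    using that by (simp add: Rect_strip)
  have 1: "trace_left T ?w (\<lambda>t. q0 t + c * r0 t)"
    unfolding trace_left_def
    by (rule has_trace_combo[OF b I left[OF L(1)] left[OF L(2)]])
       (use u v in \<open>auto simp: boundary_class_def trace_left_def\<close>)
  have "has_trace {0<..<T} (\<lambda>s t. ?D u (s, t) + c * ?D v (s, t)) (\<lambda>t. q1 t + c * r1 t)"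
    by (rule has_trace_combo[OF b I left[OF D(1)] left[OF D(2)]])
       (use u v in \<open>auto simp: boundary_class_def trace_left_def\<close>)
  then have 2: "trace_left T (?D ?w) (\<lambda>t. q1 t + c * r1 t)"
    unfolding trace_left_def
  proof (rule has_trace_cong_AE[OF _ b I _ left[OF D(3)]])
    show "(\<lambda>z. ?D u (fst z, snd z) + c * ?D v (fst z, snd z)) \<in> L2 (strip b {0<..<T})"
      by (intro L2_combo left D)
  qed (use Dw in \<open>simp add: Rect_strip\<close>)
  have "has_trace {0<..<T} (\<lambda>s t. ?D u (b - s, t) + c * ?D v (b - s, t)) (\<lambda>t. 0 + c * 0)"
    by (rule has_trace_combo[OF b I L2_reflect[OF D(1)] L2_reflect[OF D(2)]])
       (use u v in \<open>auto simp: boundary_class_def trace_right_def\<close>)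
  then have "has_trace {0<..<T} (\<lambda>s t. ?D u (b - s, t) + c * ?D v (b - s, t)) (\<lambda>t. 0)" by simp
  then have 3: "trace_right b T (?D ?w) (\<lambda>t. 0)"
    unfolding trace_right_def
  proof (rule has_trace_cong_AE[OF _ b I _ L2_reflect[OF D(3)]])
    show "(\<lambda>z. ?D u (b - fst z, snd z) + c * ?D v (b - fst z, snd z)) \<in> L2 (strip b {0<..<T})"
      by (intro L2_combo L2_reflect D)
    show "AE z in lborel. z \<in> strip b {0<..<T} \<longrightarrow> ?D ?w (b - fst z, snd z) = ?D u (b - fst z, snd z) + c * ?D v (b - fst z, snd z)"
      using AE_reflect[OF Dw, of b] by eventually_elim (auto simp: strip_def Rect_def)
  qed
  show ?thesis using wH 1 2 3 by (simp add: boundary_class_def)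
qed

lemma boundary_class_H40: "u \<in> boundary_class b T (\<lambda>t. 0) (\<lambda>t. 0) \<Longrightarrow> u \<in> H40 b T"
  using Hk_mono[of u 4 "Rect b T" 2 "Rect b T"] Rect_measure(1)
  by (auto simp: boundary_class_def H40_def H20_def)

lemma Hk_norm_zero: "open \<Omega> \<Longrightarrow> u \<in> Hk k \<Omega> \<Longrightarrow> Hk_norm k \<Omega> (\<lambda>x. u x - u x) = 0"
  using Hk_norm_scale[of \<Omega> u k 0] by simp

lemma Bset_subset_Bclosure: "Bset b T r q0 q1 \<subseteq> Bclosure b T r q0 q1"
proof
  fix u assume u: "u \<in> Bset b T r q0 q1"
  then have H: "u \<in> Hk 4 (Rect b T)" by (simp add: Bset_def)
  then show "u \<in> Bclosure b T r q0 q1"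
    unfolding Bclosure_def using u Hk_norm_zero[OF Rect_open H] by (auto intro!: bexI[of _ u])
qed

text \<open>As the norm of \<open>V\<close> is strictly below \<open>M\<close>, the functions \<open>V + s d\<close> with small \<open>s > 0\<close> are
  admissible, so \<open>J\<close> cannot decrease to first order along \<open>d\<close>.\<close>

lemma gradient_nonneg_at_interior_minimizer:
  assumes b: "b > 0" and min: "is_minimizer J (Bclosure b T M q0 q1) V" and V: "V \<in> Bset b T M q0 q1"
    and grad: "is_gradient b T J V g" and d: "d \<in> boundary_class b T (\<lambda>t. 0) (\<lambda>t. 0)"
  shows "Hk_inner 4 (Rect b T) g d \<ge> 0"
proof (rule ccontr)
  let ?N = "Hk_norm 4 (Rect b T)" and ?I = "Hk_inner 4 (Rect b T) g d"
  assume "\<not> ?I \<ge> 0"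
  then have I: "?I < 0" by simp
  have dH: "d \<in> Hk 4 (Rect b T)" and VH: "V \<in> Hk 4 (Rect b T)"
    using d V by (auto simp: boundary_class_def Bset_def)
  have gH: "g \<in> Hk 4 (Rect b T)" using grad by (simp add: is_gradient_def H40_def)
  have N0: "?N d \<ge> 0" by (rule Hk_norm_nonneg)
  \<comment> \<open>an error of \<open>e\<close> times the norm of \<open>d\<close> is less than half of the slope; adding 1 avoids a case
    distinction for \<open>d = 0\<close>\<close>
  define e where "e = - ?I / (2 * (?N d + 1))"
  have e: "e > 0" unfolding e_def using I N0 by (intro divide_pos_pos) auto
  obtain \<delta> where \<delta>: "\<delta> > 0" "\<And>h. h \<in> H40 b T \<Longrightarrow> ?N h < \<delta> \<Longrightarrow>
      \<bar>J (\<lambda>x. V x + h x) - J V - Hk_inner 4 (Rect b T) g h\<bar> \<le> e * ?N h"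
    using grad e unfolding is_gradient_def by blast
  define m where "m = min \<delta> (M - ?N V)"
  have m: "m > 0" using \<delta> V by (simp add: m_def Bset_def)
  \<comment> \<open>so small that \<open>s d\<close> is in the domain of the expansion and \<open>V + s d\<close> remains in the ball\<close>
  define s where "s = m / (2 * (?N d + 1))"
  have s: "s > 0" using m N0 by (simp add: s_def)
  define h where "h = (\<lambda>x. s * d x)"
  have hd: "h \<in> boundary_class b T (\<lambda>t. 0) (\<lambda>t. 0)"
    using boundary_class_combo[OF b d d, of "s - 1"] by (simp add: h_def algebra_simps)
  have hN: "?N h = s * ?N d" unfolding h_def using Hk_norm_scale[OF Rect_open dH, of s] s by simp
  have "s * ?N d \<le> m / 2"
    using m N0 by (simp add: s_def field_simps)
  then have hm: "?N h < m" using hN m by simp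
  have "(\<lambda>x. V x + 1 * h x) \<in> boundary_class b T (\<lambda>t. q0 t + 1 * 0) (\<lambda>t. q1 t + 1 * 0)"
    by (rule boundary_class_combo[OF b _ hd]) (use V in \<open>simp add: Bset_boundary_class\<close>)
  moreover have "?N (\<lambda>x. V x + h x) < M"
  proof -
    have "?N (\<lambda>x. V x + h x) \<le> ?N V + ?N h"
      by (rule Hk_norm_triangle[OF Rect_open VH]) (use hd in \<open>simp add: boundary_class_def\<close>)
    then show ?thesis using hm by (simp add: m_def)
  qed
  ultimately have "(\<lambda>x. V x + h x) \<in> Bset b T M q0 q1" by (simp add: Bset_boundary_class)
  then have j1: "J V \<le> J (\<lambda>x. V x + h x)"
    using min Bset_subset_Bclosure[of b T M q0 q1] by (auto simp: is_minimizer_def)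
  have "\<bar>J (\<lambda>x. V x + h x) - J V - Hk_inner 4 (Rect b T) g h\<bar> \<le> e * ?N h"
    by (rule \<delta>(2)[OF boundary_class_H40[OF hd]]) (use hm in \<open>simp add: m_def\<close>)
  then have j2: "J (\<lambda>x. V x + h x) - J V - Hk_inner 4 (Rect b T) g h \<le> e * ?N h" by (simp only: abs_le_iff)
  have j3: "Hk_inner 4 (Rect b T) g h = s * ?I"
    unfolding h_def by (rule Hk_inner_scale[OF Rect_open gH dH])
  have "0 \<le> Hk_inner 4 (Rect b T) g h + e * ?N h" using j1 j2 by linarith
  then have "0 \<le> s * ?I + e * (s * ?N d)" unfolding j3 hN .
  then have "0 \<le> s * (?I + e * ?N d)" by (simp add: algebra_simps)
  then have "0 \<le> ?I + e * ?N d" using s by (simp add: zero_le_mult_iff)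
  moreover have "e * ?N d \<le> - ?I / 2"
    using I N0 by (simp add: e_def field_simps)
  ultimately show False using I by simp
qed

section \<open>The functional near the exact solution\<close>

lemma five_squares: "(a + b + (c + (d + e)))\<^sup>2 \<le> 4 * a\<^sup>2 + 4 * b\<^sup>2 + 4 * c\<^sup>2 + 8 * d\<^sup>2 + 8 * e\<^sup>2" for a b c d e :: real
  using two_squares[of "a + b" "c + (d + e)"] two_squares[of a b] two_squares[of c "d + e"] two_squares[of d e]
  by linarith

text \<open>Write \<tau> for the trace of \<open>h\<^sub>y\<close>. Since \<open>S(V) = 0\<close> and \<open>4 V\<^sub>y(y, 0) = p(y)\<close>, one has
  \<open>S(V + h) = h\<^sub>y\<^sub>y - 2 h\<^sub>y\<^sub>t + p h + 4 \<tau> V + 4 \<tau> h\<close>. The first four terms are linear in \<open>h\<close>. In the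
  last one, \<open>h(y, t)\<^sup>2 \<le> m(t)\<close> separates the variables and makes the integral of the square a product of
  two integrals, each of order \<open>n\<^sup>2\<close>. The weight is at most 1.\<close>

lemma residual_bound:
  assumes bT: "0 < b" "0 < T" and V: "V \<in> Hk 4 (Rect b T)" and h: "h \<in> Hk 4 (Rect b T)"
    and small: "Hk_norm 4 (Rect b T) h \<le> 1"
    and eq: "AE z in lborel. z \<in> Rect b T \<longrightarrow>
      wd (Rect b T) (yt 2 0) V z - 2 * wd (Rect b T) (yt 1 1) V z + p (fst z) * V z = 0"
    and init: "AE y in lborel. y \<in> {0<..<b} \<longrightarrow> coeff_of b T V y = p y"
    and CV: "\<And>z. z \<in> Rect b T \<Longrightarrow> \<bar>V z\<bar> \<le> CV" and Cp: "\<And>y. \<bar>p y\<bar> \<le> Cp" and l: "0 \<le> l" "0 < \<beta>"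
  shows "(LINT x:Rect b T|lborel. (S_op b T (\<lambda>x. V x + h x) x)\<^sup>2 * psi \<beta> l x)
    \<le> (20 + 4 * Cp\<^sup>2 + 128 * CV\<^sup>2 * T * (2 / T + 2 * T) + 128 * (2 / T + 2 * T) * (4 / b + 6 * b)) * (Hk_norm 4 (Rect b T) h)\<^sup>2"
proof -
  let ?R = "Rect b T"
  define n where "n = Hk_norm 4 ?R h"
  define Ct where "Ct = 2 / T + 2 * T"
  define Cm where "Cm = 4 / b + 6 * b"
  have n: "0 \<le> n" "n \<le> 1" using small by (simp_all add: n_def Hk_norm_nonneg)
  have pos: "Ct > 0" "Cm > 0" using bT by (auto simp: Ct_def Cm_def intro!: add_pos_pos)
  have lower: "u \<in> Hk k ?R" "Hk_norm k ?R u \<le> Hk_norm 4 ?R u" if "u \<in> Hk 4 ?R" "k \<le> 4" for u k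
    using Hk_mono[OF that(1,2) order_refl Rect_measure(1)] Hk_norm_mono[OF Rect_open Rect_open that(1,2) order_refl] by auto
  define \<tau> where "\<tau> = bottom b (wd ?R (yt 1 0) h)"
  have h2: "h \<in> Hk 2 ?R" and h1: "h \<in> Hk 1 ?R" and V2: "V \<in> Hk 2 ?R" using lower(1) h V by auto
  have \<tau>L: "\<tau> \<in> L2 {0<..<b}" unfolding \<tau>_def by (rule bottom_wd_norm(2)[OF bT h2])
  have \<tau>n: "(L2_norm {0<..<b} \<tau>)\<^sup>2 \<le> Ct * n\<^sup>2"
  proof -
    have "(L2_norm {0<..<b} \<tau>)\<^sup>2 \<le> Ct * (Hk_norm 2 ?R h)\<^sup>2"
      unfolding \<tau>_def Ct_def by (rule bottom_wd_norm(1)[OF bT h2])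
    also have "\<dots> \<le> Ct * n\<^sup>2"
      using lower(2)[OF h, of 2] pos by (intro mult_left_mono power_mono) (auto simp: n_def Hk_norm_nonneg)
    finally show ?thesis .
  qed
  obtain m where m: "integrable lborel m" "\<And>t. m t \<ge> 0" "(LINT t|lborel. m t) \<le> Cm * (Hk_norm 1 ?R h)\<^sup>2"
    "AE z in lborel. z \<in> ?R \<longrightarrow> (h z)\<^sup>2 \<le> m (snd z)"
  proof (rule Hk_sup_bound[OF bT h1])
    fix k assume k: "integrable lborel k" "\<And>t. k t \<ge> 0" "(LINT t|lborel. k t) \<le> (4 / b + 6 * b) * (Hk_norm 1 ?R h)\<^sup>2"
      "AE z in lborel. z \<in> ?R \<longrightarrow> (h z)\<^sup>2 \<le> k (snd z)"
    show thesis by (rule that[OF k(1,2) _ k(4)]) (use k(3) in \<open>simp add: Cm_def\<close>)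
  qed
  have mn: "(LINT t|lborel. m t) \<le> Cm * n\<^sup>2"
  proof -
    have "Cm * (Hk_norm 1 ?R h)\<^sup>2 \<le> Cm * n\<^sup>2"
      using lower(2)[OF h, of 1] pos by (intro mult_left_mono power_mono) (auto simp: n_def Hk_norm_nonneg)
    then show ?thesis using m(3) by simp
  qed
  let ?W = "\<lambda>x. V x + h x"
  have W: "?W \<in> Hk 4 ?R" using Hk_combo[OF Rect_open V h, of 1] by simp
  have d20: "AE x in lborel. x \<in> ?R \<longrightarrow> wd ?R (yt 2 0) ?W x = wd ?R (yt 2 0) V x + wd ?R (yt 2 0) h x"
    using wd_combo[OF Rect_open V h, of 2 0 1] by simp
  have d11: "AE x in lborel. x \<in> ?R \<longrightarrow> wd ?R (yt 1 1) ?W x = wd ?R (yt 1 1) V x + wd ?R (yt 1 1) h x"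
    using wd_combo[OF Rect_open V h, of 1 1 1] by simp
  have bot: "AE y in lborel. y \<in> {0<..<b} \<longrightarrow> bottom b (wd ?R (yt 1 0) ?W) y = bottom b (wd ?R (yt 1 0) V) y + 1 * \<tau> y"
    unfolding \<tau>_def
  proof (rule bottom_combo[OF bT])
    have 1: "wd ?R (yt 1 0) f \<in> L2 ?R" if "f \<in> Hk 4 ?R" for f by (rule Hk_wd(2)[OF Rect_open that]) simp
    have 2: "wd ?R (yt 1 1) f \<in> L2 ?R" if "f \<in> Hk 4 ?R" for f by (rule Hk_wd(2)[OF Rect_open that]) simp
    show "wd ?R (yt 1 0) V \<in> L2 ?R" "wd ?R (yt 1 1) V \<in> L2 ?R" "wd ?R (yt 1 0) h \<in> L2 ?R" "wd ?R (yt 1 1) h \<in> L2 ?R" "wd ?R (yt 1 0) ?W \<in> L2 ?R"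
      by (rule 1[OF V] 2[OF V] 1[OF h] 2[OF h] 1[OF W])+
    show "AE z in lborel. z \<in> ?R \<longrightarrow> wd ?R (yt 1 0) ?W z = wd ?R (yt 1 0) V z + 1 * wd ?R (yt 1 0) h z"
      using wd_combo[OF Rect_open V h, of 1 0 1] by simp
  qed (rule Hk_wd_split V2 h2)+
  define Bd where "Bd = (\<lambda>z. 4 * (indicator ?R z * wd ?R (yt 2 0) h z)\<^sup>2 + 16 * (indicator ?R z * wd ?R (yt 1 1) h z)\<^sup>2
    + 4 * Cp\<^sup>2 * (indicator ?R z * h z)\<^sup>2
    + 128 * CV\<^sup>2 * ((indicator {0<..<b} (fst z) * \<tau> (fst z))\<^sup>2 * indicator {0<..<T} (snd z))
    + 128 * ((indicator {0<..<b} (fst z) * \<tau> (fst z))\<^sup>2 * m (snd z)))"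
  have iT: "integrable lborel (indicator {0<..<T} :: real \<Rightarrow> real)" by (rule integrable_indicator_bounded) auto
  note p1 = product_integral[OF L2D(2)[OF \<tau>L] iT] and p2 = product_integral[OF L2D(2)[OF \<tau>L] m(1)]
  have hL: "wd ?R (yt 2 0) h \<in> L2 ?R" "wd ?R (yt 1 1) h \<in> L2 ?R" "h \<in> L2 ?R"
    using Hk_wd(2)[OF Rect_open h] h by (auto simp: Hk_def)
  note sq = L2D(2)[OF hL(1)] L2D(2)[OF hL(2)] L2D(2)[OF hL(3)]
  have Bi: "integrable lborel Bd" unfolding Bd_def
    by (intro Bochner_Integration.integrable_add integrable_mult_right sq p1(1) p2(1))
  have CV0: "CV \<ge> 0" if "z \<in> ?R" for z using CV[OF that] by linarith
  have "(LINT x:?R|lborel. (S_op b T ?W x)\<^sup>2 * psi \<beta> l x) \<le> (LINT z|lborel. Bd z)"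
    unfolding set_lebesgue_integral_def
  proof (rule integral_mono_AE'[OF Bi])
    show "AE z in lborel. 0 \<le> Bd z" using m(2) by (auto simp: Bd_def)
    show "AE z in lborel. indicator ?R z *\<^sub>R ((S_op b T ?W z)\<^sup>2 * psi \<beta> l z) \<le> Bd z"
      using eq d20 d11 AE_fst[OF bot] AE_fst[OF init] m(4)
    proof eventually_elim
      case (elim z)
      show ?case
      proof (cases "z \<in> ?R")
        case True
        then have z: "fst z \<in> {0<..<b}" "snd z \<in> {0<..<T}" by (auto simp: Rect_def)
        let ?t = "\<tau> (fst z)"
        have S: "S_op b T ?W z = wd ?R (yt 2 0) h z + (- 2) * wd ?R (yt 1 1) h z
            + (p (fst z) * h z + (4 * ?t * V z + 4 * ?t * h z))"
        proof -
          have "4 * bottom b (wd ?R (yt 1 0) V) (fst z) = p (fst z)"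
            using elim(5) z(1) by (simp add: coeff_of_def)
          then have "4 * bottom b (wd ?R (yt 1 0) ?W) (fst z) = p (fst z) + 4 * ?t"
            using elim(4) z(1) by simp
          then have "S_op b T ?W z = (wd ?R (yt 2 0) V z + wd ?R (yt 2 0) h z) - 2 * (wd ?R (yt 1 1) V z + wd ?R (yt 1 1) h z)
             + (p (fst z) + 4 * ?t) * (V z + h z)"
            using elim(2,3) True by (simp add: S_op_def)
          then show ?thesis using elim(1) True by (simp add: algebra_simps)
        qed
        have "(S_op b T ?W z)\<^sup>2 * psi \<beta> l z \<le> (S_op b T ?W z)\<^sup>2 * 1"
        proof (rule mult_left_mono)
          have "0 \<le> l * (fst z + \<beta> * snd z)" using l z by simp
          then show "psi \<beta> l z \<le> 1" by (cases z) (simp add: psi_def mult.assoc)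
        qed simp
        also have "\<dots> \<le> 4 * (wd ?R (yt 2 0) h z)\<^sup>2 + 4 * ((- 2) * wd ?R (yt 1 1) h z)\<^sup>2
            + 4 * (p (fst z) * h z)\<^sup>2 + 8 * (4 * ?t * V z)\<^sup>2 + 8 * (4 * ?t * h z)\<^sup>2"
          unfolding S mult_1_right by (rule five_squares)
        also have "\<dots> = 4 * (wd ?R (yt 2 0) h z)\<^sup>2 + 16 * (wd ?R (yt 1 1) h z)\<^sup>2
            + 4 * ((p (fst z))\<^sup>2 * (h z)\<^sup>2) + 128 * (?t\<^sup>2 * (V z)\<^sup>2) + 128 * (?t\<^sup>2 * (h z)\<^sup>2)"
          by (simp add: power_mult_distrib)
        also have "\<dots> \<le> 4 * (wd ?R (yt 2 0) h z)\<^sup>2 + 16 * (wd ?R (yt 1 1) h z)\<^sup>2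
            + 4 * (Cp\<^sup>2 * (h z)\<^sup>2) + 128 * (?t\<^sup>2 * CV\<^sup>2) + 128 * (?t\<^sup>2 * m (snd z))"
        proof -
          have "(p (fst z))\<^sup>2 \<le> Cp\<^sup>2" using power_mono[OF Cp[of "fst z"], of 2] by simp
          moreover have "(V z)\<^sup>2 \<le> CV\<^sup>2" using power_mono[OF CV[OF True], of 2] by simp
          moreover have "(h z)\<^sup>2 \<le> m (snd z)" using elim(6) True by simp
          ultimately show ?thesis by (intro add_mono mult_left_mono mult_right_mono order_refl) auto
        qed
        also have "\<dots> = Bd z" using z True by (simp add: Bd_def)
        finally show ?thesis using True by simp
      next
        case False
        then show ?thesis using m(2) by (simp add: Bd_def)
      qed
    qed
  qed
  also have "(LINT z|lborel. Bd z) = 4 * (L2_norm ?R (wd ?R (yt 2 0) h))\<^sup>2 + 16 * (L2_norm ?R (wd ?R (yt 1 1) h))\<^sup>2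
     + 4 * Cp\<^sup>2 * (L2_norm ?R h)\<^sup>2 + 128 * CV\<^sup>2 * ((L2_norm {0<..<b} \<tau>)\<^sup>2 * T)
     + 128 * ((L2_norm {0<..<b} \<tau>)\<^sup>2 * (LINT t|lborel. m t))"
  proof -
    have "(LINT t|lborel. indicator {0<..<T} t) = T" using bT by simp
    then show ?thesis
      unfolding Bd_def L2_norm_power2 using sq p1 p2 by simp
  qed
  also have "\<dots> \<le> 4 * n\<^sup>2 + 16 * n\<^sup>2 + 4 * Cp\<^sup>2 * n\<^sup>2 + 128 * CV\<^sup>2 * ((Ct * n\<^sup>2) * T) + 128 * ((Ct * n\<^sup>2) * (Cm * 1))"
  proof -
    have 1: "(L2_norm ?R (wd ?R (yt i j) h))\<^sup>2 \<le> n\<^sup>2" if "i + j \<le> 4" for i j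
      unfolding n_def by (intro power_mono L2_norm_wd_le L2_norm_nonneg that)
    have 2: "(L2_norm ?R h)\<^sup>2 \<le> n\<^sup>2"
      unfolding n_def by (intro power_mono L2_norm_wd_zero Rect_open h L2_norm_nonneg)
    \<comment> \<open>of the factor \<open>n\<^sup>4\<close> from the quadratic term, \<open>n\<^sup>2\<close> is estimated by 1\<close>
    have "n\<^sup>2 \<le> 1" using n by (simp add: power_le_one)
    then have "Cm * n\<^sup>2 \<le> Cm * 1" using pos by (intro mult_left_mono) auto
    then have 3: "(LINT t|lborel. m t) \<le> Cm * 1" using mn by linarith
    have m0: "(LINT t|lborel. m t) \<ge> 0" using m(2) by simp
    show ?thesis
      using 1[of 2 0] 1[of 1 1] 2 3 \<tau>n bT pos m0 by (intro add_mono mult_left_mono mult_right_mono mult_mono) auto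
  qed
  also have "\<dots> = (20 + 4 * Cp\<^sup>2 + 128 * CV\<^sup>2 * T * Ct + 128 * Ct * Cm) * n\<^sup>2"
    by (simp add: algebra_simps)
  finally show ?thesis by (simp add: n_def Ct_def Cm_def)
qed

section \<open>The convergence estimate\<close>

lemma Rtri_open: "open (Rtri \<beta> \<mu> b)"
  unfolding Rtri_def case_prod_beta' by (intro open_Collect_conj open_Collect_less continuous_intros)

lemma Rtri_subset:
  assumes "0 < \<beta>" "\<beta> < 1 / 2" "0 < \<mu>" "0 < b" "T \<ge> 4 * b" shows "Rtri \<beta> \<mu> b \<subseteq> Rect b T"
proof
  fix z assume "z \<in> Rtri \<beta> \<mu> b"
  then obtain y t where z: "z = (y, t)" "y + \<beta> * t < 2 * \<beta> * b - \<mu>" "0 < y" "0 < t" by (auto simp: Rtri_def)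
  have "\<beta> * t > 0" using z assms by simp
  moreover have "2 * \<beta> * b < b" using assms by simp
  ultimately have "y < b" using z assms by linarith
  moreover have "\<beta> * t < \<beta> * (2 * b)" using z(2,3) assms(3) by (simp only: mult.left_commute[of \<beta> 2 b])
  then have "t < 2 * b" using mult_less_cancel_left_pos[OF assms(1), of t "2 * b"] by blast
  ultimately show "z \<in> Rect b T" using z assms by (simp add: Rect_def)
qed

lemma L2_norm_le_H1_norm: "L2_norm I (wd I [1] g) \<le> H1_norm I g"
  unfolding H1_norm_def by (rule real_le_rsqrt) simp

text \<open>By \<open>bottom_weak_deriv\<close> the trace of the difference of \<open>u\<^sub>y\<close> and \<open>v\<^sub>y\<close> is the weak derivative of
  the difference of the traces, one of the two parts of the \<open>H\<^sup>1\<close> norm.\<close>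

lemma trace_difference_bound:
  assumes bT: "0 < b" "0 < T" and u: "u \<in> Hk 4 (Rect b T)" and v: "v \<in> Hk 4 (Rect b T)" and r: "0 < r" "r \<le> b"
  shows "L2_norm {0<..<r} (\<lambda>y. bottom b (wd (Rect b T) (yt 1 0) u) y + (- 1) * bottom b (wd (Rect b T) (yt 1 0) v) y)
    \<le> H1_norm {0<..<r} (\<lambda>y. bottom b u y - bottom b v y)"
proof -
  let ?R = "Rect b T" and ?I = "{0<..<r}"
  let ?d = "\<lambda>y. bottom b (wd ?R (yt 1 0) u) y + (- 1) * bottom b (wd ?R (yt 1 0) v) y"
  have H2: "u \<in> Hk 2 ?R" "v \<in> Hk 2 ?R"
    using Hk_mono[OF u, of 2 ?R] Hk_mono[OF v, of 2 ?R] Rect_measure(1) by auto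
  have "weak_deriv {0<..<b} [1] (\<lambda>y. bottom b u y + (- 1) * bottom b v y) ?d"
    by (rule weak_deriv_combo[OF _ bottom_weak_deriv[OF bT H2(1)] bottom_weak_deriv[OF bT H2(2)]]) simp
  moreover have "?I \<subseteq> {0<..<b}" using r by auto
  ultimately have "weak_deriv ?I [1] (\<lambda>y. bottom b u y + (- 1) * bottom b v y) ?d"
    using weak_deriv_restrict[of "[1 :: real]" "{0<..<b}"] by simp
  then have wdd: "weak_deriv ?I [1] (\<lambda>y. bottom b u y - bottom b v y) ?d" by simp
  have dL: "?d \<in> L2 ?I"
    by (rule L2_mono(1)[OF L2_combo[OF bottom_wd_norm(2)[OF bT H2(1)] bottom_wd_norm(2)[OF bT H2(2)]]])
       (use r in auto)
  have ae: "AE y in lborel. y \<in> ?I \<longrightarrow> wd ?I [1] (\<lambda>y. bottom b u y - bottom b v y) y = ?d y"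
    by (rule wd_AE_eq[OF _ _ wdd]) auto
  have "set_borel_measurable lborel ?I (wd ?I [1] (\<lambda>y. bottom b u y - bottom b v y))"
    using wd_weak_deriv[OF wdd] by (intro loc_integrable_measurable) (auto simp: weak_deriv_def)
  from L2_cong_AE[OF dL this ae]
  have "wd ?I [1] (\<lambda>y. bottom b u y - bottom b v y) \<in> L2 ?I" .
  from L2_norm_cong_AE[OF dL this ae]
  have "L2_norm ?I ?d = L2_norm ?I (wd ?I [1] (\<lambda>y. bottom b u y - bottom b v y))" by simp
  then show ?thesis using L2_norm_le_H1_norm by simp
qed

lemma bottom_wd_combo:
  assumes bT: "0 < b" "0 < T" and u: "u \<in> Hk 4 (Rect b T)" and v: "v \<in> Hk 4 (Rect b T)"
  shows "AE y in lborel. y \<in> {0<..<b} \<longrightarrow> bottom b (wd (Rect b T) (yt 1 0) (\<lambda>x. u x + c * v x)) y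
    = bottom b (wd (Rect b T) (yt 1 0) u) y + c * bottom b (wd (Rect b T) (yt 1 0) v) y"
proof (rule bottom_combo[OF bT])
  let ?R = "Rect b T"
  have H2: "u \<in> Hk 2 ?R" "v \<in> Hk 2 ?R"
    using Hk_mono[OF u, of 2 ?R] Hk_mono[OF v, of 2 ?R] Rect_measure(1) by auto
  have 1: "wd ?R (yt 1 0) f \<in> L2 ?R" "wd ?R (yt 1 1) f \<in> L2 ?R" if "f \<in> Hk 4 ?R" for f
    by (rule Hk_wd(2)[OF Rect_open that], simp)+
  show "wd ?R (yt 1 0) u \<in> L2 ?R" "wd ?R (yt 1 1) u \<in> L2 ?R" "wd ?R (yt 1 0) v \<in> L2 ?R" "wd ?R (yt 1 1) v \<in> L2 ?R"
    "wd ?R (yt 1 0) (\<lambda>x. u x + c * v x) \<in> L2 ?R"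
    by (rule 1[OF u] 1[OF v] 1(1)[OF Hk_combo[OF Rect_open u v]])+
  show "weak_deriv ?R (yt 0 1) (wd ?R (yt 1 0) u) (wd ?R (yt 1 1) u)"
    "weak_deriv ?R (yt 0 1) (wd ?R (yt 1 0) v) (wd ?R (yt 1 1) v)"
    by (rule Hk_wd_split[OF H2(1)] Hk_wd_split[OF H2(2)])+
  show "AE z in lborel. z \<in> ?R \<longrightarrow> wd ?R (yt 1 0) (\<lambda>x. u x + c * v x) z = wd ?R (yt 1 0) u z + c * wd ?R (yt 1 0) v z"
    by (rule wd_combo[OF Rect_open u v]) simp
qed

lemma parameter_arithmetic:
  fixes \<sigma> :: real
  assumes \<sigma>: "0 < \<sigma>" "\<sigma> < 1" and q: "0 < q" and lam: "lam = ln (\<sigma> powr (- 1 / (2 * q)))"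
  shows "lam = - ln \<sigma> / (2 * q)" "exp (- 2 * lam * q) = \<sigma>" "exp (- lam * r) = \<sigma> powr (r / (2 * q))"
proof -
  show l: "lam = - ln \<sigma> / (2 * q)" using \<sigma> by (simp add: lam ln_powr)
  have "- 2 * lam * q = ln \<sigma>" using q by (simp add: l)
  then show "exp (- 2 * lam * q) = \<sigma>" using \<sigma> by simp
  have "- lam * r = r / (2 * q) * ln \<sigma>" by (simp add: l)
  then show "exp (- lam * r) = \<sigma> powr (r / (2 * q))" using \<sigma> by (simp add: powr_def)
qed

text \<open>The convexity inequality between \<open>Vm\<close> and the shifted exact solution \<open>W\<close>; the gradient term,
  \<open>J(Vm)\<close> and the term with the \<open>H\<^sup>4\<close> norm are nonnegative and are dropped.\<close>

lemma stability_estimate: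
  assumes bT: "0 < b" "T \<ge> 4 * b" and \<beta>: "0 < \<beta>" "\<beta> < 1 / 2" and \<mu>: "0 < \<mu>" "\<mu> < 2 * \<beta> * b" and M: "M > 0"
    and Vs: "Vs \<in> Bset b T M qs0 qs1"
    and F: "F \<in> boundary_class b T q0 q1" and Fs: "Fs \<in> boundary_class b T qs0 qs1"
    and \<sigma>: "Hk_norm 4 (Rect b T) (\<lambda>x. F x - Fs x) < \<sigma>" "0 < \<sigma>" "\<sigma> < 1" "\<sigma> < M"
    and eq: "AE z in lborel. z \<in> Rect b T \<longrightarrow>
      wd (Rect b T) (yt 2 0) Vs z - 2 * wd (Rect b T) (yt 1 1) Vs z + p (fst z) * Vs z = 0"
    and init: "AE y in lborel. y \<in> {0<..<b} \<longrightarrow> coeff_of b T Vs y = p y"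
    and CV: "\<And>z. z \<in> Rect b T \<Longrightarrow> \<bar>Vs z\<bar> \<le> CV" and Cp: "\<And>y. \<bar>p y\<bar> \<le> Cp"
    and l: "l \<ge> 1" and \<gamma>: "0 < \<gamma>" "\<gamma> < 1" and K1: "K1 > 0"
    and min: "is_minimizer (J_fun b T \<beta> l \<gamma>) (Bclosure b T M q0 q1) Vm" and Vm: "Vm \<in> Bset b T M q0 q1"
    and convex: "\<And>V1. V1 \<in> Bclosure b T (3 * M) q0 q1 \<Longrightarrow> \<exists>g. is_gradient b T (J_fun b T \<beta> l \<gamma>) V1 g \<and>
         (\<forall>V2 \<in> Bclosure b T (3 * M) q0 q1.
            J_fun b T \<beta> l \<gamma> V2 - J_fun b T \<beta> l \<gamma> V1 - Hk_inner 4 (Rect b T) g (\<lambda>x. V2 x - V1 x)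
            \<ge> K1 * exp (- 2 * l * (2 * \<beta> * b - \<mu>))
                * ((Hk_norm 1 (Rtri \<beta> \<mu> b) (\<lambda>x. V2 x - V1 x))\<^sup>2
                   + (H1_norm {0<..<2 * \<beta> * b - \<mu>} (\<lambda>y. bottom b V2 y - bottom b V1 y))\<^sup>2)
              + \<gamma> / 2 * (Hk_norm 4 (Rect b T) (\<lambda>x. V2 x - V1 x))\<^sup>2)"
  defines "W \<equiv> \<lambda>x. Vs x + (F x - Fs x)"
  defines "KJ \<equiv> 20 + 4 * Cp\<^sup>2 + 128 * CV\<^sup>2 * T * (2 / T + 2 * T) + 128 * (2 / T + 2 * T) * (4 / b + 6 * b)"
  shows "W \<in> boundary_class b T q0 q1"
    and "K1 * exp (- 2 * l * (2 * \<beta> * b - \<mu>)) * ((Hk_norm 1 (Rtri \<beta> \<mu> b) (\<lambda>x. W x - Vm x))\<^sup>2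
      + (H1_norm {0<..<2 * \<beta> * b - \<mu>} (\<lambda>y. bottom b W y - bottom b Vm y))\<^sup>2) \<le> KJ * \<sigma>\<^sup>2 + 4 * \<gamma> * M\<^sup>2"
proof -
  let ?R = "Rect b T" and ?N = "Hk_norm 4 (Rect b T)" and ?J = "J_fun b T \<beta> l \<gamma>"
  have T: "T > 0" using bT by simp
  define h where "h = (\<lambda>x. F x - Fs x)"
  have hc: "h \<in> boundary_class b T (\<lambda>t. q0 t + (- 1) * qs0 t) (\<lambda>t. q1 t + (- 1) * qs1 t)"
    using boundary_class_combo[OF bT(1) F Fs, of "- 1"] by (simp add: h_def)
  have hH: "h \<in> Hk 4 ?R" using hc by (simp add: boundary_class_def)
  have VsH: "Vs \<in> Hk 4 ?R" and VsN: "?N Vs < M" using Vs by (auto simp: Bset_def)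
  have hN: "?N h < \<sigma>" using \<sigma>(1) by (simp add: h_def)
  have hN0: "0 \<le> ?N h" by (rule Hk_norm_nonneg)
  have Vsc: "Vs \<in> boundary_class b T qs0 qs1" using Vs by (simp add: Bset_boundary_class)
  show Wc: "W \<in> boundary_class b T q0 q1"
    using boundary_class_combo[OF bT(1) Vsc hc, of 1] by (simp add: W_def h_def)
  have Weq: "W = (\<lambda>x. Vs x + h x)" by (simp add: W_def h_def)
  have WN: "?N W < 2 * M"
    using Hk_norm_triangle[OF Rect_open VsH hH] VsN hN \<sigma> unfolding Weq by linarith
  have Wcl: "W \<in> Bclosure b T (3 * M) q0 q1"
    using Wc WN M Bset_subset_Bclosure[of b T "3 * M" q0 q1] by (auto simp: Bset_boundary_class)
  have Vmc: "Vm \<in> boundary_class b T q0 q1" and VmN: "?N Vm < M" using Vm by (auto simp: Bset_boundary_class)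
  have Vmcl: "Vm \<in> Bclosure b T (3 * M) q0 q1"
    using Vmc VmN M Bset_subset_Bclosure[of b T "3 * M" q0 q1] by (auto simp: Bset_boundary_class)
  obtain g where g: "is_gradient b T ?J Vm g" and gW: "?J W - ?J Vm - Hk_inner 4 ?R g (\<lambda>x. W x - Vm x)
            \<ge> K1 * exp (- 2 * l * (2 * \<beta> * b - \<mu>))
                * ((Hk_norm 1 (Rtri \<beta> \<mu> b) (\<lambda>x. W x - Vm x))\<^sup>2
                   + (H1_norm {0<..<2 * \<beta> * b - \<mu>} (\<lambda>y. bottom b W y - bottom b Vm y))\<^sup>2)
              + \<gamma> / 2 * (?N (\<lambda>x. W x - Vm x))\<^sup>2"
    using convex[OF Vmcl] Wcl by blast
  have "(\<lambda>x. W x + (- 1) * Vm x) \<in> boundary_class b T (\<lambda>t. q0 t + (- 1) * q0 t) (\<lambda>t. q1 t + (- 1) * q1 t)"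
    by (rule boundary_class_combo[OF bT(1) Wc Vmc])
  then have "(\<lambda>x. W x - Vm x) \<in> boundary_class b T (\<lambda>t. 0) (\<lambda>t. 0)" by simp
  from gradient_nonneg_at_interior_minimizer[OF bT(1) min Vm g this]
  have inner: "0 \<le> Hk_inner 4 ?R g (\<lambda>x. W x - Vm x)" .
  have Jm: "0 \<le> ?J Vm"
  proof -
    have "0 \<le> (LINT x:?R|lborel. (S_op b T Vm x)\<^sup>2 * psi \<beta> l x)"
      unfolding set_lebesgue_integral_def
      by (rule Bochner_Integration.integral_nonneg) (auto simp: psi_def indicator_def split: prod.splits)
    then show ?thesis using \<gamma> by (simp add: J_fun_def)
  qed
  have JW: "?J W \<le> KJ * \<sigma>\<^sup>2 + 4 * \<gamma> * M\<^sup>2"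
  proof -
    have "(LINT x:?R|lborel. (S_op b T W x)\<^sup>2 * psi \<beta> l x) \<le> KJ * (?N h)\<^sup>2"
      unfolding Weq KJ_def
      by (rule residual_bound[where p = p, OF bT(1) T VsH hH _ eq init CV Cp]) (use hN \<sigma> l \<beta> in auto)
    also have "\<dots> \<le> KJ * \<sigma>\<^sup>2"
      using hN hN0 bT T unfolding KJ_def by (intro mult_left_mono power_mono) auto
    finally have 1: "(LINT x:?R|lborel. (S_op b T W x)\<^sup>2 * psi \<beta> l x) \<le> KJ * \<sigma>\<^sup>2" .
    have "(?N W)\<^sup>2 \<le> (2 * M)\<^sup>2" using WN by (intro power_mono Hk_norm_nonneg) auto
    then have "\<gamma> * (?N W)\<^sup>2 \<le> \<gamma> * (2 * M)\<^sup>2" using \<gamma> by (intro mult_left_mono) auto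
    with 1 show ?thesis by (simp add: J_fun_def power_mult_distrib)
  qed
  have "\<gamma> / 2 * (?N (\<lambda>x. W x - Vm x))\<^sup>2 \<ge> 0" using \<gamma> by simp
  then show "K1 * exp (- 2 * l * (2 * \<beta> * b - \<mu>)) * ((Hk_norm 1 (Rtri \<beta> \<mu> b) (\<lambda>x. W x - Vm x))\<^sup>2
      + (H1_norm {0<..<2 * \<beta> * b - \<mu>} (\<lambda>y. bottom b W y - bottom b Vm y))\<^sup>2) \<le> KJ * \<sigma>\<^sup>2 + 4 * \<gamma> * M\<^sup>2"
    using gW inner Jm JW by linarith
qed

text \<open>The differences \<open>V* - V\<^sub>n\<close> and \<open>p - 4 \<partial>\<^sub>y V\<^sub>n(y, 0)\<close> are decomposed along \<open>V*\<close>, \<open>W\<close>, \<open>Vm\<close>, \<open>V\<^sub>n\<close>.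
  The outer steps are controlled by the \<open>H\<^sup>4\<close> norm through the trace constant \<open>c\<close>. In the middle step
  the \<open>H\<^sup>1\<close> norm of the trace is kept, because that is what the stability estimate bounds.\<close>

lemma error_splitting:
  assumes bT: "0 < b" "T \<ge> 4 * b" and \<beta>: "0 < \<beta>" "\<beta> < 1 / 2" and \<mu>: "0 < \<mu>" "\<mu> < 2 * \<beta> * b"
    and Vs: "Vs \<in> Hk 4 (Rect b T)" and h: "h \<in> Hk 4 (Rect b T)" and Vm: "Vm \<in> Hk 4 (Rect b T)" and Vn: "Vn \<in> Hk 4 (Rect b T)"
    and init: "AE y in lborel. y \<in> {0<..<b} \<longrightarrow> coeff_of b T Vs y = p y" and p: "continuous_on UNIV p"
  defines "W \<equiv> \<lambda>x. Vs x + h x"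
  defines "c \<equiv> sqrt (2 / T + 2 * T)"
  shows "Hk_norm 1 (Rtri \<beta> \<mu> b) (\<lambda>x. Vs x - Vn x) + L2_norm {0<..<2 * \<beta> * b - \<mu>} (\<lambda>y. p y - coeff_of b T Vn y)
    \<le> (1 + 4 * c) * Hk_norm 4 (Rect b T) h
      + (Hk_norm 1 (Rtri \<beta> \<mu> b) (\<lambda>x. W x - Vm x) + 4 * H1_norm {0<..<2 * \<beta> * b - \<mu>} (\<lambda>y. bottom b W y - bottom b Vm y))
      + (1 + 4 * c) * Hk_norm 4 (Rect b T) (\<lambda>x. Vm x - Vn x)"
proof -
  let ?R = "Rect b T" and ?Q = "Rtri \<beta> \<mu> b" and ?r = "2 * \<beta> * b - \<mu>"
  let ?I = "{0<..<?r}" and ?D = "wd (Rect b T) (yt 1 0)"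
  have T: "T > 0" using bT by simp
  have "2 * \<beta> * b < b" using \<beta> bT by simp
  then have r: "0 < ?r" "?r \<le> b" using \<mu> by auto
  note sub = Rtri_subset[OF \<beta> \<mu>(1) bT]
  have diff: "(\<lambda>x. u x - v x) \<in> Hk 4 ?R" if "u \<in> Hk 4 ?R" "v \<in> Hk 4 ?R" for u v
    using Hk_combo[OF Rect_open that, of "- 1"] by simp
  have W: "W \<in> Hk 4 ?R" unfolding W_def using Hk_combo[OF Rect_open Vs h, of 1] by simp
  have nh: "(\<lambda>x. - 1 * h x) \<in> Hk 4 ?R" using Hk_combo[OF Rect_open h h, of "- 2"] by simp
  have e: "(\<lambda>x. Vm x - Vn x) \<in> Hk 4 ?R" and d: "(\<lambda>x. W x - Vm x) \<in> Hk 4 ?R" using diff W Vm Vn by auto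
  have tri: "f \<in> Hk 1 ?Q" "Hk_norm 1 ?Q f \<le> Hk_norm 4 ?R f" if "f \<in> Hk 4 ?R" for f
    using Hk_mono[OF that _ sub, of 1] Hk_norm_mono[OF Rect_open Rtri_open that _ sub, of 1] Rtri_open by auto
  have de: "(\<lambda>x. (W x - Vm x) + (Vm x - Vn x)) \<in> Hk 1 ?Q"
    using Hk_combo[OF Rtri_open tri(1)[OF d] tri(1)[OF e], of 1] by simp
  have "Hk_norm 1 ?Q (\<lambda>x. Vs x - Vn x) = Hk_norm 1 ?Q (\<lambda>x. - 1 * h x + ((W x - Vm x) + (Vm x - Vn x)))"
    by (simp add: W_def)
  moreover have "Hk_norm 1 ?Q (\<lambda>x. - 1 * h x + ((W x - Vm x) + (Vm x - Vn x)))
      \<le> Hk_norm 1 ?Q (\<lambda>x. - 1 * h x) + Hk_norm 1 ?Q (\<lambda>x. (W x - Vm x) + (Vm x - Vn x))"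
    by (rule Hk_norm_triangle[OF Rtri_open tri(1)[OF nh] de])
  moreover have "Hk_norm 1 ?Q (\<lambda>x. (W x - Vm x) + (Vm x - Vn x)) \<le> Hk_norm 1 ?Q (\<lambda>x. W x - Vm x) + Hk_norm 1 ?Q (\<lambda>x. Vm x - Vn x)"
    by (rule Hk_norm_triangle[OF Rtri_open tri(1)[OF d] tri(1)[OF e]])
  moreover have "Hk_norm 1 ?Q (\<lambda>x. - 1 * h x) = Hk_norm 1 ?Q h"
    using Hk_norm_scale[OF Rtri_open tri(1)[OF h], of "- 1"] by simp
  ultimately have first: "Hk_norm 1 ?Q (\<lambda>x. Vs x - Vn x) \<le> Hk_norm 4 ?R h + Hk_norm 1 ?Q (\<lambda>x. W x - Vm x) + Hk_norm 4 ?R (\<lambda>x. Vm x - Vn x)"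
    using tri(2)[OF h] tri(2)[OF e] by linarith
  define \<tau> where "\<tau> = (\<lambda>f. bottom b (?D f))"
  have H2: "f \<in> Hk 2 ?R" if "f \<in> Hk 4 ?R" for f using Hk_mono[OF that, of 2 ?R] Rect_measure(1) by auto
  have Ib: "?I \<subseteq> {0<..<b}" "?I \<in> sets borel" using r by auto
  have \<tau>L: "\<tau> f \<in> L2 ?I" "L2_norm ?I (\<tau> f) \<le> c * Hk_norm 4 ?R f" if f: "f \<in> Hk 4 ?R" for f
  proof -
    note b2 = bottom_wd_norm[OF bT(1) T H2[OF f]]
    show "\<tau> f \<in> L2 ?I" unfolding \<tau>_def by (rule L2_mono(1)[OF b2(2) Ib])
    have "L2_norm ?I (\<tau> f) \<le> L2_norm {0<..<b} (\<tau> f)" unfolding \<tau>_def by (rule L2_mono(2)[OF b2(2) Ib])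
    also have "\<dots> \<le> sqrt ((2 / T + 2 * T) * (Hk_norm 2 ?R f)\<^sup>2)"
      unfolding \<tau>_def by (rule real_le_rsqrt[OF b2(1)])
    also have "\<dots> = c * Hk_norm 2 ?R f" by (simp add: real_sqrt_mult c_def Hk_norm_nonneg)
    also have "\<dots> \<le> c * Hk_norm 4 ?R f"
      using Hk_norm_mono[OF Rect_open Rect_open f, of 2] T by (intro mult_left_mono) (auto simp: c_def)
    finally show "L2_norm ?I (\<tau> f) \<le> c * Hk_norm 4 ?R f" .
  qed
  let ?d = "\<lambda>y. \<tau> W y + (- 1) * \<tau> Vm y"
  have dL: "?d \<in> L2 ?I" by (rule L2_combo[OF \<tau>L(1)[OF W] \<tau>L(1)[OF Vm]])
  have dn: "L2_norm ?I ?d \<le> H1_norm ?I (\<lambda>y. bottom b W y - bottom b Vm y)"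
    unfolding \<tau>_def by (rule trace_difference_bound[OF bT(1) T W Vm r])
  let ?s = "\<lambda>y. 4 * ((- 1 * \<tau> h y + ?d y) + \<tau> (\<lambda>x. Vm x - Vn x) y)"
  have nhL: "(\<lambda>y. - 1 * \<tau> h y) \<in> L2 ?I" using L2_combo[OF \<tau>L(1)[OF h] \<tau>L(1)[OF h], of "- 2"] by simp
  have sum1: "(\<lambda>y. - 1 * \<tau> h y + ?d y) \<in> L2 ?I" using L2_combo[OF nhL dL, of 1] by simp
  have sum2: "(\<lambda>y. (- 1 * \<tau> h y + ?d y) + \<tau> (\<lambda>x. Vm x - Vn x) y) \<in> L2 ?I"
    using L2_combo[OF sum1 \<tau>L(1)[OF e], of 1] by simp
  have sL: "?s \<in> L2 ?I" using L2_combo[OF sum2 sum2, of 3] by (auto elim!: back_subst[of "\<lambda>f. f \<in> L2 ?I"])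
  have pL: "(\<lambda>y. p y - coeff_of b T Vn y) \<in> L2 ?I"
  proof -
    have "p \<in> L2 ?I"
    proof (rule L2I)
      have [measurable]: "p \<in> borel_measurable borel" by (rule borel_measurable_continuous_onI[OF p])
      show "(\<lambda>x. indicator ?I x * p x) \<in> borel_measurable borel" by measurable
      have "integrable lborel (\<lambda>x. indicator {0..?r} x *\<^sub>R (p x)\<^sup>2)"
        by (rule borel_integrable_compact[OF compact_Icc continuous_on_subset[OF continuous_on_power[OF p]]]) simp
      then show "integrable lborel (\<lambda>x. (indicator ?I x * p x)\<^sup>2)"
        by (rule Bochner_Integration.integrable_bound) (auto simp: indicator_def)
    qed
    from L2_combo[OF this \<tau>L(1)[OF Vn], of "- 4"] show ?thesis by (simp add: coeff_of_def \<tau>_def)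
  qed
  have chain: "x \<le> 4 * (A' + D' + E')"
    if "x = s" "s = 4 * t" "t \<le> u + E" "u \<le> m + D" "m = A" "A \<le> A'" "D \<le> D'" "E \<le> E'"
    for x s t u m A D E A' D' E' :: real using that by (simp add: ring_distribs)
  have "AE y in lborel. y \<in> ?I \<longrightarrow> p y - coeff_of b T Vn y = ?s y"
    using init bottom_wd_combo[OF bT(1) T Vs h, of 1] bottom_wd_combo[OF bT(1) T Vm Vn, of "- 1"]
  proof eventually_elim
    case (elim y)
    show ?case
    proof
      assume "y \<in> ?I"
      then have "y \<in> {0<..<b}" using Ib by blast
      with elim show "p y - coeff_of b T Vn y = ?s y"
        by (simp add: coeff_of_def \<tau>_def W_def)
    qed
  qed
  then have "L2_norm ?I (\<lambda>y. p y - coeff_of b T Vn y) = L2_norm ?I ?s"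
    by (rule L2_norm_cong_AE[OF sL pL])
  moreover have "L2_norm ?I ?s = 4 * L2_norm ?I (\<lambda>y. (- 1 * \<tau> h y + ?d y) + \<tau> (\<lambda>x. Vm x - Vn x) y)"
    using L2_norm_scale[of ?I 4 "\<lambda>y. (- 1 * \<tau> h y + ?d y) + \<tau> (\<lambda>x. Vm x - Vn x) y"] by simp
  moreover have "L2_norm ?I (\<lambda>y. (- 1 * \<tau> h y + ?d y) + \<tau> (\<lambda>x. Vm x - Vn x) y)
     \<le> L2_norm ?I (\<lambda>y. - 1 * \<tau> h y + ?d y) + L2_norm ?I (\<tau> (\<lambda>x. Vm x - Vn x))"
    by (rule L2_norm_triangle[OF sum1 \<tau>L(1)[OF e]])
  moreover have "L2_norm ?I (\<lambda>y. - 1 * \<tau> h y + ?d y) \<le> L2_norm ?I (\<lambda>y. - 1 * \<tau> h y) + L2_norm ?I ?d"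
    by (rule L2_norm_triangle[OF nhL dL])
  moreover have "L2_norm ?I (\<lambda>y. - 1 * \<tau> h y) = L2_norm ?I (\<tau> h)"
    using L2_norm_scale[of ?I "- 1" "\<tau> h"] by simp
  ultimately have second: "L2_norm ?I (\<lambda>y. p y - coeff_of b T Vn y) \<le> 4 * (c * Hk_norm 4 ?R h
      + H1_norm ?I (\<lambda>y. bottom b W y - bottom b Vm y) + c * Hk_norm 4 ?R (\<lambda>x. Vm x - Vn x))"
    using \<tau>L(2)[OF h] dn \<tau>L(2)[OF e] by (rule chain)
  show ?thesis using first second by (simp add: algebra_simps)
qed

text \<open>After division by \<sigma> both powers on the right-hand side are at most \<open>\<sigma> powr (2 * \<rho>)\<close>, since
  \<open>\<sigma> < 1\<close>.\<close>

lemma power_bound: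
  fixes \<sigma> :: real
  assumes \<sigma>: "0 < \<sigma>" "\<sigma> < 1" and K1: "K1 > 0" and A: "A \<ge> 0" "B \<ge> 0"
    and \<rho>: "2 * \<rho> \<le> 1" "2 * \<rho> \<le> e - 1"
    and le: "K1 * \<sigma> * (X\<^sup>2 + Y\<^sup>2) \<le> A * \<sigma>\<^sup>2 + B * \<sigma> powr e"
  shows "X + 4 * Y \<le> 5 * sqrt ((A + B) / K1) * \<sigma> powr \<rho>"
proof -
  have "\<sigma> \<le> \<sigma> powr (2 * \<rho>)" using powr_mono'[OF \<rho>(1), of \<sigma>] \<sigma> by simp
  moreover have "\<sigma> powr (e - 1) \<le> \<sigma> powr (2 * \<rho>)" using powr_mono'[OF \<rho>(2), of \<sigma>] \<sigma> by simp
  ultimately have "A * \<sigma> + B * \<sigma> powr (e - 1) \<le> A * \<sigma> powr (2 * \<rho>) + B * \<sigma> powr (2 * \<rho>)"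
    using A by (intro add_mono mult_left_mono)
  moreover have "\<sigma> * \<sigma> powr (e - 1) = \<sigma> powr e"
    using \<sigma> by (simp add: powr_diff)
  then have "A * \<sigma>\<^sup>2 + B * \<sigma> powr e = \<sigma> * (A * \<sigma> + B * \<sigma> powr (e - 1))"
    by (simp add: power2_eq_square distrib_left mult.left_commute)
  with le have "\<sigma> * (K1 * (X\<^sup>2 + Y\<^sup>2)) \<le> \<sigma> * (A * \<sigma> + B * \<sigma> powr (e - 1))" by (simp add: mult_ac)
  then have "K1 * (X\<^sup>2 + Y\<^sup>2) \<le> A * \<sigma> + B * \<sigma> powr (e - 1)" using \<sigma> by simp
  ultimately have "K1 * (X\<^sup>2 + Y\<^sup>2) \<le> (A + B) * \<sigma> powr (2 * \<rho>)" by (simp add: distrib_right)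
  then have q: "X\<^sup>2 + Y\<^sup>2 \<le> (A + B) / K1 * \<sigma> powr (2 * \<rho>)" using K1 by (simp add: field_simps)
  define S where "S = sqrt ((A + B) / K1) * \<sigma> powr \<rho>"
  have "S\<^sup>2 = (A + B) / K1 * \<sigma> powr (2 * \<rho>)"
  proof -
    have "(\<sigma> powr \<rho>)\<^sup>2 = \<sigma> powr (2 * \<rho>)" using \<sigma> by (simp add: power2_eq_square powr_add[symmetric])
    then show ?thesis using A K1 by (simp add: S_def power_mult_distrib)
  qed
  then have "X\<^sup>2 \<le> S\<^sup>2" "Y\<^sup>2 \<le> S\<^sup>2" using q zero_le_power2[of X] zero_le_power2[of Y] by linarith+
  moreover have "S \<ge> 0" using A K1 by (simp add: S_def)
  ultimately have "X \<le> S" "Y \<le> S" by (auto intro: power2_le_imp_le)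
  then show ?thesis by (simp add: S_def)
qed

theorem theorem4p13:
  fixes b T :: real
  assumes "b > 0" and "T \<ge> 4 * b"
  shows "\<exists>C>0. \<forall>(cbar::real) (\<beta>::real) (\<mu>::real) (M::real) (lam0::real) (lam1::real) (lam2::real)
      (\<omega>::real) (\<rho>::real) (p::real \<Rightarrow> real) (w::real \<times> real \<Rightarrow> real) (\<sigma>0::real) (\<theta>0::real).
    cbar > 1 \<and> b \<ge> sqrt cbar \<and> 0 < \<beta> \<and> \<beta> < 1 / 2 \<and> 0 < \<mu> \<and> \<mu> < 2 * \<beta> * b \<and> M > 0 \<and>
    convexity_threshold b T \<beta> M lam0 lam1 \<and> convexity_threshold b T \<beta> (3 * M) lam0 lam2 \<and>
    lam2 \<ge> lam1 \<and>
    \<omega> = (\<beta> * (T - 4 * b) + \<mu>) / (2 * (2 * \<beta> * b - \<mu>)) \<and> \<rho> = 1 / 2 * min \<omega> 1 \<and>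
    p C1_differentiable_on UNIV \<and> (\<forall>y. y < 0 \<or> y > sqrt cbar \<longrightarrow> p y = 0) \<and>
    wave_solution p w \<and> exact_V w \<in> Bset b T M (exact_q0 w) (exact_q1 w) \<and>
    0 < \<sigma>0 \<and> \<sigma>0 < 1 \<and> ln (\<sigma>0 powr (- 1 / (2 * (2 * \<beta> * b - \<mu>)))) \<ge> lam2 \<and>
    0 < \<theta>0 \<and> \<theta>0 < 1 / 3
    \<longrightarrow> (\<exists>K>0. \<forall>(q0::real \<Rightarrow> real) (q1::real \<Rightarrow> real) (F::real \<times> real \<Rightarrow> real)
          (Fs::real \<times> real \<Rightarrow> real) (\<sigma>::real) (lam::real) (\<gamma>::real) (Vmin::real \<times> real \<Rightarrow> real)
          (V::nat \<Rightarrow> real \<times> real \<Rightarrow> real) (\<kappa>0::real) (\<kappa>::real) (\<theta>::real).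
        F \<in> Bset b T M q0 q1 \<and> Fs \<in> Bset b T M (exact_q0 w) (exact_q1 w) \<and>
        Hk_norm 4 (Rect b T) (\<lambda>x. F x - Fs x) < \<sigma> \<and>
        0 < \<sigma> \<and> \<sigma> < \<sigma>0 \<and> \<sigma> < min 1 M \<and>
        lam = ln (\<sigma> powr (- 1 / (2 * (2 * \<beta> * b - \<mu>)))) \<and>
        \<gamma> = 2 * exp (- lam * \<beta> * T) \<and> 0 < \<gamma> \<and> \<gamma> < 1 \<and>
        is_minimizer (J_fun b T \<beta> lam \<gamma>) (Bclosure b T M q0 q1) Vmin \<and>
        Vmin \<in> Bset b T (\<theta>0 * M) q0 q1 \<and> V 0 \<in> Bset b T (\<theta>0 * M) q0 q1 \<and>
        0 < \<kappa>0 \<and> \<kappa>0 < 1 \<and> 0 < \<kappa> \<and> \<kappa> < \<kappa>0 \<and> 0 < \<theta> \<and> \<theta> < 1 \<and>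
        (\<forall>n\<ge>1. (\<exists>g. is_gradient b T (J_fun b T \<beta> lam \<gamma>) (V (n - 1)) g \<and>
                   (AE x in lborel. x \<in> Rect b T \<longrightarrow> V n x = V (n - 1) x - \<kappa> * g x)) \<and>
                V n \<in> Bset b T M q0 q1 \<and>
                Hk_norm 4 (Rect b T) (\<lambda>x. Vmin x - V n x)
                  \<le> \<theta> ^ n * Hk_norm 4 (Rect b T) (\<lambda>x. Vmin x - V 0 x))
        \<longrightarrow> (\<forall>n\<ge>1. Hk_norm 1 (Rtri \<beta> \<mu> b) (\<lambda>x. exact_V w x - V n x)
                + L2_norm {0<..<2 * \<beta> * b - \<mu>} (\<lambda>y. p y - coeff_of b T (V n) y)
              \<le> 2 * K * \<sigma> powr \<rho>
                + 4 * C * \<theta> ^ n * Hk_norm 4 (Rect b T) (\<lambda>x. Vmin x - V 0 x)))"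
proof -
  let ?R = "Rect b T" and ?N = "Hk_norm 4 (Rect b T)"
  have T: "T > 0" using assms by simp
  define c where "c = sqrt (2 / T + 2 * T)"
  have c: "c \<ge> 0" using T by (simp add: c_def)
  show ?thesis
  proof (rule exI[of _ "1 + c"], rule conjI, use c in simp, intro allI impI, elim conjE)
    fix cbar \<beta> \<mu> M lam0 lam1 lam2 \<omega> \<rho> :: real and p :: "real \<Rightarrow> real" and w :: "real \<times> real \<Rightarrow> real" and \<sigma>0 \<theta>0 :: real
    assume \<beta>: "0 < \<beta>" "\<beta> < 1 / 2" and \<mu>: "0 < \<mu>" "\<mu> < 2 * \<beta> * b" and M: "M > 0"
      and conv: "convexity_threshold b T \<beta> (3 * M) lam0 lam2"
      and \<omega>: "\<omega> = (\<beta> * (T - 4 * b) + \<mu>) / (2 * (2 * \<beta> * b - \<mu>))" and \<rho>: "\<rho> = 1 / 2 * min \<omega> 1"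
      and p: "p C1_differentiable_on UNIV" "\<forall>y. y < 0 \<or> y > sqrt cbar \<longrightarrow> p y = 0"
      and wave: "wave_solution p w" and Vs: "exact_V w \<in> Bset b T M (exact_q0 w) (exact_q1 w)"
      and \<sigma>0: "0 < \<sigma>0" "\<sigma>0 < 1" "ln (\<sigma>0 powr (- 1 / (2 * (2 * \<beta> * b - \<mu>)))) \<ge> lam2"
      and \<theta>0: "0 < \<theta>0" "\<theta>0 < 1 / 3"
    define q where "q = 2 * \<beta> * b - \<mu>"
    have q: "q > 0" using \<mu> by (simp add: q_def)
    have VsH: "exact_V w \<in> Hk 4 ?R" using Vs by (simp add: Bset_def)
    then have VsH2: "exact_V w \<in> Hk 2 ?R" by (rule Hk_mono) (auto simp: Rect_measure)
    note ex = exact_solution_properties[where d = "sqrt cbar", OF wave p(1) p(2)[rule_format] assms(1) T VsH2]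
    obtain CV where CV: "CV > 0" "\<And>z. z \<in> ?R \<Longrightarrow> \<bar>exact_V w z\<bar> \<le> CV" using ex(3) by blast
    obtain Cp where Cp: "Cp > 0" "\<And>y. \<bar>p y\<bar> \<le> Cp" using ex(4) by blast
    have lam2: "lam2 \<ge> 1" using conv by (simp add: convexity_threshold_def)
    obtain K1 where K1: "K1 > 0" and K1c: "\<And>q0 q1 l \<gamma> V1. l \<ge> lam2 \<Longrightarrow> 2 * exp (- l * \<beta> * T) \<le> \<gamma> \<Longrightarrow> \<gamma> < 1 \<Longrightarrow>
       V1 \<in> Bclosure b T (3 * M) q0 q1 \<Longrightarrow> \<exists>g. is_gradient b T (J_fun b T \<beta> l \<gamma>) V1 g \<and>
         (\<forall>V2 \<in> Bclosure b T (3 * M) q0 q1.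
            J_fun b T \<beta> l \<gamma> V2 - J_fun b T \<beta> l \<gamma> V1 - Hk_inner 4 ?R g (\<lambda>x. V2 x - V1 x)
            \<ge> K1 * exp (- 2 * l * (2 * \<beta> * b - \<mu>))
                * ((Hk_norm 1 (Rtri \<beta> \<mu> b) (\<lambda>x. V2 x - V1 x))\<^sup>2
                   + (H1_norm {0<..<2 * \<beta> * b - \<mu>} (\<lambda>y. bottom b V2 y - bottom b V1 y))\<^sup>2)
              + \<gamma> / 2 * (?N (\<lambda>x. V2 x - V1 x))\<^sup>2)"
    proof -
      have "\<exists>K1>0. \<forall>q0 q1 l \<gamma>. l \<ge> lam2 \<and> 2 * exp (- l * \<beta> * T) \<le> \<gamma> \<and> \<gamma> < 1 \<longrightarrow>
       (\<forall>V1 \<in> Bclosure b T (3 * M) q0 q1. \<exists>g. is_gradient b T (J_fun b T \<beta> l \<gamma>) V1 g \<and>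
         (\<forall>V2 \<in> Bclosure b T (3 * M) q0 q1.
            J_fun b T \<beta> l \<gamma> V2 - J_fun b T \<beta> l \<gamma> V1 - Hk_inner 4 ?R g (\<lambda>x. V2 x - V1 x)
            \<ge> K1 * exp (- 2 * l * (2 * \<beta> * b - \<mu>))
                * ((Hk_norm 1 (Rtri \<beta> \<mu> b) (\<lambda>x. V2 x - V1 x))\<^sup>2
                   + (H1_norm {0<..<2 * \<beta> * b - \<mu>} (\<lambda>y. bottom b V2 y - bottom b V1 y))\<^sup>2)
              + \<gamma> / 2 * (?N (\<lambda>x. V2 x - V1 x))\<^sup>2))"
        using conv \<mu> unfolding convexity_threshold_def by blast
      then obtain K1 where "K1 > 0" and *: "\<forall>q0 q1 l \<gamma>. l \<ge> lam2 \<and> 2 * exp (- l * \<beta> * T) \<le> \<gamma> \<and> \<gamma> < 1 \<longrightarrow>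
       (\<forall>V1 \<in> Bclosure b T (3 * M) q0 q1. \<exists>g. is_gradient b T (J_fun b T \<beta> l \<gamma>) V1 g \<and>
         (\<forall>V2 \<in> Bclosure b T (3 * M) q0 q1.
            J_fun b T \<beta> l \<gamma> V2 - J_fun b T \<beta> l \<gamma> V1 - Hk_inner 4 ?R g (\<lambda>x. V2 x - V1 x)
            \<ge> K1 * exp (- 2 * l * (2 * \<beta> * b - \<mu>))
                * ((Hk_norm 1 (Rtri \<beta> \<mu> b) (\<lambda>x. V2 x - V1 x))\<^sup>2
                   + (H1_norm {0<..<2 * \<beta> * b - \<mu>} (\<lambda>y. bottom b V2 y - bottom b V1 y))\<^sup>2)
              + \<gamma> / 2 * (?N (\<lambda>x. V2 x - V1 x))\<^sup>2))" by blast
      show thesis by (rule that[OF \<open>K1 > 0\<close>]) (rule *[rule_format]; simp)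
    qed
    define KJ where "KJ = 20 + 4 * Cp\<^sup>2 + 128 * CV\<^sup>2 * T * (2 / T + 2 * T) + 128 * (2 / T + 2 * T) * (4 / b + 6 * b)"
    have KJ: "KJ \<ge> 0" using T assms unfolding KJ_def by (intro add_nonneg_nonneg mult_nonneg_nonneg) auto
    \<comment> \<open>the step from \<open>V*\<close> to \<open>W\<close> contributes \<open>1 + 4 c\<close>, the step from \<open>W\<close> to \<open>Vmin\<close> the square root\<close>
    define K where "K = ((1 + 4 * c) + 5 * sqrt ((KJ + 8 * M\<^sup>2) / K1)) / 2"
    have K: "K > 0" using c KJ K1 unfolding K_def by (intro divide_pos_pos add_pos_nonneg) auto
    define e where "e = \<beta> * T / (2 * q)"
    have \<rho>1: "2 * \<rho> \<le> 1" by (simp add: \<rho>)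
    have \<rho>2: "2 * \<rho> \<le> e - 1"
    proof -
      \<comment> \<open>this exceeds \<open>\<omega>\<close>, which has \<open>\<mu>\<close> in place of \<open>2 \<mu>\<close>\<close>
      have "e - 1 = (\<beta> * (T - 4 * b) + 2 * \<mu>) / (2 * q)"
        using q by (simp add: e_def field_simps) (simp add: q_def algebra_simps)
      moreover have "\<omega> \<le> (\<beta> * (T - 4 * b) + 2 * \<mu>) / (2 * q)"
        unfolding \<omega> q_def[symmetric] using q \<mu> by (intro divide_right_mono) auto
      ultimately show ?thesis by (simp add: \<rho>)
    qed
    show "\<exists>K>0. \<forall>(q0::real \<Rightarrow> real) (q1::real \<Rightarrow> real) (F::real \<times> real \<Rightarrow> real)
          (Fs::real \<times> real \<Rightarrow> real) (\<sigma>::real) (lam::real) (\<gamma>::real) (Vmin::real \<times> real \<Rightarrow> real)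
          (V::nat \<Rightarrow> real \<times> real \<Rightarrow> real) (\<kappa>0::real) (\<kappa>::real) (\<theta>::real).
        F \<in> Bset b T M q0 q1 \<and> Fs \<in> Bset b T M (exact_q0 w) (exact_q1 w) \<and>
        ?N (\<lambda>x. F x - Fs x) < \<sigma> \<and>
        0 < \<sigma> \<and> \<sigma> < \<sigma>0 \<and> \<sigma> < min 1 M \<and>
        lam = ln (\<sigma> powr (- 1 / (2 * (2 * \<beta> * b - \<mu>)))) \<and>
        \<gamma> = 2 * exp (- lam * \<beta> * T) \<and> 0 < \<gamma> \<and> \<gamma> < 1 \<and>
        is_minimizer (J_fun b T \<beta> lam \<gamma>) (Bclosure b T M q0 q1) Vmin \<and>
        Vmin \<in> Bset b T (\<theta>0 * M) q0 q1 \<and> V 0 \<in> Bset b T (\<theta>0 * M) q0 q1 \<and>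
        0 < \<kappa>0 \<and> \<kappa>0 < 1 \<and> 0 < \<kappa> \<and> \<kappa> < \<kappa>0 \<and> 0 < \<theta> \<and> \<theta> < 1 \<and>
        (\<forall>n\<ge>1. (\<exists>g. is_gradient b T (J_fun b T \<beta> lam \<gamma>) (V (n - 1)) g \<and>
                   (AE x in lborel. x \<in> ?R \<longrightarrow> V n x = V (n - 1) x - \<kappa> * g x)) \<and>
                V n \<in> Bset b T M q0 q1 \<and>
                ?N (\<lambda>x. Vmin x - V n x) \<le> \<theta> ^ n * ?N (\<lambda>x. Vmin x - V 0 x))
        \<longrightarrow> (\<forall>n\<ge>1. Hk_norm 1 (Rtri \<beta> \<mu> b) (\<lambda>x. exact_V w x - V n x)
                + L2_norm {0<..<2 * \<beta> * b - \<mu>} (\<lambda>y. p y - coeff_of b T (V n) y)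
              \<le> 2 * K * \<sigma> powr \<rho> + 4 * (1 + c) * \<theta> ^ n * ?N (\<lambda>x. Vmin x - V 0 x))"
    proof (rule exI[of _ K], rule conjI, rule K, intro allI impI, elim conjE)
      fix q0 q1 :: "real \<Rightarrow> real" and F Fs :: "real \<times> real \<Rightarrow> real" and \<sigma> lam \<gamma> :: real
        and Vmin :: "real \<times> real \<Rightarrow> real" and V :: "nat \<Rightarrow> real \<times> real \<Rightarrow> real" and \<kappa>0 \<kappa> \<theta> :: real and n :: nat
      assume F: "F \<in> Bset b T M q0 q1" and Fs: "Fs \<in> Bset b T M (exact_q0 w) (exact_q1 w)"
        and F\<sigma>: "?N (\<lambda>x. F x - Fs x) < \<sigma>" and \<sigma>: "0 < \<sigma>" "\<sigma> < \<sigma>0" "\<sigma> < min 1 M"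
        and lam: "lam = ln (\<sigma> powr (- 1 / (2 * (2 * \<beta> * b - \<mu>))))"
        and \<gamma>: "\<gamma> = 2 * exp (- lam * \<beta> * T)" "0 < \<gamma>" "\<gamma> < 1"
        and min: "is_minimizer (J_fun b T \<beta> lam \<gamma>) (Bclosure b T M q0 q1) Vmin"
        and Vmin: "Vmin \<in> Bset b T (\<theta>0 * M) q0 q1"
        and seq: "\<forall>n\<ge>1. (\<exists>g. is_gradient b T (J_fun b T \<beta> lam \<gamma>) (V (n - 1)) g \<and>
                   (AE x in lborel. x \<in> ?R \<longrightarrow> V n x = V (n - 1) x - \<kappa> * g x)) \<and>
                V n \<in> Bset b T M q0 q1 \<and>
                ?N (\<lambda>x. Vmin x - V n x) \<le> \<theta> ^ n * ?N (\<lambda>x. Vmin x - V 0 x)"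
        and n: "1 \<le> n"
      have \<sigma>1: "\<sigma> < 1" "\<sigma> < M" using \<sigma> by auto
      note par = parameter_arithmetic[OF \<sigma>(1) \<sigma>1(1) q lam[folded q_def]]
      have lam_ge: "lam \<ge> lam2"
      proof -
        have "ln (\<sigma>0 powr (- 1 / (2 * q))) = - ln \<sigma>0 / (2 * q)"
          using parameter_arithmetic(1)[OF \<sigma>0(1,2) q refl] .
        moreover have "- ln \<sigma>0 / (2 * q) \<le> - ln \<sigma> / (2 * q)"
          using \<sigma> \<sigma>0 q by (intro divide_right_mono) auto
        ultimately show ?thesis using \<sigma>0(3) par(1) unfolding q_def by linarith
      qed
      have \<gamma>e: "\<gamma> = 2 * \<sigma> powr e"
        using par(3)[of "\<beta> * T"] by (simp add: \<gamma>(1) e_def mult.assoc)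
      \<comment> \<open>the minimizer is an interior point of the ball of radius \<open>M\<close>\<close>
      have "\<theta>0 * M \<le> 1 * M" using \<theta>0 M by (intro mult_right_mono) auto
      then have Vm: "Vmin \<in> Bset b T M q0 q1" using Vmin by (auto simp: Bset_def)
      have Vn: "V n \<in> Hk 4 ?R" "?N (\<lambda>x. Vmin x - V n x) \<le> \<theta> ^ n * ?N (\<lambda>x. Vmin x - V 0 x)"
        using seq n by (auto simp: Bset_def)
      have Fc: "F \<in> boundary_class b T q0 q1" "Fs \<in> boundary_class b T (exact_q0 w) (exact_q1 w)"
        using F Fs by (auto simp: Bset_boundary_class)
      define h where "h = (\<lambda>x. F x - Fs x)"
      have hH: "h \<in> Hk 4 ?R"
        using Hk_combo[OF Rect_open, of F 4 b T Fs "- 1"] F Fs by (simp add: h_def Bset_def)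
      let ?W = "\<lambda>x. exact_V w x + (F x - Fs x)"
      have VmH: "Vmin \<in> Hk 4 ?R" using Vm by (simp add: Bset_def)
      define A where "A = Hk_norm 1 (Rtri \<beta> \<mu> b) (\<lambda>x. ?W x - Vmin x)"
      define B where "B = H1_norm {0<..<2 * \<beta> * b - \<mu>} (\<lambda>y. bottom b ?W y - bottom b Vmin y)"
      have "K1 * exp (- 2 * lam * (2 * \<beta> * b - \<mu>)) * (A\<^sup>2 + B\<^sup>2) \<le> KJ * \<sigma>\<^sup>2 + 4 * \<gamma> * M\<^sup>2"
        unfolding A_def B_def KJ_def
      proof (rule stability_estimate(2)[where p = p and Vs = "exact_V w" and Vm = Vmin and F = F and Fs = Fs, OF assms \<beta> \<mu> M Vs Fc F\<sigma> \<sigma>(1) \<sigma>1 ex(1,2) CV(2) Cp(2) _ \<gamma>(2,3) K1 min Vm])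
        show "lam \<ge> 1" using lam_ge lam2 by simp
      qed (assumption | (rule K1c[OF lam_ge _ \<gamma>(3)], simp add: \<gamma>(1)))+
      then have "K1 * \<sigma> * (A\<^sup>2 + B\<^sup>2) \<le> KJ * \<sigma>\<^sup>2 + (8 * M\<^sup>2) * \<sigma> powr e"
        unfolding q_def[symmetric] par(2) \<gamma>e by (simp add: mult_ac)
      from power_bound[OF \<sigma>(1) \<sigma>1(1) K1 KJ _ \<rho>1 \<rho>2 this]
      have AB: "A + 4 * B \<le> 5 * sqrt ((KJ + 8 * M\<^sup>2) / K1) * \<sigma> powr \<rho>" by simp
      have "\<sigma> \<le> \<sigma> powr \<rho>" using powr_mono'[of \<rho> 1 \<sigma>] \<rho>1 \<sigma> \<sigma>1 by simp
      then have "?N h \<le> \<sigma> powr \<rho>" using F\<sigma> by (simp add: h_def)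
      then have hb: "(1 + 4 * c) * ?N h \<le> (1 + 4 * c) * \<sigma> powr \<rho>" using c by (intro mult_left_mono) auto
      have "Hk_norm 1 (Rtri \<beta> \<mu> b) (\<lambda>x. exact_V w x - V n x)
          + L2_norm {0<..<2 * \<beta> * b - \<mu>} (\<lambda>y. p y - coeff_of b T (V n) y)
          \<le> (1 + 4 * c) * ?N h + (A + 4 * B) + (1 + 4 * c) * ?N (\<lambda>x. Vmin x - V n x)"
        using error_splitting[where p = p and Vs = "exact_V w" and Vn = "V n", OF assms \<beta> \<mu> VsH hH VmH Vn(1) ex(2,5)]
        unfolding A_def B_def c_def h_def .
      also have "\<dots> \<le> 2 * K * \<sigma> powr \<rho> + (1 + 4 * c) * ?N (\<lambda>x. Vmin x - V n x)"
        using hb AB by (simp add: K_def algebra_simps)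
      also have "(1 + 4 * c) * ?N (\<lambda>x. Vmin x - V n x) \<le> (4 * (1 + c)) * (\<theta> ^ n * ?N (\<lambda>x. Vmin x - V 0 x))"
        using Vn(2) c by (intro mult_mono Hk_norm_nonneg) auto
      finally show "Hk_norm 1 (Rtri \<beta> \<mu> b) (\<lambda>x. exact_V w x - V n x)
          + L2_norm {0<..<2 * \<beta> * b - \<mu>} (\<lambda>y. p y - coeff_of b T (V n) y)
          \<le> 2 * K * \<sigma> powr \<rho> + 4 * (1 + c) * \<theta> ^ n * ?N (\<lambda>x. Vmin x - V 0 x)"
        by (simp add: mult_ac)
    qed
  qed
qed

end
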